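(* Let $\mathcal C$ be a finite braided tensor category over a field $\Bbbk$ with $\mathrm{char}\,\Bbbk=0$. If $A$ is a non-zero algebra in $\mathcal C$ which is projective as an object of the category $A\text{-}\mathbf{bimod}_{\mathcal C}$ of $A$-bimodules in $\mathcal C$, then $\mathcal C$ is semisimple and thus $A$ is separable.
   Context: A finite category is a $\Bbbk$-linear category equivalent to finite-dimensional modules over a finite-dimensional $\Bbbk$-algebra. A finite tensor category is a finite category that is (strict) monoidal with $\Bbbk$-bilinear tensor product, left and right duals, and simple unit. An algebra $A$ in $\mathcal C$ is regarded as the regular $A$-bimodule; it is separable if its multiplication $A\otimes A\to A$ has a section as a morphism of $A$-bimodules in $\mathcal C$. *)

theory Defs
  imports Complex_Main "HOL-Library.Function_Algebras"
begin

section \<open>Linear categories\<close>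

text \<open>
  All hom spaces of a linear category are subspaces of one ambient vector space of morphisms
  (for instance, of the direct sum of all hom spaces), so that addition, zero and scalar
  multiplication of morphisms are those of the ambient space, and composition is an operation on
  the ambient type. Every small linear category is isomorphic to one of this form. The hom spaces
  are not required to be disjoint; operations whose result depends on the source or the target
  of a morphism therefore take these objects as arguments.
\<close>

record ('o, 'm, 'k) lincat =
  obj :: "'o set"
  hom :: "'o \<Rightarrow> 'o \<Rightarrow> 'm set"
  ident :: "'o \<Rightarrow> 'm"
  comp :: "'m \<Rightarrow> 'm \<Rightarrow> 'm"  (infixr "\<cdot>\<index>" 70)
  scale :: "'k \<Rightarrow> 'm \<Rightarrow> 'm"

locale linear_category =
  fixes C :: "('o, 'm::ab_group_add, 'k::field, 'x) lincat_scheme" (structure)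
  assumes ambient_vector_space: "vector_space (scale C)"
    and hom_subspace:
      "\<lbrakk>X \<in> obj C; Y \<in> obj C\<rbrakk> \<Longrightarrow> module.subspace (scale C) (hom C X Y)"
    and ident_in_hom: "X \<in> obj C \<Longrightarrow> ident C X \<in> hom C X X"
    and comp_in_hom:
      "\<lbrakk>X \<in> obj C; Y \<in> obj C; Z \<in> obj C; f \<in> hom C X Y; g \<in> hom C Y Z\<rbrakk>
        \<Longrightarrow> g \<cdot> f \<in> hom C X Z"
    and comp_ident: "\<lbrakk>X \<in> obj C; Y \<in> obj C; f \<in> hom C X Y\<rbrakk> \<Longrightarrow> f \<cdot> ident C X = f"
    and ident_comp: "\<lbrakk>X \<in> obj C; Y \<in> obj C; f \<in> hom C X Y\<rbrakk> \<Longrightarrow> ident C Y \<cdot> f = f"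
    and comp_assoc:
      "\<lbrakk>W \<in> obj C; X \<in> obj C; Y \<in> obj C; Z \<in> obj C;
        f \<in> hom C W X; g \<in> hom C X Y; h \<in> hom C Y Z\<rbrakk>
        \<Longrightarrow> (h \<cdot> g) \<cdot> f = h \<cdot> (g \<cdot> f)"
    and comp_add_left:
      "\<lbrakk>X \<in> obj C; Y \<in> obj C; Z \<in> obj C; f \<in> hom C X Y; g \<in> hom C Y Z; g' \<in> hom C Y Z\<rbrakk>
        \<Longrightarrow> (g + g') \<cdot> f = (g \<cdot> f) + (g' \<cdot> f)"
    and comp_add_right:
      "\<lbrakk>X \<in> obj C; Y \<in> obj C; Z \<in> obj C; f \<in> hom C X Y; f' \<in> hom C X Y; g \<in> hom C Y Z\<rbrakk>
        \<Longrightarrow> g \<cdot> (f + f') = (g \<cdot> f) + (g \<cdot> f')"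
    and comp_scale_left:
      "\<lbrakk>X \<in> obj C; Y \<in> obj C; Z \<in> obj C; f \<in> hom C X Y; g \<in> hom C Y Z\<rbrakk>
        \<Longrightarrow> scale C c g \<cdot> f = scale C c (g \<cdot> f)"
    and comp_scale_right:
      "\<lbrakk>X \<in> obj C; Y \<in> obj C; Z \<in> obj C; f \<in> hom C X Y; g \<in> hom C Y Z\<rbrakk>
        \<Longrightarrow> g \<cdot> scale C c f = scale C c (g \<cdot> f)"

definition isomorphism :: "('o, 'm, 'k, 'x) lincat_scheme \<Rightarrow> 'o \<Rightarrow> 'o \<Rightarrow> 'm \<Rightarrow> bool" where
  "isomorphism C X Y f \<longleftrightarrow> f \<in> hom C X Y \<and>
     (\<exists>g\<in>hom C Y X. g \<cdot>\<^bsub>C\<^esub> f = ident C X \<and> f \<cdot>\<^bsub>C\<^esub> g = ident C Y)"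

definition monomorphism :: "('o, 'm, 'k, 'x) lincat_scheme \<Rightarrow> 'o \<Rightarrow> 'o \<Rightarrow> 'm \<Rightarrow> bool" where
  "monomorphism C X Y f \<longleftrightarrow> f \<in> hom C X Y \<and>
     (\<forall>W\<in>obj C. \<forall>g\<in>hom C W X. \<forall>h\<in>hom C W X. f \<cdot>\<^bsub>C\<^esub> g = f \<cdot>\<^bsub>C\<^esub> h \<longrightarrow> g = h)"

definition epimorphism :: "('o, 'm, 'k, 'x) lincat_scheme \<Rightarrow> 'o \<Rightarrow> 'o \<Rightarrow> 'm \<Rightarrow> bool" where
  "epimorphism C X Y f \<longleftrightarrow> f \<in> hom C X Y \<and>
     (\<forall>Z\<in>obj C. \<forall>g\<in>hom C Y Z. \<forall>h\<in>hom C Y Z. g \<cdot>\<^bsub>C\<^esub> f = h \<cdot>\<^bsub>C\<^esub> f \<longrightarrow> g = h)"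

definition zero_object :: "('o, 'm, 'k, 'x) lincat_scheme \<Rightarrow> 'o \<Rightarrow> bool" where
  "zero_object C Z \<longleftrightarrow> Z \<in> obj C \<and>
     (\<forall>X\<in>obj C. (\<exists>!f. f \<in> hom C Z X) \<and> (\<exists>!f. f \<in> hom C X Z))"

definition simple_object :: "('o, 'm, 'k, 'x) lincat_scheme \<Rightarrow> 'o \<Rightarrow> bool" where
  "simple_object C S \<longleftrightarrow> S \<in> obj C \<and> \<not> zero_object C S \<and>
     (\<forall>X\<in>obj C. \<forall>i. monomorphism C X S i \<longrightarrow> zero_object C X \<or> isomorphism C X S i)"

definition projective_object :: "('o, 'm, 'k, 'x) lincat_scheme \<Rightarrow> 'o \<Rightarrow> bool" where
  "projective_object C P \<longleftrightarrow> P \<in> obj C \<and>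
     (\<forall>X\<in>obj C. \<forall>Y\<in>obj C. \<forall>e. epimorphism C X Y e \<longrightarrow>
        (\<forall>f\<in>hom C P Y. \<exists>g\<in>hom C P X. e \<cdot>\<^bsub>C\<^esub> g = f))"

definition direct_sum ::
    "('o, 'm::ab_group_add, 'k, 'x) lincat_scheme \<Rightarrow> nat \<Rightarrow> (nat \<Rightarrow> 'o) \<Rightarrow> 'o \<Rightarrow> bool" where
  "direct_sum C n S X \<longleftrightarrow>
     (\<exists>\<iota> \<pi>. (\<forall>i<n. \<iota> i \<in> hom C (S i) X \<and> \<pi> i \<in> hom C X (S i)) \<and>
        (\<forall>i<n. \<forall>j<n. \<pi> i \<cdot>\<^bsub>C\<^esub> \<iota> j = (if i = j then ident C (S i) else 0)) \<and>
        (\<Sum>i<n. \<iota> i \<cdot>\<^bsub>C\<^esub> \<pi> i) = ident C X)"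

definition semisimple_category :: "('o, 'm::ab_group_add, 'k, 'x) lincat_scheme \<Rightarrow> bool" where
  "semisimple_category C \<longleftrightarrow>
     (\<forall>X\<in>obj C. \<exists>n S. (\<forall>i<n. simple_object C (S i)) \<and> direct_sum C n S X)"


section \<open>Linear functors and equivalences\<close>

record ('o, 'm, 'p, 'n) lfunctor =
  on_obj :: "'o \<Rightarrow> 'p"
  on_hom :: "'o \<Rightarrow> 'o \<Rightarrow> 'm \<Rightarrow> 'n"

definition linear_functor ::
    "('o, 'm::ab_group_add, 'k, 'x) lincat_scheme \<Rightarrow> ('p, 'n::ab_group_add, 'k, 'y) lincat_scheme
      \<Rightarrow> ('o, 'm, 'p, 'n) lfunctor \<Rightarrow> bool" where
  "linear_functor C D F \<longleftrightarrow>
     (\<forall>X\<in>obj C. on_obj F X \<in> obj D \<and> on_hom F X X (ident C X) = ident D (on_obj F X)) \<and>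
     (\<forall>X\<in>obj C. \<forall>Y\<in>obj C. \<forall>f\<in>hom C X Y.
        on_hom F X Y f \<in> hom D (on_obj F X) (on_obj F Y) \<and>
        (\<forall>f'\<in>hom C X Y. on_hom F X Y (f + f') = on_hom F X Y f + on_hom F X Y f') \<and>
        (\<forall>c. on_hom F X Y (scale C c f) = scale D c (on_hom F X Y f))) \<and>
     (\<forall>X\<in>obj C. \<forall>Y\<in>obj C. \<forall>Z\<in>obj C. \<forall>f\<in>hom C X Y. \<forall>g\<in>hom C Y Z.
        on_hom F X Z (g \<cdot>\<^bsub>C\<^esub> f) = on_hom F Y Z g \<cdot>\<^bsub>D\<^esub> on_hom F X Y f)"

definition id_functor :: "('o, 'm, 'o, 'm) lfunctor" where
  "id_functor = \<lparr>on_obj = (\<lambda>X. X), on_hom = (\<lambda>X Y f. f)\<rparr>"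

definition comp_functor ::
    "('p, 'n, 'q, 'l) lfunctor \<Rightarrow> ('o, 'm, 'p, 'n) lfunctor \<Rightarrow> ('o, 'm, 'q, 'l) lfunctor" where
  "comp_functor G F =
     \<lparr>on_obj = (\<lambda>X. on_obj G (on_obj F X)),
      on_hom = (\<lambda>X Y f. on_hom G (on_obj F X) (on_obj F Y) (on_hom F X Y f))\<rparr>"

definition natural_isomorphism ::
    "('o, 'm, 'k, 'x) lincat_scheme \<Rightarrow> ('p, 'n, 'k, 'y) lincat_scheme
      \<Rightarrow> ('o, 'm, 'p, 'n) lfunctor \<Rightarrow> ('o, 'm, 'p, 'n) lfunctor \<Rightarrow> ('o \<Rightarrow> 'n) \<Rightarrow> bool" where
  "natural_isomorphism C D F G \<eta> \<longleftrightarrow>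
     (\<forall>X\<in>obj C. isomorphism D (on_obj F X) (on_obj G X) (\<eta> X)) \<and>
     (\<forall>X\<in>obj C. \<forall>Y\<in>obj C. \<forall>f\<in>hom C X Y.
        \<eta> Y \<cdot>\<^bsub>D\<^esub> on_hom F X Y f = on_hom G X Y f \<cdot>\<^bsub>D\<^esub> \<eta> X)"

definition linearly_equivalent ::
    "('o, 'm::ab_group_add, 'k, 'x) lincat_scheme \<Rightarrow> ('p, 'n::ab_group_add, 'k, 'y) lincat_scheme
      \<Rightarrow> bool" where
  "linearly_equivalent C D \<longleftrightarrow>
     (\<exists>F G \<eta> \<epsilon>. linear_functor C D F \<and> linear_functor D C G \<and>
        natural_isomorphism C C id_functor (comp_functor G F) \<eta> \<and>
        natural_isomorphism D D (comp_functor F G) id_functor \<epsilon>)"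


section \<open>Finite-dimensional algebras and their modules\<close>

text \<open>
  The underlying vector spaces of finite-dimensional algebras and modules are finite-dimensional
  subspaces of the space of all sequences. As this space is infinite-dimensional, every
  finite-dimensional algebra, and every finite-dimensional module over it, has an isomorphic copy
  of this form; hence the category \<open>fd_modules A\<close> below is equivalent to the category of all
  finite-dimensional left modules.
\<close>

type_synonym 'k sequence = "nat \<Rightarrow> 'k"

definition seq_scale :: "'k::field \<Rightarrow> 'k sequence \<Rightarrow> 'k sequence" where
  "seq_scale c v = (\<lambda>i. c * v i)"

definition fd_space :: "'k::field sequence set \<Rightarrow> bool" where
  "fd_space V \<longleftrightarrow> (\<exists>B. finite B \<and> module.span seq_scale B = V)"

record 'k fd_alg =
  alg_space :: "'k sequence set"
  alg_mult :: "'k sequence \<Rightarrow> 'k sequence \<Rightarrow> 'k sequence"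
  alg_one :: "'k sequence"

definition bilinear_op ::
    "'k::field sequence set \<Rightarrow> 'k sequence set \<Rightarrow> 'k sequence set
      \<Rightarrow> ('k sequence \<Rightarrow> 'k sequence \<Rightarrow> 'k sequence) \<Rightarrow> bool" where
  "bilinear_op U V W b \<longleftrightarrow>
     (\<forall>u\<in>U. \<forall>v\<in>V. b u v \<in> W \<and>
        (\<forall>u'\<in>U. b (u + u') v = b u v + b u' v) \<and>
        (\<forall>v'\<in>V. b u (v + v') = b u v + b u v') \<and>
        (\<forall>c. b (seq_scale c u) v = seq_scale c (b u v) \<and>
             b u (seq_scale c v) = seq_scale c (b u v)))"

definition fd_algebra :: "'k::field fd_alg \<Rightarrow> bool" where
  "fd_algebra A \<longleftrightarrow> fd_space (alg_space A) \<and>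
     bilinear_op (alg_space A) (alg_space A) (alg_space A) (alg_mult A) \<and>
     alg_one A \<in> alg_space A \<and>
     (\<forall>a\<in>alg_space A. alg_mult A (alg_one A) a = a \<and> alg_mult A a (alg_one A) = a) \<and>
     (\<forall>a\<in>alg_space A. \<forall>b\<in>alg_space A. \<forall>c\<in>alg_space A.
        alg_mult A (alg_mult A a b) c = alg_mult A a (alg_mult A b c))"

record 'k fd_mod =
  mod_space :: "'k sequence set"
  mod_act :: "'k sequence \<Rightarrow> 'k sequence \<Rightarrow> 'k sequence"

definition fd_module :: "'k::field fd_alg \<Rightarrow> 'k fd_mod \<Rightarrow> bool" where
  "fd_module A M \<longleftrightarrow> fd_space (mod_space M) \<and>
     bilinear_op (alg_space A) (mod_space M) (mod_space M) (mod_act M) \<and>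
     (\<forall>v\<in>mod_space M. mod_act M (alg_one A) v = v) \<and>
     (\<forall>a\<in>alg_space A. \<forall>b\<in>alg_space A. \<forall>v\<in>mod_space M.
        mod_act M (alg_mult A a b) v = mod_act M a (mod_act M b v))"

text \<open>
  Module homomorphisms are represented by functions that vanish outside the source module, which
  makes them a linear subspace of the function space and determines them by their values on the
  source.
\<close>

definition module_homs ::
    "'k::field fd_alg \<Rightarrow> 'k fd_mod \<Rightarrow> 'k fd_mod \<Rightarrow> ('k sequence \<Rightarrow> 'k sequence) set" where
  "module_homs A M N =
     {f. (\<forall>v\<in>mod_space M. f v \<in> mod_space N \<and>
            (\<forall>w\<in>mod_space M. f (v + w) = f v + f w) \<and>
            (\<forall>c. f (seq_scale c v) = seq_scale c (f v)) \<and>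
            (\<forall>a\<in>alg_space A. f (mod_act M a v) = mod_act N a (f v))) \<and>
         (\<forall>v. v \<notin> mod_space M \<longrightarrow> f v = 0)}"

definition fd_modules ::
    "'k::field fd_alg \<Rightarrow> ('k fd_mod, 'k sequence \<Rightarrow> 'k sequence, 'k) lincat" where
  "fd_modules A =
     \<lparr>obj = {M. fd_module A M},
      hom = module_homs A,
      ident = (\<lambda>M v. if v \<in> mod_space M then v else 0),
      comp = (\<lambda>g f. g \<circ> f),
      scale = (\<lambda>c f v. seq_scale c (f v))\<rparr>"

definition finite_category :: "('o, 'm::ab_group_add, 'k::field, 'x) lincat_scheme \<Rightarrow> bool" where
  "finite_category C \<longleftrightarrow> linear_category C \<and>
     (\<exists>A. fd_algebra A \<and> linearly_equivalent C (fd_modules A))"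


section \<open>Finite braided tensor categories\<close>

record ('o, 'm, 'k) moncat = "('o, 'm, 'k) lincat" +
  tensor_obj :: "'o \<Rightarrow> 'o \<Rightarrow> 'o"  (infixr "\<odot>\<index>" 75)
  tensor :: "'m \<Rightarrow> 'm \<Rightarrow> 'm"  (infixr "\<otimes>\<index>" 75)
  unit_obj :: "'o"

locale linear_monoidal_category = linear_category C
  for C :: "('o, 'm::ab_group_add, 'k::field, 'x) moncat_scheme" (structure) +
  assumes unit_in_obj: "unit_obj C \<in> obj C"
    and tensor_in_obj: "\<lbrakk>X \<in> obj C; Y \<in> obj C\<rbrakk> \<Longrightarrow> X \<odot> Y \<in> obj C"
    and tensor_in_hom:
      "\<lbrakk>X \<in> obj C; X' \<in> obj C; Y \<in> obj C; Y' \<in> obj C; f \<in> hom C X X'; g \<in> hom C Y Y'\<rbrakk>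
        \<Longrightarrow> f \<otimes> g \<in> hom C (X \<odot> Y) (X' \<odot> Y')"
    and tensor_ident:
      "\<lbrakk>X \<in> obj C; Y \<in> obj C\<rbrakk> \<Longrightarrow> ident C X \<otimes> ident C Y = ident C (X \<odot> Y)"
    and tensor_comp:
      "\<lbrakk>X \<in> obj C; X' \<in> obj C; X'' \<in> obj C; Y \<in> obj C; Y' \<in> obj C; Y'' \<in> obj C;
        f \<in> hom C X X'; f' \<in> hom C X' X''; g \<in> hom C Y Y'; g' \<in> hom C Y' Y''\<rbrakk>
        \<Longrightarrow> (f' \<cdot> f) \<otimes> (g' \<cdot> g) = (f' \<otimes> g') \<cdot> (f \<otimes> g)"
    and tensor_add_left:
      "\<lbrakk>X \<in> obj C; X' \<in> obj C; Y \<in> obj C; Y' \<in> obj C;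
        f \<in> hom C X X'; f' \<in> hom C X X'; g \<in> hom C Y Y'\<rbrakk>
        \<Longrightarrow> (f + f') \<otimes> g = (f \<otimes> g) + (f' \<otimes> g)"
    and tensor_add_right:
      "\<lbrakk>X \<in> obj C; X' \<in> obj C; Y \<in> obj C; Y' \<in> obj C;
        f \<in> hom C X X'; g \<in> hom C Y Y'; g' \<in> hom C Y Y'\<rbrakk>
        \<Longrightarrow> f \<otimes> (g + g') = (f \<otimes> g) + (f \<otimes> g')"
    and tensor_scale_left:
      "\<lbrakk>X \<in> obj C; X' \<in> obj C; Y \<in> obj C; Y' \<in> obj C; f \<in> hom C X X'; g \<in> hom C Y Y'\<rbrakk>
        \<Longrightarrow> scale C c f \<otimes> g = scale C c (f \<otimes> g)"
    and tensor_scale_right: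
      "\<lbrakk>X \<in> obj C; X' \<in> obj C; Y \<in> obj C; Y' \<in> obj C; f \<in> hom C X X'; g \<in> hom C Y Y'\<rbrakk>
        \<Longrightarrow> f \<otimes> scale C c g = scale C c (f \<otimes> g)"
    and tensor_obj_assoc:
      "\<lbrakk>X \<in> obj C; Y \<in> obj C; Z \<in> obj C\<rbrakk> \<Longrightarrow> (X \<odot> Y) \<odot> Z = X \<odot> (Y \<odot> Z)"
    and tensor_assoc:
      "\<lbrakk>X \<in> obj C; X' \<in> obj C; Y \<in> obj C; Y' \<in> obj C; Z \<in> obj C; Z' \<in> obj C;
        f \<in> hom C X X'; g \<in> hom C Y Y'; h \<in> hom C Z Z'\<rbrakk>
        \<Longrightarrow> (f \<otimes> g) \<otimes> h = f \<otimes> (g \<otimes> h)"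
    and tensor_obj_unit: "X \<in> obj C \<Longrightarrow> unit_obj C \<odot> X = X" "X \<in> obj C \<Longrightarrow> X \<odot> unit_obj C = X"
    and tensor_unit:
      "\<lbrakk>X \<in> obj C; Y \<in> obj C; f \<in> hom C X Y\<rbrakk> \<Longrightarrow> ident C (unit_obj C) \<otimes> f = f"
      "\<lbrakk>X \<in> obj C; Y \<in> obj C; f \<in> hom C X Y\<rbrakk> \<Longrightarrow> f \<otimes> ident C (unit_obj C) = f"

text \<open>
  \<open>dual_pair C D X ev coev\<close>: \<open>D\<close> is a left dual of \<open>X\<close>, equivalently \<open>X\<close> is a right dual
  of \<open>D\<close>, with evaluation \<open>D \<odot> X \<rightarrow> 1\<close> and coevaluation \<open>1 \<rightarrow> X \<odot> D\<close>.
\<close>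

definition dual_pair ::
    "('o, 'm, 'k, 'x) moncat_scheme \<Rightarrow> 'o \<Rightarrow> 'o \<Rightarrow> 'm \<Rightarrow> 'm \<Rightarrow> bool" where
  "dual_pair C D X ev coev \<longleftrightarrow>
     ev \<in> hom C (D \<odot>\<^bsub>C\<^esub> X) (unit_obj C) \<and> coev \<in> hom C (unit_obj C) (X \<odot>\<^bsub>C\<^esub> D) \<and>
     (ident C X \<otimes>\<^bsub>C\<^esub> ev) \<cdot>\<^bsub>C\<^esub> (coev \<otimes>\<^bsub>C\<^esub> ident C X) = ident C X \<and>
     (ev \<otimes>\<^bsub>C\<^esub> ident C D) \<cdot>\<^bsub>C\<^esub> (ident C D \<otimes>\<^bsub>C\<^esub> coev) = ident C D"

locale finite_tensor_category = linear_monoidal_category C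
  for C :: "('o, 'm::ab_group_add, 'k::field, 'x) moncat_scheme" (structure) +
  assumes finite_cat: "finite_category C"
    and left_dual: "X \<in> obj C \<Longrightarrow> \<exists>D\<in>obj C. \<exists>ev coev. dual_pair C D X ev coev"
    and right_dual: "X \<in> obj C \<Longrightarrow> \<exists>D\<in>obj C. \<exists>ev coev. dual_pair C X D ev coev"
    and simple_unit: "simple_object C (unit_obj C)"

record ('o, 'm, 'k) brcat = "('o, 'm, 'k) moncat" +
  braiding :: "'o \<Rightarrow> 'o \<Rightarrow> 'm"

locale finite_braided_tensor_category = finite_tensor_category C
  for C :: "('o, 'm::ab_group_add, 'k::field, 'x) brcat_scheme" (structure) +
  assumes braiding_iso:
      "\<lbrakk>X \<in> obj C; Y \<in> obj C\<rbrakk> \<Longrightarrow> isomorphism C (X \<odot> Y) (Y \<odot> X) (braiding C X Y)"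
    and braiding_natural:
      "\<lbrakk>X \<in> obj C; X' \<in> obj C; Y \<in> obj C; Y' \<in> obj C; f \<in> hom C X X'; g \<in> hom C Y Y'\<rbrakk>
        \<Longrightarrow> braiding C X' Y' \<cdot> (f \<otimes> g) = (g \<otimes> f) \<cdot> braiding C X Y"
    and hexagon_left:
      "\<lbrakk>X \<in> obj C; Y \<in> obj C; Z \<in> obj C\<rbrakk> \<Longrightarrow>
        braiding C (X \<odot> Y) Z =
          (braiding C X Z \<otimes> ident C Y) \<cdot> (ident C X \<otimes> braiding C Y Z)"
    and hexagon_right:
      "\<lbrakk>X \<in> obj C; Y \<in> obj C; Z \<in> obj C\<rbrakk> \<Longrightarrow>
        braiding C X (Y \<odot> Z) =
          (ident C Y \<otimes> braiding C X Z) \<cdot> (braiding C X Y \<otimes> ident C Z)"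


section \<open>Algebras and bimodules\<close>

record ('o, 'm) algebra_object =
  carrier_obj :: "'o"
  mult :: "'m"
  unit_mor :: "'m"

definition is_algebra ::
    "('o, 'm, 'k, 'x) moncat_scheme \<Rightarrow> ('o, 'm) algebra_object \<Rightarrow> bool" where
  "is_algebra C A \<longleftrightarrow>
     (let a = carrier_obj A; \<mu> = mult A; \<eta> = unit_mor A in
        a \<in> obj C \<and> \<mu> \<in> hom C (a \<odot>\<^bsub>C\<^esub> a) a \<and> \<eta> \<in> hom C (unit_obj C) a \<and>
        \<mu> \<cdot>\<^bsub>C\<^esub> (\<mu> \<otimes>\<^bsub>C\<^esub> ident C a) = \<mu> \<cdot>\<^bsub>C\<^esub> (ident C a \<otimes>\<^bsub>C\<^esub> \<mu>) \<and>
        \<mu> \<cdot>\<^bsub>C\<^esub> (\<eta> \<otimes>\<^bsub>C\<^esub> ident C a) = ident C a \<and>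
        \<mu> \<cdot>\<^bsub>C\<^esub> (ident C a \<otimes>\<^bsub>C\<^esub> \<eta>) = ident C a)"

record ('o, 'm) bimodule =
  bimod_obj :: "'o"
  left_act :: "'m"
  right_act :: "'m"

definition is_bimodule ::
    "('o, 'm, 'k, 'x) moncat_scheme \<Rightarrow> ('o, 'm) algebra_object \<Rightarrow> ('o, 'm) bimodule \<Rightarrow> bool" where
  "is_bimodule C A M \<longleftrightarrow>
     (let a = carrier_obj A; \<mu> = mult A; \<eta> = unit_mor A;
          m = bimod_obj M; l = left_act M; r = right_act M in
        m \<in> obj C \<and> l \<in> hom C (a \<odot>\<^bsub>C\<^esub> m) m \<and> r \<in> hom C (m \<odot>\<^bsub>C\<^esub> a) m \<and>
        l \<cdot>\<^bsub>C\<^esub> (\<mu> \<otimes>\<^bsub>C\<^esub> ident C m) = l \<cdot>\<^bsub>C\<^esub> (ident C a \<otimes>\<^bsub>C\<^esub> l) \<and>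
        l \<cdot>\<^bsub>C\<^esub> (\<eta> \<otimes>\<^bsub>C\<^esub> ident C m) = ident C m \<and>
        r \<cdot>\<^bsub>C\<^esub> (ident C m \<otimes>\<^bsub>C\<^esub> \<mu>) = r \<cdot>\<^bsub>C\<^esub> (r \<otimes>\<^bsub>C\<^esub> ident C a) \<and>
        r \<cdot>\<^bsub>C\<^esub> (ident C m \<otimes>\<^bsub>C\<^esub> \<eta>) = ident C m \<and>
        r \<cdot>\<^bsub>C\<^esub> (l \<otimes>\<^bsub>C\<^esub> ident C a) = l \<cdot>\<^bsub>C\<^esub> (ident C a \<otimes>\<^bsub>C\<^esub> r))"

definition bimodule_homs ::
    "('o, 'm, 'k, 'x) moncat_scheme \<Rightarrow> ('o, 'm) algebra_object
      \<Rightarrow> ('o, 'm) bimodule \<Rightarrow> ('o, 'm) bimodule \<Rightarrow> 'm set" where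
  "bimodule_homs C A M N =
     {f \<in> hom C (bimod_obj M) (bimod_obj N).
        f \<cdot>\<^bsub>C\<^esub> left_act M = left_act N \<cdot>\<^bsub>C\<^esub> (ident C (carrier_obj A) \<otimes>\<^bsub>C\<^esub> f) \<and>
        f \<cdot>\<^bsub>C\<^esub> right_act M = right_act N \<cdot>\<^bsub>C\<^esub> (f \<otimes>\<^bsub>C\<^esub> ident C (carrier_obj A))}"

definition bimod ::
    "('o, 'm, 'k, 'x) moncat_scheme \<Rightarrow> ('o, 'm) algebra_object
      \<Rightarrow> (('o, 'm) bimodule, 'm, 'k) lincat" where
  "bimod C A =
     \<lparr>obj = {M. is_bimodule C A M},
      hom = bimodule_homs C A,
      ident = (\<lambda>M. ident C (bimod_obj M)),
      comp = comp C,
      scale = scale C\<rparr>"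

definition regular_bimodule :: "('o, 'm) algebra_object \<Rightarrow> ('o, 'm) bimodule" where
  "regular_bimodule A =
     \<lparr>bimod_obj = carrier_obj A, left_act = mult A, right_act = mult A\<rparr>"

definition tensor_square_bimodule ::
    "('o, 'm, 'k, 'x) moncat_scheme \<Rightarrow> ('o, 'm) algebra_object \<Rightarrow> ('o, 'm) bimodule" where
  "tensor_square_bimodule C A =
     \<lparr>bimod_obj = carrier_obj A \<odot>\<^bsub>C\<^esub> carrier_obj A,
      left_act = mult A \<otimes>\<^bsub>C\<^esub> ident C (carrier_obj A),
      right_act = ident C (carrier_obj A) \<otimes>\<^bsub>C\<^esub> mult A\<rparr>"

definition separable :: "('o, 'm, 'k, 'x) moncat_scheme \<Rightarrow> ('o, 'm) algebra_object \<Rightarrow> bool" where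
  "separable C A \<longleftrightarrow>
     (\<exists>s \<in> hom (bimod C A) (regular_bimodule A) (tensor_square_bimodule C A).
        mult A \<cdot>\<^bsub>C\<^esub> s = ident C (carrier_obj A))"

end

theory Submission
  imports Defs
begin

text \<open>A bimodule section of the multiplication yields a Casimir element, so it suffices to show that the
  unit object is projective. The Casimir element also cuts out the centre of the algebra, which is again
  separable and projective, and it is non-zero; so let \<open>a\<close> be commutative. Then the trace form
  \<open>a \<rightarrow> 1\<close> of the regular module is non-degenerate, and if its value on the unit \<open>1 \<rightarrow> a\<close> is
  non-zero, then the unit object is a retract of the projective object \<open>a\<close>.

  Suppose that this value is zero. Bimodules over \<open>a\<close> with a twist form a semisimple category, because
  generalized inverses can be averaged with the Casimir element and, in characteristic zero, with the twist.
  The trace form of the bimodule \<open>V \<odot> a\<close> induced from \<open>V\<close> is the trace form of \<open>V\<close> times the value on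
  the unit, hence zero. Taking for \<open>V\<close> a rational combination of simple objects whose multiplicities are
  given by a rational functional of the traces, one gets a null vector \<open>V \<odot> a\<close> of the form
  \<open>dim Hom(X, Y)\<close>. This form is positive definite on the rational Grothendieck group, so the trace form of
  \<open>a\<close> itself would vanish.\<close>

section \<open>String diagrams\<close>

text \<open>Neither a pivotal structure nor an algebraically closed field is available, and both
  gaps shape the argument. A strand can only be closed through the braiding, and closing
  \<open>V \<odot> a\<close> in this way links its two strands, so that traces by themselves are not
  multiplicative. The twists repair this: the double braiding in the twist of
  \<open>V \<odot> a\<close> undoes the linking. The category controls only the square of a twist,
  through the double twist, so a twist may be replaced by its negative; this sign explains the
  average over two terms and the comparison of simple objects up to sign. Bimodules are used because
  \<open>V \<odot> a\<close> keeps its two actions apart; on symmetric bimodules, induction is then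
  left adjoint to symmetrization, and this reciprocity converts traces of induced objects into
  values of the form dim Hom. That form is positive over the rational numbers, while traces lie in a
  space over the ground field. An additive rational functional with value 1 on the trace form
  connects the two; its existence rests on characteristic zero.\<close>

type_synonym ('o, 'm) box = "'o list \<times> 'o list \<times> 'm"
text \<open>Layers are listed in the order in which they act, each with the number of wires to its
  left. Lists of wires in place of iterated tensor products turn strict associativity and units into
  list append, so that typing and positions can be computed by the simplifier.\<close>

type_synonym ('o, 'm) diagram = "(nat \<times> ('o, 'm) box) list"

fun run :: "'o list \<Rightarrow> ('o, 'm) diagram \<Rightarrow> 'o list" where
  "run w [] = w"
| "run w ((i, x, y, m) # d) = run (take i w @ y @ drop (i + length x) w) d"

definition shift :: "nat \<Rightarrow> ('o, 'm) diagram \<Rightarrow> ('o, 'm) diagram" where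
  "shift i d = map (\<lambda>(j, b). (i + j, b)) d"

lemma shift_simps [simp]:
  "shift i [] = []" "shift i ((j, b) # d) = (i + j, b) # shift i d"
  by (auto simp: shift_def)

lemma shift_append [simp]: "shift i (d @ d') = shift i d @ shift i d'"
  by (simp add: shift_def)

text \<open>The interchange law as a sorting step: a layer moves behind a later one that lies
  entirely to the right of its outputs, and the position of the latter is recounted with the inputs
  instead. As \<open>j\<close> is at least \<open>length y\<close>, the truncated subtraction is
  harmless.\<close>

fun insert_layer :: "nat \<times> ('o, 'm) box \<Rightarrow> ('o, 'm) diagram \<Rightarrow> ('o, 'm) diagram" where
  "insert_layer l [] = [l]"
| "insert_layer (i, x, y, m) ((j, x', y', m') # d) =
     (if i + length y \<le> j
      then (j + length x - length y, x', y', m') # insert_layer (i, x, y, m) d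
      else (i, x, y, m) # (j, x', y', m') # d)"

text \<open>Insertion sort by interchange. Only soundness matters: equal results prove two diagrams
  equal, different results prove nothing.\<close>

fun norm :: "('o, 'm) diagram \<Rightarrow> ('o, 'm) diagram" where
  "norm [] = []"
| "norm (l # d) = insert_layer l (norm d)"

lemma run_append [simp]: "run w (d @ d') = run (run w d) d'"
  by (induction w d rule: run.induct) auto

section \<open>Typing, meaning and equality of diagrams\<close>

context linear_monoidal_category
begin

definition tens :: "'o list \<Rightarrow> 'o" where
  "tens ws = foldr (\<odot>) ws (unit_obj C)"

definition box :: "('o, 'm) box \<Rightarrow> bool" where
  "box b \<longleftrightarrow> (case b of (x, y, m) \<Rightarrow>
     set x \<subseteq> obj C \<and> set y \<subseteq> obj C \<and> m \<in> hom C (tens x) (tens y))"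

fun ok :: "'o list \<Rightarrow> ('o, 'm) diagram \<Rightarrow> bool" where
  "ok w [] \<longleftrightarrow> set w \<subseteq> obj C"
| "ok w ((i, x, y, m) # d) \<longleftrightarrow> set w \<subseteq> obj C \<and> box (x, y, m) \<and> i \<le> length w \<and>
     take (length x) (drop i w) = x \<and> ok (take i w @ y @ drop (i + length x) w) d"

definition layer :: "'o list \<Rightarrow> 'm \<Rightarrow> 'o list \<Rightarrow> 'm" where
  "layer L m R = ident C (tens L) \<otimes> (m \<otimes> ident C (tens R))"

fun sem :: "'o list \<Rightarrow> ('o, 'm) diagram \<Rightarrow> 'm" where
  "sem w [] = ident C (tens w)"
| "sem w ((i, x, y, m) # d) =
     sem (take i w @ y @ drop (i + length x) w) d \<cdot> layer (take i w) m (drop (i + length x) w)"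

text \<open>The typing of both sides and the common target are part of the relation, so that chains
  of rewriting steps carry all side conditions with them.\<close>

definition deq :: "'o list \<Rightarrow> ('o, 'm) diagram \<Rightarrow> ('o, 'm) diagram \<Rightarrow> bool" where
  "deq w d d' \<longleftrightarrow> ok w d \<and> ok w d' \<and> run w d = run w d' \<and> sem w d = sem w d'"

lemma tens_Nil [simp]: "tens [] = unit_obj C"
  and tens_Cons: "tens (X # ws) = X \<odot> tens ws"
  by (auto simp: tens_def)

lemma tens_in_obj [simp]: "set ws \<subseteq> obj C \<Longrightarrow> tens ws \<in> obj C"
  by (induction ws) (auto simp: tens_Cons unit_in_obj tensor_in_obj)

lemma tens_single [simp]: "X \<in> obj C \<Longrightarrow> tens [X] = X"
  by (simp add: tens_Cons tensor_obj_unit)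

lemma tens_append: "set u \<subseteq> obj C \<Longrightarrow> set v \<subseteq> obj C \<Longrightarrow> tens (u @ v) = tens u \<odot> tens v"
  by (induction u) (auto simp: tens_Cons tensor_obj_unit tensor_obj_assoc)

lemma layer_in_hom:
  assumes "set L \<subseteq> obj C" "set R \<subseteq> obj C" "set x \<subseteq> obj C" "set y \<subseteq> obj C" "m \<in> hom C (tens x) (tens y)"
  shows "layer L m R \<in> hom C (tens (L @ x @ R)) (tens (L @ y @ R))"
  using assms unfolding layer_def
  by (auto simp: tens_append tensor_in_obj ident_in_hom intro!: tensor_in_hom)

lemma ok_set: "ok w d \<Longrightarrow> set w \<subseteq> obj C"
  by (cases d) auto

lemma ok_split:
  assumes "i \<le> length w" "take (length x) (drop i w) = x"
  obtains L R where "w = L @ x @ R" "length L = i" "take i w = L" "drop (i + length x) w = R"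
proof -
  have "w = take i w @ drop i w" by simp
  also have "drop i w = take (length x) (drop i w) @ drop (length x) (drop i w)"
    by (rule append_take_drop_id[symmetric])
  finally have "w = take i w @ x @ drop (i + length x) w"
    using assms(2) by (simp add: add.commute)
  with assms(1) show ?thesis by (intro that[of "take i w" "drop (i + length x) w"]) auto
qed

lemma run_obj: "ok w d \<Longrightarrow> set (run w d) \<subseteq> obj C"
  by (induction w d rule: ok.induct) (auto simp: box_def)

lemma sem_in_hom: "ok w d \<Longrightarrow> sem w d \<in> hom C (tens w) (tens (run w d))"
proof (induction w d rule: ok.induct)
  case (1 w)
  then show ?case by (auto intro: ident_in_hom)
next
  case (2 w i x y m d)
  then obtain L R where w: "w = L @ x @ R" "length L = i" "take i w = L" "drop (i + length x) w = R"
    by (auto elim: ok_split)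
  from 2 w have sets: "set L \<subseteq> obj C" "set R \<subseteq> obj C" "set x \<subseteq> obj C" "set y \<subseteq> obj C"
    "m \<in> hom C (tens x) (tens y)" by (auto simp: box_def)
  have okr: "ok (L @ y @ R) d" and ih: "sem (L @ y @ R) d \<in> hom C (tens (L @ y @ R)) (tens (run (L @ y @ R) d))"
    using 2 w by auto
  have "set (run (L @ y @ R) d) \<subseteq> obj C" using run_obj[OF okr] .
  then show ?case
    using ih layer_in_hom[OF sets] sets comp_in_hom[of "tens w" "tens (L @ y @ R)"]
    by (simp add: w(1,2))
qed

lemma sem_append:
  assumes "ok w d" "ok (run w d) d'"
  shows "sem w (d @ d') = sem (run w d) d' \<cdot> sem w d"
  using assms
proof (induction w d rule: ok.induct)
  case (1 w)
  then show ?case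
    using sem_in_hom[OF 1(2)] run_obj[OF 1(2)] by (simp add: comp_ident[of "tens w" "tens (run w d')"])
next
  case (2 w i x y m d)
  then obtain L R where w: "w = L @ x @ R" "length L = i" "take i w = L" "drop (i + length x) w = R"
    by (auto elim: ok_split)
  from 2 w have sets: "set L \<subseteq> obj C" "set R \<subseteq> obj C" "set x \<subseteq> obj C" "set y \<subseteq> obj C"
    "m \<in> hom C (tens x) (tens y)" by (auto simp: box_def)
  have okr: "ok (L @ y @ R) d" "ok (run (L @ y @ R) d) d'" using 2 w by auto
  have ih: "sem (L @ y @ R) (d @ d') = sem (run (L @ y @ R) d) d' \<cdot> sem (L @ y @ R) d"
    using 2 w by auto
  have o: "set (run (L @ y @ R) d) \<subseteq> obj C" "set (run (run (L @ y @ R) d) d') \<subseteq> obj C"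
    using run_obj[OF okr(1)] run_obj[OF okr(2)] .
  show ?case
    using ih layer_in_hom[OF sets] sets o sem_in_hom[OF okr(1)] sem_in_hom[OF okr(2)]
      comp_assoc[of "tens w" "tens (L @ y @ R)" "tens (run (L @ y @ R) d)" "tens (run (run (L @ y @ R) d) d')"
        "layer L m R" "sem (L @ y @ R) d" "sem (run (L @ y @ R) d) d'"]
    by (simp add: w(1,2))
qed

lemma ok_append: "ok w (d @ d') \<longleftrightarrow> ok w d \<and> ok (run w d) d'"
  by (induction w d rule: ok.induct) (auto dest: ok_set)

lemma tensor_id_comp:
  assumes "X \<in> obj C" "Y \<in> obj C" "Z \<in> obj C" "W \<in> obj C" "f \<in> hom C X Y" "g \<in> hom C Y Z"
  shows "ident C W \<otimes> (g \<cdot> f) = (ident C W \<otimes> g) \<cdot> (ident C W \<otimes> f)"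
    and "(g \<cdot> f) \<otimes> ident C W = (g \<otimes> ident C W) \<cdot> (f \<otimes> ident C W)"
  using tensor_comp[of W W W X Y Z "ident C W" "ident C W" f g]
    tensor_comp[of X Y Z W W W f g "ident C W" "ident C W"] assms
    comp_ident[of W W "ident C W"] ident_in_hom[of W] by auto

lemma layer_comp:
  assumes "set L \<subseteq> obj C" "set R \<subseteq> obj C" "X \<in> obj C" "Y \<in> obj C" "Z \<in> obj C"
    "f \<in> hom C X Y" "g \<in> hom C Y Z"
  shows "layer L (g \<cdot> f) R = layer L g R \<cdot> layer L f R"
proof -
  let ?R = "ident C (tens R)"
  have h: "f \<otimes> ?R \<in> hom C (X \<odot> tens R) (Y \<odot> tens R)" "g \<otimes> ?R \<in> hom C (Y \<odot> tens R) (Z \<odot> tens R)"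
    using assms by (auto intro!: tensor_in_hom ident_in_hom)
  show ?thesis unfolding layer_def
    using assms h by (subst tensor_id_comp(2)[of X Y Z], simp_all add: tensor_in_obj
        tensor_id_comp(1)[of "X \<odot> tens R" "Y \<odot> tens R" "Z \<odot> tens R" "tens L"])
qed

lemma layer_layer:
  assumes "set L \<subseteq> obj C" "set R \<subseteq> obj C" "set L' \<subseteq> obj C" "set R' \<subseteq> obj C"
    "set x \<subseteq> obj C" "set y \<subseteq> obj C" "m \<in> hom C (tens x) (tens y)"
  shows "layer L (layer L' m R') R = layer (L @ L') m (R' @ R)"
proof -
  let ?i = "\<lambda>u. ident C (tens u)"
  have ii: "?i (L @ L') = ?i L \<otimes> ?i L'" "?i (R' @ R) = ?i R' \<otimes> ?i R"
    using assms by (auto simp: tens_append tensor_ident)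
  have m: "m \<in> hom C (tens x) (tens y)" by fact
  have h: "?i L \<in> hom C (tens L) (tens L)" "?i R \<in> hom C (tens R) (tens R)"
    "?i L' \<in> hom C (tens L') (tens L')" "?i R' \<in> hom C (tens R') (tens R')"
    using assms by (auto intro: ident_in_hom)
  have mr: "m \<otimes> ?i R' \<in> hom C (tens x \<odot> tens R') (tens y \<odot> tens R')"
    "m \<otimes> (?i R' \<otimes> ?i R) \<in> hom C (tens x \<odot> tens R' \<odot> tens R) (tens y \<odot> tens R' \<odot> tens R)"
    using assms h by (auto intro!: tensor_in_hom simp: tensor_in_obj)
  have "(?i L' \<otimes> (m \<otimes> ?i R')) \<otimes> ?i R = ?i L' \<otimes> ((m \<otimes> ?i R') \<otimes> ?i R)"
    by (rule tensor_assoc[OF _ _ _ _ _ _ h(3) mr(1) h(2)]) (use assms in \<open>auto simp: tensor_in_obj\<close>)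
  also have "(m \<otimes> ?i R') \<otimes> ?i R = m \<otimes> (?i R' \<otimes> ?i R)"
    by (rule tensor_assoc[OF _ _ _ _ _ _ m h(4) h(2)]) (use assms in \<open>auto simp: tensor_in_obj\<close>)
  finally have 1: "(?i L' \<otimes> (m \<otimes> ?i R')) \<otimes> ?i R = ?i L' \<otimes> (m \<otimes> (?i R' \<otimes> ?i R))" .
  have "(?i L \<otimes> ?i L') \<otimes> (m \<otimes> (?i R' \<otimes> ?i R)) = ?i L \<otimes> (?i L' \<otimes> (m \<otimes> (?i R' \<otimes> ?i R)))"
    by (rule tensor_assoc[OF _ _ _ _ _ _ h(1) h(3) mr(2)]) (use assms in \<open>auto simp: tensor_in_obj\<close>)
  then show ?thesis unfolding layer_def ii 1 by simp
qed

lemma layer_ident: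
  assumes "set L \<subseteq> obj C" "set R \<subseteq> obj C" "set w \<subseteq> obj C"
  shows "layer L (ident C (tens w)) R = ident C (tens (L @ w @ R))"
  using assms by (simp add: layer_def tens_append tensor_ident tensor_in_obj)

text \<open>Whiskering: placing a diagram between further wires tensors its meaning with identities.
  Local rewriting is sound because of this.\<close>

lemma shift_ok:
  assumes "ok s d" "set L \<subseteq> obj C" "set R \<subseteq> obj C"
  shows "ok (L @ s @ R) (shift (length L) d) \<and> run (L @ s @ R) (shift (length L) d) = L @ run s d @ R
    \<and> sem (L @ s @ R) (shift (length L) d) = layer L (sem s d) R"
  using assms
proof (induction s d rule: ok.induct)
  case (1 w)
  then show ?case by (simp add: layer_ident)
next
  case (2 w i x y m d)
  then obtain L' R' where w: "w = L' @ x @ R'" "length L' = i" "take i w = L'" "drop (i + length x) w = R'"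
    by (auto elim: ok_split)
  from 2 w have sets: "set L' \<subseteq> obj C" "set R' \<subseteq> obj C" "set x \<subseteq> obj C" "set y \<subseteq> obj C"
    "m \<in> hom C (tens x) (tens y)" by (auto simp: box_def)
  have okr: "ok (L' @ y @ R') d" using 2 w by auto
  have ih: "ok (L @ (L' @ y @ R') @ R) (shift (length L) d)"
    "run (L @ (L' @ y @ R') @ R) (shift (length L) d) = L @ run (L' @ y @ R') d @ R"
    "sem (L @ (L' @ y @ R') @ R) (shift (length L) d) = layer L (sem (L' @ y @ R') d) R"
    using 2 w by auto
  have c: "layer L (sem (L' @ y @ R') d \<cdot> layer L' m R') R =
     layer L (sem (L' @ y @ R') d) R \<cdot> layer L (layer L' m R') R"
    using sem_in_hom[OF okr] run_obj[OF okr] layer_in_hom[OF sets] sets 2 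
    by (intro layer_comp[of _ _ "tens (L' @ x @ R')" "tens (L' @ y @ R')" "tens (run (L' @ y @ R') d)"]) auto
  have b: "box (x, y, m)" using 2 by simp
  show ?case using ih c b sets 2(3,4) w layer_layer[OF 2(3,4) sets]
    by (simp add: w(1,2))
qed

lemma deq_refl: "ok w d \<Longrightarrow> deq w d d"
  by (simp add: deq_def)

lemma deq_sym: "deq w d d' \<Longrightarrow> deq w d' d"
  by (simp add: deq_def)

lemma deq_trans [trans]: "deq w d d' \<Longrightarrow> deq w d' d'' \<Longrightarrow> deq w d d''"
  by (simp add: deq_def)

lemma deq_context:
  assumes "deq s l r" "ok w (pre @ shift i l @ post)"
    "i \<le> length (run w pre)" "take (length s) (drop i (run w pre)) = s"
  shows "deq w (pre @ shift i l @ post) (pre @ shift i r @ post)"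
proof -
  obtain L R where u: "run w pre = L @ s @ R" "length L = i"
    using assms(3,4) by (auto elim: ok_split)
  have op: "ok w pre" and ol: "ok (run w pre) (shift i l)" and opo: "ok (run (run w pre) (shift i l)) post"
    using assms(2) by (auto simp: ok_append)
  have LR: "set L \<subseteq> obj C" "set R \<subseteq> obj C" using run_obj[OF op] u by auto
  have l: "ok s l" and r: "ok s r" and lr: "run s l = run s r" "sem s l = sem s r"
    using assms(1) by (auto simp: deq_def)
  note L1 = shift_ok[OF l LR] and R1 = shift_ok[OF r LR]
  show ?thesis unfolding deq_def
    using op ol opo L1 R1 lr u by (simp add: ok_append sem_append)
qed

text \<open>By functoriality of the tensor product both sides are \<open>m\<close> and
  \<open>m'\<close> side by side. The calculation is done without wires on the left;
  \<open>L\<close> is whiskered on at the end.\<close>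

lemma layer_swap:
  assumes "set L \<subseteq> obj C" "set M \<subseteq> obj C" "set R \<subseteq> obj C"
    "box (x, y, m)" "box (x', y', m')"
  shows "layer (L @ y @ M) m' R \<cdot> layer L m (M @ x' @ R) = layer L m (M @ y' @ R) \<cdot> layer (L @ x @ M) m' R"
proof -
  let ?i = "\<lambda>u. ident C (tens u)"
  have b: "set x \<subseteq> obj C" "set y \<subseteq> obj C" "m \<in> hom C (tens x) (tens y)"
      "set x' \<subseteq> obj C" "set y' \<subseteq> obj C" "m' \<in> hom C (tens x') (tens y')"
    using assms by (auto simp: box_def)
  have h: "layer M m' R \<in> hom C (tens (M @ x' @ R)) (tens (M @ y' @ R))"
    "?i (M @ x' @ R) \<in> hom C (tens (M @ x' @ R)) (tens (M @ x' @ R))"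
    "?i (M @ y' @ R) \<in> hom C (tens (M @ y' @ R)) (tens (M @ y' @ R))"
    "?i y \<in> hom C (tens y) (tens y)" "?i x \<in> hom C (tens x) (tens x)"
    using assms b by (auto intro!: layer_in_hom ident_in_hom)
  have e: "layer y m' R' = ?i y \<otimes> (m' \<otimes> ?i R')" for y R' by (simp add: layer_def)
  have t: "layer (y @ M) m' R = ?i y \<otimes> layer M m' R" if "set y \<subseteq> obj C" for y
    using layer_layer[of y "[]" M R x' y' m'] that assms b h(1)
      tensor_unit(2)[of "tens (M @ x' @ R)" "tens (M @ y' @ R)" "layer M m' R"]
    by (simp add: layer_def)
  have l0: "layer [] m (M @ z @ R) = m \<otimes> ?i (M @ z @ R)" if "set z \<subseteq> obj C" for z
  proof -
    have "tens (M @ z @ R) \<in> obj C" using assms that by simp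
    then have "m \<otimes> ?i (M @ z @ R) \<in> hom C (tens x \<odot> tens (M @ z @ R)) (tens y \<odot> tens (M @ z @ R))"
      using b by (intro tensor_in_hom ident_in_hom) auto
    then show ?thesis
      using tensor_unit(1)[of "tens x \<odot> tens (M @ z @ R)" "tens y \<odot> tens (M @ z @ R)" "m \<otimes> ?i (M @ z @ R)"]
        b \<open>tens (M @ z @ R) \<in> obj C\<close> by (simp add: layer_def tensor_in_obj)
  qed
  have "layer (y @ M) m' R \<cdot> layer [] m (M @ x' @ R) = (?i y \<otimes> layer M m' R) \<cdot> (m \<otimes> ?i (M @ x' @ R))"
    using b t l0 by simp
  also have "... = (?i y \<cdot> m) \<otimes> (layer M m' R \<cdot> ?i (M @ x' @ R))"
    using tensor_comp[OF _ _ _ _ _ _ b(3) h(4) h(2) h(1)] assms b by simp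
  also have "... = (m \<cdot> ?i x) \<otimes> (?i (M @ y' @ R) \<cdot> layer M m' R)"
    using b h assms by (simp add: comp_ident[of "tens x" "tens y"] ident_comp[of "tens x" "tens y"]
        comp_ident[of "tens (M @ x' @ R)" "tens (M @ y' @ R)"] ident_comp[of "tens (M @ x' @ R)" "tens (M @ y' @ R)"])
  also have "... = (m \<otimes> ?i (M @ y' @ R)) \<cdot> (?i x \<otimes> layer M m' R)"
    using tensor_comp[OF _ _ _ _ _ _ h(5) b(3) h(1) h(3)] assms b by simp
  also have "... = layer [] m (M @ y' @ R) \<cdot> layer (x @ M) m' R"
    using b t l0 by simp
  finally have eq: "layer (y @ M) m' R \<cdot> layer [] m (M @ x' @ R) = layer [] m (M @ y' @ R) \<cdot> layer (x @ M) m' R" .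
  have hh: "layer (y @ M) m' R \<in> hom C (tens ((y @ M) @ x' @ R)) (tens ((y @ M) @ y' @ R))"
     "layer [] m (M @ x' @ R) \<in> hom C (tens ([] @ x @ (M @ x' @ R))) (tens ([] @ y @ (M @ x' @ R)))"
     "layer [] m (M @ y' @ R) \<in> hom C (tens ([] @ x @ (M @ y' @ R))) (tens ([] @ y @ (M @ y' @ R)))"
     "layer (x @ M) m' R \<in> hom C (tens ((x @ M) @ x' @ R)) (tens ((x @ M) @ y' @ R))"
    by (rule layer_in_hom; use assms b in auto)+
  have "layer L (layer (y @ M) m' R \<cdot> layer [] m (M @ x' @ R)) [] = 
     layer L (layer (y @ M) m' R) [] \<cdot> layer L (layer [] m (M @ x' @ R)) []"
    using hh assms b by (intro layer_comp) auto
  moreover have "layer L (layer [] m (M @ y' @ R) \<cdot> layer (x @ M) m' R) [] = 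
     layer L (layer [] m (M @ y' @ R)) [] \<cdot> layer L (layer (x @ M) m' R) []"
    using hh assms b by (intro layer_comp[of _ _ "tens (x @ M @ x' @ R)"  "tens (x @ M @ y' @ R)"]) auto
  ultimately show ?thesis using eq assms b
    by (simp add: layer_layer[of L "[]" _ _ x y m] layer_layer[of L "[]" _ _ x' y' m'])
qed

lemma ok_layer: "ok (L @ x @ R) ((length L, x, y, m) # d) \<longleftrightarrow>
      set (L @ x @ R) \<subseteq> obj C \<and> box (x, y, m) \<and> ok (L @ y @ R) d"
  and run_layer: "run (L @ x @ R) ((length L, x, y, m) # d) = run (L @ y @ R) d"
  and sem_layer: "sem (L @ x @ R) ((length L, x, y, m) # d) = sem (L @ y @ R) d \<cdot> layer L m R"
  by auto

lemma deq_swap: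
  assumes "ok w ((i, x, y, m) # (j, x', y', m') # d)" "i + length y \<le> j"
  shows "deq w ((i, x, y, m) # (j, x', y', m') # d)
           ((j + length x - length y, x', y', m') # (i, x, y, m) # d)"
proof -
  obtain L R0 where w: "w = L @ x @ R0" "length L = i"
    using assms(1) by (auto elim: ok_split)
  have ok1: "j \<le> length (L @ y @ R0)" "take (length x') (drop j (L @ y @ R0)) = x'"
    using assms(1) w by auto
  obtain L1 R where u: "L @ y @ R0 = L1 @ x' @ R" "length L1 = j"
    using ok_split[OF ok1] by metis
  define M where "M = take (j - length L - length y) R0"
  have "take j (L @ y @ R0) = L1" using u by simp
  then have L1: "L1 = L @ y @ M"
    using assms(2) w(2) by (simp add: M_def)
  with u have M: "L1 = L @ y @ M" "R0 = M @ x' @ R" by auto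
  have s: "set L \<subseteq> obj C" "set M \<subseteq> obj C" "set R \<subseteq> obj C" and b: "box (x, y, m)" "box (x', y', m')"
    and d: "ok (L @ y @ M @ y' @ R) d"
    using assms(1) w u M by auto
  have j: "j = length L + length y + length M" using u M by simp
  have bb: "set x \<subseteq> obj C" "set y \<subseteq> obj C" "m \<in> hom C (tens x) (tens y)"
      "set x' \<subseteq> obj C" "set y' \<subseteq> obj C" "m' \<in> hom C (tens x') (tens y')"
    using b by (auto simp: box_def)
  have j': "j + length x - length y = length L + length x + length M" using j by simp
  have h: "layer (L @ y @ M) m' R \<in> hom C (tens ((L @ y @ M) @ x' @ R)) (tens ((L @ y @ M) @ y' @ R))"
     "layer L m (M @ x' @ R) \<in> hom C (tens (L @ x @ (M @ x' @ R))) (tens (L @ y @ (M @ x' @ R)))"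
     "layer L m (M @ y' @ R) \<in> hom C (tens (L @ x @ (M @ y' @ R))) (tens (L @ y @ (M @ y' @ R)))"
     "layer (L @ x @ M) m' R \<in> hom C (tens ((L @ x @ M) @ x' @ R)) (tens ((L @ x @ M) @ y' @ R))"
     by (rule layer_in_hom; use s bb in auto)+
  have eq: "sem (L @ y @ M @ y' @ R) d \<cdot> layer (L @ y @ M) m' R \<cdot> layer L m (M @ x' @ R) =
        sem (L @ y @ M @ y' @ R) d \<cdot> layer L m (M @ y' @ R) \<cdot> layer (L @ x @ M) m' R"
    using layer_swap[OF s b] by simp
  have w': "w = L @ x @ (M @ x' @ R)" "L @ x @ (M @ x' @ R) = (L @ x @ M) @ x' @ R"
      "L @ y @ (M @ x' @ R) = (L @ y @ M) @ x' @ R" using w M by simp_all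
  have i: "i = length L" and j2: "j = length (L @ y @ M)" and j'2: "j + length x - length y = length (L @ x @ M)"
    using w(2) j by simp_all
  have "ok ((L @ x @ M) @ x' @ R) ((length (L @ x @ M), x', y', m') # (length L, x, y, m) # d)"
    unfolding ok_layer using ok_layer[of L x "M @ y' @ R" y m d] s b d bb by simp
  then have okD: "ok w ((j + length x - length y, x', y', m') # (i, x, y, m) # d)"
    unfolding j'2 i w' .
  have runs: "run w ((i, x, y, m) # (j, x', y', m') # d) = run (L @ y @ M @ y' @ R) d"
     "run w ((j + length x - length y, x', y', m') # (i, x, y, m) # d) = run (L @ y @ M @ y' @ R) d"
    unfolding j'2 unfolding i j2 w'(1) run_layer unfolding w'(2,3) run_layer
    using run_layer[of L x "M @ y' @ R" y m d] by simp_all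
  have s1: "sem w ((i, x, y, m) # (j, x', y', m') # d) = 
     (sem (L @ y @ M @ y' @ R) d \<cdot> layer (L @ y @ M) m' R) \<cdot> layer L m (M @ x' @ R)"
    unfolding i j2 w'(1) sem_layer unfolding w'(2,3) sem_layer by simp
  have s2: "sem w ((j + length x - length y, x', y', m') # (i, x, y, m) # d) = 
     (sem (L @ y @ M @ y' @ R) d \<cdot> layer L m (M @ y' @ R)) \<cdot> layer (L @ x @ M) m' R"
    unfolding j'2 unfolding i w'(1) unfolding w'(2) sem_layer
    using sem_layer[of L x "M @ y' @ R" y m d] by simp
  have hs: "sem (L @ y @ M @ y' @ R) d \<in> hom C (tens ((L @ y @ M) @ y' @ R)) (tens (run (L @ y @ M @ y' @ R) d))"
    "sem (L @ y @ M @ y' @ R) d \<in> hom C (tens (L @ y @ (M @ y' @ R))) (tens (run (L @ y @ M @ y' @ R) d))"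
    "layer (L @ y @ M) m' R \<in> hom C (tens (L @ y @ (M @ x' @ R))) (tens ((L @ y @ M) @ y' @ R))"
    "layer (L @ x @ M) m' R \<in> hom C (tens ((L @ x @ M) @ x' @ R)) (tens (L @ x @ (M @ y' @ R)))"
    using sem_in_hom[OF d] h by simp_all
  have a1: "(sem (L @ y @ M @ y' @ R) d \<cdot> layer (L @ y @ M) m' R) \<cdot> layer L m (M @ x' @ R) =
      sem (L @ y @ M @ y' @ R) d \<cdot> (layer (L @ y @ M) m' R \<cdot> layer L m (M @ x' @ R))"
    by (rule comp_assoc[OF _ _ _ _ h(2) hs(3) hs(1)]) (use s bb run_obj[OF d] in auto)
  have a2: "(sem (L @ y @ M @ y' @ R) d \<cdot> layer L m (M @ y' @ R)) \<cdot> layer (L @ x @ M) m' R =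
      sem (L @ y @ M @ y' @ R) d \<cdot> (layer L m (M @ y' @ R) \<cdot> layer (L @ x @ M) m' R)"
    by (rule comp_assoc[OF _ _ _ _ hs(4) h(3) hs(2)]) (use s bb run_obj[OF d] in auto)
  show ?thesis unfolding deq_def runs s1 s2 a1 a2 using assms(1) okD eq by blast
qed

lemma deq_Cons:
  assumes "ok w (l # d)" "\<And>w'. ok w' d \<Longrightarrow> deq w' d d'"
  shows "deq w (l # d) (l # d')"
proof -
  obtain i x y m where l: "l = (i, x, y, m)" by (cases l)
  show ?thesis using assms unfolding l by (auto simp: deq_def)
qed

lemma deq_insert_layer: "ok w (l # d) \<Longrightarrow> deq w (l # d) (insert_layer l d)"
proof (induction l d arbitrary: w rule: insert_layer.induct)
  case (1 l)
  then show ?case by (simp add: deq_refl)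
next
  case (2 i x y m j x' y' m' d)
  show ?case
  proof (cases "i + length y \<le> j")
    case True
    note s = deq_swap[OF 2(2) True]
    have "ok w ((j + length x - length y, x', y', m') # (i, x, y, m) # d)"
      using s unfolding deq_def by blast
    then have "deq w ((j + length x - length y, x', y', m') # (i, x, y, m) # d)
         ((j + length x - length y, x', y', m') # insert_layer (i, x, y, m) d)"
      using 2(1)[OF True] by (rule deq_Cons)
    then show ?thesis unfolding insert_layer.simps if_P[OF True] by (rule deq_trans[OF s])
  next
    case False
    show ?thesis unfolding insert_layer.simps if_not_P[OF False] using 2(2) by (rule deq_refl)
  qed
qed

lemma deq_norm: "ok w d \<Longrightarrow> deq w d (norm d)"
proof (induction d arbitrary: w)
  case Nil
  then show ?case by (simp add: deq_refl)
next
  case (Cons l d)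
  have 1: "deq w (l # d) (l # norm d)" by (rule deq_Cons[OF Cons(2) Cons(1)])
  then have "ok w (l # norm d)" by (simp add: deq_def)
  from deq_trans[OF 1 deq_insert_layer[OF this]] show ?case by simp
qed

text \<open>Deformations in the plane are decided by computation: both sides are sorted and
  compared.\<close>

lemma isotopy:
  assumes "norm d = norm d'" "ok w d" "ok w d'"
  shows "deq w d d'"
  using deq_trans[OF deq_norm[OF assms(2)]] deq_sym[OF deq_norm[OF assms(3)]] assms(1) by simp

text \<open>Rewriting with \<open>deq s l r\<close> at wire \<open>i\<close> after the layers \<open>pre\<close>, up to commuting
  layers that do not touch.\<close>

lemma step:
  assumes "deq s l r" "norm (pre @ shift i l @ post) = norm D" "norm (pre @ shift i r @ post) = norm D'"
    "ok w D" "ok w D'" "ok w (pre @ shift i l @ post)"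
    "i \<le> length (run w pre)" "take (length s) (drop i (run w pre)) = s"
  shows "deq w D D'"
proof -
  note c = deq_context[OF assms(1,6,7,8)]
  then have ok': "ok w (pre @ shift i r @ post)" unfolding deq_def by blast
  show ?thesis
    using deq_trans[OF isotopy[OF assms(2)[symmetric] assms(4,6)] deq_trans[OF c isotopy[OF assms(3) ok' assms(5)]]] .
qed

lemma step_sym:
  assumes "deq s r l" "norm (pre @ shift i l @ post) = norm D" "norm (pre @ shift i r @ post) = norm D'"
    "ok w D" "ok w D'" "ok w (pre @ shift i l @ post)"
    "i \<le> length (run w pre)" "take (length s) (drop i (run w pre)) = s"
  shows "deq w D D'"
  by (rule step[OF deq_sym[OF assms(1)] assms(2-8)])

text \<open>The form of \<open>step\<close> for a left-hand side whose layers are already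
  consecutive in \<open>D\<close>: the context is cut out of \<open>D\<close>, so a rewrite is
  specified by the wire \<open>i\<close> and the number \<open>n\<close> of layers before
  it.\<close>

lemma at:
  assumes "deq s l r" "shift i l = take (length l) (drop n D)"
    "norm (take n D @ shift i r @ drop (n + length l) D) = norm D'" "ok w D" "ok w D'"
    "i \<le> length (run w (take n D))" "take (length s) (drop i (run w (take n D))) = s"
  shows "deq w D D'"
proof -
  have D: "take n D @ shift i l @ drop (n + length l) D = D"
    unfolding assms(2) by (metis add.commute append_take_drop_id drop_drop)
  show ?thesis
    by (rule step[OF assms(1) _ assms(3-5) _ assms(6,7)]) (use D assms(4) in simp_all)
qed

lemmas at_sym = at[OF deq_sym]

end

section \<open>Translation between equations of morphisms and equations of diagrams\<close>

context linear_monoidal_category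
begin

lemma layer_Nil [simp]:
  "set x \<subseteq> obj C \<Longrightarrow> set y \<subseteq> obj C \<Longrightarrow> m \<in> hom C (tens x) (tens y) \<Longrightarrow> layer [] m [] = m"
  unfolding layer_def by (simp add: tensor_unit[of "tens x" "tens y"])

lemma layer_left:
  assumes "set x \<subseteq> obj C" "set y \<subseteq> obj C" "m \<in> hom C (tens x) (tens y)" "set R \<subseteq> obj C"
  shows "layer [] m R = m \<otimes> ident C (tens R)"
proof -
  have "m \<otimes> ident C (tens R) \<in> hom C (tens x \<odot> tens R) (tens y \<odot> tens R)"
    using assms by (auto intro!: tensor_in_hom ident_in_hom)
  then show ?thesis
    using tensor_unit(1)[of "tens x \<odot> tens R" "tens y \<odot> tens R"] assms by (simp add: layer_def tensor_in_obj)
qed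

lemma layer_right:
  assumes "set x \<subseteq> obj C" "set y \<subseteq> obj C" "m \<in> hom C (tens x) (tens y)" "set L \<subseteq> obj C"
  shows "layer L m [] = ident C (tens L) \<otimes> m"
  using assms unfolding layer_def by (simp add: tensor_unit[of "tens x" "tens y"])

lemma sem_single:
  assumes "ok w [(i, x, y, m)]"
  shows "sem w [(i, x, y, m)] = layer (take i w) m (drop (i + length x) w)"
proof -
  from assms obtain L R where w: "w = L @ x @ R" "length L = i" "take i w = L" "drop (i + length x) w = R"
    by (auto elim: ok_split)
  from assms w have sets: "set L \<subseteq> obj C" "set R \<subseteq> obj C" "set x \<subseteq> obj C" "set y \<subseteq> obj C"
    "m \<in> hom C (tens x) (tens y)" by (auto simp: box_def)
  show ?thesis using layer_in_hom[OF sets] sets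
    by (simp add: w(1,2) ident_comp[of "tens (L @ x @ R)" "tens (L @ y @ R)"])
qed

lemma tens_simps: "X \<in> obj C \<Longrightarrow> tens [X] = X" "tens (X # Y # ws) = X \<odot> tens (Y # ws)"
  by (simp_all add: tens_Cons tensor_obj_unit)

lemma boxI: "set x \<subseteq> obj C \<Longrightarrow> set y \<subseteq> obj C \<Longrightarrow> m \<in> hom C (tens x) (tens y) \<Longrightarrow> box (x, y, m)"
  by (simp add: box_def)

lemma layer_box: "box (x, y, m) \<Longrightarrow> layer [] m [] = m"
  "box (x, y, m) \<Longrightarrow> set (Y # R) \<subseteq> obj C \<Longrightarrow> layer [] m (Y # R) = m \<otimes> ident C (tens (Y # R))"
  "box (x, y, m) \<Longrightarrow> set (Y # L) \<subseteq> obj C \<Longrightarrow> layer (Y # L) m [] = ident C (tens (Y # L)) \<otimes> m"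
  unfolding box_def using layer_left[of x y m "Y # R"] layer_right[of x y m "Y # L"] by auto

lemma sem_box: "box (x, y, m) \<Longrightarrow> sem x [(0, x, y, m)] = m"
  using layer_box(1)[of x y m] by (subst sem_single) (simp_all add: box_def)

lemma ok_box: "box (x, y, m) \<Longrightarrow> ok x [(0, x, y, m)]"
  by (simp add: box_def)

lemma deq_comp:
  assumes "deq w d d'" "ok w (d @ e)"
  shows "deq w (d @ e) (d' @ e)"
  using assms by (auto simp: deq_def ok_append sem_append)

lemma deq_comp2:
  assumes "deq (run w e) d d'" "ok w e"
  shows "deq w (e @ d) (e @ d')"
  using assms by (auto simp: deq_def ok_append sem_append)

text \<open>Gives a name to a subdiagram: it can be folded into one box, moved as a whole by
  naturality, and unfolded elsewhere.\<close>

lemma deq_box: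
  assumes "ok w d" "run w d = y"
  shows "deq w [(0, w, y, sem w d)] d" "box (w, y, sem w d)"
proof -
  show b: "box (w, y, sem w d)"
    using assms sem_in_hom[OF assms(1)] ok_set[OF assms(1)] run_obj[OF assms(1)] by (auto simp: box_def)
  show "deq w [(0, w, y, sem w d)] d"
    using assms ok_box[OF b] sem_box[OF b] by (simp add: deq_def)
qed

text \<open>\<open>layer\<close> does not mention the wires of its box. This copy records them, so
  that the simplifier can establish \<open>box (x, y, m)\<close> when it removes trivial tensor
  factors.\<close>

definition typed_layer :: "'o list \<Rightarrow> 'o list \<Rightarrow> 'o list \<Rightarrow> 'm \<Rightarrow> 'o list \<Rightarrow> 'm" where
  "typed_layer x y L m R = layer L m R"

lemma typed_layer: "box (x, y, m) \<Longrightarrow> typed_layer x y [] m [] = m"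
  "box (x, y, m) \<Longrightarrow> set (Y # R) \<subseteq> obj C \<Longrightarrow> typed_layer x y [] m (Y # R) = m \<otimes> ident C (tens (Y # R))"
  "box (x, y, m) \<Longrightarrow> set (Y # L) \<subseteq> obj C \<Longrightarrow> typed_layer x y (Y # L) m [] = ident C (tens (Y # L)) \<otimes> m"
  by (auto simp: typed_layer_def layer_box)

lemma sem_typed: "ok w [(i, x, y, m)] \<Longrightarrow> sem w [(i, x, y, m)] = typed_layer x y (take i w) m (drop (i + length x) w)"
  "sem w ((i, x, y, m) # l # d) =
    sem (take i w @ y @ drop (i + length x) w) (l # d) \<cdot> typed_layer x y (take i w) m (drop (i + length x) w)"
  by (simp_all add: typed_layer_def sem_single del: ok.simps sem.simps(2)) (simp add: typed_layer_def)?

lemmas sem_eval = sem_typed typed_layer tens_simps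

lemma typed_layer_middle:
  "typed_layer x y (X # L) m (Y # R) = ident C (tens (X # L)) \<otimes> (m \<otimes> ident C (tens (Y # R)))"
  by (simp add: typed_layer_def layer_def)

lemmas sem_morphism = deq_def sem_eval typed_layer_middle

text \<open>The retraction \<open>p\<close> undoes the final \<open>i\<close>. Equations are
  transported to a retract in this way: they are proved after inclusion into the large object and
  then cancelled.\<close>

lemma section_cancel:
  assumes pi: "deq [y] [(0, [y], [v], i), (0, [v], [y], p)] []" and p: "box ([v], [y], p)"
    and d: "deq w (d @ [(0, [y], [v], i)]) (d' @ [(0, [y], [v], i)])" "run w d = [y]" "run w d' = [y]"
  shows "deq w d d'"
proof -
  have o: "ok w (d @ [(0, [y], [v], i), (0, [v], [y], p)])" "ok w (d' @ [(0, [y], [v], i), (0, [v], [y], p)])"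
    using assms by (auto simp: deq_def ok_append)
  have *: "deq w (d @ [(0, [y], [v], i), (0, [v], [y], p)]) d" if "run w d = [y]" "ok w (d @ [(0, [y], [v], i), (0, [v], [y], p)])" for d
    using deq_comp2[of w d "[(0, [y], [v], i), (0, [v], [y], p)]" "[]"] pi that by (simp add: ok_append)
  have "deq w ((d @ [(0, [y], [v], i)]) @ [(0, [v], [y], p)]) ((d' @ [(0, [y], [v], i)]) @ [(0, [v], [y], p)])"
    by (rule deq_comp[OF d(1)]) (use o in simp)
  with *[OF d(2) o(1)] *[OF d(3) o(2)] show ?thesis
    by (auto simp: deq_def)
qed

end

text \<open>\<open>wire_right i X ws\<close> moves the wire \<open>X\<close> at position \<open>i\<close> over the wires \<open>ws\<close> on its right,
  \<open>wire_left i ws X\<close> moves it back over the wires \<open>ws\<close> on its left.\<close>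

context finite_braided_tensor_category
begin

abbreviation Br :: "'o \<Rightarrow> 'o \<Rightarrow> ('o, 'm) box" where
  "Br X Y \<equiv> ([X, Y], [Y, X], braiding C X Y)"

fun wire_right :: "nat \<Rightarrow> 'o \<Rightarrow> 'o list \<Rightarrow> ('o, 'm) diagram" where
  "wire_right i X [] = []"
| "wire_right i X (Y # ws) = (i, Br X Y) # wire_right (Suc i) X ws"

fun wire_left :: "nat \<Rightarrow> 'o list \<Rightarrow> 'o \<Rightarrow> ('o, 'm) diagram" where
  "wire_left i [] X = []"
| "wire_left i (Y # ws) X = wire_left (Suc i) ws X @ [(i, Br Y X)]"

lemma braiding_in_hom: "X \<in> obj C \<Longrightarrow> Y \<in> obj C \<Longrightarrow> braiding C X Y \<in> hom C (X \<odot> Y) (Y \<odot> X)"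
  using braiding_iso[of X Y] by (simp add: isomorphism_def)

lemma box_Br [simp]: "X \<in> obj C \<Longrightarrow> Y \<in> obj C \<Longrightarrow> box (Br X Y)"
  by (simp add: box_def tens_simps braiding_in_hom)

text \<open>A hexagon with two unit objects makes the braiding with the unit idempotent, and an
  invertible idempotent is the identity.\<close>

lemma braiding_unit:
  assumes "X \<in> obj C"
  shows "braiding C X (unit_obj C) = ident C X" "braiding C (unit_obj C) X = ident C X"
proof -
  let ?u = "unit_obj C"
  have idem: "f = ident C X" if f: "f \<in> hom C X X" "g \<in> hom C X X" "g \<cdot> f = ident C X" "f = f \<cdot> f" for f g
  proof -
    have "f = ident C X \<cdot> f" using f assms by (simp add: ident_comp[of X X])
    also have "... = g \<cdot> (f \<cdot> f)" using f(3) comp_assoc[of X X X X f f g] f assms by simp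
    also have "... = ident C X" using f by simp
    finally show ?thesis .
  qed
  have h: "braiding C X ?u \<in> hom C X X" "braiding C ?u X \<in> hom C X X"
    using braiding_in_hom[of X ?u] braiding_in_hom[of ?u X] assms unit_in_obj by (simp_all add: tensor_obj_unit)
  obtain g where g: "g \<in> hom C X X" "g \<cdot> braiding C X ?u = ident C X"
    using braiding_iso[of X ?u] assms unit_in_obj by (auto simp: isomorphism_def tensor_obj_unit)
  obtain g' where g': "g' \<in> hom C X X" "g' \<cdot> braiding C ?u X = ident C X"
    using braiding_iso[of ?u X] assms unit_in_obj by (auto simp: isomorphism_def tensor_obj_unit)
  have "braiding C X ?u = braiding C X ?u \<cdot> braiding C X ?u"
    using hexagon_right[of X ?u ?u] h assms unit_in_obj by (simp add: tensor_obj_unit tensor_unit[of X X])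
  then show "braiding C X ?u = ident C X" by (rule idem[OF h(1) g])
  have "braiding C ?u X = braiding C ?u X \<cdot> braiding C ?u X"
    using hexagon_left[of ?u ?u X] h assms unit_in_obj by (simp add: tensor_obj_unit tensor_unit[of X X])
  then show "braiding C ?u X = ident C X" by (rule idem[OF h(2) g'])
qed

lemma shift_wire_right: "shift i (wire_right j X ws) = wire_right (i + j) X ws"
  by (induction ws arbitrary: j) auto

lemma shift_wire_left: "shift i (wire_left j ws X) = wire_left (i + j) ws X"
  by (induction ws arbitrary: j) auto

text \<open>The hexagon iterated: crossing wires one at a time is crossing their tensor product.
  Naturality of the braiding thus applies to boxes with any number of wires.\<close>

lemma wire_right:
  assumes "X \<in> obj C" "set ws \<subseteq> obj C"
  shows "ok (X # ws) (wire_right 0 X ws) \<and> run (X # ws) (wire_right 0 X ws) = ws @ [X]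
    \<and> sem (X # ws) (wire_right 0 X ws) = braiding C X (tens ws)"
  using assms(2)
proof (induction ws)
  case Nil
  then show ?case using assms by (simp add: braiding_unit)
next
  case (Cons Y ws)
  have ih: "ok (X # ws) (wire_right 0 X ws)" "run (X # ws) (wire_right 0 X ws) = ws @ [X]"
    "sem (X # ws) (wire_right 0 X ws) = braiding C X (tens ws)" using Cons by auto
  have s: "ok (Y # X # ws) (wire_right 1 X ws)" "run (Y # X # ws) (wire_right 1 X ws) = Y # ws @ [X]"
    "sem (Y # X # ws) (wire_right 1 X ws) = layer [Y] (braiding C X (tens ws)) []"
    using shift_ok[OF ih(1), of "[Y]" "[]"] ih Cons(2) by (simp_all add: shift_wire_right)
  have "braiding C X (tens ws) \<in> hom C (tens (X # ws)) (tens (ws @ [X]))"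
    using sem_in_hom[OF ih(1)] ih by simp
  then have l: "layer [Y] (braiding C X (tens ws)) [] = ident C Y \<otimes> braiding C X (tens ws)"
    using Cons(2) assms by (subst layer_right[of "X # ws" "ws @ [X]"]) auto
  have l2: "layer [] (braiding C X Y) ws = braiding C X Y \<otimes> ident C (tens ws)"
    using Cons(2) assms by (subst layer_left[of "[X, Y]" "[Y, X]"]) (auto simp: tens_simps braiding_in_hom)
  show ?case using s l l2 Cons(2) assms hexagon_right[of X Y "tens ws"] by (simp add: tens_Cons)
qed

lemma wire_left:
  assumes "X \<in> obj C" "set ws \<subseteq> obj C"
  shows "ok (ws @ [X]) (wire_left 0 ws X) \<and> run (ws @ [X]) (wire_left 0 ws X) = X # ws
    \<and> sem (ws @ [X]) (wire_left 0 ws X) = braiding C (tens ws) X"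
  using assms(2)
proof (induction ws)
  case Nil
  then show ?case using assms by (simp add: braiding_unit)
next
  case (Cons Y ws)
  have ih: "ok (ws @ [X]) (wire_left 0 ws X)" "run (ws @ [X]) (wire_left 0 ws X) = X # ws"
    "sem (ws @ [X]) (wire_left 0 ws X) = braiding C (tens ws) X" using Cons by auto
  have s: "ok (Y # ws @ [X]) (wire_left 1 ws X)" "run (Y # ws @ [X]) (wire_left 1 ws X) = Y # X # ws"
    "sem (Y # ws @ [X]) (wire_left 1 ws X) = layer [Y] (braiding C (tens ws) X) []"
    using shift_ok[OF ih(1), of "[Y]" "[]"] ih Cons(2) by (simp_all add: shift_wire_left)
  have "braiding C (tens ws) X \<in> hom C (tens (ws @ [X])) (tens (X # ws))"
    using sem_in_hom[OF ih(1)] ih by simp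
  then have l: "layer [Y] (braiding C (tens ws) X) [] = ident C Y \<otimes> braiding C (tens ws) X"
    using Cons(2) assms by (subst layer_right[of "ws @ [X]" "X # ws"]) auto
  have l2: "layer [] (braiding C Y X) ws = braiding C Y X \<otimes> ident C (tens ws)"
    using Cons(2) assms by (subst layer_left[of "[Y, X]" "[X, Y]"]) (auto simp: tens_simps braiding_in_hom)
  have b: "ok (Y # X # ws) [(0, Br Y X)]" using Cons(2) assms by simp
  have "sem (Y # X # ws) [(0, Br Y X)] = braiding C Y X \<otimes> ident C (tens ws)"
    using b l2 by (simp add: sem_single del: sem.simps)
  then show ?case using s l Cons(2) assms hexagon_left[of Y "tens ws" X] b
    by (simp add: tens_Cons sem_append ok_append del: sem.simps)
qed

text \<open>A box slides through a crossing strand. With no wires on one side the strand is pulled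
  off a unit, a cup or a cap; with a braiding as the box this is the Yang-Baxter equation.\<close>

lemma wire_right_natural:
  assumes "box (x, y, m)" "X \<in> obj C"
  shows "deq (X # x) ((1, x, y, m) # wire_right 0 X y) (wire_right 0 X x @ [(0, x, y, m)])"
proof -
  have b: "set x \<subseteq> obj C" "set y \<subseteq> obj C" "m \<in> hom C (tens x) (tens y)" using assms by (auto simp: box_def)
  note x = wire_right[OF assms(2) b(1)] and y = wire_right[OF assms(2) b(2)]
  have l: "layer [X] m [] = ident C X \<otimes> m" "layer [] m [X] = m \<otimes> ident C X"
    using layer_right[OF b, of "[X]"] layer_left[OF b, of "[X]"] assms by auto
  have o: "ok (x @ [X]) [(0, x, y, m)]" using b assms by simp
  have "sem (x @ [X]) [(0, x, y, m)] = m \<otimes> ident C X"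
    using l sem_single[OF o] by simp
  moreover have "ok (X # x) (wire_right 0 X x)" "ok (run (X # x) (wire_right 0 X x)) [(0, x, y, m)]" using x o by auto
  ultimately have "sem (X # x) (wire_right 0 X x @ [(0, x, y, m)]) = (m \<otimes> ident C X) \<cdot> braiding C X (tens x)"
    using x by (subst sem_append) auto
  then show ?thesis
    using x y b l assms braiding_natural[of X X "tens x" "tens y" "ident C X" m]
    by (simp add: deq_def ok_append ident_in_hom)
qed

lemma wire_left_natural:
  assumes "box (x, y, m)" "X \<in> obj C"
  shows "deq (x @ [X]) ((0, x, y, m) # wire_left 0 y X) (wire_left 0 x X @ [(1, x, y, m)])"
proof -
  have b: "set x \<subseteq> obj C" "set y \<subseteq> obj C" "m \<in> hom C (tens x) (tens y)" using assms by (auto simp: box_def)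
  note x = wire_left[OF assms(2) b(1)] and y = wire_left[OF assms(2) b(2)]
  have l: "layer [X] m [] = ident C X \<otimes> m" "layer [] m [X] = m \<otimes> ident C X"
    using layer_right[OF b, of "[X]"] layer_left[OF b, of "[X]"] assms by auto
  have o: "ok (X # x) [(1, x, y, m)]" using b assms by simp
  have "sem (X # x) [(1, x, y, m)] = ident C X \<otimes> m"
    using l sem_single[OF o] by simp
  moreover have "ok (x @ [X]) (wire_left 0 x X)" "ok (run (x @ [X]) (wire_left 0 x X)) [(1, x, y, m)]" using x o by auto
  ultimately have "sem (x @ [X]) (wire_left 0 x X @ [(1, x, y, m)]) = (ident C X \<otimes> m) \<cdot> braiding C (tens x) X"
    using x by (subst sem_append) auto
  then show ?thesis
    using x y b l assms braiding_natural[of "tens x" "tens y" X X  m "ident C X"]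
    by (simp add: deq_def ok_append ident_in_hom)
qed

end

declare (in linear_monoidal_category) sem.simps(2) [simp del]
text \<open>Positions are brought into successor form, so that \<open>take\<close>,
  \<open>drop\<close>, \<open>run\<close> and \<open>norm\<close> evaluate on concrete
  diagrams.\<close>

declare eval_nat_numeral [simp]

section \<open>The centre of a separable algebra\<close>

locale braided_algebra = finite_braided_tensor_category C
  for C :: "('o, 'm::ab_group_add, 'k::field, 'x) brcat_scheme" (structure) +
  fixes a :: 'o and \<mu> \<eta> :: 'm
  assumes algebra: "is_algebra C \<lparr>carrier_obj = a, mult = \<mu>, unit_mor = \<eta>\<rparr>"
begin

lemma a_obj [simp]: "a \<in> obj C"
  and mu_hom: "\<mu> \<in> hom C (a \<odot> a) a"
  and eta_hom: "\<eta> \<in> hom C (unit_obj C) a"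
  and mu_assoc: "\<mu> \<cdot> (\<mu> \<otimes> ident C a) = \<mu> \<cdot> (ident C a \<otimes> \<mu>)"
  and mu_eta: "\<mu> \<cdot> (\<eta> \<otimes> ident C a) = ident C a" "\<mu> \<cdot> (ident C a \<otimes> \<eta>) = ident C a"
  using algebra by (auto simp: is_algebra_def Let_def)

abbreviation M :: "('o, 'm) box" where "M \<equiv> ([a, a], [a], \<mu>)"
abbreviation E :: "('o, 'm) box" where "E \<equiv> ([], [a], \<eta>)"

lemma box_M [simp]: "box M" and box_E [simp]: "box E"
  by (simp_all add: box_def tens_simps mu_hom eta_hom)

lemma assoc: "deq [a, a, a] [(0, M), (0, M)] [(1, M), (0, M)]"
  using mu_assoc by (simp add: deq_def sem_eval del: sem.simps)

lemma unit_left: "deq [a] [(0, E), (0, M)] []"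
  using mu_eta by (simp add: deq_def sem_eval)

lemma unit_right: "deq [a] [(1, E), (0, M)] []"
  using mu_eta by (simp add: deq_def sem_eval)

end

text \<open>\<open>e\<close> is the image of the unit under a bimodule section of the
  multiplication. In element notation, used below, \<open>e\<close> is e_1 \<otimes> e_2 and the
  Casimir identity reads x e_1 \<otimes> e_2 = e_1 \<otimes> e_2 x.\<close>

locale separable_braided_algebra = braided_algebra C a \<mu> \<eta>
  for C :: "('o, 'm::ab_group_add, 'k::field, 'x) brcat_scheme" (structure) and a \<mu> \<eta> +
  fixes e :: 'm
  assumes e_hom: "e \<in> hom C (unit_obj C) (a \<odot> a)"
    and e_casimir: "(\<mu> \<otimes> ident C a) \<cdot> (ident C a \<otimes> e) = (ident C a \<otimes> \<mu>) \<cdot> (e \<otimes> ident C a)"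
    and mu_e: "\<mu> \<cdot> e = \<eta>"
begin

abbreviation S :: "('o, 'm) box" where "S \<equiv> ([], [a, a], e)"

lemma box_S [simp]: "box S"
  by (simp add: box_def tens_simps e_hom)

lemma casimir: "deq [a] [(1, S), (0, M)] [(0, S), (1, M)]"
  using e_casimir by (simp add: deq_def sem_eval)

lemma split: "deq [] [(0, S), (0, M)] [(0, E)]"
  using mu_e by (simp add: deq_def sem_eval)

abbreviation B :: "('o, 'm) box" where "B \<equiv> Br a a"

definition centering :: 'm where
  "centering = sem [a] [(0, S), (1, B), (1, M), (0, M)]"

abbreviation P :: "('o, 'm) box" where "P \<equiv> ([a], [a], centering)"

lemma P_def: "deq [a] [(0, P)] [(0, S), (1, B), (1, M), (0, M)]"
  unfolding centering_def by (rule deq_box) simp_all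

lemma box_P [simp]: "box P"
  unfolding centering_def by (rule deq_box) simp_all

text \<open>The image of \<open>centering\<close>, \<open>x \<mapsto> e\<^sub>1 x e\<^sub>2\<close>, is the left centre.\<close>

lemma centering_central: "deq [a, a] [(1, P), (0, M)] [(0, B), (0, P), (0, M)]"
proof -
  have "deq [a, a] [(1, P), (0, M)] [(1, S), (2, B), (2, M), (1, M), (0, M)]"
    by (rule at[OF P_def, of 1 0]; simp)
  also have "deq [a, a] ... [(1, S), (0, M), (1, B), (1, M), (0, M)]"
    by (rule at_sym[OF assoc, of 0 3]; simp)
  \<comment> \<open>The Casimir identity takes the left factor from in front of e_1 to behind e_2;
    the remaining steps only reassociate and slide it through a crossing.\<close>
  also have "deq [a, a] ... [(0, S), (1, M), (1, B), (1, M), (0, M)]"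
    by (rule at[OF casimir, of 0 0]; simp)
  also have "deq [a, a] ... [(0, S), (2, B), (1, B), (2, M), (1, M), (0, M)]"
    by (rule at[OF wire_left_natural[of _ _ \<mu> a], of "[a, a]" "[a]" 1 1]; simp)
  also have "deq [a, a] ... [(0, S), (2, B), (1, B), (1, M), (1, M), (0, M)]"
    by (rule at_sym[OF assoc, of 1 3]; simp)
  also have "deq [a, a] ... [(0, S), (2, B), (1, B), (1, M), (0, M), (0, M)]"
    by (rule at_sym[OF assoc, of 0 4]; simp)
  also have "deq [a, a] ... [(0, B), (0, P), (0, M)]"
    by (rule step_sym[OF P_def, of "[(0, B)]" 0 "[(0, M)]"]; simp)
  finally show ?thesis .
qed

text \<open>The sandwich e_1 1 e_2 collapses by the normalization of \<open>e\<close>. Through this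
  identity the unit of the algebra lies in the centre, which therefore cannot vanish.\<close>

lemma centering_unit: "deq [] [(0, E), (0, P)] [(0, E)]"
proof -
  have "deq [] [(0, E), (0, P)] [(0, S), (2, E), (1, B), (1, M), (0, M)]"
    by (rule at[OF P_def, of 0 1]; simp)
  also have "deq [] ... [(0, S), (1, E), (1, M), (0, M)]"
    by (rule at[OF wire_right_natural[of _ _ \<eta> a], of "[]" "[a]" 1 1]; simp)
  also have "deq [] ... [(0, S), (0, M)]"
    by (rule at[OF unit_left, of 1 1]; simp)
  also have "deq [] ... [(0, E)]"
    by (rule at[OF split, of 0 0]; simp)
  finally show ?thesis .
qed

text \<open>In e_1 P(x) e_2 the central factor P(x) moves past e_2 to the right, and e_1 e_2 = 1
  remains in front of it.\<close>

lemma centering_idem: "deq [a] [(0, P), (0, P)] [(0, P)]"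
proof -
  have "deq [a] [(0, P), (0, P)] [(0, S), (2, P), (1, B), (1, M), (0, M)]"
    by (rule at[OF P_def, of 0 1]; simp)
  also have "deq [a] ... [(0, S), (1, B), (1, P), (1, M), (0, M)]"
    by (rule at[OF wire_right_natural[of _ _ centering a], of "[a]" "[a]" 1 1]; simp)
  also have "deq [a] ... [(0, S), (2, P), (1, M), (0, M)]"
    by (rule at_sym[OF centering_central, of 1 1]; simp)
  also have "deq [a] ... [(0, S), (0, M), (1, P), (0, M)]"
    by (rule at_sym[OF assoc, of 0 2]; simp)
  also have "deq [a] ... [(0, P), (0, E), (0, M)]"
    by (rule at[OF split, of 0 0]; simp)
  also have "deq [a] ... [(0, P)]"
    by (rule at[OF unit_left, of 0 1]; simp)
  finally show ?thesis .
qed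

end

locale split_centre = separable_braided_algebra C a \<mu> \<eta> e
  for C :: "('o, 'm::ab_group_add, 'k::field, 'x) brcat_scheme" (structure) and a \<mu> \<eta> e +
  fixes z :: 'o and \<iota> \<rho> :: 'm
  assumes z_obj [simp]: "z \<in> obj C"
    and iota_hom: "\<iota> \<in> hom C z a" and rho_hom: "\<rho> \<in> hom C a z"
    and rho_iota: "\<rho> \<cdot> \<iota> = ident C z" and iota_rho: "\<iota> \<cdot> \<rho> = centering"
begin

abbreviation I :: "('o, 'm) box" where "I \<equiv> ([z], [a], \<iota>)"
abbreviation R :: "('o, 'm) box" where "R \<equiv> ([a], [z], \<rho>)"

lemma box_I [simp]: "box I" and box_R [simp]: "box R"
  by (simp_all add: box_def iota_hom rho_hom)

lemma IR: "deq [z] [(0, I), (0, R)] []"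
  using rho_iota by (simp add: deq_def sem_eval)

lemma RI: "deq [a] [(0, R), (0, I)] [(0, P)]"
  using iota_rho by (simp add: deq_def sem_eval)

lemma IP: "deq [z] [(0, I), (0, P)] [(0, I)]"
proof -
  have "deq [z] [(0, I), (0, P)] [(0, I), (0, R), (0, I)]"
    by (rule at_sym[OF RI, of 0 1]; simp)
  also have "deq [z] ... [(0, I)]"
    by (rule at[OF IR, of 0 0]; simp)
  finally show ?thesis .
qed

lemmas I_cancel = section_cancel[OF IR box_R]

lemma I_central: "deq [a, z] [(1, I), (0, M)] [(0, Br a z), (0, I), (0, M)]"
proof -
  have "deq [a, z] [(1, I), (0, M)] [(1, I), (1, P), (0, M)]"
    by (rule at_sym[OF IP, of 1 0]; simp)
  also have "deq [a, z] ... [(1, I), (0, B), (0, P), (0, M)]"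
    by (rule at[OF centering_central, of 0 1]; simp)
  also have "deq [a, z] ... [(0, Br a z), (0, I), (0, P), (0, M)]"
    by (rule at[OF wire_right_natural[of _ _ \<iota> a], of "[z]" "[a]" 0 0]; simp)
  also have "deq [a, z] ... [(0, Br a z), (0, I), (0, M)]"
    by (rule at[OF IP, of 0 1]; simp)
  finally show ?thesis .
qed

text \<open>With \<open>centering_left\<close> this makes \<open>centering\<close> linear over its
  image. Here the central factor stands directly before e_2 and has to pass only that leg.\<close>

lemma centering_right: "deq [a, z] [(1, I), (0, M), (0, P)] [(0, P), (1, I), (0, M)]"
proof -
  have "deq [a, z] [(1, I), (0, M), (0, P)] [(0, S), (3, I), (2, M), (1, B), (1, M), (0, M)]"
    by (rule at[OF P_def, of 0 2]; simp)
  also have "deq [a, z] ... [(0, S), (1, B), (3, I), (2, B), (1, M), (1, M), (0, M)]"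
    by (rule at[OF wire_right_natural[of _ _ \<mu> a], of "[a, a]" "[a]" 1 2]; simp)
  also have "deq [a, z] ... [(0, S), (1, B), (2, Br a z), (2, I), (1, M), (1, M), (0, M)]"
    by (rule at[OF wire_right_natural[of _ _ \<iota> a], of "[z]" "[a]" 2 2]; simp)
  also have "deq [a, z] ... [(0, S), (1, B), (2, Br a z), (2, I), (2, M), (1, M), (0, M)]"
    by (rule at[OF assoc, of 1 4]; simp)
  also have "deq [a, z] ... [(0, S), (1, B), (3, I), (2, M), (1, M), (0, M)]"
    by (rule at_sym[OF I_central, of 2 2]; simp)
  also have "deq [a, z] ... [(0, S), (1, B), (3, I), (1, M), (1, M), (0, M)]"
    by (rule at_sym[OF assoc, of 1 3]; simp)
  also have "deq [a, z] ... [(0, S), (1, B), (1, M), (0, M), (1, I), (0, M)]"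
    by (rule at_sym[OF assoc, of 0 4]; simp)
  also have "deq [a, z] ... [(0, P), (1, I), (0, M)]"
    by (rule at_sym[OF P_def, of 0 0]; simp)
  finally show ?thesis .
qed

text \<open>Here the central factor follows e_1. It is moved in front of e_1 by
  \<open>I_central\<close>, after which it crosses both legs of \<open>e\<close> and slides
  off.\<close>

lemma centering_left: "deq [z, a] [(0, I), (0, M), (0, P)] [(1, P), (0, I), (0, M)]"
proof -
  have "deq [z, a] [(0, I), (0, M), (0, P)] [(0, I), (0, S), (2, M), (1, B), (1, M), (0, M)]"
    by (rule at[OF P_def, of 0 2]; simp)
  also have "deq [z, a] ... [(0, I), (0, S), (1, B), (2, B), (1, M), (1, M), (0, M)]"
    by (rule at[OF wire_right_natural[of _ _ \<mu> a], of "[a, a]" "[a]" 1 2]; simp)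
  also have "deq [z, a] ... [(0, I), (0, S), (1, B), (2, B), (2, M), (1, M), (0, M)]"
    by (rule at[OF assoc, of 1 4]; simp)
  also have "deq [z, a] ... [(0, S), (2, I), (1, B), (2, B), (2, M), (0, M), (0, M)]"
    by (rule at_sym[OF assoc, of 0 5]; simp)
  also have "deq [z, a] ... [(0, S), (1, Br a z), (1, I), (0, M), (1, B), (1, M), (0, M)]"
    by (rule at[OF wire_right_natural[of _ _ \<iota> a], of "[z]" "[a]" 1 1]; simp)
  also have "deq [z, a] ... [(0, S), (1, Br a z), (0, Br a z), (0, I), (0, M), (1, B), (1, M), (0, M)]"
    by (rule at[OF I_central, of 0 2]; simp)
  also have "deq [z, a] ... [(1, S), (2, B), (2, M), (0, I), (0, M), (0, M)]"
    by (rule at[OF wire_left_natural[of _ _ e z], of "[]" "[a, a]" 0 0]; simp)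
  also have "deq [z, a] ... [(1, S), (2, B), (2, M), (1, M), (0, I), (0, M)]"
    by (rule at[OF assoc, of 0 4]; simp)
  also have "deq [z, a] ... [(1, P), (0, I), (0, M)]"
    by (rule at_sym[OF P_def, of 1 0]; simp)
  finally show ?thesis .
qed

definition mu_z :: 'm where "mu_z = sem [z, z] [(0, I), (1, I), (0, M), (0, R)]"
definition eta_z :: 'm where "eta_z = sem [] [(0, E), (0, R)]"

abbreviation MZ :: "('o, 'm) box" where "MZ \<equiv> ([z, z], [z], mu_z)"
abbreviation EZ :: "('o, 'm) box" where "EZ \<equiv> ([], [z], eta_z)"

lemma MZ_def: "deq [z, z] [(0, MZ)] [(0, I), (1, I), (0, M), (0, R)]"
  and box_MZ [simp]: "box MZ"
  unfolding mu_z_def by (rule deq_box; simp)+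

lemma EZ_def: "deq [] [(0, EZ)] [(0, E), (0, R)]"
  and box_EZ [simp]: "box EZ"
  unfolding eta_z_def by (rule deq_box; simp)+

text \<open>The projection \<open>\<rho>\<close> in the definition of the product loses nothing,
  since by linearity over the centre a product of central elements is fixed by
  \<open>centering\<close>. Hence the axioms for \<open>z\<close> can be checked in
  \<open>a\<close>.\<close>

lemma MZ_I: "deq [z, z] [(0, MZ), (0, I)] [(0, I), (1, I), (0, M)]"
proof -
  have "deq [z, z] [(0, MZ), (0, I)] [(0, I), (1, I), (0, M), (0, R), (0, I)]"
    by (rule at[OF MZ_def, of 0 0]; simp)
  also have "deq [z, z] ... [(0, I), (1, I), (0, M), (0, P)]"
    by (rule at[OF RI, of 0 3]; simp)
  also have "deq [z, z] ... [(0, I), (0, P), (1, I), (0, M)]"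
    by (rule at[OF centering_right, of 0 1]; simp)
  also have "deq [z, z] ... [(0, I), (1, I), (0, M)]"
    by (rule at[OF IP, of 0 0]; simp)
  finally show ?thesis .
qed

lemma EZ_I: "deq [] [(0, EZ), (0, I)] [(0, E)]"
proof -
  have "deq [] [(0, EZ), (0, I)] [(0, E), (0, R), (0, I)]"
    by (rule at[OF EZ_def, of 0 0]; simp)
  also have "deq [] ... [(0, E), (0, P)]"
    by (rule at[OF RI, of 0 1]; simp)
  also note centering_unit
  finally show ?thesis .
qed

lemma assoc_z: "deq [z, z, z] [(0, MZ), (0, MZ)] [(1, MZ), (0, MZ)]"
proof (rule I_cancel)
  have "deq [z, z, z] [(0, MZ), (0, MZ), (0, I)] [(0, MZ), (0, I), (1, I), (0, M)]"
    by (rule at[OF MZ_I, of 0 1]; simp)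
  also have "deq [z, z, z] ... [(0, I), (1, I), (2, I), (0, M), (0, M)]"
    by (rule at[OF MZ_I, of 0 0]; simp)
  also have "deq [z, z, z] ... [(0, I), (1, I), (2, I), (1, M), (0, M)]"
    by (rule at[OF assoc, of 0 3]; simp)
  also have "deq [z, z, z] ... [(1, MZ), (0, I), (1, I), (0, M)]"
    by (rule at_sym[OF MZ_I, of 1 1]; simp)
  also have "deq [z, z, z] ... [(1, MZ), (0, MZ), (0, I)]"
    by (rule at_sym[OF MZ_I, of 0 1]; simp)
  finally show "deq [z, z, z] ([(0, MZ), (0, MZ)] @ [(0, I)]) ([(1, MZ), (0, MZ)] @ [(0, I)])" by simp
qed simp_all

lemma unit_left_z: "deq [z] [(0, EZ), (0, MZ)] []"
proof (rule I_cancel)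
  have "deq [z] [(0, EZ), (0, MZ), (0, I)] [(0, EZ), (0, I), (1, I), (0, M)]"
    by (rule at[OF MZ_I, of 0 1]; simp)
  also have "deq [z] ... [(0, I), (0, E), (0, M)]"
    by (rule at[OF EZ_I, of 0 0]; simp)
  also have "deq [z] ... [(0, I)]"
    by (rule at[OF unit_left, of 0 1]; simp)
  finally show "deq [z] ([(0, EZ), (0, MZ)] @ [(0, I)]) ([] @ [(0, I)])" by simp
qed simp_all

lemma commutative_z: "deq [z, z] [(0, Br z z), (0, MZ)] [(0, MZ)]"
proof (rule I_cancel)
  have "deq [z, z] [(0, Br z z), (0, MZ), (0, I)] [(0, Br z z), (1, I), (0, I), (0, M)]"
    by (rule at[OF MZ_I, of 0 1]; simp)
  also have "deq [z, z] ... [(0, I), (0, Br a z), (0, I), (0, M)]"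
    by (rule at_sym[OF wire_left_natural[of _ _ \<iota> z], of "[z]" "[a]" 0 0]; simp)
  also have "deq [z, z] ... [(0, I), (1, I), (0, M)]"
    by (rule at_sym[OF I_central, of 0 1]; simp)
  also have "deq [z, z] ... [(0, MZ), (0, I)]"
    by (rule deq_sym[OF MZ_I])
  finally show "deq [z, z] ([(0, Br z z), (0, MZ)] @ [(0, I)]) ([(0, MZ)] @ [(0, I)])" by simp
qed simp_all

lemma unit_right_z: "deq [z] [(1, EZ), (0, MZ)] []"
proof -
  have "deq [z] [(1, EZ), (0, MZ)] [(1, EZ), (0, Br z z), (0, MZ)]"
    by (rule at_sym[OF commutative_z, of 0 1]; simp)
  also have "deq [z] ... [(0, EZ), (0, MZ)]"
    by (rule at[OF wire_right_natural[of _ _ eta_z z], of "[]" "[z]" 0 0]; simp)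
  also note unit_left_z
  finally show ?thesis .
qed

text \<open>The retraction is linear over the centre; this and its mirror image carry Casimir
  identities from \<open>a\<close> to \<open>z\<close>.\<close>

lemma R_left: "deq [z, a] [(0, I), (0, M), (0, R)] [(1, R), (0, MZ)]"
proof (rule I_cancel)
  have "deq [z, a] [(0, I), (0, M), (0, R), (0, I)] [(0, I), (0, M), (0, P)]"
    by (rule at[OF RI, of 0 2]; simp)
  also note centering_left
  also have "deq [z, a] [(1, P), (0, I), (0, M)] [(1, R), (1, I), (0, I), (0, M)]"
    by (rule at_sym[OF RI, of 1 0]; simp)
  also have "deq [z, a] ... [(1, R), (0, MZ), (0, I)]"
    by (rule step_sym[OF MZ_I, of "[(1, R)]" 0 "[]"]; simp)
  finally show "deq [z, a] ([(0, I), (0, M), (0, R)] @ [(0, I)]) ([(1, R), (0, MZ)] @ [(0, I)])" by simp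
qed simp_all

lemma R_right: "deq [a, z] [(1, I), (0, M), (0, R)] [(0, R), (0, MZ)]"
proof (rule I_cancel)
  have "deq [a, z] [(1, I), (0, M), (0, R), (0, I)] [(1, I), (0, M), (0, P)]"
    by (rule at[OF RI, of 0 2]; simp)
  also note centering_right
  also have "deq [a, z] [(0, P), (1, I), (0, M)] [(0, R), (0, I), (1, I), (0, M)]"
    by (rule at_sym[OF RI, of 0 0]; simp)
  also have "deq [a, z] ... [(0, R), (0, MZ), (0, I)]"
    by (rule at_sym[OF MZ_I, of 0 1]; simp)
  finally show "deq [a, z] ([(1, I), (0, M), (0, R)] @ [(0, I)]) ([(0, R), (0, MZ)] @ [(0, I)])" by simp
qed simp_all

end

section \<open>Traces and twists\<close>

context linear_monoidal_category
begin

definition dualizes :: "'o \<Rightarrow> 'o \<Rightarrow> 'm \<Rightarrow> 'm \<Rightarrow> bool" where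
  "dualizes D V ev co \<longleftrightarrow> V \<in> obj C \<and> D \<in> obj C \<and> dual_pair C D V ev co"

lemma dualizes_box:
  assumes "dualizes D V ev co"
  shows "V \<in> obj C" "D \<in> obj C" "box ([D, V], [], ev)" "box ([], [V, D], co)"
  using assms by (auto simp: dualizes_def dual_pair_def box_def tens_simps)

lemma snake:
  assumes "dualizes D V ev co"
  shows "deq [V] [(0, [], [V, D], co), (1, [D, V], [], ev)] []"
    and "deq [D] [(1, [], [V, D], co), (0, [D, V], [], ev)] []"
  using assms dualizes_box[OF assms]
  by (simp_all add: dualizes_def dual_pair_def deq_def sem_eval)

lemma sem_left: "ok s d \<Longrightarrow> set R \<subseteq> obj C \<Longrightarrow> sem (s @ R) d = sem s d \<otimes> ident C (tens R)"
  and ok_left: "ok s d \<Longrightarrow> set R \<subseteq> obj C \<Longrightarrow> ok (s @ R) d"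
  and run_left: "ok s d \<Longrightarrow> set R \<subseteq> obj C \<Longrightarrow> run (s @ R) d = run s d @ R"
  using shift_ok[of s d "[]" R] layer_left[of s "run s d" "sem s d" R] sem_in_hom[of s d]
    ok_set[of s d] run_obj[of s d] by (auto simp: shift_def case_prod_beta)

lemma sem_right: "ok s d \<Longrightarrow> set L \<subseteq> obj C \<Longrightarrow> sem (L @ s) (shift (length L) d) = ident C (tens L) \<otimes> sem s d"
  and ok_right: "ok s d \<Longrightarrow> set L \<subseteq> obj C \<Longrightarrow> ok (L @ s) (shift (length L) d)"
  and run_right: "ok s d \<Longrightarrow> set L \<subseteq> obj C \<Longrightarrow> run (L @ s) (shift (length L) d) = L @ run s d"
  using shift_ok[of s d L "[]"] layer_right[of s "run s d" "sem s d" L] sem_in_hom[of s d]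
    ok_set[of s d] run_obj[of s d] by auto

text \<open>Cups and caps are nested, which reverses the order of the duals. The explicit formulas
  are kept because double twists and traces of tensor products are computed with them.\<close>

lemma dualizes_tensor:
  assumes "dualizes D V ev co" "dualizes D' V' ev' co'"
  shows "dualizes (D' \<odot> D) (V \<odot> V')
    (sem [D', D, V, V'] [(1, [D, V], [], ev), (0, [D', V'], [], ev')])
    (sem [] [(0, [], [V, D], co), (1, [], [V', D'], co')])"
proof -
  note [simp] = dualizes_box[OF assms(1)] dualizes_box[OF assms(2)]
  let ?Ev = "([D, V], [], ev)" and ?Co = "([], [V, D], co)"
    and ?Ev' = "([D', V'], [], ev')" and ?Co' = "([], [V', D'], co')"
  let ?d = "[(1, ?Ev), (0, ?Ev')]" and ?c = "[(0, ?Co), (1, ?Co')]"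
  have ok: "ok [D', D, V, V'] ?d" "ok [] ?c" "run [D', D, V, V'] ?d = []" "run [] ?c = [V, V', D', D]"
    by simp_all
  have h: "sem [D', D, V, V'] ?d \<in> hom C ((D' \<odot> D) \<odot> (V \<odot> V')) (unit_obj C)"
    "sem [] ?c \<in> hom C (unit_obj C) ((V \<odot> V') \<odot> (D' \<odot> D))"
    using sem_in_hom[OF ok(1)] sem_in_hom[OF ok(2)] unfolding ok(3,4)
    by (simp_all add: tens_simps tensor_obj_assoc tensor_in_obj)
  have "deq [V, V'] (?c @ shift 2 ?d) [(0, ?Co), (1, ?Ev), (1, ?Co'), (2, ?Ev')]"
    using deq_norm[of "[V, V']" "?c @ shift 2 ?d"] by simp
  also have "deq [V, V'] ... [(0, ?Co), (1, ?Ev)]"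
    by (rule at[OF snake(1)[OF assms(2)], of 1 2]; simp)
  also have "deq [V, V'] ... []"
    by (rule at[OF snake(1)[OF assms(1)], of 0 0]; simp)
  finally have "sem [V, V'] (?c @ shift 2 ?d) = ident C (V \<odot> V')"
    by (simp add: deq_def tens_simps del: shift_simps append.simps shift_append)
  moreover have "sem [V, V'] ?c = sem [] ?c \<otimes> ident C (V \<odot> V')" "ok [V, V'] ?c" "run [V, V'] ?c = [V, V'] @ [D', D, V, V']"
    using sem_left[OF ok(2), of "[V, V']"] ok_left[OF ok(2), of "[V, V']"] run_left[OF ok(2), of "[V, V']"] ok(4)
    by (simp_all add: tens_simps del: sem.simps ok.simps run.simps)
  moreover have "sem ([V, V'] @ [D', D, V, V']) (shift 2 ?d) = ident C (V \<odot> V') \<otimes> sem [D', D, V, V'] ?d"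
    "ok ([V, V'] @ [D', D, V, V']) (shift 2 ?d)"
    using sem_right[OF ok(1), of "[V, V']"] ok_right[OF ok(1), of "[V, V']"]
    by (simp_all add: tens_simps numeral_2_eq_2 del: sem.simps ok.simps run.simps shift_simps)
  ultimately have 1: "(ident C (V \<odot> V') \<otimes> sem [D', D, V, V'] ?d) \<cdot> (sem [] ?c \<otimes> ident C (V \<odot> V')) = ident C (V \<odot> V')"
    by (simp add: sem_append del: sem.simps ok.simps run.simps shift_simps append.simps)
  have "deq [D', D] (shift 2 ?c @ ?d) [(1, ?Co'), (0, ?Ev')]"
    by (rule step[OF snake(2)[OF assms(1)], of "[]" 1 "[(1, ?Co'), (0, ?Ev')]"]; simp)
  also have "deq [D', D] ... []"
    by (rule at[OF snake(2)[OF assms(2)], of 0 0]; simp)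
  finally have "sem [D', D] (shift 2 ?c @ ?d) = ident C (D' \<odot> D)"
    by (simp add: deq_def tens_simps del: shift_simps append.simps shift_append)
  moreover have "sem [D', D] (shift 2 ?c) = ident C (D' \<odot> D) \<otimes> sem [] ?c" "ok [D', D] (shift 2 ?c)"
     "run [D', D] (shift 2 ?c) = [D', D, V, V'] @ [D', D]"
    using sem_right[OF ok(2), of "[D', D]"] ok_right[OF ok(2), of "[D', D]"] run_right[OF ok(2), of "[D', D]"] ok(4)
    by (simp_all add: tens_simps numeral_2_eq_2 del: sem.simps ok.simps run.simps shift_simps)
  moreover have "sem ([D', D, V, V'] @ [D', D]) ?d = sem [D', D, V, V'] ?d \<otimes> ident C (D' \<odot> D)"
    "ok ([D', D, V, V'] @ [D', D]) ?d"
    using sem_left[OF ok(1), of "[D', D]"] ok_left[OF ok(1), of "[D', D]"]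
    by (simp_all add: tens_simps del: sem.simps ok.simps run.simps)
  ultimately have 2: "(sem [D', D, V, V'] ?d \<otimes> ident C (D' \<odot> D)) \<cdot> (ident C (D' \<odot> D) \<otimes> sem [] ?c) = ident C (D' \<odot> D)"
    by (simp add: sem_append del: sem.simps ok.simps run.simps shift_simps append.simps)
  show ?thesis unfolding dualizes_def dual_pair_def using h 1 2 by (simp add: tensor_in_obj)
qed

text \<open>\<open>g\<close> is \<open>f\<close> with its strand bent around at both ends. The two
  equations let \<open>f\<close> slide over a cap and over a cup.\<close>

lemma mate:
  assumes "dualizes D V ev co" "dualizes D' V' ev' co'" "box ([V], [V'], f)"
  obtains g where "box ([D'], [D], g)"
    "deq [D', V] [(0, [D'], [D], g), (0, [D, V], [], ev)] [(1, [V], [V'], f), (0, [D', V'], [], ev')]"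
    "deq [] [(0, [], [V', D'], co'), (1, [D'], [D], g)] [(0, [], [V, D], co), (0, [V], [V'], f)]"
proof -
  note [simp] = dualizes_box[OF assms(1)] dualizes_box[OF assms(2)] assms(3)
  let ?Ev = "([D, V], [], ev)" and ?Co = "([], [V, D], co)"
    and ?Ev' = "([D', V'], [], ev')" and ?Co' = "([], [V', D'], co')" and ?f = "([V], [V'], f)"
  obtain g where g: "deq [D'] [(0, ([D'], [D], g))] [(1, ?Co), (1, ?f), (0, ?Ev')]" and [simp]: "box ([D'], [D], g)"
    by (rule that[OF deq_box]; simp)
  let ?g = "([D'], [D], g)"
  have "deq [D', V] [(0, ?g), (0, ?Ev)] [(1, ?Co), (1, ?f), (0, ?Ev'), (0, ?Ev)]"
    by (rule at[OF g, of 0 0]; simp)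
  also have "deq [D', V] ... [(1, ?f), (0, ?Ev')]"
    by (rule step[OF snake(1)[OF assms(1)], of "[]" 1 "[(1, ?f), (0, ?Ev')]"]; simp)
  finally have 1: "deq [D', V] [(0, ?g), (0, ?Ev)] [(1, ?f), (0, ?Ev')]" .
  have "deq [] [(0, ?Co'), (1, ?g)] [(0, ?Co'), (2, ?Co), (2, ?f), (1, ?Ev')]"
    by (rule at[OF g, of 1 1]; simp)
  also have "deq [] ... [(0, ?Co), (0, ?f)]"
    by (rule step[OF snake(1)[OF assms(2)], of "[(0, ?Co), (0, ?f)]" 0 "[]"]; simp)
  finally show ?thesis using that[of g] 1 by simp
qed

end

context finite_braided_tensor_category
begin

text \<open>Partial trace of \<open>\<beta> : U \<odot> V \<rightarrow> V\<close>.\<close>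

definition trace_diagram :: "'o \<Rightarrow> 'o \<Rightarrow> 'm \<Rightarrow> 'm \<Rightarrow> 'o \<Rightarrow> 'm \<Rightarrow> ('o, 'm) diagram" where
  "trace_diagram D V ev co U \<beta> =
     [(1, [], [V, D], co), (0, [U, V], [V], \<beta>), (0, Br V D), (0, [D, V], [], ev)]"

text \<open>\<open>f\<close> travels once along the closed strand: over the cup as its mate, through
  the crossing by naturality, and over the cap back to itself. The two sides may use unrelated
  duals.\<close>

lemma trace_cyclic:
  assumes "dualizes D V ev co" "dualizes D' V' ev' co'" "box ([V], [V'], f)" "box ([U, V'], [V], g)" "U \<in> obj C"
  shows "deq [U] [(1, [], [V, D], co), (1, [V], [V'], f), (0, [U, V'], [V], g), (0, Br V D), (0, [D, V], [], ev)]
     [(1, [], [V', D'], co'), (0, [U, V'], [V], g), (0, [V], [V'], f), (0, Br V' D'), (0, [D', V'], [], ev')]"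
proof -
  note [simp] = dualizes_box[OF assms(1)] dualizes_box[OF assms(2)] assms(3-5)
  let ?Ev = "([D, V], [], ev)" and ?Co = "([], [V, D], co)"
    and ?Ev' = "([D', V'], [], ev')" and ?Co' = "([], [V', D'], co')" and ?f = "([V], [V'], f)"
    and ?g = "([U, V'], [V], g)"
  obtain h where h: "box ([D'], [D], h)" "deq [D', V] [(0, [D'], [D], h), (0, ?Ev)] [(1, ?f), (0, ?Ev')]"
    "deq [] [(0, ?Co'), (1, [D'], [D], h)] [(0, ?Co), (0, ?f)]"
    using mate[OF assms(1-3)] by blast
  note [simp] = h(1)
  let ?h = "([D'], [D], h)"
  have "deq [U] [(1, ?Co), (1, ?f), (0, ?g), (0, Br V D), (0, ?Ev)]
     [(1, ?Co'), (2, ?h), (0, ?g), (0, Br V D), (0, ?Ev)]"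
    by (rule step_sym[OF h(3), of "[]" 1 "[(0, ?g), (0, Br V D), (0, ?Ev)]"]; simp)
  also have "deq [U] ... [(1, ?Co'), (0, ?g), (0, Br V D'), (0, ?h), (0, ?Ev)]"
    by (rule step[OF wire_right_natural[of _ _ h V], of "[D']" "[D]" "[(1, ?Co'), (0, ?g)]" 0 "[(0, ?Ev)]"]; simp)
  also have "deq [U] ... [(1, ?Co'), (0, ?g), (0, Br V D'), (1, ?f), (0, ?Ev')]"
    by (rule at[OF h(2), of 0 3]; simp)
  also have "deq [U] ... [(1, ?Co'), (0, ?g), (0, ?f), (0, Br V' D'), (0, ?Ev')]"
    by (rule at_sym[OF wire_left_natural[of _ _ f D'], of "[V]" "[V']" 0 2]; simp)
  finally show ?thesis .
qed

text \<open>The double twist: a curl over and a curl under the same strand. Unlike a single twist it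
  needs no identification of \<open>V\<close> with its double dual.\<close>

definition double_twist_diagram :: "'o \<Rightarrow> 'o \<Rightarrow> 'm \<Rightarrow> 'm \<Rightarrow> ('o, 'm) diagram" where
  "double_twist_diagram D V ev co = [(1, [], [V, D], co), (1, Br V D), (0, Br V D), (0, [D, V], [], ev)]"

text \<open>The same journey as for the trace, now through both curls and out at the other
  end.\<close>

lemma double_twist_natural:
  assumes "dualizes D V ev co" "dualizes D' V' ev' co'" "box ([V], [V'], f)"
  shows "deq [V] (double_twist_diagram D V ev co @ [(0, [V], [V'], f)])
     ((0, [V], [V'], f) # double_twist_diagram D' V' ev' co')"
proof -
  note [simp] = dualizes_box[OF assms(1)] dualizes_box[OF assms(2)] assms(3)
  let ?Ev = "([D, V], [], ev)" and ?Co = "([], [V, D], co)"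
    and ?Ev' = "([D', V'], [], ev')" and ?Co' = "([], [V', D'], co')" and ?f = "([V], [V'], f)"
  obtain h where h: "box ([D'], [D], h)" "deq [D', V] [(0, [D'], [D], h), (0, ?Ev)] [(1, ?f), (0, ?Ev')]"
    "deq [] [(0, ?Co'), (1, [D'], [D], h)] [(0, ?Co), (0, ?f)]"
    using mate[OF assms(1-3)] by blast
  note [simp] = h(1)
  let ?h = "([D'], [D], h)"
  have "deq [V] [(1, ?Co), (1, Br V D), (0, Br V D), (0, ?Ev), (0, ?f)]
     [(1, ?Co), (1, ?f), (1, Br V' D), (0, Br V D), (0, ?Ev)]"
    by (rule step_sym[OF wire_left_natural[of _ _ f D], of "[V]" "[V']" "[(1, ?Co)]" 1 "[(0, Br V D), (0, ?Ev)]"]; simp)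
  also have "deq [V] ... [(1, ?Co'), (2, ?h), (1, Br V' D), (0, Br V D), (0, ?Ev)]"
    by (rule step_sym[OF h(3), of "[]" 1 "[(1, Br V' D), (0, Br V D), (0, ?Ev)]"]; simp)
  also have "deq [V] ... [(1, ?Co'), (1, Br V' D'), (1, ?h), (0, Br V D), (0, ?Ev)]"
    by (rule at[OF wire_right_natural[of _ _ h V'], of "[D']" "[D]" 1 1]; simp)
  also have "deq [V] ... [(1, ?Co'), (1, Br V' D'), (0, Br V D'), (0, ?h), (0, ?Ev)]"
    by (rule at[OF wire_right_natural[of _ _ h V], of "[D']" "[D]" 0 2]; simp)
  also have "deq [V] ... [(1, ?Co'), (1, Br V' D'), (0, Br V D'), (1, ?f), (0, ?Ev')]"
    by (rule at[OF h(2), of 0 3]; simp)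
  also have "deq [V] ... [(0, ?f), (1, ?Co'), (1, Br V' D'), (0, Br V' D'), (0, ?Ev')]"
    by (rule at_sym[OF wire_left_natural[of _ _ f D'], of "[V]" "[V']" 0 2]; simp)
  finally show ?thesis by (simp add: double_twist_diagram_def)
qed

lemma double_twist_box:
  assumes "dualizes D V ev co"
  shows "ok [V] (double_twist_diagram D V ev co)" "run [V] (double_twist_diagram D V ev co) = [V]"
    "sem [V] (double_twist_diagram D V ev co) \<in> hom C V V"
proof -
  note [simp] = dualizes_box[OF assms]
  show 1: "ok [V] (double_twist_diagram D V ev co)" "run [V] (double_twist_diagram D V ev co) = [V]"
    by (simp_all add: double_twist_diagram_def)
  from sem_in_hom[OF 1(1)] show "sem [V] (double_twist_diagram D V ev co) \<in> hom C V V" unfolding 1(2) by simp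
qed

definition double_twist :: "'o \<Rightarrow> 'm" where
  "double_twist V = (case SOME (D, ev, co). dualizes D V ev co of
     (D, ev, co) \<Rightarrow> sem [V] (double_twist_diagram D V ev co))"

lemma double_twist_obtain:
  assumes "V \<in> obj C"
  obtains D ev co where "dualizes D V ev co" "double_twist V = sem [V] (double_twist_diagram D V ev co)"
proof -
  have "\<exists>t. case t of (D, ev, co) \<Rightarrow> dualizes D V ev co"
    using left_dual[OF assms] assms by (auto simp: dualizes_def)
  from someI_ex[OF this] show ?thesis
    using that by (cases "SOME (D, ev, co). dualizes D V ev co") (auto simp: double_twist_def)
qed

lemma double_twist_commute:
  assumes "V \<in> obj C" "V' \<in> obj C" "f \<in> hom C V V'" "dualizes D' V' ev' co'"
  shows "f \<cdot> double_twist V = sem [V'] (double_twist_diagram D' V' ev' co') \<cdot> f"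
proof -
  obtain D ev co where d: "dualizes D V ev co" "double_twist V = sem [V] (double_twist_diagram D V ev co)"
    using double_twist_obtain[OF assms(1)] .
  have b: "box ([V], [V'], f)" using assms by (simp add: box_def)
  note n = double_twist_natural[OF d(1) assms(4) b] and t = double_twist_box[OF d(1)] double_twist_box[OF assms(4)]
  have "sem [V] (double_twist_diagram D V ev co @ [(0, [V], [V'], f)]) = f \<cdot> double_twist V"
    using sem_append[OF t(1), of "[(0, [V], [V'], f)]"] t(2) sem_box[OF b] ok_box[OF b] d(2) by simp
  moreover have "sem [V] ([(0, [V], [V'], f)] @ double_twist_diagram D' V' ev' co') =
     sem [V'] (double_twist_diagram D' V' ev' co') \<cdot> f"
    using sem_append[OF ok_box[OF b], of "double_twist_diagram D' V' ev' co'"] t(4) sem_box[OF b] assms by simp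
  ultimately show ?thesis using n by (simp add: deq_def del: sem.simps)
qed

text \<open>Naturality along the identity of \<open>V\<close>, with different duals at the two ends,
  shows that the chosen dual does not matter.\<close>

lemma double_twist_eq:
  assumes "dualizes D V ev co"
  shows "double_twist V = sem [V] (double_twist_diagram D V ev co)"
proof -
  note V = dualizes_box(1)[OF assms]
  obtain D' ev' co' where d: "dualizes D' V ev' co'" "double_twist V = sem [V] (double_twist_diagram D' V ev' co')"
    using double_twist_obtain[OF V] .
  have "double_twist V \<in> hom C V V" using double_twist_box[OF d(1)] d(2) by simp
  then show ?thesis
    using double_twist_commute[OF V V ident_in_hom[OF V] assms] double_twist_box[OF assms] V
    by (simp add: ident_comp[of V V] comp_ident[of V V])
qed

lemma double_twist_in_hom: "V \<in> obj C \<Longrightarrow> double_twist V \<in> hom C V V"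
  using double_twist_obtain[of V] double_twist_box(3) by metis

lemma double_twist_nat:
  assumes "V \<in> obj C" "V' \<in> obj C" "f \<in> hom C V V'"
  shows "f \<cdot> double_twist V = double_twist V' \<cdot> f"
proof -
  obtain D ev co where "dualizes D V' ev co" "double_twist V' = sem [V'] (double_twist_diagram D V' ev co)"
    using double_twist_obtain[OF assms(2)] .
  then show ?thesis using double_twist_commute[OF assms] by simp
qed

end

section \<open>Commutative separable algebras are Frobenius\<close>

locale commutative_separable_algebra = separable_braided_algebra C a \<mu> \<eta> e
  for C :: "('o, 'm::ab_group_add, 'k::field, 'x) brcat_scheme" (structure) and a \<mu> \<eta> e +
  assumes mu_comm: "\<mu> \<cdot> braiding C a a = \<mu>"
begin

lemma commutative: "deq [a, a] [(0, B), (0, M)] [(0, M)]"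
  using mu_comm by (simp add: deq_def sem_eval)

definition dual_a :: "'o \<times> 'm \<times> 'm" where
  "dual_a = (SOME (D, ev, co). dualizes D a ev co)"

lemma dual_a: obtains D ev co where "dual_a = (D, ev, co)" "dualizes D a ev co"
proof -
  have "\<exists>t. case t of (D, ev, co) \<Rightarrow> dualizes D a ev co"
    using left_dual[OF a_obj] by (auto simp: dualizes_def)
  from someI_ex[OF this] show ?thesis
    using that by (cases dual_a) (auto simp: dual_a_def)
qed

text \<open>The character of the regular module, x \<mapsto> tr(y \<mapsto> x y), where the loop is
  closed through the braiding.\<close>

definition trace_form :: 'm where
  "trace_form = (case dual_a of (D, ev, co) \<Rightarrow> sem [a] (trace_diagram D a ev co a \<mu>))"

abbreviation L :: "('o, 'm) box" where "L \<equiv> ([a], [], trace_form)"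

lemma trace_form_box [simp]: "box L"
proof -
  obtain D ev co where d: "dual_a = (D, ev, co)" and du: "dualizes D a ev co" by (rule dual_a)
  note [simp] = dualizes_box[OF du]
  show ?thesis unfolding trace_form_def d prod.case trace_diagram_def
    by (rule deq_box; simp)
qed

text \<open>After commutativity has brought the loop variable y in front of e_1, the identity y e_1
  \<otimes> e_2 = e_1 \<otimes> e_2 y takes it out of the evaluation. The loop becomes a zigzag, and
  straightening it leaves e_1 e_2 = 1.\<close>

lemma e_trace_left: "deq [] [(0, S), (0, L)] [(0, E)]"
proof -
  obtain D ev co where d: "dual_a = (D, ev, co)" and du: "dualizes D a ev co" by (rule dual_a)
  note [simp] = dualizes_box[OF du]
  let ?Ev = "([D, a], [], ev)" and ?Co = "([], [a, D], co)"
  have L: "deq [a] [(0, L)] [(1, ?Co), (0, M), (0, Br a D), (0, ?Ev)]"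
    unfolding trace_form_def d prod.case trace_diagram_def by (rule deq_box; simp)
  \<comment> \<open>\<open>h\<close> collects one leg of \<open>e\<close> together with the
    evaluation into a map from the dual to \<open>a\<close>, so that both pass the crossing at
    once.\<close>
  obtain h where H: "deq [D] [(0, ([D], [a], h))] [(1, S), (0, ?Ev)]" and [simp]: "box ([D], [a], h)"
    by (rule that[OF deq_box]; simp)
  let ?H = "([D], [a], h)"
  have "deq [] [(0, S), (0, L)] [(0, S), (1, ?Co), (0, M), (0, Br a D), (0, ?Ev)]"
    by (rule at[OF L, of 0 1]; simp)
  also have "deq [] ... [(0, S), (1, ?Co), (0, B), (0, M), (0, Br a D), (0, ?Ev)]"
    by (rule at_sym[OF commutative, of 0 2]; simp)
  also have "deq [] ... [(0, S), (1, ?Co), (0, B), (1, Br a D), (0, Br a D), (1, M), (0, ?Ev)]"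
    by (rule at[OF wire_left_natural[of _ _ \<mu> D], of "[a, a]" "[a]" 0 3]; simp)
  also have "deq [] ... [(0, S), (0, ?Co), (0, Br a D), (1, M), (0, ?Ev)]"
    by (rule at[OF wire_right_natural[of _ _ co a], of "[]" "[a, D]" 0 1]; simp)
  also have "deq [] ... [(0, ?Co), (0, Br a D), (1, S), (0, ?Ev), (0, M)]"
    by (rule step[OF casimir, of "[(0, ?Co), (0, Br a D)]" 1 "[(0, ?Ev)]"]; simp)
  also have "deq [] ... [(0, ?Co), (0, Br a D), (0, ?H), (0, M)]"
    by (rule at_sym[OF H, of 0 2]; simp)
  also have "deq [] ... [(0, ?Co), (1, ?H), (0, B), (0, M)]"
    by (rule at_sym[OF wire_right_natural[of _ _ h a], of "[D]" "[a]" 0 1]; simp)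
  also have "deq [] ... [(0, ?Co), (1, ?H), (0, M)]"
    by (rule at[OF commutative, of 0 2]; simp)
  also have "deq [] ... [(0, S), (0, ?Co), (1, ?Ev), (0, M)]"
    by (rule at[OF H, of 1 1]; simp)
  also have "deq [] ... [(0, S), (0, M)]"
    by (rule at[OF snake(1)[OF du], of 0 1]; simp)
  also note split
  finally show ?thesis .
qed

lemma snake_left: "deq [a] [(1, S), (0, M), (0, L)] []"
proof -
  have "deq [a] [(1, S), (0, M), (0, L)] [(0, S), (0, L), (0, M)]"
    by (rule at[OF casimir, of 0 0]; simp)
  also have "deq [a] ... [(0, E), (0, M)]"
    by (rule at[OF e_trace_left, of 0 0]; simp)
  also note unit_left
  finally show ?thesis .
qed

text \<open>The symmetry of \<open>e\<close> is not yet known, so the second leg needs its own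
  argument. For t = e_1 \<epsilon>(e_2), with \<epsilon> the trace form, \<open>snake_left\<close>
  gives e_1 t \<otimes> e_2 = e_1 \<otimes> e_2; hence t = e_1 e_2 t = e_1 t e_2 = e_1 e_2 = 1,
  where the middle step is commutativity.\<close>

lemma e_trace_right: "deq [] [(0, S), (1, L)] [(0, E)]"
proof -
  obtain t where T: "deq [] [(0, ([], [a], t))] [(0, S), (1, L)]" and [simp]: "box ([], [a], t)"
    by (rule that[OF deq_box]; simp)
  let ?T = "([], [a], t)"
  have "deq [] [(0, S), (1, ?T), (0, M)] [(0, S), (1, S), (2, L), (0, M)]"
    by (rule at[OF T, of 1 1]; simp)
  also have "deq [] ... [(0, S), (0, S), (1, M), (1, L)]"
    by (rule step[OF casimir, of "[(0, S)]" 0 "[(1, L)]"]; simp)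
  also have "deq [] ... [(0, S)]"
    by (rule step[OF snake_left, of "[(0, S)]" 1 "[]"]; simp)
  finally have St: "deq [] [(0, S), (1, ?T), (0, M)] [(0, S)]" .
  have "deq [] [(0, ?T)] [(0, ?T), (0, E), (0, M)]"
    by (rule at_sym[OF unit_left, of 0 1]; simp)
  also have "deq [] ... [(0, S), (0, M), (1, ?T), (0, M)]"
    by (rule step_sym[OF split, of "[]" 0 "[(1, ?T), (0, M)]"]; simp)
  also have "deq [] ... [(0, S), (2, ?T), (1, M), (0, M)]"
    by (rule step[OF assoc, of "[(0, S), (2, ?T)]" 0 "[]"]; simp)
  also have "deq [] ... [(0, S), (1, ?T), (1, B), (1, M), (0, M)]"
    by (rule at_sym[OF wire_left_natural[of _ _ t a], of "[]" "[a]" 1 1]; simp)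
  also have "deq [] ... [(0, S), (1, ?T), (1, M), (0, M)]"
    by (rule at[OF commutative, of 1 2]; simp)
  also have "deq [] ... [(0, S), (1, ?T), (0, M), (0, M)]"
    by (rule at_sym[OF assoc, of 0 2]; simp)
  also have "deq [] ... [(0, S), (0, M)]"
    by (rule at[OF St, of 0 0]; simp)
  also note split
  finally have "deq [] [(0, ?T)] [(0, E)]" .
  with T show ?thesis by (blast intro: deq_trans deq_sym)
qed

definition pairing :: 'm where "pairing = sem [a, a] [(0, M), (0, L)]"

abbreviation K :: "('o, 'm) box" where "K \<equiv> ([a, a], [], pairing)"

lemma K_def: "deq [a, a] [(0, K)] [(0, M), (0, L)]"
  and box_K [simp]: "box K"
  unfolding pairing_def by (rule deq_box; simp)+

lemma BK: "deq [a, a] [(0, B), (0, K)] [(0, K)]"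
proof -
  have "deq [a, a] [(0, B), (0, K)] [(0, B), (0, M), (0, L)]"
    by (rule at[OF K_def, of 0 1]; simp)
  also have "deq [a, a] ... [(0, M), (0, L)]"
    by (rule at[OF commutative, of 0 0]; simp)
  also note deq_sym[OF K_def]
  finally show ?thesis .
qed

lemma SK_left: "deq [a] [(1, S), (0, K)] []"
proof -
  have "deq [a] [(1, S), (0, K)] [(1, S), (0, M), (0, L)]"
    by (rule at[OF K_def, of 0 1]; simp)
  also note snake_left
  finally show ?thesis .
qed

lemma SK_right: "deq [a] [(0, S), (1, K)] []"
proof -
  have "deq [a] [(0, S), (1, K)] [(0, S), (1, M), (1, L)]"
    by (rule at[OF K_def, of 1 1]; simp)
  also have "deq [a] ... [(1, S), (2, L), (0, M)]"
    by (rule at_sym[OF casimir, of 0 0]; simp)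
  also have "deq [a] ... [(1, E), (0, M)]"
    by (rule at[OF e_trace_right, of 1 0]; simp)
  also note unit_right
  finally show ?thesis .
qed

text \<open>Because the pairing is symmetric, \<open>e\<close> followed by the braiding is again a
  copairing for it, and the copairing of a pairing is unique.\<close>

lemma SB: "deq [] [(0, S), (0, B)] [(0, S)]"
proof -
  have "deq [a] [(0, S), (0, B), (1, K)] [(1, S), (0, B), (1, B), (0, B), (1, K)]"
    by (rule at_sym[OF wire_right_natural[of _ _ e a], of "[]" "[a, a]" 0 0]; simp)
  also have "deq [a] ... [(1, S), (1, B), (0, B), (1, B), (1, K)]"
    by (rule at_sym[OF wire_right_natural[of _ _ "braiding C a a" a], of "[a, a]" "[a, a]" 0 1]; simp)
  also have "deq [a] ... [(1, S), (1, B), (0, B), (1, K)]"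
    by (rule at[OF BK, of 1 3]; simp)
  also have "deq [a] ... [(1, S), (0, K)]"
    by (rule at_sym[OF wire_left_natural[of _ _ pairing a], of "[a, a]" "[]" 0 1]; simp)
  also note SK_left
  finally have *: "deq [a] [(0, S), (0, B), (1, K)] []" .
  have "deq [] [(0, S), (0, B)] [(0, S), (0, S), (0, B), (1, K)]"
    by (rule at_sym[OF SK_left, of 1 2]; simp)
  also have "deq [] ... [(0, S)]"
    by (rule at[OF *, of 0 1]; simp)
  finally show ?thesis .
qed

lemma dualizes_self: "dualizes a a pairing e"
proof -
  have K: "sem [a, a] [(0, K)] = pairing" "sem [] [(0, S)] = e" by (rule sem_box; simp)+
  have h: "pairing \<in> hom C (a \<odot> a) (unit_obj C)"
    using box_K by (simp add: box_def tens_simps)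
  have "sem [a] [(0, S), (1, K)] = (ident C a \<otimes> pairing) \<cdot> (e \<otimes> ident C a)"
    "sem [a] [(1, S), (0, K)] = (pairing \<otimes> ident C a) \<cdot> (ident C a \<otimes> e)"
    by (simp_all add: sem_eval del: sem.simps)
  with SK_left SK_right show ?thesis
    by (simp add: dualizes_def dual_pair_def h e_hom deq_def)
qed

text \<open>Computed with the self-duality of \<open>a\<close>, the crossings are absorbed by the
  symmetric pairing and copairing. Consequently the identity is an admissible twist on the regular
  module.\<close>

lemma double_twist_self: "deq [a] (double_twist_diagram a a pairing e) []"
proof -
  have "deq [a] [(1, S), (1, B), (0, B), (0, K)] [(1, S), (1, B), (0, K)]"
    by (rule at[OF BK, of 0 2]; simp)
  also have "deq [a] ... [(1, S), (0, K)]"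
    by (rule at[OF SB, of 1 0]; simp)
  also note SK_left
  finally show ?thesis by (simp add: double_twist_diagram_def)
qed

lemma double_twist_a: "double_twist a = ident C a"
  using double_twist_self by (simp add: double_twist_eq[OF dualizes_self] deq_def)

end

section \<open>Twisted modules\<close>

text \<open>A module \<open>V\<close> over a commutative algebra with an automorphism \<open>f\<close> of the object \<open>V\<close> that
  behaves like a balancing twist: it intertwines the action with its composite with the double
  braiding, and its square is inverse to the double twist.\<close>

locale twisted_module = commutative_separable_algebra C a \<mu> \<eta> e
  for C :: "('o, 'm::ab_group_add, 'k::field, 'x) brcat_scheme" (structure) and a \<mu> \<eta> e +
  fixes V :: 'o and l f :: 'm
  assumes V_obj [simp]: "V \<in> obj C"
    and l_hom: "l \<in> hom C (a \<odot> V) V" and f_hom: "f \<in> hom C V V"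
    and action_assoc: "l \<cdot> (\<mu> \<otimes> ident C V) = l \<cdot> (ident C a \<otimes> l)"
    and action_unit: "l \<cdot> (\<eta> \<otimes> ident C V) = ident C V"
    and twist_action: "f \<cdot> l = l \<cdot> ((braiding C V a \<cdot> braiding C a V) \<cdot> (ident C a \<otimes> f))"
    and twist_double: "f \<cdot> (double_twist V \<cdot> f) = ident C V"
begin

abbreviation Ac :: "('o, 'm) box" where "Ac \<equiv> ([a, V], [V], l)"
abbreviation Tw :: "('o, 'm) box" where "Tw \<equiv> ([V], [V], f)"

lemma box_Ac [simp]: "box Ac" and box_Tw [simp]: "box Tw"
  by (simp_all add: box_def tens_simps l_hom f_hom)

lemma Ac_assoc: "deq [a, a, V] [(0, M), (0, Ac)] [(1, Ac), (0, Ac)]"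
  using action_assoc by (simp add: deq_def sem_eval)

lemma Ac_unit: "deq [V] [(0, E), (0, Ac)] []"
  using action_unit by (simp add: deq_def sem_eval)

lemma Tw_Ac: "deq [a, V] [(0, Ac), (0, Tw)] [(1, Tw), (0, Br a V), (0, Br V a), (0, Ac)]"
proof -
  have h: "ident C a \<otimes> f \<in> hom C (a \<odot> V) (a \<odot> V)"
    by (intro tensor_in_hom) (auto simp: f_hom ident_in_hom)
  have "(l \<cdot> (braiding C V a \<cdot> braiding C a V)) \<cdot> (ident C a \<otimes> f) = l \<cdot> ((braiding C V a \<cdot> braiding C a V) \<cdot> (ident C a \<otimes> f))"
    "(l \<cdot> braiding C V a) \<cdot> braiding C a V = l \<cdot> (braiding C V a \<cdot> braiding C a V)"
    by (rule comp_assoc[OF _ _ _ _ h comp_in_hom[OF _ _ _ braiding_in_hom braiding_in_hom] l_hom]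
       comp_assoc[OF _ _ _ _ braiding_in_hom braiding_in_hom l_hom]; simp add: tensor_in_obj)+
  with twist_action show ?thesis by (simp add: deq_def sem_eval)
qed

lemma Tw_double:
  assumes "dualizes D V ev co"
  shows "deq [V] ((0, Tw) # double_twist_diagram D V ev co @ [(0, Tw)]) []"
proof -
  note t = double_twist_box[OF assms]
  have "sem [V] (double_twist_diagram D V ev co @ [(0, Tw)]) = f \<cdot> double_twist V"
    using sem_append[OF t(1), of "[(0, Tw)]"] t(2) sem_box[OF box_Tw] ok_box[OF box_Tw]
      double_twist_eq[OF assms] by simp
  moreover have "ok [V] (double_twist_diagram D V ev co @ [(0, Tw)])"
    "run [V] (double_twist_diagram D V ev co @ [(0, Tw)]) = [V]" using t by (simp_all add: ok_append)
  moreover have "(f \<cdot> double_twist V) \<cdot> f = f \<cdot> (double_twist V \<cdot> f)"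
    by (rule comp_assoc[OF _ _ _ _ f_hom double_twist_in_hom f_hom]) auto
  ultimately show ?thesis using twist_double
      sem_append[OF ok_box[OF box_Tw], of "double_twist_diagram D V ev co @ [(0, Tw)]"] sem_box[OF box_Tw]
    by (simp add: deq_def)
qed

text \<open>The balancing formula for the twist of a tensor product, with the identity as the twist
  of \<open>a\<close>.\<close>

definition free_twist :: 'm where
  "free_twist = sem [V, a] [(0, Tw), (0, Br V a), (0, Br a V)]"

abbreviation FT :: "('o, 'm) box" where "FT \<equiv> ([V, a], [V, a], free_twist)"

lemma FT_def: "deq [V, a] [(0, FT)] [(0, Tw), (0, Br V a), (0, Br a V)]"
  and box_FT [simp]: "box FT"
  unfolding free_twist_def by (rule deq_box; simp)+

lemma FT_def2: "deq [V, a] [(0, FT)] [(0, Br V a), (0, Br a V), (0, Tw)]"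
proof -
  note FT_def
  also have "deq [V, a] [(0, Tw), (0, Br V a), (0, Br a V)] [(0, Br V a), (1, Tw), (0, Br a V)]"
    by (rule at[OF wire_left_natural[of _ _ f a], of "[V]" "[V]" 0 0]; simp)
  also have "deq [V, a] ... [(0, Br V a), (0, Br a V), (0, Tw)]"
    by (rule at[OF wire_right_natural[of _ _ f a], of "[V]" "[V]" 0 1]; simp)
  finally show ?thesis .
qed

text \<open>Two words for the full twist on three strands, s1 s1 s2 s1 s1 s2 = s2 s2 s1 s2 s2 s1 in
  the braid group, derived from naturality of the braiding with respect to braidings.\<close>

lemma full_twist_assoc: "deq [a, V, a]
   [(0, Br a V), (0, Br V a), (1, Br V a), (0, B), (0, B), (1, Br a V)]
   [(1, Br V a), (1, Br a V), (0, Br a V), (1, B), (1, B), (0, Br V a)]"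
proof -
  let ?b = "braiding C"
  have "deq [a, V, a] [(0, Br a V), (0, Br V a), (1, Br V a), (0, B), (0, B), (1, Br a V)]
     [(0, Br a V), (1, B), (0, Br V a), (1, Br V a), (0, B), (1, Br a V)]"
    by (rule step_sym[OF wire_right_natural[of _ _ "?b a a" V], of "[a, a]" "[a, a]" "[(0, Br a V)]" 0 "[(0, B), (1, Br a V)]"]; simp)
  also have "deq [a, V, a] ... [(0, Br a V), (1, B), (1, B), (0, Br V a), (1, Br V a), (1, Br a V)]"
    by (rule step_sym[OF wire_right_natural[of _ _ "?b a a" V], of "[a, a]" "[a, a]" "[(0, Br a V), (1, B)]" 0 "[(1, Br a V)]"]; simp)
  finally have 1: "deq [a, V, a] [(0, Br a V), (0, Br V a), (1, Br V a), (0, B), (0, B), (1, Br a V)]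
     [(0, Br a V), (1, B), (1, B), (0, Br V a), (1, Br V a), (1, Br a V)]" .
  have "deq [a, V, a] [(1, Br V a), (1, Br a V), (0, Br a V), (1, B), (1, B), (0, Br V a)]
      [(1, Br V a), (0, B), (1, Br a V), (0, Br a V), (1, B), (0, Br V a)]"
    by (rule step[OF wire_right_natural[of _ _ "?b a V" a], of "[a, V]" "[V, a]" "[(1, Br V a)]" 0 "[(1, B), (0, Br V a)]"]; simp)
  also have "deq [a, V, a] ... [(0, Br a V), (1, B), (0, Br V a), (0, Br a V), (1, B), (0, Br V a)]"
    by (rule step[OF wire_right_natural[of _ _ "?b V a" a], of "[V, a]" "[a, V]" "[]" 0 "[(0, Br a V), (1, B), (0, Br V a)]"]; simp)
  also have "deq [a, V, a] ... [(0, Br a V), (1, B), (0, Br V a), (1, Br V a), (0, B), (1, Br a V)]"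
    by (rule at[OF wire_left_natural[of _ _ "?b a V" a], of "[a, V]" "[V, a]" 0 3]; simp)
  also have "deq [a, V, a] ... [(0, Br a V), (1, B), (1, B), (0, Br V a), (1, Br V a), (1, Br a V)]"
    by (rule at[OF wire_left_natural[of _ _ "?b V a" a], of "[V, a]" "[a, V]" 0 2]; simp)
  finally show ?thesis using 1 by (blast intro: deq_trans deq_sym)
qed

lemma FT_left: "deq [a, V, a] [(0, Ac), (0, FT)]
   [(1, FT), (0, Br a V), (1, B), (1, B), (0, Br V a), (0, Ac)]"
proof -
  have "deq [a, V, a] [(0, Ac), (0, FT)] [(0, Ac), (0, Tw), (0, Br V a), (0, Br a V)]"
    by (rule at[OF FT_def, of 0 1]; simp)
  also have "deq [a, V, a] ... [(1, Tw), (0, Br a V), (0, Br V a), (0, Ac), (0, Br V a), (0, Br a V)]"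
    by (rule at[OF Tw_Ac, of 0 0]; simp)
  also have "deq [a, V, a] ... [(1, Tw), (0, Br a V), (0, Br V a), (1, Br V a), (0, B), (1, Ac), (0, Br a V)]"
    by (rule at[OF wire_left_natural[of _ _ l a], of "[a, V]" "[V]" 0 3]; simp)
  also have "deq [a, V, a] ... [(1, Tw), (0, Br a V), (0, Br V a), (1, Br V a), (0, B), (0, B), (1, Br a V), (0, Ac)]"
    by (rule at[OF wire_right_natural[of _ _ l a], of "[a, V]" "[V]" 0 5]; simp)
  also have "deq [a, V, a] ... [(1, Tw), (1, Br V a), (1, Br a V), (0, Br a V), (1, B), (1, B), (0, Br V a), (0, Ac)]"
    by (rule at[OF full_twist_assoc, of 0 1]; simp)
  also have "deq [a, V, a] ... [(1, FT), (0, Br a V), (1, B), (1, B), (0, Br V a), (0, Ac)]"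
    by (rule at_sym[OF FT_def, of 1 0]; simp)
  finally show ?thesis .
qed

text \<open>The strand \<open>a\<close> carries the trivial twist, and the double braiding of its
  two copies is absorbed by the commutative multiplication.\<close>

lemma FT_right: "deq [V, a, a] [(1, M), (0, FT)]
   [(0, FT), (1, B), (0, Br V a), (0, Br a V), (1, B), (1, M)]"
proof -
  let ?b = "braiding C"
  have "deq [V, a, a] [(1, M), (0, FT)] [(0, Tw), (1, M), (0, Br V a), (0, Br a V)]"
    by (rule at[OF FT_def, of 0 1]; simp)
  also have "deq [V, a, a] ... [(0, Tw), (0, Br V a), (1, Br V a), (0, M), (0, Br a V)]"
    by (rule at[OF wire_right_natural[of _ _ \<mu> V], of "[a, a]" "[a]" 0 1]; simp)
  also have "deq [V, a, a] ... [(0, Tw), (0, Br V a), (1, Br V a), (1, Br a V), (0, Br a V), (1, M)]"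
    by (rule at[OF wire_left_natural[of _ _ \<mu> V], of "[a, a]" "[a]" 0 3]; simp)
  finally have 1: "deq [V, a, a] [(1, M), (0, FT)] [(0, Tw), (0, Br V a), (1, Br V a), (1, Br a V), (0, Br a V), (1, M)]" .
  have "deq [V, a, a] [(0, FT), (1, B), (0, Br V a), (0, Br a V), (1, B), (1, M)]
     [(0, FT), (1, B), (0, Br V a), (0, Br a V), (1, M)]"
    by (rule step[OF commutative, of "[(0, FT), (1, B), (0, Br V a), (0, Br a V)]" 1 "[]"]; simp)
  also have "deq [V, a, a] ... [(0, Tw), (0, Br V a), (0, Br a V), (1, B), (0, Br V a), (0, Br a V), (1, M)]"
    by (rule step[OF FT_def, of "[]" 0 "[(1, B), (0, Br V a), (0, Br a V), (1, M)]"]; simp)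
  also have "deq [V, a, a] ... [(0, Tw), (0, Br V a), (1, Br V a), (0, B), (1, Br a V), (0, Br a V), (1, M)]"
    by (rule at[OF wire_left_natural[of _ _ "?b a V" a], of "[a, V]" "[V, a]" 0 2]; simp)
  also have "deq [V, a, a] ... [(0, Tw), (0, Br V a), (1, Br V a), (1, Br a V), (0, Br a V), (1, B), (1, M)]"
    by (rule at[OF wire_left_natural[of _ _ "?b a a" V], of "[a, a]" "[a, a]" 0 3]; simp)
  also have "deq [V, a, a] ... [(0, Tw), (0, Br V a), (1, Br V a), (1, Br a V), (0, Br a V), (1, M)]"
    by (rule at[OF commutative, of 1 5]; simp)
  finally show ?thesis using 1 by (blast intro: deq_trans deq_sym)
qed

text \<open>Moving \<open>V \<odot> a\<close> past its dual \<open>a \<odot> D\<close>: the free strand unlinks.\<close>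

abbreviation BR :: "'o \<Rightarrow> ('o, 'm) diagram" where
  "BR D \<equiv> [(1, B), (0, Br V a), (2, Br a D), (1, Br V D)]"

text \<open>The double braiding from the free twist is exactly what separates the two closed
  strands: the pairing of \<open>a\<close> ends up as an isolated cap between \<open>V\<close> and
  its dual. Symmetry of the pairing removes the last crossing.\<close>

lemma unlink_cap:
  assumes "dualizes D V ev co"
  shows "deq [V, a, a, D] ([(0, Br V a), (0, Br a V)] @ BR D @ [(1, [D, V], [], ev), (0, K)])
     [(1, K), (0, Br V D), (0, [D, V], [], ev)]"
proof -
  note [simp] = dualizes_box[OF assms]
  let ?Ev = "([D, V], [], ev)"
  obtain p where P: "deq [V, D] [(0, ([V, D], [], p))] [(0, Br V D), (0, ?Ev)]" and [simp]: "box ([V, D], [], p)"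
    by (rule that[OF deq_box]; simp)
  let ?P = "([V, D], [], p)"
  let ?b = "braiding C"
  have "deq [V, a, a, D] ([(0, Br V a), (0, Br a V)] @ BR D @ [(1, ?Ev), (0, K)])
    [(0, Br V a), (1, Br V a), (0, B), (1, Br a V), (2, Br a D), (1, Br V D), (1, ?Ev), (0, K)]"
    by (rule step[OF wire_left_natural[of _ _ "?b a V" a], of "[a, V]" "[V, a]" "[(0, Br V a)]" 0
          "[(2, Br a D), (1, Br V D), (1, ?Ev), (0, K)]"]; simp)
  also have "deq [V, a, a, D] ... [(0, Br V a), (1, Br V a), (0, B), (1, Br a V), (2, Br a D), (1, ?P), (0, K)]"
    by (rule step_sym[OF P, of "[(0, Br V a), (1, Br V a), (0, B), (1, Br a V), (2, Br a D)]" 1 "[(0, K)]"]; simp)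
  also have "deq [V, a, a, D] ... [(0, Br V a), (1, Br V a), (0, B), (2, ?P), (0, K)]"
    by (rule at_sym[OF wire_right_natural[of _ _ p a], of "[V, D]" "[]" 1 3]; simp)
  also have "deq [V, a, a, D] ... [(0, Br V a), (1, Br V a), (0, K), (0, ?P)]"
    by (rule step[OF BK, of "[(0, Br V a), (1, Br V a)]" 0 "[(0, ?P)]"]; simp)
  also have "deq [V, a, a, D] ... [(1, K), (0, ?P)]"
    by (rule at_sym[OF wire_right_natural[of _ _ pairing V], of "[a, a]" "[]" 0 0]; simp)
  also have "deq [V, a, a, D] ... [(1, K), (0, Br V D), (0, ?Ev)]"
    by (rule at[OF P, of 0 1]; simp)
  finally show ?thesis .
qed

lemma unlink_cup:
  assumes "dualizes D V ev co"
  shows "deq [] ([(0, [], [V, D], co), (1, S)] @ BR D @ [(2, Br V a), (2, Br a V)])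
     [(0, S), (1, [], [V, D], co), (1, Br V D)]"
proof -
  note [simp] = dualizes_box[OF assms]
  let ?Co = "([], [V, D], co)"
  obtain q where Q: "deq [] [(0, ([], [D, V], q))] [(0, ?Co), (0, Br V D)]" and [simp]: "box ([], [D, V], q)"
    by (rule that[OF deq_box]; simp)
  let ?Q = "([], [D, V], q)"
  let ?b = "braiding C"
  have "deq [] ([(0, ?Co), (1, S)] @ BR D @ [(2, Br V a), (2, Br a V)])
    [(0, ?Co), (1, S), (1, B), (0, Br V a), (1, Br V a), (2, Br V D), (1, Br a D), (2, Br a V)]"
    by (rule step_sym[OF wire_left_natural[of _ _ "?b V a" D], of "[V, a]" "[a, V]" "[(0, ?Co), (1, S), (1, B), (0, Br V a)]" 1
          "[(2, Br a V)]"]; simp)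
  also have "deq [] ... [(0, ?Co), (1, S), (0, Br V a), (1, Br V a), (2, Br V D), (1, Br a D), (2, Br a V)]"
    by (rule step[OF SB, of "[(0, ?Co)]" 1 "[(0, Br V a), (1, Br V a), (2, Br V D), (1, Br a D), (2, Br a V)]"]; simp)
  also have "deq [] ... [(0, S), (2, ?Co), (2, Br V D), (1, Br a D), (2, Br a V)]"
    by (rule at[OF wire_right_natural[of _ _ e V], of "[]" "[a, a]" 0 1]; simp)
  also have "deq [] ... [(0, S), (2, ?Q), (1, Br a D), (2, Br a V)]"
    by (rule at_sym[OF Q, of 2 1]; simp)
  also have "deq [] ... [(0, S), (1, ?Q)]"
    by (rule at[OF wire_right_natural[of _ _ q a], of "[]" "[D, V]" 1 1]; simp)
  also have "deq [] ... [(0, S), (1, ?Co), (1, Br V D)]"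
    by (rule at[OF Q, of 1 1]; simp)
  finally show ?thesis .
qed

text \<open>One free twist unlinks the caps and the other unlinks the cups. The strand
  \<open>a\<close> then straightens by self-duality, and what remains is the double twist axiom of
  \<open>V\<close>.\<close>

lemma FT_double:
  assumes "dualizes D V ev co"
  shows "deq [V, a] ([(0, FT), (2, [], [V, D], co), (3, S)] @ shift 2 (BR D) @ BR D @ [(1, [D, V], [], ev), (0, K), (0, FT)]) []"
proof -
  note [simp] = dualizes_box[OF assms]
  let ?Ev = "([D, V], [], ev)" and ?Co = "([], [V, D], co)"
  have "deq [V, a] ([(0, FT), (2, ?Co), (3, S)] @ shift 2 (BR D) @ BR D @ [(1, ?Ev), (0, K), (0, FT)])
     ([(0, FT), (2, ?Co), (3, S)] @ shift 2 (BR D) @ BR D @ [(1, ?Ev), (0, K), (0, Br V a), (0, Br a V), (0, Tw)])"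
    by (rule step[OF FT_def2, of "[(0, FT), (2, ?Co), (3, S)] @ shift 2 (BR D) @ BR D @ [(1, ?Ev), (0, K)]" 0 "[]"]; simp)
  also have "deq [V, a] \<dots> ([(0, Tw), (0, Br V a), (0, Br a V), (2, ?Co), (3, S)] @ shift 2 (BR D) @ BR D @ [(1, ?Ev), (0, K), (0, Br V a), (0, Br a V), (0, Tw)])"
    by (rule step[OF FT_def, of "[]" 0 "[(2, ?Co), (3, S)] @ shift 2 (BR D) @ BR D @ [(1, ?Ev), (0, K), (0, Br V a), (0, Br a V), (0, Tw)]"]; simp)
  also have "deq [V, a] \<dots> ([(0, Tw), (2, ?Co), (3, S)] @ shift 2 (BR D) @ [(1, K), (0, Br V D), (0, ?Ev), (0, Br V a), (0, Br a V), (0, Tw)])"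
    by (rule step[OF unlink_cap[OF assms], of "[(0, Tw), (2, ?Co), (3, S)] @ shift 2 (BR D)" 0 "[(0, Br V a), (0, Br a V), (0, Tw)]"]; simp)
  also have "deq [V, a] ... [(0, Tw), (2, S), (3, ?Co), (3, Br V D), (1, K), (0, Br V D), (0, ?Ev), (0, Tw)]"
    by (rule step[OF unlink_cup[OF assms], of "[(0, Tw)]" 2 "[(1, K), (0, Br V D), (0, ?Ev), (0, Tw)]"]; simp)
  also have "deq [V, a] ... [(0, Tw), (1, ?Co), (1, Br V D), (0, Br V D), (0, ?Ev), (0, Tw)]"
    by (rule step[OF SK_left, of "[(0, Tw)]" 1 "[(1, ?Co), (1, Br V D), (0, Br V D), (0, ?Ev), (0, Tw)]"]; simp)
  also have "deq [V, a] ... []"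
    by (rule step[OF Tw_double[OF assms], of "[]" 0 "[]"]; simp add: double_twist_diagram_def)
  finally show ?thesis .
qed

text \<open>Once unlinked, the loop of \<open>a\<close> contracts to the trace form of e_1 e_2 = 1
  and stands beside the closed strand of \<open>V\<close>.\<close>

lemma FT_trace:
  assumes "dualizes D V ev co"
  shows "deq [a] ([(1, [], [V, D], co), (2, S), (0, Ac), (0, FT)] @ BR D @ [(1, [D, V], [], ev), (0, K)])
     [(1, [], [V, D], co), (0, Ac), (0, Tw), (1, E), (1, L), (0, Br V D), (0, [D, V], [], ev)]"
proof -
  note [simp] = dualizes_box[OF assms]
  let ?Ev = "([D, V], [], ev)" and ?Co = "([], [V, D], co)"
  have "deq [a] ([(1, ?Co), (2, S), (0, Ac), (0, FT)] @ BR D @ [(1, ?Ev), (0, K)])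
     ([(1, ?Co), (2, S), (0, Ac), (0, Tw), (0, Br V a), (0, Br a V)] @ BR D @ [(1, ?Ev), (0, K)])"
    by (rule step[OF FT_def, of "[(1, ?Co), (2, S), (0, Ac)]" 0 "BR D @ [(1, ?Ev), (0, K)]"]; simp)
  also have "deq [a] ... [(1, ?Co), (2, S), (0, Ac), (0, Tw), (1, K), (0, Br V D), (0, ?Ev)]"
    by (rule step[OF unlink_cap[OF assms], of "[(1, ?Co), (2, S), (0, Ac), (0, Tw)]" 0 "[]"]; simp)
  also have "deq [a] ... [(1, ?Co), (0, Ac), (0, Tw), (1, S), (1, M), (1, L), (0, Br V D), (0, ?Ev)]"
    by (rule step[OF K_def, of "[(1, ?Co), (0, Ac), (0, Tw), (1, S)]" 1 "[(0, Br V D), (0, ?Ev)]"]; simp)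
  also have "deq [a] ... [(1, ?Co), (0, Ac), (0, Tw), (1, E), (1, L), (0, Br V D), (0, ?Ev)]"
    by (rule at[OF split, of 1 3]; simp)
  finally show ?thesis .
qed

text \<open>Over a commutative algebra a left module acquires a right action through the
  braiding.\<close>

abbreviation Rc :: "('o, 'm) diagram" where "Rc \<equiv> [(0, Br V a), (0, Ac)]"

lemma Rc_assoc: "deq [V, a, a] ([(1, M)] @ Rc) (Rc @ Rc)"
proof -
  have "deq [V, a, a] ([(1, M)] @ Rc) [(0, Br V a), (1, Br V a), (0, M), (0, Ac)]"
    by (rule step[OF wire_right_natural[of _ _ \<mu> V], of "[a, a]" "[a]" "[]" 0 "[(0, Ac)]"]; simp)
  also have "deq [V, a, a] ... [(0, Br V a), (1, Br V a), (0, B), (0, M), (0, Ac)]"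
    by (rule at_sym[OF commutative, of 0 2]; simp)
  also have "deq [V, a, a] ... [(0, Br V a), (1, Br V a), (0, B), (1, Ac), (0, Ac)]"
    by (rule at[OF Ac_assoc, of 0 3]; simp)
  also have "deq [V, a, a] \<dots> (Rc @ Rc)"
    by (rule at_sym[OF wire_left_natural[of _ _ l a], of "[a, V]" "[V]" 0 1]; simp)
  finally show ?thesis .
qed

lemma Rc_unit: "deq [V] ([(1, E)] @ Rc) []"
proof -
  have "deq [V] ([(1, E)] @ Rc) [(0, E), (0, Ac)]"
    by (rule step[OF wire_right_natural[of _ _ \<eta> V], of "[]" "[a]" "[]" 0 "[(0, Ac)]"]; simp)
  also note Ac_unit
  finally show ?thesis .
qed

lemma Rc_Ac: "deq [a, V, a] ([(0, Ac)] @ Rc) ([(1, Br V a), (1, Ac)] @ [(0, Ac)])"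
proof -
  have "deq [a, V, a] ([(0, Ac)] @ Rc) [(1, Br V a), (0, B), (1, Ac), (0, Ac)]"
    by (rule step[OF wire_left_natural[of _ _ l a], of "[a, V]" "[V]" "[]" 0 "[(0, Ac)]"]; simp)
  also have "deq [a, V, a] ... [(1, Br V a), (0, B), (0, M), (0, Ac)]"
    by (rule at_sym[OF Ac_assoc, of 0 2]; simp)
  also have "deq [a, V, a] ... [(1, Br V a), (0, M), (0, Ac)]"
    by (rule at[OF commutative, of 0 1]; simp)
  also have "deq [a, V, a] \<dots> ([(1, Br V a), (1, Ac)] @ [(0, Ac)])"
    by (rule at[OF Ac_assoc, of 0 1]; simp)
  finally show ?thesis .
qed

lemma Rc_Tw: "deq [V, a] (Rc @ [(0, Tw)]) ([(0, Tw), (0, Br V a), (0, Br a V)] @ Rc)"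
proof -
  have "deq [V, a] (Rc @ [(0, Tw)]) [(0, Br V a), (1, Tw), (0, Br a V), (0, Br V a), (0, Ac)]"
    by (rule step[OF Tw_Ac, of "[(0, Br V a)]" 0 "[]"]; simp)
  also have "deq [V, a] \<dots> ([(0, Tw), (0, Br V a), (0, Br a V)] @ Rc)"
    by (rule at_sym[OF wire_left_natural[of _ _ f a], of "[V]" "[V]" 0 0]; simp)
  finally show ?thesis .
qed

end

section \<open>Zero, negatives and differences of morphisms\<close>

context linear_category
begin

lemma hom_zero: "X \<in> obj C \<Longrightarrow> Y \<in> obj C \<Longrightarrow> 0 \<in> hom C X Y"
  and hom_add: "X \<in> obj C \<Longrightarrow> Y \<in> obj C \<Longrightarrow> f \<in> hom C X Y \<Longrightarrow> g \<in> hom C X Y \<Longrightarrow> f + g \<in> hom C X Y"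
  and hom_scale: "X \<in> obj C \<Longrightarrow> Y \<in> obj C \<Longrightarrow> f \<in> hom C X Y \<Longrightarrow> scale C c f \<in> hom C X Y"
proof -
  interpret vector_space "scale C" by (rule ambient_vector_space)
  assume *: "X \<in> obj C" "Y \<in> obj C"
  show "0 \<in> hom C X Y" using hom_subspace[OF *] by (rule subspace_0)
  show "f + g \<in> hom C X Y" if "f \<in> hom C X Y" "g \<in> hom C X Y"
    using hom_subspace[OF *] that by (rule subspace_add)
  show "scale C c f \<in> hom C X Y" if "f \<in> hom C X Y"
    using hom_subspace[OF *] that by (rule subspace_scale)
qed

lemma scale_minus_one: "scale C (- 1) f = - f"
proof -
  interpret vector_space "scale C" by (rule ambient_vector_space)
  show ?thesis by simp
qed

lemma hom_minus: "X \<in> obj C \<Longrightarrow> Y \<in> obj C \<Longrightarrow> f \<in> hom C X Y \<Longrightarrow> - f \<in> hom C X Y"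
  using hom_scale[of X Y f "- 1"] by (simp add: scale_minus_one)

lemma hom_diff: "X \<in> obj C \<Longrightarrow> Y \<in> obj C \<Longrightarrow> f \<in> hom C X Y \<Longrightarrow> g \<in> hom C X Y \<Longrightarrow> f - g \<in> hom C X Y"
  using hom_add[of X Y f "- g"] hom_minus by simp

lemma comp_zero:
  assumes "X \<in> obj C" "Y \<in> obj C" "Z \<in> obj C"
  shows "f \<in> hom C X Y \<Longrightarrow> 0 \<cdot> f = 0" and "g \<in> hom C Y Z \<Longrightarrow> g \<cdot> 0 = 0"
  using comp_add_left[OF assms, of f 0 0] comp_add_right[OF assms, of 0 0 g] hom_zero assms by auto

lemma comp_minus:
  assumes "X \<in> obj C" "Y \<in> obj C" "Z \<in> obj C" "f \<in> hom C X Y" "g \<in> hom C Y Z"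
  shows "(- g) \<cdot> f = - (g \<cdot> f)" and "g \<cdot> (- f) = - (g \<cdot> f)"
  using comp_scale_left[OF assms, of "- 1"] comp_scale_right[OF assms, of "- 1"] by (simp_all add: scale_minus_one)

lemma comp_diff_left:
  assumes "X \<in> obj C" "Y \<in> obj C" "Z \<in> obj C" "f \<in> hom C X Y" "g \<in> hom C Y Z" "g' \<in> hom C Y Z"
  shows "(g - g') \<cdot> f = g \<cdot> f - g' \<cdot> f"
  using comp_add_left[OF assms(1-5), of "- g'"] comp_minus(1)[OF assms(1-4,6)] assms hom_minus by simp

lemma comp_diff_right:
  assumes "X \<in> obj C" "Y \<in> obj C" "Z \<in> obj C" "f \<in> hom C X Y" "f' \<in> hom C X Y" "g \<in> hom C Y Z"
  shows "g \<cdot> (f - f') = g \<cdot> f - g \<cdot> f'"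
  using comp_add_right[OF assms(1-4) hom_minus assms(6), of f'] comp_minus(2)[OF assms(1-3,5,6)] assms by simp

end

context linear_monoidal_category
begin

lemma tensor_zero:
  assumes "X \<in> obj C" "X' \<in> obj C" "Y \<in> obj C" "Y' \<in> obj C"
  shows "g \<in> hom C Y Y' \<Longrightarrow> 0 \<otimes> g = 0" and "f \<in> hom C X X' \<Longrightarrow> f \<otimes> 0 = 0"
  using tensor_add_left[OF assms, of 0 0 g] tensor_add_right[OF assms, of f 0 0] hom_zero assms by auto

lemma sem_zero_layer:
  assumes "ok w (d @ (i, x, y, 0) # d')"
  shows "sem w (d @ (i, x, y, 0) # d') = 0"
proof -
  let ?u = "run w d"
  have 1: "ok w d" "ok ?u ((i, x, y, 0) # d')" using assms by (simp_all add: ok_append)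
  then obtain L R where u: "?u = L @ x @ R" "length L = i" by (auto elim: ok_split)
  have s: "set L \<subseteq> obj C" "set R \<subseteq> obj C" "box (x, y, 0)" "ok (L @ y @ R) d'"
    using 1(2) u ok_layer[of L x R y 0 d'] by auto
  then have xy: "set x \<subseteq> obj C" "set y \<subseteq> obj C" by (auto simp: box_def)
  have "layer L 0 R = 0"
  proof -
    have "0 \<otimes> ident C (tens R) = 0"
      by (rule tensor_zero(1)[of "tens x" "tens y" "tens R" "tens R"]) (use xy s in \<open>auto intro: ident_in_hom\<close>)
    moreover have "ident C (tens L) \<otimes> 0 = 0"
      by (rule tensor_zero(2)[of "tens L" "tens L" "tens R" "tens R"]) (use s in \<open>auto intro: ident_in_hom\<close>)
    ultimately show ?thesis by (simp add: layer_def)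
  qed
  then have "sem ?u ((i, x, y, 0) # d') = 0"
    using sem_layer[of L x R y 0 d'] u comp_zero(2)[of "unit_obj C", OF _ _ _ sem_in_hom[OF s(4)]] run_obj[OF s(4)] s xy
    by (simp add: unit_in_obj)
  then show ?thesis
    using sem_append[OF 1] comp_zero(1)[OF _ _ _ sem_in_hom[OF 1(1)], of "unit_obj C"] run_obj[OF 1(1)] ok_set[OF 1(1)]
      run_obj[OF 1(2)] by (simp add: unit_in_obj)
qed

end

section \<open>The trace as a function of the action\<close>

context finite_braided_tensor_category
begin

lemma trace_diagram_box:
  assumes "dualizes D V ev co" "U \<in> obj C" "u \<in> hom C (U \<odot> V) V"
  shows "ok [U] (trace_diagram D V ev co U u)" "run [U] (trace_diagram D V ev co U u) = []"
    "sem [U] (trace_diagram D V ev co U u) =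
      ((ev \<cdot> braiding C V D) \<cdot> (u \<otimes> ident C D)) \<cdot> (ident C U \<otimes> co)"
proof -
  note [simp] = dualizes_box[OF assms(1)]
  have [simp]: "box ([U, V], [V], u)" using assms by (simp add: box_def tens_simps)
  note [simp] = assms(2)
  show "ok [U] (trace_diagram D V ev co U u)" "run [U] (trace_diagram D V ev co U u) = []"
    by (simp_all add: trace_diagram_def)
  show "sem [U] (trace_diagram D V ev co U u) =
      ((ev \<cdot> braiding C V D) \<cdot> (u \<otimes> ident C D)) \<cdot> (ident C U \<otimes> co)"
    by (simp add: trace_diagram_def sem_eval)
qed

definition trace :: "'o \<Rightarrow> 'o \<Rightarrow> 'm \<Rightarrow> 'm" where
  "trace U V \<beta> = (case SOME (D, ev, co). dualizes D V ev co of
     (D, ev, co) \<Rightarrow> sem [U] (trace_diagram D V ev co U \<beta>))"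

lemma trace_obtain:
  assumes "V \<in> obj C"
  obtains D ev co where "dualizes D V ev co" "\<And>U \<beta>. trace U V \<beta> = sem [U] (trace_diagram D V ev co U \<beta>)"
proof -
  have "\<exists>t. case t of (D, ev, co) \<Rightarrow> dualizes D V ev co"
    using left_dual[OF assms] assms by (auto simp: dualizes_def)
  from someI_ex[OF this] show ?thesis
    using that by (cases "SOME (D, ev, co). dualizes D V ev co") (auto simp: trace_def)
qed

lemma trace_diagram_cyclic:
  assumes d: "dualizes D V ev co" "dualizes D' V' ev' co'" and U: "U \<in> obj C"
    and f: "f \<in> hom C V V'" and g: "g \<in> hom C (U \<odot> V') V"
  shows "sem [U] (trace_diagram D V ev co U (g \<cdot> (ident C U \<otimes> f))) =
    sem [U] (trace_diagram D' V' ev' co' U (f \<cdot> g))"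
proof -
  note [simp] = dualizes_box[OF d(1)] dualizes_box[OF d(2)] U
  have [simp]: "box ([V], [V'], f)" "box ([U, V'], [V], g)"
    using f g by (simp_all add: box_def tens_simps)
  have h: "ident C U \<otimes> f \<in> hom C (U \<odot> V) (U \<odot> V')" "g \<cdot> (ident C U \<otimes> f) \<in> hom C (U \<odot> V) V" "f \<cdot> g \<in> hom C (U \<odot> V') V'"
  proof -
    show 1: "ident C U \<otimes> f \<in> hom C (U \<odot> V) (U \<odot> V')"
      by (rule tensor_in_hom) (use f in \<open>auto intro: ident_in_hom\<close>)
    show "g \<cdot> (ident C U \<otimes> f) \<in> hom C (U \<odot> V) V" by (rule comp_in_hom[OF _ _ _ 1 g]) (auto simp: tensor_in_obj)
    show "f \<cdot> g \<in> hom C (U \<odot> V') V'" by (rule comp_in_hom[OF _ _ _ g f]) (auto simp: tensor_in_obj)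
  qed
  let ?x = "([U, V], [V], g \<cdot> (ident C U \<otimes> f))" and ?y = "([U, V'], [V'], f \<cdot> g)"
  have [simp]: "box ?x" "box ?y" using h by (simp_all add: box_def tens_simps)
  have x: "deq [U, V] [(0, ?x)] [(1, [V], [V'], f), (0, [U, V'], [V], g)]"
    and y: "deq [U, V'] [(0, ?y)] [(0, [U, V'], [V], g), (0, [V], [V'], f)]"
    by (simp_all add: deq_def sem_eval)
  have "deq [U] (trace_diagram D V ev co U (g \<cdot> (ident C U \<otimes> f)))
      [(1, [], [V, D], co), (1, [V], [V'], f), (0, [U, V'], [V], g), (0, Br V D), (0, [D, V], [], ev)]"
    unfolding trace_diagram_def
    by (rule step[OF x, of "[(1, [], [V, D], co)]" 0 "[(0, Br V D), (0, [D, V], [], ev)]"]; simp)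
  also note trace_cyclic[OF d _ _ U]
  also have "deq [U] [(1, [], [V', D'], co'), (0, [U, V'], [V], g), (0, [V], [V'], f), (0, Br V' D'), (0, [D', V'], [], ev')]
      (trace_diagram D' V' ev' co' U (f \<cdot> g))"
    unfolding trace_diagram_def
    by (rule step_sym[OF y, of "[(1, [], [V', D'], co')]" 0 "[(0, Br V' D'), (0, [D', V'], [], ev')]"]; simp)
  finally show ?thesis by (simp add: deq_def)
qed

text \<open>Cyclicity along the identity of \<open>V\<close>, with two different duals, makes the
  trace independent of the dual.\<close>

lemma trace_eq:
  assumes "dualizes D V ev co" "U \<in> obj C" "u \<in> hom C (U \<odot> V) V"
  shows "trace U V u = sem [U] (trace_diagram D V ev co U u)"
proof -
  note V = dualizes_box(1)[OF assms(1)]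
  obtain D' ev' co' where d: "dualizes D' V ev' co'" "\<And>U u. trace U V u = sem [U] (trace_diagram D' V ev' co' U u)"
    using trace_obtain[OF V] by metis
  have "ident C U \<otimes> ident C V = ident C (U \<odot> V)" using V assms by (simp add: tensor_ident)
  then show ?thesis
    using trace_diagram_cyclic[OF d(1) assms(1,2) ident_in_hom[OF V] assms(3)] V assms d(2)
    by (simp add: comp_ident[of "U \<odot> V" V] ident_comp[of "U \<odot> V" V] tensor_in_obj)
qed

lemma trace_commute:
  assumes "V \<in> obj C" "V' \<in> obj C" "U \<in> obj C" "f \<in> hom C V V'" "g \<in> hom C (U \<odot> V') V"
  shows "trace U V (g \<cdot> (ident C U \<otimes> f)) = trace U V' (f \<cdot> g)"
proof -
  obtain D ev co where d: "dualizes D V ev co" "\<And>U u. trace U V u = sem [U] (trace_diagram D V ev co U u)"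
    using trace_obtain[OF assms(1)] by metis
  obtain D' ev' co' where d': "dualizes D' V' ev' co'" "\<And>U u. trace U V' u = sem [U] (trace_diagram D' V' ev' co' U u)"
    using trace_obtain[OF assms(2)] by metis
  show ?thesis using trace_diagram_cyclic[OF d(1) d'(1) assms(3-5)] d(2) d'(2) by simp
qed

lemma trace_add:
  assumes V: "V \<in> obj C" and U: "U \<in> obj C" and h: "w \<in> hom C (U \<odot> V) V" "\<gamma> \<in> hom C (U \<odot> V) V"
  shows "trace U V (w + \<gamma>) = trace U V w + trace U V \<gamma>"
proof -
  obtain D ev co where d: "dualizes D V ev co" "\<And>U w. trace U V w = sem [U] (trace_diagram D V ev co U w)"
    using trace_obtain[OF V] by metis
  note D = dualizes_box(2)[OF d(1)] and i = ident_in_hom and u = unit_in_obj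
  note VD = tensor_in_obj[OF V D] and DV = tensor_in_obj[OF D V] and UV = tensor_in_obj[OF U V]
  note UVD = tensor_in_obj[OF U VD]
  have ev: "ev \<in> hom C (D \<odot> V) (unit_obj C)" and co: "co \<in> hom C (unit_obj C) (V \<odot> D)"
    using d(1) by (auto simp: dualizes_def dual_pair_def)
  note 1 = comp_in_hom[OF VD DV u braiding_in_hom[OF V D] ev]
  note 2 = tensor_in_hom[OF UV V D D h(1) i[OF D], unfolded tensor_obj_assoc[OF U V D]] tensor_in_hom[OF UV V D D h(2) i[OF D], unfolded tensor_obj_assoc[OF U V D]]
  note 3 = tensor_in_hom[OF U U u VD i[OF U] co, unfolded tensor_obj_unit(2)[OF U]]
  show ?thesis
    unfolding d(2) trace_diagram_box(3)[OF d(1) U hom_add[OF UV V h]] trace_diagram_box(3)[OF d(1) U h(1)] trace_diagram_box(3)[OF d(1) U h(2)]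
      tensor_add_left[OF UV V D D h i[OF D]] comp_add_right[OF UVD VD u 2 1]
    by (rule comp_add_left[OF U UVD u 3 comp_in_hom[OF UVD VD u 2(1) 1] comp_in_hom[OF UVD VD u 2(2) 1]])
qed

end

context commutative_separable_algebra
begin

lemma trace_form_eq: "trace_form = trace a a \<mu>"
proof -
  obtain D ev co where d: "dual_a = (D, ev, co)" and du: "dualizes D a ev co" by (rule dual_a)
  show ?thesis unfolding trace_form_def d using trace_eq[OF du a_obj mu_hom] by simp
qed

lemma trace_form_hom: "trace_form \<in> hom C a (unit_obj C)"
  using trace_form_box by (simp add: box_def)

lemma trace_form_e: "(trace_form \<otimes> ident C a) \<cdot> e = \<eta>"
  using e_trace_left by (simp add: deq_def sem_eval)

end

section \<open>Double twist and trace of the induced module\<close>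

context twisted_module
begin

text \<open>The hexagons resolve one crossing of composite strands into four elementary crossings,
  to which the unlinking lemmas apply.\<close>

lemma braiding_free_dual:
  assumes "dualizes D V ev co"
  shows "box ([V, a, a, D], [a, D, V, a], braiding C (V \<odot> a) (a \<odot> D))"
    and "deq [V, a, a, D] [(0, [V, a, a, D], [a, D, V, a], braiding C (V \<odot> a) (a \<odot> D))] (BR D)"
proof -
  note [simp] = dualizes_box[OF assms]
  show b [simp]: "box ([V, a, a, D], [a, D, V, a], braiding C (V \<odot> a) (a \<odot> D))"
    using braiding_in_hom[of "V \<odot> a" "a \<odot> D"] by (simp add: box_def tens_simps tensor_in_obj tensor_obj_assoc)
  let ?x = "([a, a, D], [a, D, a], braiding C a (a \<odot> D))" and ?y = "([V, a, D], [a, D, V], braiding C V (a \<odot> D))"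
  have [simp]: "box ?x" "box ?y"
    using braiding_in_hom[of a "a \<odot> D"] braiding_in_hom[of V "a \<odot> D"] by (simp_all add: box_def tens_simps tensor_in_obj tensor_obj_assoc)
  have x: "deq [a, a, D] [(0, ?x)] [(0, B), (1, Br a D)]" and y: "deq [V, a, D] [(0, ?y)] [(0, Br V a), (1, Br V D)]"
    using wire_right[of a "[a, D]"] wire_right[of V "[a, D]"] by (simp_all add: deq_def tens_simps sem_typed typed_layer)
  have "deq [V, a, a, D] [(0, [V, a, a, D], [a, D, V, a], braiding C (V \<odot> a) (a \<odot> D))] [(1, ?x), (0, ?y)]"
    using hexagon_left[symmetric, of V a "a \<odot> D"] by (simp add: sem_morphism tensor_in_obj)
  also have "deq [V, a, a, D] ... [(1, B), (2, Br a D), (0, ?y)]"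
    by (rule at[OF x, of 1 0]; simp)
  also have "deq [V, a, a, D] ... [(1, B), (2, Br a D), (0, Br V a), (1, Br V D)]"
    by (rule at[OF y, of 0 2]; simp)
  also have "deq [V, a, a, D] ... (BR D)" by (rule isotopy) simp_all
  finally show "deq [V, a, a, D] [(0, [V, a, a, D], [a, D, V, a], braiding C (V \<odot> a) (a \<odot> D))] (BR D)" .
qed

lemma free_dual:
  assumes "dualizes D V ev co"
  obtains ev' co' where "dualizes (a \<odot> D) (V \<odot> a) ev' co'"
    "box ([a, D, V, a], [], ev')" "deq [a, D, V, a] [(0, [a, D, V, a], [], ev')] [(1, [D, V], [], ev), (0, K)]"
    "box ([], [V, a, a, D], co')" "deq [] [(0, [], [V, a, a, D], co')] [(0, [], [V, D], co), (1, S)]"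
proof -
  note [simp] = dualizes_box[OF assms]
  show ?thesis by (rule that[OF dualizes_tensor[OF assms dualizes_self] deq_box(2,1) deq_box(2,1)]; simp)
qed

lemma free_twist_hom: "free_twist \<in> hom C (V \<odot> a) (V \<odot> a)"
  using box_FT by (simp add: box_def tens_simps)

lemma free_twist_double: "free_twist \<cdot> (double_twist (V \<odot> a) \<cdot> free_twist) = ident C (V \<odot> a)"
proof -
  obtain D ev co where d: "dualizes D V ev co"
    using left_dual[OF V_obj] by (auto simp: dualizes_def)
  obtain ev' co' where d': "dualizes (a \<odot> D) (V \<odot> a) ev' co'"
    and e: "box ([a, D, V, a], [], ev')" "deq [a, D, V, a] [(0, [a, D, V, a], [], ev')] [(1, [D, V], [], ev), (0, K)]"
    and c: "box ([], [V, a, a, D], co')" "deq [] [(0, [], [V, a, a, D], co')] [(0, [], [V, D], co), (1, S)]"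
    by (rule free_dual[OF d])
  note b = braiding_free_dual[OF d]
  note [simp] = dualizes_box[OF d] e(1) c(1) b(1)
  let ?W = "V \<odot> a" and ?b = "([V, a, a, D], [a, D, V, a], braiding C (V \<odot> a) (a \<odot> D))"
  let ?t = "([V, a], [V, a], double_twist ?W)" and ?c = "([], [V, a, a, D], co')" and ?e = "([a, D, V, a], [], ev')"
  have W: "?W \<in> obj C" by (simp add: tensor_in_obj)
  have th: "double_twist ?W \<in> hom C ?W ?W" by (rule double_twist_in_hom[OF W])
  then have [simp]: "box ?t" by (simp add: box_def tens_simps)
  have "sem [V, a] [(2, ?c), (2, ?b), (0, ?b), (0, ?e)] = double_twist ?W"
    using dualizes_box[OF d'] by (simp add: sem_eval double_twist_eq[OF d'] double_twist_diagram_def)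
  then have t: "deq [V, a] [(0, ?t)] [(2, ?c), (2, ?b), (0, ?b), (0, ?e)]" by (simp add: deq_def sem_box)
  have "deq [V, a] [(0, FT), (0, ?t), (0, FT)] [(0, FT), (2, ?c), (2, ?b), (0, ?b), (0, ?e), (0, FT)]"
    by (rule at[OF t, of 0 1]; simp)
  also have "deq [V, a] ... ([(0, FT), (2, [], [V, D], co), (3, S), (2, ?b), (0, ?b), (0, ?e), (0, FT)])"
    by (rule at[OF c(2), of 2 1]; simp)
  also have "deq [V, a] ... ([(0, FT), (2, [], [V, D], co), (3, S)] @ shift 2 (BR D) @ [(0, ?b), (0, ?e), (0, FT)])"
    by (rule at[OF b(2), of 2 3]; simp)
  also have "deq [V, a] ... ([(0, FT), (2, [], [V, D], co), (3, S)] @ shift 2 (BR D) @ BR D @ [(0, ?e), (0, FT)])"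
    by (rule at[OF b(2), of 0 7]; simp)
  also have "deq [V, a] ... ([(0, FT), (2, [], [V, D], co), (3, S)] @ shift 2 (BR D) @ BR D @ [(1, [D, V], [], ev), (0, K), (0, FT)])"
    by (rule at[OF e(2), of 0 11]; simp)
  also note FT_double[OF d]
  finally have "(free_twist \<cdot> double_twist ?W) \<cdot> free_twist = ident C ?W" by (simp add: sem_morphism)
  then show ?thesis using comp_assoc[OF W W W W free_twist_hom th free_twist_hom] by simp
qed

text \<open>By \<open>FT_trace\<close> the value of the trace form on the unit splits off as a
  closed factor without wires; when this factor is zero, so is the whole diagram.\<close>

lemma free_trace:
  assumes "trace_form \<cdot> \<eta> = 0"
  shows "trace a (V \<odot> a) (free_twist \<cdot> (l \<otimes> ident C a)) = 0"
proof -
  obtain D ev co where d: "dualizes D V ev co"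
    using left_dual[OF V_obj] by (auto simp: dualizes_def)
  obtain ev' co' where d': "dualizes (a \<odot> D) (V \<odot> a) ev' co'"
    and e: "box ([a, D, V, a], [], ev')" "deq [a, D, V, a] [(0, [a, D, V, a], [], ev')] [(1, [D, V], [], ev), (0, K)]"
    and c: "box ([], [V, a, a, D], co')" "deq [] [(0, [], [V, a, a, D], co')] [(0, [], [V, D], co), (1, S)]"
    by (rule free_dual[OF d])
  note b = braiding_free_dual[OF d]
  note [simp] = dualizes_box[OF d] e(1) c(1) b(1)
  let ?W = "V \<odot> a" and ?b = "([V, a, a, D], [a, D, V, a], braiding C (V \<odot> a) (a \<odot> D))"
  let ?Ev = "([D, V], [], ev)" and ?Co = "([], [V, D], co)" and ?u = "free_twist \<cdot> (l \<otimes> ident C a)" and ?z = "([], [], 0)"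
  let ?f = "([a, V, a], [V, a], ?u)" and ?c = "([], [V, a, a, D], co')" and ?e = "([a, D, V, a], [], ev')"
  have f: "deq [a, V, a] [(0, ?f)] [(0, Ac), (0, FT)]" and [simp]: "box ?f"
    using deq_box[of "[a, V, a]" "[(0, Ac), (0, FT)]"] by (simp_all add: sem_eval)
  then have u: "?u \<in> hom C (a \<odot> ?W) ?W" by (simp add: box_def tens_simps)
  have [simp]: "box ?z" by (simp add: box_def hom_zero unit_in_obj)
  have z: "deq [] [(0, E), (0, L)] [(0, ?z)]"
    using assms by (simp add: deq_def sem_eval)
  have t: "trace a ?W ?u = sem [a] [(1, ?c), (0, ?f), (0, ?b), (0, ?e)]"
    unfolding trace_eq[OF d' a_obj u] trace_diagram_box(3)[OF d' a_obj u] by (simp add: sem_morphism)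
  have "deq [a] [(1, ?c), (0, ?f), (0, ?b), (0, ?e)] [(1, ?Co), (2, S), (0, ?f), (0, ?b), (0, ?e)]"
    by (rule at[OF c(2), of 1 0]; simp)
  also have "deq [a] ... [(1, ?Co), (2, S), (0, Ac), (0, FT), (0, ?b), (0, ?e)]"
    by (rule at[OF f, of 0 2]; simp)
  also have "deq [a] ... ([(1, ?Co), (2, S), (0, Ac), (0, FT)] @ BR D @ [(0, ?e)])"
    by (rule at[OF b(2), of 0 4]; simp)
  also have "deq [a] ... ([(1, ?Co), (2, S), (0, Ac), (0, FT)] @ BR D @ [(1, ?Ev), (0, K)])"
    by (rule at[OF e(2), of 0 8]; simp)
  also note FT_trace[OF d]
  also have "deq [a] [(1, ?Co), (0, Ac), (0, Tw), (1, E), (1, L), (0, Br V D), (0, ?Ev)]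
      ([(1, ?Co), (0, Ac), (0, Tw)] @ (1, ?z) # [(0, Br V D), (0, ?Ev)])"
    by (rule at[OF z, of 1 3]; simp)
  finally have "deq [a] [(1, ?c), (0, ?f), (0, ?b), (0, ?e)] ([(1, ?Co), (0, Ac), (0, Tw)] @ (1, ?z) # [(0, Br V D), (0, ?Ev)])" .
  then show ?thesis unfolding t deq_def by (elim conjE) (erule trans, erule sem_zero_layer)
qed

end

section \<open>Induced and symmetric bimodules of a twisted module\<close>

context twisted_module
begin

lemma layers:
  "(ident C V \<otimes> \<mu>) \<otimes> ident C a = ident C V \<otimes> (\<mu> \<otimes> ident C a)"
  "(l \<otimes> ident C a) \<otimes> ident C a = l \<otimes> ident C (a \<odot> a)"
  "ident C a \<otimes> (ident C V \<otimes> \<mu>) = ident C (a \<odot> V) \<otimes> \<mu>"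
proof -
  have "(l \<otimes> ident C a) \<otimes> ident C a = l \<otimes> (ident C a \<otimes> ident C a)"
    by (rule tensor_assoc[OF _ _ _ _ _ _ l_hom ident_in_hom ident_in_hom]) (auto simp: tensor_in_obj)
  then show "(l \<otimes> ident C a) \<otimes> ident C a = l \<otimes> ident C (a \<odot> a)" by (simp add: tensor_ident)
  have "(ident C a \<otimes> ident C V) \<otimes> \<mu> = ident C a \<otimes> (ident C V \<otimes> \<mu>)"
    by (rule tensor_assoc[OF _ _ _ _ _ _ ident_in_hom ident_in_hom mu_hom]) (auto simp: tensor_in_obj)
  then show "ident C a \<otimes> (ident C V \<otimes> \<mu>) = ident C (a \<odot> V) \<otimes> \<mu>" by (simp add: tensor_ident)
  show "(ident C V \<otimes> \<mu>) \<otimes> ident C a = ident C V \<otimes> (\<mu> \<otimes> ident C a)"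
    by (rule tensor_assoc[OF _ _ _ _ _ _ ident_in_hom mu_hom ident_in_hom]) (auto simp: tensor_in_obj)
qed

lemma free_homs: "l \<otimes> ident C a \<in> hom C (a \<odot> V \<odot> a) (V \<odot> a)"
    "ident C V \<otimes> \<mu> \<in> hom C ((V \<odot> a) \<odot> a) (V \<odot> a)"
  using tensor_in_hom[OF _ _ _ _ l_hom ident_in_hom, of a] tensor_in_hom[OF _ _ _ _ ident_in_hom mu_hom, of V]
  by (simp_all add: tensor_in_obj tensor_obj_assoc)

lemma free_bimodule:
  "is_bimodule C \<lparr>carrier_obj = a, mult = \<mu>, unit_mor = \<eta>\<rparr>
     \<lparr>bimod_obj = V \<odot> a, left_act = l \<otimes> ident C a, right_act = ident C V \<otimes> \<mu>\<rparr>"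
proof -
  have 1: "deq [a, a, V, a] [(0, M), (0, Ac)] [(1, Ac), (0, Ac)]"
    by (rule at[OF Ac_assoc, of 0 0]; simp)
  have 2: "deq [V, a] [(0, E), (0, Ac)] []"
    by (rule at[OF Ac_unit, of 0 0]; simp)
  have 3: "deq [V, a, a, a] [(2, M), (1, M)] [(1, M), (1, M)]"
    by (rule at_sym[OF assoc, of 1 0]; simp)
  have 4: "deq [V, a] [(2, E), (1, M)] []"
    by (rule at[OF unit_right, of 1 0]; simp)
  have 5: "deq [a, V, a, a] [(0, Ac), (1, M)] [(2, M), (0, Ac)]"
    by (rule isotopy; simp)
  note s = sem_morphism
  show ?thesis
    using 1 2 3 4 5 free_homs
    by (simp add: is_bimodule_def Let_def tensor_in_obj layers s)
qed

lemma free_twist_eq: "free_twist = (braiding C a V \<cdot> braiding C V a) \<cdot> (f \<otimes> ident C a)"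
proof -
  have h: "f \<otimes> ident C a \<in> hom C (V \<odot> a) (V \<odot> a)"
    using tensor_in_hom[OF _ _ _ _ f_hom ident_in_hom, of a] by simp
  show ?thesis unfolding free_twist_def by (simp add: sem_eval)
qed

lemma wires_a: "ok [a, V, a] [(0, Br a V), (1, B)]" "run [a, V, a] [(0, Br a V), (1, B)] = [V, a, a]"
  "sem [a, V, a] [(0, Br a V), (1, B)] = braiding C a (V \<odot> a)"
  "ok [V, a, a] [(1, B), (0, Br V a)]" "run [V, a, a] [(1, B), (0, Br V a)] = [a, V, a]"
  "sem [V, a, a] [(1, B), (0, Br V a)] = braiding C (V \<odot> a) a"
proof -
  have r: "wire_right 0 a [V, a] = [(0, Br a V), (1, B)]" and l: "wire_left 0 [V, a] a = [(1, B), (0, Br V a)]"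
    by simp_all
  show "ok [a, V, a] [(0, Br a V), (1, B)]" "run [a, V, a] [(0, Br a V), (1, B)] = [V, a, a]"
    "sem [a, V, a] [(0, Br a V), (1, B)] = braiding C a (V \<odot> a)"
    using wire_right[of a "[V, a]", unfolded r] by (simp_all add: tens_simps)
  show "ok [V, a, a] [(1, B), (0, Br V a)]" "run [V, a, a] [(1, B), (0, Br V a)] = [a, V, a]"
    "sem [V, a, a] [(1, B), (0, Br V a)] = braiding C (V \<odot> a) a"
    using wire_left[of a "[V, a]", unfolded l] by (simp_all add: tens_simps)
qed

lemma free_twist_left: "free_twist \<cdot> (l \<otimes> ident C a) =
   (l \<otimes> ident C a) \<cdot> ((braiding C (V \<odot> a) a \<cdot> braiding C a (V \<odot> a)) \<cdot> (ident C a \<otimes> free_twist))"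
proof -
  let ?F = "[(1, FT)]" and ?x = "[(0, Br a V), (1, B)]" and ?y = "[(1, B), (0, Br V a)]" and ?A = "[(0, Ac)]"
  have s: "ok [a, V, a] ?F" "run [a, V, a] ?F = [a, V, a]" "sem [a, V, a] ?F = ident C a \<otimes> free_twist"
     "ok [a, V, a] ?A" "sem [a, V, a] ?A = l \<otimes> ident C a"
    by (simp_all add: sem_eval)
  have xy: "ok [a, V, a] (?x @ ?y)" "run [a, V, a] (?x @ ?y) = [a, V, a]"
    "sem [a, V, a] (?x @ ?y) = braiding C (V \<odot> a) a \<cdot> braiding C a (V \<odot> a)"
    using wires_a by (simp_all only: ok_append run_append sem_append simp_thms)
  have Fxy: "ok [a, V, a] (?F @ (?x @ ?y))" "run [a, V, a] (?F @ (?x @ ?y)) = [a, V, a]"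
    "sem [a, V, a] (?F @ (?x @ ?y)) = (braiding C (V \<odot> a) a \<cdot> braiding C a (V \<odot> a)) \<cdot> (ident C a \<otimes> free_twist)"
    using s xy ok_append[of "[a, V, a]" ?F "?x @ ?y"] run_append[of "[a, V, a]" ?F "?x @ ?y"]
      sem_append[of "[a, V, a]" ?F "?x @ ?y"] by metis+
  have "sem [a, V, a] ((?F @ (?x @ ?y)) @ ?A) = (l \<otimes> ident C a) \<cdot> ((braiding C (V \<odot> a) a \<cdot> braiding C a (V \<odot> a)) \<cdot> (ident C a \<otimes> free_twist))"
    using s Fxy sem_append[of "[a, V, a]" "?F @ (?x @ ?y)" ?A] by metis
  moreover have "sem [a, V, a] [(0, Ac), (0, FT)] = free_twist \<cdot> (l \<otimes> ident C a)"
    by (simp add: sem_eval)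
  moreover have "(?F @ (?x @ ?y)) @ ?A = [(1, FT), (0, Br a V), (1, B), (1, B), (0, Br V a), (0, Ac)]" by simp
  ultimately show ?thesis using FT_left unfolding deq_def by metis
qed

lemma free_twist_right: "free_twist \<cdot> (ident C V \<otimes> \<mu>) =
   (ident C V \<otimes> \<mu>) \<cdot> ((braiding C a (V \<odot> a) \<cdot> braiding C (V \<odot> a) a) \<cdot> (free_twist \<otimes> ident C a))"
proof -
  let ?F = "[(0, FT)]" and ?x = "[(0, Br a V), (1, B)]" and ?y = "[(1, B), (0, Br V a)]" and ?A = "[(1, M)]"
  have s: "ok [V, a, a] ?F" "run [V, a, a] ?F = [V, a, a]" "sem [V, a, a] ?F = free_twist \<otimes> ident C a"
     "ok [V, a, a] ?A" "sem [V, a, a] ?A = ident C V \<otimes> \<mu>"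
    by (simp_all add: sem_eval)
  have xy: "ok [V, a, a] (?y @ ?x)" "run [V, a, a] (?y @ ?x) = [V, a, a]"
    "sem [V, a, a] (?y @ ?x) = braiding C a (V \<odot> a) \<cdot> braiding C (V \<odot> a) a"
    using wires_a by (simp_all only: ok_append run_append sem_append simp_thms)
  have Fxy: "ok [V, a, a] (?F @ (?y @ ?x))" "run [V, a, a] (?F @ (?y @ ?x)) = [V, a, a]"
    "sem [V, a, a] (?F @ (?y @ ?x)) = (braiding C a (V \<odot> a) \<cdot> braiding C (V \<odot> a) a) \<cdot> (free_twist \<otimes> ident C a)"
    using s xy ok_append[of "[V, a, a]" ?F "?y @ ?x"] run_append[of "[V, a, a]" ?F "?y @ ?x"]
      sem_append[of "[V, a, a]" ?F "?y @ ?x"] by metis+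
  have "sem [V, a, a] ((?F @ (?y @ ?x)) @ ?A) = (ident C V \<otimes> \<mu>) \<cdot> ((braiding C a (V \<odot> a) \<cdot> braiding C (V \<odot> a) a) \<cdot> (free_twist \<otimes> ident C a))"
    using s Fxy sem_append[of "[V, a, a]" "?F @ (?y @ ?x)" ?A] by metis
  moreover have "sem [V, a, a] [(1, M), (0, FT)] = free_twist \<cdot> (ident C V \<otimes> \<mu>)"
    by (simp add: sem_eval)
  moreover have "(?F @ (?y @ ?x)) @ ?A = [(0, FT), (1, B), (0, Br V a), (0, Br a V), (1, B), (1, M)]" by simp
  ultimately show ?thesis using FT_right unfolding deq_def by metis
qed

abbreviation r_sym :: 'm where "r_sym \<equiv> l \<cdot> braiding C V a"

lemma r_sym_hom: "r_sym \<in> hom C (V \<odot> a) V"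
  by (rule comp_in_hom[OF _ _ _ braiding_in_hom l_hom]) (auto simp: tensor_in_obj)

lemma symmetric_bimodule:
  "is_bimodule C \<lparr>carrier_obj = a, mult = \<mu>, unit_mor = \<eta>\<rparr>
     \<lparr>bimod_obj = V, left_act = l, right_act = r_sym\<rparr>"
proof -
  let ?r = "([V, a], [V], r_sym)"
  have [simp]: "box ?r" by (simp add: box_def tens_simps r_sym_hom)
  have r: "deq [V, a] [(0, ?r)] Rc" by (simp add: deq_def sem_eval)
  have "deq [V, a, a] [(1, M), (0, ?r)] ([(1, M)] @ Rc)"
    by (rule at[OF r, of 0 1]; simp)
  also note Rc_assoc
  also have "deq [V, a, a] (Rc @ Rc) (Rc @ [(0, ?r)])"
    by (rule step_sym[OF r, of "Rc" 0 "[]"]; simp)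
  also have "deq [V, a, a] ... [(0, ?r), (0, ?r)]"
    by (rule step_sym[OF r, of "[]" 0 "[(0, ?r)]"]; simp)
  finally have 1: "deq [V, a, a] [(1, M), (0, ?r)] [(0, ?r), (0, ?r)]" .
  have "deq [V] [(1, E), (0, ?r)] ([(1, E)] @ Rc)"
    by (rule at[OF r, of 0 1]; simp)
  also note Rc_unit
  finally have 2: "deq [V] [(1, E), (0, ?r)] []" .
  have "deq [a, V, a] [(0, Ac), (0, ?r)] ([(0, Ac)] @ Rc)"
    by (rule at[OF r, of 0 1]; simp)
  also note Rc_Ac
  also have "deq [a, V, a] ([(1, Br V a), (1, Ac)] @ [(0, Ac)]) [(1, ?r), (0, Ac)]"
    by (rule step_sym[OF r, of "[]" 1 "[(0, Ac)]"]; simp)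
  finally have 3: "deq [a, V, a] [(0, Ac), (0, ?r)] [(1, ?r), (0, Ac)]" .
  show ?thesis using 1 2 3 action_assoc action_unit l_hom r_sym_hom
    by (simp add: is_bimodule_def Let_def tensor_in_obj deq_def sem_eval)
qed

lemma symmetric_twist_right:
  "f \<cdot> r_sym = r_sym \<cdot> ((braiding C a V \<cdot> braiding C V a) \<cdot> (f \<otimes> ident C a))"
proof -
  let ?r = "([V, a], [V], r_sym)"
  have [simp]: "box ?r" by (simp add: box_def tens_simps r_sym_hom)
  have r: "deq [V, a] [(0, ?r)] Rc" by (simp add: deq_def sem_eval)
  have "deq [V, a] [(0, ?r), (0, Tw)] (Rc @ [(0, Tw)])"
    by (rule at[OF r, of 0 0]; simp)
  also note Rc_Tw
  also have "deq [V, a] ([(0, Tw), (0, Br V a), (0, Br a V)] @ Rc) ([(0, Tw), (0, Br V a), (0, Br a V)] @ [(0, ?r)])"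
    by (rule step_sym[OF r, of "[(0, Tw), (0, Br V a), (0, Br a V)]" 0 "[]"]; simp)
  finally have 1: "sem [V, a] [(0, ?r), (0, Tw)] = sem [V, a] [(0, Tw), (0, Br V a), (0, Br a V), (0, ?r)]"
    by (simp add: deq_def)
  have h: "f \<otimes> ident C a \<in> hom C (V \<odot> a) (V \<odot> a)"
    using tensor_in_hom[OF _ _ _ _ f_hom ident_in_hom, of a] by simp
  have "sem [V, a] [(0, Tw), (0, Br V a), (0, Br a V), (0, ?r)] = ((r_sym \<cdot> braiding C a V) \<cdot> braiding C V a) \<cdot> (f \<otimes> ident C a)"
    by (simp add: sem_eval)
  also have "(r_sym \<cdot> braiding C a V) \<cdot> braiding C V a = r_sym \<cdot> (braiding C a V \<cdot> braiding C V a)"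
    by (rule comp_assoc[OF _ _ _ _ braiding_in_hom braiding_in_hom r_sym_hom]) (auto simp: tensor_in_obj)
  also have "... \<cdot> (f \<otimes> ident C a) = r_sym \<cdot> ((braiding C a V \<cdot> braiding C V a) \<cdot> (f \<otimes> ident C a))"
    by (rule comp_assoc[OF _ _ _ _ h comp_in_hom[OF _ _ _ braiding_in_hom braiding_in_hom] r_sym_hom]) (auto simp: tensor_in_obj)
  finally show ?thesis using 1 by (simp add: sem_eval)
qed

end

declare eval_nat_numeral [simp del]

section \<open>Dimensions of subspaces\<close>

text \<open>An inclusion instead of an equality, so that the property passes to subsets; for
  subspaces a finite basis is recovered in \<open>finite_basis\<close>.\<close>

definition fin_dim :: "('a::field \<Rightarrow> 'b::ab_group_add \<Rightarrow> 'b) \<Rightarrow> 'b set \<Rightarrow> bool" where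
  "fin_dim s W \<longleftrightarrow> (\<exists>B. finite B \<and> W \<subseteq> module.span s B)"

text \<open>A copy of \<open>vector_space\<close>: new facts in the library locale would clash with those of its
  global interpretation for real vector spaces.\<close>

locale ambient_space = vector_space scale
  for scale :: "'a::field \<Rightarrow> 'b::ab_group_add \<Rightarrow> 'b"
begin

lemma fin_dim_subset: "fin_dim scale W \<Longrightarrow> W' \<subseteq> W \<Longrightarrow> fin_dim scale W'"
  unfolding fin_dim_def by blast

lemma finite_basis:
  assumes "subspace W" "fin_dim scale W"
  obtains B where "finite B" "independent B" "B \<subseteq> W" "W = span B" "card B = dim W"
proof -
  obtain B where B: "B \<subseteq> W" "independent B" "W \<subseteq> span B" "card B = dim W"
    by (rule basis_exists[of W])
  obtain T where "finite T" "W \<subseteq> span T" using assms(2) by (auto simp: fin_dim_def)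
  then have "finite B" using independent_span_bound[of T B] B by blast
  moreover have "W = span B" using B assms(1) span_minimal by blast
  ultimately show ?thesis using B that by blast
qed

lemma dim_less:
  assumes "subspace W" "subspace U" "fin_dim scale U" "W \<subseteq> U" "u \<in> U" "u \<notin> W"
  shows "dim W < dim U"
proof -
  obtain A where A: "finite A" "independent A" "W = span A" "card A = dim W" "A \<subseteq> W"
    using finite_basis[OF assms(1) fin_dim_subset[OF assms(3,4)]] by metis
  obtain B where B: "finite B" "U = span B" "card B = dim U"
    using finite_basis[OF assms(2,3)] by metis
  have "independent (insert u A)" using A(2,3) assms(6) by (intro independent_insertI) simp_all
  moreover have "insert u A \<subseteq> span B" using A(5) B(2) assms(4,5) by blast
  ultimately have "card (insert u A) \<le> card B" using independent_span_bound[OF B(1)] by blast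
  moreover have "u \<notin> A" using A(5) assms(6) by blast
  ultimately show ?thesis using A(1,4) B(3) by simp
qed

lemma dim_add_disjoint:
  assumes "subspace W" "subspace U" "fin_dim scale W" "fin_dim scale U" "W \<inter> U = {0}"
  shows "dim {x + y |x y. x \<in> W \<and> y \<in> U} = dim W + dim U"
    and "fin_dim scale {x + y |x y. x \<in> W \<and> y \<in> U}"
proof -
  obtain A where A: "finite A" "independent A" "W = span A" "card A = dim W" "A \<subseteq> W"
    using finite_basis[OF assms(1,3)] by metis
  obtain B where B: "finite B" "independent B" "U = span B" "card B = dim U" "B \<subseteq> U"
    using finite_basis[OF assms(2,4)] by metis
  have "independent (A \<union> T)" if "finite T" "T \<subseteq> B" for T
    using that
  proof (induction T)
    case empty
    then show ?case using A by simp
  next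
    case (insert b T)
    have "b \<notin> span (A \<union> T)"
    proof
      assume "b \<in> span (A \<union> T)"
      then obtain x y where xy: "b = x + y" "x \<in> span A" "y \<in> span T" unfolding span_Un by auto
      have "b \<in> U" "y \<in> U" using insert B xy span_mono[of T B] by auto
      then have "x \<in> U" using xy assms(2) subspace_diff[of U b y] by simp
      then have "x = 0" using xy A assms(5) by auto
      then have "b \<in> span T" using xy by simp
      moreover have "independent (insert b T)" using insert B independent_mono by blast
      ultimately show False using insert by (metis independent_insert)
    qed
    then show ?case using insert independent_insertI[of b "A \<union> T"] by simp
  qed
  then have AB: "independent (A \<union> B)" using B by blast
  have "0 \<notin> A" using A(2) dependent_zero by auto
  moreover have "A \<inter> B \<subseteq> {0}" using Int_mono[OF A(5) B(5)] unfolding assms(5) .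
  ultimately have "A \<inter> B = {}" by auto
  then have c: "card (A \<union> B) = dim W + dim U" using A B card_Un_disjoint by metis
  have s: "{x + y |x y. x \<in> W \<and> y \<in> U} = span (A \<union> B)"
    unfolding span_Un A(3) B(3) by simp
  show "dim {x + y |x y. x \<in> W \<and> y \<in> U} = dim W + dim U"
    unfolding s using c AB by (simp add: dim_eq_card_independent)
  show "fin_dim scale {x + y |x y. x \<in> W \<and> y \<in> U}"
    unfolding s fin_dim_def using A(1) B(1) by blast
qed

lemma subspace_family_sum:
  assumes "\<And>i. i < (n::nat) \<Longrightarrow> subspace (W i)"
  shows "subspace {\<Sum>i<n. x i |x. \<forall>i<n. x i \<in> W i}"
proof (rule subspaceI)
  show "0 \<in> {\<Sum>i<n. x i |x. \<forall>i<n. x i \<in> W i}"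
    using assms subspace_0 by (auto intro!: exI[of _ "\<lambda>_. 0"])
next
  fix u v assume "u \<in> {\<Sum>i<n. x i |x. \<forall>i<n. x i \<in> W i}" "v \<in> {\<Sum>i<n. x i |x. \<forall>i<n. x i \<in> W i}"
  then obtain x y where "u = (\<Sum>i<n. x i)" "v = (\<Sum>i<n. y i)" "\<forall>i<n. x i \<in> W i" "\<forall>i<n. y i \<in> W i" by auto
  then show "u + v \<in> {\<Sum>i<n. x i |x. \<forall>i<n. x i \<in> W i}"
    using assms subspace_add by (auto intro!: exI[of _ "\<lambda>i. x i + y i"] simp: sum.distrib)
next
  fix c u assume "u \<in> {\<Sum>i<n. x i |x. \<forall>i<n. x i \<in> W i}"
  then obtain x where "u = (\<Sum>i<n. x i)" "\<forall>i<n. x i \<in> W i" by auto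
  then show "scale c u \<in> {\<Sum>i<n. x i |x. \<forall>i<n. x i \<in> W i}"
    using assms subspace_scale by (auto intro!: exI[of _ "\<lambda>i. scale c (x i)"] simp: scale_sum_right)
qed

lemma dim_family_sum:
  assumes "\<And>i. i < (n::nat) \<Longrightarrow> subspace (W i)" "\<And>i. i < n \<Longrightarrow> fin_dim scale (W i)"
    and "\<And>x. (\<forall>i<n. x i \<in> W i) \<Longrightarrow> (\<Sum>i<n. x i) = 0 \<Longrightarrow> \<forall>i<n. x i = 0"
  shows "dim {\<Sum>i<n. x i |x. \<forall>i<n. x i \<in> W i} = (\<Sum>i<n. dim (W i)) \<and>
    fin_dim scale {\<Sum>i<n. x i |x. \<forall>i<n. x i \<in> W i}"
  using assms
proof (induction n)
  case 0
  have "dim {0} = 0" using dim_eq_card[of "{}" "{0}"] independent_empty by (simp add: span_insert_0[of "{}"])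
  moreover have "fin_dim scale {0}" unfolding fin_dim_def by (intro exI[of _ "{}"]) simp
  ultimately show ?case by simp
next
  case (Suc n)
  let ?S = "{\<Sum>i<n. x i |x. \<forall>i<n. x i \<in> W i}"
  have zero: "\<forall>i<n. x i = 0" if "\<forall>i<n. x i \<in> W i" "(\<Sum>i<n. x i) = 0" for x
    using Suc(4)[of "\<lambda>i. if i < n then x i else 0"] that subspace_0[OF Suc(2)] by (auto simp: less_Suc_eq)
  have ih: "dim ?S = (\<Sum>i<n. dim (W i))" "fin_dim scale ?S" using Suc zero by auto
  have sub: "subspace ?S" "subspace (W n)" using Suc(2) by (auto intro!: subspace_family_sum)
  have "?S \<inter> W n \<subseteq> {0}"
  proof
    fix u assume "u \<in> ?S \<inter> W n"
    then obtain x where x: "u = (\<Sum>i<n. x i)" "\<forall>i<n. x i \<in> W i" "u \<in> W n" by auto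
    \<comment> \<open>An element common to the partial sum and the last subspace is a relation whose
      last member is \<open>- u\<close>.\<close>
    let ?y = "\<lambda>i. if i < n then x i else - u"
    have "\<forall>i<Suc n. ?y i \<in> W i" using x subspace_neg[OF sub(2)] by (auto simp: less_Suc_eq)
    moreover have "(\<Sum>i<Suc n. ?y i) = 0" using x by simp
    ultimately have "\<forall>i<Suc n. ?y i = 0" by (rule Suc(4))
    then have "?y n = 0" by blast
    then show "u \<in> {0}" by simp
  qed
  then have disj: "?S \<inter> W n = {0}" using subspace_0[OF sub(1)] subspace_0[OF sub(2)] by auto
  have eq: "{\<Sum>i<Suc n. x i |x. \<forall>i<Suc n. x i \<in> W i} = {x + y |x y. x \<in> ?S \<and> y \<in> W n}"
  proof (rule set_eqI, rule iffI)
    fix u assume "u \<in> {\<Sum>i<Suc n. x i |x. \<forall>i<Suc n. x i \<in> W i}"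
    then obtain x where x: "u = (\<Sum>i<Suc n. x i)" "\<forall>i<Suc n. x i \<in> W i" by blast
    then have "u = (\<Sum>i<n. x i) + x n" "x n \<in> W n" "\<forall>i<n. x i \<in> W i" by simp_all
    then show "u \<in> {x + y |x y. x \<in> ?S \<and> y \<in> W n}" by blast
  next
    fix u assume "u \<in> {x + y |x y. x \<in> ?S \<and> y \<in> W n}"
    then obtain x y where "u = (\<Sum>i<n. x i) + y" "\<forall>i<n. x i \<in> W i" "y \<in> W n" by auto
    then show "u \<in> {\<Sum>i<Suc n. x i |x. \<forall>i<Suc n. x i \<in> W i}"
      by (auto intro!: exI[of _ "\<lambda>i. if i < n then x i else y"] simp: less_Suc_eq)
  qed
  show ?case unfolding eq using dim_add_disjoint[OF sub ih(2) Suc(3)[of n] disj] ih by simp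
qed

end

locale ambient_space_pair = vector_space_pair s1 s2
  for s1 :: "'a::field \<Rightarrow> 'b::ab_group_add \<Rightarrow> 'b" and s2 :: "'a::field \<Rightarrow> 'c::ab_group_add \<Rightarrow> 'c"
begin


text \<open>Composition with a fixed morphism is linear on hom spaces only. Extending it from a
  basis yields a map that is linear on the whole ambient space and agrees with it where it
  matters.\<close>

lemma extend_from_subspace:
  assumes "vs1.subspace W"
    and add: "\<And>x y. x \<in> W \<Longrightarrow> y \<in> W \<Longrightarrow> T (x + y) = T x + T y"
    and scale: "\<And>c x. x \<in> W \<Longrightarrow> T (s1 c x) = s2 c (T x)"
  obtains g B where "Vector_Spaces.linear s1 s2 g" "\<And>x. x \<in> W \<Longrightarrow> g x = T x" "vs1.independent B" "B \<subseteq> W" "W = vs1.span B" "card B = vs1.dim W"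
proof -
  obtain B where B: "B \<subseteq> W" "vs1.independent B" "W \<subseteq> vs1.span B" "card B = vs1.dim W"
    by (rule vs1.basis_exists[of W])
  then have WB: "W = vs1.span B" using assms(1) vs1.span_minimal by blast
  obtain g where g: "Vector_Spaces.linear s1 s2 g" "\<And>x. x \<in> B \<Longrightarrow> g x = T x"
    using linear_independent_extend[OF B(2)] by blast
  have T0: "T 0 = 0" using scale[of 0 0] vs1.subspace_0[OF assms(1)] by simp
  have "vs1.subspace {x \<in> W. g x = T x}"
    using assms g(1) T0
    by (auto intro!: vs1.subspaceI simp: vs1.subspace_0 vs1.subspace_add vs1.subspace_scale linear_0 linear_add linear_scale)
  then have "vs1.span B \<subseteq> {x \<in> W. g x = T x}"
    using B g by (intro vs1.span_minimal) auto
  then show ?thesis using that g(1) B WB by blast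
qed

lemma dim_bij:
  assumes "vs1.subspace W" "bij_betw T W U"
    and "\<And>x y. x \<in> W \<Longrightarrow> y \<in> W \<Longrightarrow> T (x + y) = T x + T y"
    and "\<And>c x. x \<in> W \<Longrightarrow> T (s1 c x) = s2 c (T x)"
  shows "vs2.dim U = vs1.dim W"
proof -
  obtain g B where g: "Vector_Spaces.linear s1 s2 g" "\<And>x. x \<in> W \<Longrightarrow> g x = T x" "vs1.independent B" "B \<subseteq> W" "W = vs1.span B" "card B = vs1.dim W"
    using extend_from_subspace[OF assms(1,3,4)] by blast
  have inj: "inj_on g W" using assms(2) g(2) by (metis (no_types, lifting) bij_betw_def inj_on_cong)
  have "U = g ` W" using assms(2) g(2) by (auto simp: bij_betw_def)
  then have "U = vs2.span (g ` B)" using g(5) linear_span_image[OF g(1), of B] by simp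
  moreover have "vs2.independent (g ` B)" using linear_independent_injective_image[OF g(1,3)] inj g(5) by simp
  ultimately have "vs2.dim U = card (g ` B)" by (simp add: vs2.dim_eq_card_independent)
  also have "... = card B" using inj g(4) by (intro card_image) (auto intro: inj_on_subset)
  finally show ?thesis using g by simp
qed

lemma fin_dim_inj:
  assumes "vs1.subspace W" "inj_on T W" "fin_dim s2 (T ` W)"
    and "\<And>x y. x \<in> W \<Longrightarrow> y \<in> W \<Longrightarrow> T (x + y) = T x + T y"
    and "\<And>c x. x \<in> W \<Longrightarrow> T (s1 c x) = s2 c (T x)"
  shows "fin_dim s1 W"
proof -
  obtain g B where g: "Vector_Spaces.linear s1 s2 g" "\<And>x. x \<in> W \<Longrightarrow> g x = T x" "vs1.independent B" "B \<subseteq> W" "W = vs1.span B" "card B = vs1.dim W"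
    using extend_from_subspace[OF assms(1,4,5)] by blast
  have inj: "inj_on g W" using assms(2) g(2) by (metis (no_types, lifting) inj_on_cong)
  obtain S where S: "finite S" "T ` W \<subseteq> vs2.span S" using assms(3) by (auto simp: fin_dim_def)
  have "vs2.independent (g ` B)" using linear_independent_injective_image[OF g(1,3)] inj g(5) by simp
  moreover have "g ` B \<subseteq> vs2.span S" using S g by (metis image_cong image_mono subset_trans)
  ultimately have "finite (g ` B)" using vs2.independent_span_bound[OF S(1)] by blast
  then have "finite B" using inj g(4) by (meson finite_imageD inj_on_subset)
  then show ?thesis using g(5) by (auto simp: fin_dim_def)
qed

end

section \<open>Semisimple linear categories\<close>

text \<open>Semisimplicity without kernels and cokernels: every morphism has a generalized inverse
  and idempotents split. For twisted bimodules these properties are accessible by averaging.\<close>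

locale regular_linear_category = linear_category C
  for C :: "('o, 'm::ab_group_add, 'k::field, 'x) lincat_scheme" (structure) +
  assumes hom_fin_dim: "\<lbrakk>X \<in> obj C; Y \<in> obj C\<rbrakk> \<Longrightarrow> fin_dim (scale C) (hom C X Y)"
    and regular: "\<lbrakk>X \<in> obj C; Y \<in> obj C; f \<in> hom C X Y\<rbrakk> \<Longrightarrow> \<exists>g\<in>hom C Y X. (f \<cdot> g) \<cdot> f = f"
    and idem_split: "\<lbrakk>X \<in> obj C; u \<in> hom C X X; u \<cdot> u = u\<rbrakk> \<Longrightarrow>
      \<exists>Y\<in>obj C. \<exists>i\<in>hom C Y X. \<exists>p\<in>hom C X Y. p \<cdot> i = ident C Y \<and> i \<cdot> p = u"

section \<open>Zero objects, sums of morphisms and isomorphic objects\<close>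

context linear_category
begin

lemma zero_object_iff: "X \<in> obj C \<Longrightarrow> zero_object C X \<longleftrightarrow> ident C X = 0"
proof
  assume X: "X \<in> obj C"
  show "ident C X = 0" if "zero_object C X"
    using that X ident_in_hom[OF X] hom_zero[OF X X] by (auto simp: zero_object_def)
  assume 0: "ident C X = 0"
  have "f = 0" if "f \<in> hom C X Y" "Y \<in> obj C" for f Y
    using comp_ident[OF X that(2,1)] comp_zero(2)[OF X X that(2) that(1)] 0 by simp
  moreover have "f = 0" if "f \<in> hom C Y X" "Y \<in> obj C" for f Y
    using ident_comp[OF that(2) X that(1)] comp_zero(1)[OF that(2) X X that(1)] 0 by simp
  ultimately show "zero_object C X"
    using X hom_zero unfolding zero_object_def by (metis (no_types))
qed

lemma comp_sum_left:
  assumes "X \<in> obj C" "Y \<in> obj C" "Z \<in> obj C" "f \<in> hom C X Y" "\<And>i. i \<in> I \<Longrightarrow> g i \<in> hom C Y Z"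
  shows "(\<Sum>i\<in>I. g i) \<cdot> f = (\<Sum>i\<in>I. g i \<cdot> f) \<and> (\<Sum>i\<in>I. g i) \<in> hom C Y Z"
  using assms(5)
proof (induction I rule: infinite_finite_induct)
  case (insert i I)
  then have "(\<Sum>i\<in>I. g i) \<in> hom C Y Z" "g i \<in> hom C Y Z" by auto
  with insert show ?case using comp_add_left[OF assms(1-4), of "g i" "\<Sum>i\<in>I. g i"] assms hom_add by simp
qed (use assms comp_zero hom_zero in auto)

lemma comp_sum_right:
  assumes "X \<in> obj C" "Y \<in> obj C" "Z \<in> obj C" "g \<in> hom C Y Z" "\<And>i. i \<in> I \<Longrightarrow> f i \<in> hom C X Y"
  shows "g \<cdot> (\<Sum>i\<in>I. f i) = (\<Sum>i\<in>I. g \<cdot> f i) \<and> (\<Sum>i\<in>I. f i) \<in> hom C X Y"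
  using assms(5)
proof (induction I rule: infinite_finite_induct)
  case (insert i I)
  then have "(\<Sum>i\<in>I. f i) \<in> hom C X Y" "f i \<in> hom C X Y" by auto
  with insert show ?case using comp_add_right[OF assms(1-3), of "f i" "\<Sum>i\<in>I. f i" g] assms hom_add by simp
qed (use assms comp_zero hom_zero in auto)

definition isomorphic :: "'o \<Rightarrow> 'o \<Rightarrow> bool" where
  "isomorphic X Y \<longleftrightarrow> (\<exists>f. isomorphism C X Y f)"

lemma isomorphic_refl: "X \<in> obj C \<Longrightarrow> isomorphic X X"
  unfolding isomorphic_def isomorphism_def
  by (intro exI[of _ "ident C X"]) (auto intro!: bexI[of _ "ident C X"] simp: ident_in_hom comp_ident[of X X])

lemma isomorphic_sym: "isomorphic X Y \<Longrightarrow> isomorphic Y X"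
  unfolding isomorphic_def isomorphism_def by blast

lemma isomorphic_trans:
  assumes "isomorphic X Y" "isomorphic Y Z" "X \<in> obj C" "Y \<in> obj C" "Z \<in> obj C"
  shows "isomorphic X Z"
proof -
  obtain f g where fg: "f \<in> hom C X Y" "g \<in> hom C Y X" "g \<cdot> f = ident C X" "f \<cdot> g = ident C Y"
    using assms(1) by (auto simp: isomorphic_def isomorphism_def)
  obtain f' g' where fg': "f' \<in> hom C Y Z" "g' \<in> hom C Z Y" "g' \<cdot> f' = ident C Y" "f' \<cdot> g' = ident C Z"
    using assms(2) by (auto simp: isomorphic_def isomorphism_def)
  note o = assms(3-5)
  have h: "f' \<cdot> f \<in> hom C X Z" "g \<cdot> g' \<in> hom C Z X" using fg fg' o comp_in_hom by blast+
  have "(g \<cdot> g') \<cdot> (f' \<cdot> f) = g \<cdot> ((g' \<cdot> f') \<cdot> f)"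
    using comp_assoc[OF o(1,3,2,1) h(1) fg'(2) fg(2)] comp_assoc[OF o(1,2,3,2) fg(1) fg'(1,2)] by simp
  also have "... = ident C X" using fg fg' o by (simp add: ident_comp[OF o(1,2)])
  finally have 1: "(g \<cdot> g') \<cdot> (f' \<cdot> f) = ident C X" .
  have "(f' \<cdot> f) \<cdot> (g \<cdot> g') = f' \<cdot> ((f \<cdot> g) \<cdot> g')"
    using comp_assoc[OF o(3,1,2,3) h(2) fg(1) fg'(1)] comp_assoc[OF o(3,2,1,2) fg'(2) fg(2,1)] by simp
  also have "... = ident C Z" using fg fg' o by (simp add: ident_comp[OF o(3,2)])
  finally show ?thesis using h 1 by (auto simp: isomorphic_def isomorphism_def)
qed

lemma direct_sumE:
  assumes "direct_sum C n S X"
  shows "\<exists>\<iota> \<pi>. (\<forall>i<n. \<iota> i \<in> hom C (S i) X) \<and> (\<forall>i<n. \<pi> i \<in> hom C X (S i)) \<and>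
    (\<forall>i<n. \<forall>j<n. \<pi> i \<cdot> \<iota> j = (if i = j then ident C (S i) else 0)) \<and> (\<Sum>i<n. \<iota> i \<cdot> \<pi> i) = ident C X"
  using assms unfolding direct_sum_def by blast

end

text \<open>Dual statements are obtained by passing to the opposite category: those on the second
  argument of \<open>hom_dim\<close>, and those on injective objects.\<close>

definition op_cat :: "('o, 'm, 'k, 'x) lincat_scheme \<Rightarrow> ('o, 'm, 'k) lincat" where
  "op_cat C = \<lparr>obj = obj C, hom = (\<lambda>X Y. hom C Y X), ident = ident C, comp = (\<lambda>g f. f \<cdot>\<^bsub>C\<^esub> g), scale = scale C\<rparr>"

lemma op_cat_simps [simp]:
  "obj (op_cat C) = obj C" "hom (op_cat C) X Y = hom C Y X" "ident (op_cat C) = ident C"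
  "comp (op_cat C) g f = f \<cdot>\<^bsub>C\<^esub> g" "scale (op_cat C) = scale C"
  by (simp_all add: op_cat_def)

lemma (in linear_category) op_linear: "linear_category (op_cat C)"
  by (rule linear_category.intro)
    (auto intro: ambient_vector_space hom_subspace ident_in_hom comp_in_hom comp_ident ident_comp comp_assoc[symmetric]
      comp_add_left comp_add_right comp_scale_left comp_scale_right)

context regular_linear_category
begin

sublocale amb: ambient_space "scale C"
  by (rule ambient_space.intro[OF ambient_vector_space])

abbreviation hom_dim :: "'o \<Rightarrow> 'o \<Rightarrow> nat" where
  "hom_dim X Y \<equiv> amb.dim (hom C X Y)"

lemma vector_space_pair_self: "ambient_space_pair (scale C) (scale C)"
  by (simp add: ambient_space_pair_def vector_space_pair_def ambient_vector_space)

text \<open>The map f \<mapsto> i f p embeds the endomorphisms of the retract, and the identity of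
  \<open>X\<close> lies outside its image. The dimension of the endomorphism space is therefore a
  measure for induction.\<close>

lemma hom_dim_retract_less:
  assumes o: "X \<in> obj C" "Y \<in> obj C" and i: "i \<in> hom C Y X" and p: "p \<in> hom C X Y"
    and pi: "p \<cdot> i = ident C Y" and ne: "i \<cdot> p \<noteq> ident C X"
  shows "hom_dim Y Y < hom_dim X X"
proof -
  let ?T = "\<lambda>f. (i \<cdot> f) \<cdot> p" and ?H = "hom C Y Y"
  have T: "?T f \<in> hom C X X" and T': "p \<cdot> (?T f \<cdot> i) = f" if "f \<in> ?H" for f
  proof -
    have if': "i \<cdot> f \<in> hom C Y X" using comp_in_hom[OF o(2,2,1) that i] .
    then show T: "?T f \<in> hom C X X" using comp_in_hom[OF o(1,2,1) p] by blast
    have "?T f \<cdot> i = (i \<cdot> f) \<cdot> (p \<cdot> i)" by (rule comp_assoc[OF o(2,1,2,1) i p if'])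
    also have "... = i \<cdot> f" using pi comp_ident[OF o(2,1) if'] by simp
    also have "p \<cdot> \<dots> = (p \<cdot> i) \<cdot> f" by (rule comp_assoc[symmetric, OF o(2,2,1,2) that i p])
    finally show "p \<cdot> (?T f \<cdot> i) = f" using pi ident_comp[OF o(2,2) that] by simp
  qed
  have add: "?T (f + g) = ?T f + ?T g" if "f \<in> ?H" "g \<in> ?H" for f g
    using that comp_add_right[OF o(2,2,1) that i] comp_add_left[OF o(1,2,1) p comp_in_hom[OF o(2,2,1) _ i] comp_in_hom[OF o(2,2,1) _ i]]
    by simp
  have sc: "?T (scale C c f) = scale C c (?T f)" if "f \<in> ?H" for f c
    using that comp_scale_right[OF o(2,2,1) that i] comp_scale_left[OF o(1,2,1) p comp_in_hom[OF o(2,2,1) _ i]]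
    by simp
  interpret ambient_space_pair "scale C" "scale C" by (rule vector_space_pair_self)
  note sub = hom_subspace[OF o(2,2)] hom_subspace[OF o(1,1)]
  obtain g where g: "Vector_Spaces.linear (scale C) (scale C) g" "\<And>x. x \<in> ?H \<Longrightarrow> g x = ?T x"
    using extend_from_subspace[OF sub(1) add sc] by metis
  have im: "g ` ?H = ?T ` ?H" using g(2) by auto
  have "inj_on ?T ?H" using T' by (metis (no_types, lifting) inj_onI)
  then have "hom_dim Y Y = amb.dim (?T ` ?H)"
    using dim_bij[OF sub(1), of ?T "?T ` ?H"] add sc by (simp add: bij_betw_def)
  also have "... < hom_dim X X"
  proof (rule amb.dim_less[OF _ sub(2) hom_fin_dim[OF o(1,1)]])
    show "amb.subspace (?T ` ?H)" using linear_subspace_image[OF g(1) sub(1)] im by simp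
    show "?T ` ?H \<subseteq> hom C X X" using T by auto
    show "ident C X \<in> hom C X X" using o by (simp add: ident_in_hom)
    show "ident C X \<notin> ?T ` ?H"
    proof
      assume "ident C X \<in> ?T ` ?H"
      then obtain f where f: "f \<in> ?H" "ident C X = ?T f" by auto
      have "f = p \<cdot> (ident C X \<cdot> i)" using T'[OF f(1)] f(2) by simp
      also have "... = ident C Y" using ident_comp[OF o(2,1) i] pi by simp
      finally show False using f ne comp_ident[OF o(2,1) i] by simp
    qed
  qed
  finally show ?thesis .
qed

text \<open>A generalized inverse \<open>j\<close> of a monomorphism \<open>i\<close> satisfies j i
  = 1 and makes i j idempotent; by hypothesis i j is zero or the identity.\<close>

lemma simple_or_split:
  assumes X: "X \<in> obj C" "ident C X \<noteq> 0"
    and triv: "\<And>u. u \<in> hom C X X \<Longrightarrow> u \<cdot> u = u \<Longrightarrow> u = 0 \<or> u = ident C X"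
  shows "simple_object C X"
  unfolding simple_object_def
proof (intro conjI ballI allI impI)
  show "X \<in> obj C" "\<not> zero_object C X" using X zero_object_iff by auto
  fix W i assume W: "W \<in> obj C" "monomorphism C W X i"
  then have i: "i \<in> hom C W X" and mono: "\<And>g h. g \<in> hom C W W \<Longrightarrow> h \<in> hom C W W \<Longrightarrow> i \<cdot> g = i \<cdot> h \<Longrightarrow> g = h"
    by (auto simp: monomorphism_def)
  obtain j where j: "j \<in> hom C X W" "(i \<cdot> j) \<cdot> i = i" using regular[OF W(1) X(1) i] by blast
  have ji: "j \<cdot> i \<in> hom C W W" "i \<cdot> j \<in> hom C X X" using comp_in_hom i j W X by blast+
  have "i \<cdot> (j \<cdot> i) = i \<cdot> ident C W"
    using comp_assoc[OF W(1) X(1) W(1) X(1) i j(1) i] j comp_ident[OF W(1) X(1) i] by simp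
  then have 1: "j \<cdot> i = ident C W" using mono[OF ji(1) ident_in_hom[OF W(1)]] by blast
  have "(i \<cdot> j) \<cdot> (i \<cdot> j) = i \<cdot> j"
    using comp_assoc[OF X(1) W(1) X(1) X(1) j(1) i ji(2)] j by simp
  from triv[OF ji(2) this] show "zero_object C W \<or> isomorphism C W X i"
  proof
    assume "i \<cdot> j = 0"
    then have "i = 0" using j comp_zero(1)[OF W(1) X(1) X(1) i] by simp
    then have "ident C W = 0" using 1 comp_zero(2)[OF W(1) X(1) W(1) j(1)] by simp
    then show ?thesis using zero_object_iff[OF W(1)] by blast
  next
    assume "i \<cdot> j = ident C X"
    then show ?thesis using i j 1 by (auto simp: isomorphism_def)
  qed
qed

lemma direct_sum_extend:
  assumes o: "X \<in> obj C" "Y \<in> obj C" "Z \<in> obj C"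
    and i: "i \<in> hom C Y X" and p: "p \<in> hom C X Y" and i': "i' \<in> hom C Z X" and p': "p' \<in> hom C X Z"
    and pi: "p \<cdot> i = ident C Y" "p' \<cdot> i' = ident C Z" and s: "i \<cdot> p + i' \<cdot> p' = ident C X"
    and Z: "direct_sum C m T Z" "\<And>k. k < m \<Longrightarrow> T k \<in> obj C"
  shows "direct_sum C (Suc m) (T(m := Y)) X"
proof -
  have ip: "i \<cdot> p \<in> hom C X X" "i' \<cdot> p' \<in> hom C X X" using comp_in_hom[OF o(1,2,1) p i] comp_in_hom[OF o(1,3,1) p' i'] by simp_all
  \<comment> \<open>Orthogonality is derived: composing the resolution of the identity with
    \<open>i\<close> leaves \<open>i' \<cdot> (p' \<cdot> i) = 0\<close>, and \<open>p'\<close>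
    cancels \<open>i'\<close>. The other mixed composite is treated in the same way.\<close>
  have "i \<cdot> ident C Y + i' \<cdot> (p' \<cdot> i) = i"
    using comp_add_left[OF o(2,1,1) i ip] s comp_assoc[OF o(2,1,2,1) i p i] comp_assoc[OF o(2,1,3,1) i p' i'] pi ident_comp[OF o(2,1) i] by simp
  then have "i' \<cdot> (p' \<cdot> i) = 0" using comp_ident[OF o(2,1) i] by simp
  then have pi': "p' \<cdot> i = 0"
    using comp_assoc[OF o(2,3,1,3) comp_in_hom[OF o(2,1,3) i p'] i' p'] pi ident_comp[OF o(2,3) comp_in_hom[OF o(2,1,3) i p']] comp_zero(2)[OF o(2,1,3) p'] by simp
  have "i \<cdot> (p \<cdot> i') + i' \<cdot> ident C Z = i'"
    using comp_add_left[OF o(3,1,1) i' ip] s comp_assoc[OF o(3,1,2,1) i' p i] comp_assoc[OF o(3,1,3,1) i' p' i'] pi ident_comp[OF o(3,1) i'] by simp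
  then have "i \<cdot> (p \<cdot> i') = 0" using comp_ident[OF o(3,1) i'] by simp
  then have p'i: "p \<cdot> i' = 0"
    using comp_assoc[OF o(3,2,1,2) comp_in_hom[OF o(3,1,2) i' p] i p] pi ident_comp[OF o(3,2) comp_in_hom[OF o(3,1,2) i' p]] comp_zero(2)[OF o(3,1,2) p] by simp
  obtain \<kappa> \<rho> where T: "\<forall>i<m. \<kappa> i \<in> hom C (T i) Z" "\<forall>i<m. \<rho> i \<in> hom C Z (T i)"
    "\<forall>i<m. \<forall>j<m. \<rho> i \<cdot> \<kappa> j = (if i = j then ident C (T i) else 0)"
    "(\<Sum>k<m. \<kappa> k \<cdot> \<rho> k) = ident C Z" using direct_sumE[OF Z(1)] by blast
  have \<kappa>: "\<kappa> k \<in> hom C (T k) Z" and \<rho>: "\<rho> k \<in> hom C Z (T k)" if "k < m" for k using T(1,2) that by simp_all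
  let ?i = "\<lambda>k. if k < m then i' \<cdot> \<kappa> k else i" and ?p = "\<lambda>k. if k < m then \<rho> k \<cdot> p' else p"
  have hom: "?i k \<in> hom C ((T(m := Y)) k) X" "?p k \<in> hom C X ((T(m := Y)) k)" if "k < Suc m" for k
    using that i p comp_in_hom[OF Z(2) o(3,1) \<kappa> i'] comp_in_hom[OF o(1,3) Z(2) p' \<rho>] by auto
  have orth: "?p k \<cdot> ?i j = (if k = j then ident C ((T(m := Y)) k) else 0)" if "k < Suc m" "j < Suc m" for k j
  proof -
    have kj: "k < m \<or> k = m" "j < m \<or> j = m" using that by auto
    consider "k < m" "j < m" | "k < m" "j = m" | "k = m" "j < m" | "k = m" "j = m" using kj by blast
    then show ?thesis
    proof cases
      case 1
      then show ?thesis
        using comp_assoc[OF Z(2)[of j] o(1,3) Z(2)[of k] comp_in_hom[OF Z(2)[of j] o(3,1) \<kappa>[of j] i'] p' \<rho>[of k]]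
          comp_assoc[OF Z(2)[of j] o(3,1,3) \<kappa>[of j] i' p'] pi ident_comp[OF Z(2)[of j] o(3) \<kappa>[of j]] T(3) by simp
    next
      case 2
      then show ?thesis using comp_assoc[OF o(2,1,3) Z(2)[of k] i p' \<rho>[of k]] pi' comp_zero(2)[OF o(2,3) Z(2)[of k] \<rho>[of k]] by simp
    next
      case 3
      then show ?thesis using comp_assoc[OF Z(2)[of j] o(3,1,2) \<kappa>[of j] i' p] p'i comp_zero(1)[OF Z(2)[of j] o(3,2) \<kappa>[of j]] by simp
    qed (simp add: pi)
  qed
  have "(\<Sum>k<m. ?i k \<cdot> ?p k) = (\<Sum>k<m. (i' \<cdot> (\<kappa> k \<cdot> \<rho> k)) \<cdot> p')"
  proof (rule sum.cong[OF refl])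
    fix k assume "k \<in> {..<m}"
    then have k: "k < m" by simp
    show "?i k \<cdot> ?p k = (i' \<cdot> (\<kappa> k \<cdot> \<rho> k)) \<cdot> p'"
      using k comp_assoc[OF o(1,3) Z(2)[OF k] o(1) p' \<rho>[OF k] comp_in_hom[OF Z(2)[OF k] o(3,1) \<kappa>[OF k] i']]
        comp_assoc[OF o(3) Z(2)[OF k] o(3,1) \<rho>[OF k] \<kappa>[OF k] i'] by simp
  qed
  also have "... = (i' \<cdot> (\<Sum>k<m. \<kappa> k \<cdot> \<rho> k)) \<cdot> p'"
    using comp_sum_right[OF o(3,3,1) i', of "{..<m}" "\<lambda>k. \<kappa> k \<cdot> \<rho> k"] comp_sum_left[OF o(1,3,1) p', of "{..<m}" "\<lambda>k. i' \<cdot> (\<kappa> k \<cdot> \<rho> k)"]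
      comp_in_hom[OF o(3) Z(2) o(3) \<rho> \<kappa>] comp_in_hom[OF o(3,3,1) _ i'] by simp
  also have "... = i' \<cdot> p'" using T(4) comp_ident[OF o(3,1) i'] by simp
  finally have "(\<Sum>k<Suc m. ?i k \<cdot> ?p k) = ident C X" using s by (simp add: add.commute)
  then show ?thesis unfolding direct_sum_def using hom orth by (intro exI[of _ ?i] exI[of _ ?p] conjI allI impI)
qed

lemma simple_retract:
  assumes "X \<in> obj C" "ident C X \<noteq> 0"
  shows "\<exists>Y. simple_object C Y \<and> (\<exists>i\<in>hom C Y X. \<exists>p\<in>hom C X Y. p \<cdot> i = ident C Y)"
  using assms
proof (induction "hom_dim X X" arbitrary: X rule: less_induct)
  case less
  note X = less(2)
  show ?case
  proof (cases "\<exists>u\<in>hom C X X. u \<cdot> u = u \<and> u \<noteq> 0 \<and> u \<noteq> ident C X")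
    case True
    then obtain u where u: "u \<in> hom C X X" "u \<cdot> u = u" "u \<noteq> 0" "u \<noteq> ident C X" by blast
    obtain Y i p where Y: "Y \<in> obj C" "i \<in> hom C Y X" "p \<in> hom C X Y" "p \<cdot> i = ident C Y" "i \<cdot> p = u"
      using idem_split[OF X u(1,2)] by blast
    have "hom_dim Y Y < hom_dim X X" using hom_dim_retract_less[OF X Y(1-4)] Y(5) u by simp
    moreover have "ident C Y \<noteq> 0"
      using u(3) Y(5) comp_ident[OF Y(1) X Y(2)] comp_zero(2)[OF Y(1,1) X Y(2)] comp_zero(1)[OF X Y(1) X Y(3)] by auto
    ultimately obtain S j q where S: "simple_object C S" "j \<in> hom C S Y" "q \<in> hom C Y S" "q \<cdot> j = ident C S"
      using less(1)[OF _ Y(1)] by blast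
    have So: "S \<in> obj C" using S by (simp add: simple_object_def)
    have "(q \<cdot> p) \<cdot> (i \<cdot> j) = q \<cdot> ((p \<cdot> i) \<cdot> j)"
      unfolding comp_assoc[OF So X Y(1) So comp_in_hom[OF So Y(1) X S(2) Y(2)] Y(3) S(3)] comp_assoc[OF So Y(1) X Y(1) S(2) Y(2,3)] ..
    then have "(q \<cdot> p) \<cdot> (i \<cdot> j) = ident C S" using S(4) Y(4) ident_comp[OF So Y(1) S(2)] by simp
    then show ?thesis using S(1) comp_in_hom[OF So Y(1) X S(2) Y(2)] comp_in_hom[OF X Y(1) So Y(3) S(3)] by blast
  next
    case False
    then have "simple_object C X" using simple_or_split[OF X less(3)] by blast
    then show ?thesis using ident_in_hom[OF X] ident_comp[OF X X ident_in_hom[OF X]] by blast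
  qed
qed

text \<open>A simple retract is split off; the complementary idempotent splits as well, and its
  image has fewer endomorphisms.\<close>

lemma decompose:
  assumes "X \<in> obj C"
  shows "\<exists>n S. (\<forall>i<n. simple_object C (S i)) \<and> direct_sum C n S X"
  using assms
proof (induction "hom_dim X X" arbitrary: X rule: less_induct)
  case less
  note X = less(2) and I = ident_in_hom[OF less(2)]
  show ?case
  proof (cases "ident C X = 0")
    case True
    then have "direct_sum C 0 (\<lambda>_. X) X" by (simp add: direct_sum_def)
    then show ?thesis by (intro exI[of _ 0]) auto
  next
    case False
    obtain Y i p where Y: "simple_object C Y" "i \<in> hom C Y X" "p \<in> hom C X Y" "p \<cdot> i = ident C Y"
      using simple_retract[OF X False] by blast
    have Yo: "Y \<in> obj C" "ident C Y \<noteq> 0" using Y(1) zero_object_iff[of Y] by (auto simp: simple_object_def)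
    let ?u = "i \<cdot> p" and ?v = "ident C X - i \<cdot> p"
    have u: "?u \<in> hom C X X" by (rule comp_in_hom[OF X Yo(1) X Y(3,2)])
    have pu: "p \<cdot> ?u = p" using comp_assoc[OF X Yo(1) X Yo(1) Y(3,2,3)] Y(4) ident_comp[OF X Yo(1) Y(3)] by simp
    have v: "?v \<in> hom C X X" by (rule hom_diff[OF X X I u])
    have "?u \<cdot> ?v = 0"
      using comp_assoc[OF X X Yo(1) X v Y(3,2)] comp_diff_right[OF X X Yo(1) I u Y(3)] pu comp_ident[OF X Yo(1) Y(3)] comp_zero(2)[OF X Yo(1) X Y(2)] by simp
    then have "?v \<cdot> ?v = ?v" using comp_diff_left[OF X X X v I u] ident_comp[OF X X v] by simp
    then obtain Z i' p' where Z: "Z \<in> obj C" "i' \<in> hom C Z X" "p' \<in> hom C X Z" "p' \<cdot> i' = ident C Z" "i' \<cdot> p' = ?v"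
      using idem_split[OF X v] by blast
    have "?u \<noteq> 0"
    proof
      assume "?u = 0"
      then have "p = 0" using pu comp_zero(2)[OF X X Yo(1) Y(3)] by simp
      then show False using Y(4) Yo(2) comp_zero(1)[OF Yo(1) X Yo(1) Y(2)] by simp
    qed
    then have "hom_dim Z Z < hom_dim X X" using hom_dim_retract_less[OF X Z(1-4)] Z(5) by simp
    from less(1)[OF this Z(1)] obtain m T where T: "\<forall>k<m. simple_object C (T k)" "direct_sum C m T Z" by blast
    have "direct_sum C (Suc m) (T(m := Y)) X"
      by (rule direct_sum_extend[OF X Yo(1) Z(1) Y(2,3) Z(2,3) Y(4) Z(4) _ T(2)]) (use Z(5) T(1) in \<open>simp_all add: simple_object_def\<close>)
    moreover have "\<forall>k<Suc m. simple_object C ((T(m := Y)) k)" using T(1) Y(1) by (simp add: less_Suc_eq)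
    ultimately show ?thesis by blast
  qed
qed

lemma semisimple: "semisimple_category C"
  unfolding semisimple_category_def using decompose by blast

text \<open>Splitting \<open>u\<close> produces a subobject of \<open>S\<close>, which is zero or
  everything.\<close>

lemma simple_idem:
  assumes S: "simple_object C S" and u: "u \<in> hom C S S" "u \<cdot> u = u" "u \<noteq> 0"
  shows "u = ident C S"
proof -
  have So: "S \<in> obj C" using S by (simp add: simple_object_def)
  obtain Y i p where Y: "Y \<in> obj C" "i \<in> hom C Y S" "p \<in> hom C S Y" "p \<cdot> i = ident C Y" "i \<cdot> p = u"
    using idem_split[OF So u(1,2)] by blast
  have "monomorphism C Y S i"
    unfolding monomorphism_def
  proof (intro conjI ballI impI)
    show "i \<in> hom C Y S" by fact
    fix W g h assume W: "W \<in> obj C" "g \<in> hom C W Y" "h \<in> hom C W Y" "i \<cdot> g = i \<cdot> h"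
    have "p \<cdot> (i \<cdot> k) = k" if "k \<in> hom C W Y" for k
      using comp_assoc[OF W(1) Y(1) So Y(1) that Y(2,3)] Y(4) ident_comp[OF W(1) Y(1) that] by simp
    from this[OF W(2)] this[OF W(3)] show "g = h" unfolding W(4) by simp
  qed
  then consider "zero_object C Y" | "isomorphism C Y S i" using S Y by (auto simp: simple_object_def)
  then show ?thesis
  proof cases
    case 1
    then have "ident C Y = 0" using zero_object_iff[OF Y(1)] by simp
    then have "i = 0" using comp_ident[OF Y(1) So Y(2)] comp_zero(2)[OF Y(1) Y(1) So Y(2)] by simp
    then show ?thesis using Y(5) u(3) comp_zero(1)[OF So Y(1) So Y(3)] by simp
  next
    case 2
    then obtain j where j: "j \<in> hom C S Y" "i \<cdot> j = ident C S" by (auto simp: isomorphism_def)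
    have "p = j"
      using comp_assoc[OF So Y(1) So Y(1) j(1) Y(2,3)] Y(4) j ident_comp[OF So Y(1) j(1)] comp_ident[OF So Y(1) Y(3)] by simp
    then show ?thesis using j Y by simp
  qed
qed

text \<open>With a generalized inverse \<open>g\<close>, both f g and g f are non-zero idempotents
  of simple objects, hence identities.\<close>

lemma schur:
  assumes S: "simple_object C S" "simple_object C T" and f: "f \<in> hom C S T" "f \<noteq> 0"
  shows "isomorphism C S T f"
proof -
  have o: "S \<in> obj C" "T \<in> obj C" using S by (auto simp: simple_object_def)
  obtain g where g: "g \<in> hom C T S" "(f \<cdot> g) \<cdot> f = f" using regular[OF o f(1)] by blast
  have h: "g \<cdot> f \<in> hom C S S" "f \<cdot> g \<in> hom C T T" using comp_in_hom o f g by blast+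
  have "f \<cdot> g \<noteq> 0" using g f comp_zero(1)[OF o(1,2,2) f(1)] by auto
  moreover have "(f \<cdot> g) \<cdot> (f \<cdot> g) = f \<cdot> g" using comp_assoc[OF o(2,1,2,2) g(1) f(1) h(2)] g by simp
  ultimately have 1: "f \<cdot> g = ident C T" using simple_idem[OF S(2) h(2)] by blast
  have "f \<cdot> (g \<cdot> f) = f" using comp_assoc[OF o(1,2,1,2) f(1) g(1) f(1)] g by simp
  then have "g \<cdot> f \<noteq> 0" using f comp_zero(2)[OF o(1,1,2) f(1)] by auto
  moreover have "(g \<cdot> f) \<cdot> (g \<cdot> f) = g \<cdot> f"
    using comp_assoc[OF o(1,2,1,1) f(1) g(1) h(1)] comp_assoc[OF o(2,1,2,1) g(1) f(1) g(1)] 1 comp_ident[OF o(2,1) g(1)] by simp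
  ultimately have "g \<cdot> f = ident C S" using simple_idem[OF S(1) h(1)] by blast
  with 1 show ?thesis using f g by (auto simp: isomorphism_def)
qed

lemma hom_dim_not_isomorphic:
  assumes "simple_object C S" "simple_object C T" "\<not> isomorphic S T"
  shows "hom_dim S T = 0"
proof -
  have "hom C S T = {0}"
    using schur[OF assms(1,2)] assms(3) hom_zero[of S T] assms(1,2) by (auto simp: isomorphic_def simple_object_def)
  then show ?thesis using amb.dim_eq_card[of "{}" "{0}"] amb.independent_empty by (simp add: amb.span_insert_0[of "{}"])
qed

lemma hom_dim_self_pos:
  assumes "simple_object C S"
  shows "0 < hom_dim S S"
proof -
  have o: "S \<in> obj C" "ident C S \<noteq> 0" using assms zero_object_iff by (auto simp: simple_object_def)
  have "amb.dim {0} < hom_dim S S"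
    by (rule amb.dim_less[OF _ hom_subspace hom_fin_dim])
      (use o hom_zero ident_in_hom in \<open>auto simp: amb.subspace_def\<close>)
  then show ?thesis by simp
qed

lemma hom_dim_iso_left:
  assumes "isomorphic X X'" "X \<in> obj C" "X' \<in> obj C" "Y \<in> obj C"
  shows "hom_dim X Y = hom_dim X' Y"
proof -
  obtain f g where fg: "f \<in> hom C X X'" "g \<in> hom C X' X" "g \<cdot> f = ident C X" "f \<cdot> g = ident C X'"
    using assms(1) by (auto simp: isomorphic_def isomorphism_def)
  note o = assms(2-4)
  interpret ambient_space_pair "scale C" "scale C" by (rule vector_space_pair_self)
  have a: "(h \<cdot> f) \<cdot> g = h" if "h \<in> hom C X' Y" for h
    using comp_assoc[OF o(2,1,2,3) fg(2,1) that] fg(4) comp_ident[OF o(2,3) that] by simp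
  have b: "(h \<cdot> g) \<cdot> f = h" if "h \<in> hom C X Y" for h
    using comp_assoc[OF o(1,2,1,3) fg(1,2) that] fg(3) comp_ident[OF o(1,3) that] by simp
  have "bij_betw (\<lambda>h. h \<cdot> f) (hom C X' Y) (hom C X Y)"
    by (rule bij_betw_byWitness[where f' = "\<lambda>h. h \<cdot> g"])
      (use a b comp_in_hom[OF o(1,2,3) fg(1)] comp_in_hom[OF o(2,1,3) fg(2)] in auto)
  from dim_bij[OF hom_subspace[OF o(2,3)] this] show "hom_dim X Y = hom_dim X' Y"
    using comp_add_left[OF o(1,2,3) fg(1)] comp_scale_left[OF o(1,2,3) fg(1)] by simp
qed

text \<open>The images of \<open>hom C (S i) Y\<close> under precomposition with the projections are
  independent, because the injections separate them, and they exhaust \<open>hom C X Y\<close>,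
  because the projections resolve the identity.\<close>

lemma hom_dim_direct_sum_left:
  assumes X: "direct_sum C n S X" "\<And>i. i < n \<Longrightarrow> S i \<in> obj C" "X \<in> obj C" and Y: "Y \<in> obj C"
  shows "hom_dim X Y = (\<Sum>i<n. hom_dim (S i) Y)"
proof -
  obtain \<iota> \<pi> where S: "\<forall>i<n. \<iota> i \<in> hom C (S i) X" "\<forall>i<n. \<pi> i \<in> hom C X (S i)"
    "\<forall>i<n. \<forall>j<n. \<pi> i \<cdot> \<iota> j = (if i = j then ident C (S i) else 0)"
    "(\<Sum>k<n. \<iota> k \<cdot> \<pi> k) = ident C X" using direct_sumE[OF X(1)] by blast
  have S: "\<And>k. k < n \<Longrightarrow> \<iota> k \<in> hom C (S k) X" "\<And>k. k < n \<Longrightarrow> \<pi> k \<in> hom C X (S k)"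
    "\<And>k j. k < n \<Longrightarrow> j < n \<Longrightarrow> \<pi> k \<cdot> \<iota> j = (if k = j then ident C (S k) else 0)"
    "(\<Sum>k<n. \<iota> k \<cdot> \<pi> k) = ident C X" using S by simp_all
  interpret ambient_space_pair "scale C" "scale C" by (rule vector_space_pair_self)
  note o = X(2,3) Y
  let ?W = "\<lambda>i. (\<lambda>h. h \<cdot> \<pi> i) ` hom C (S i) Y"
  have W: "?W i \<subseteq> hom C X Y" if "i < n" for i
    using comp_in_hom[OF X(3) X(2)[OF that] Y S(2)[OF that]] by auto
  have pi: "(h \<cdot> \<pi> i) \<cdot> \<iota> j = (if i = j then h else 0)" if "i < n" "j < n" "h \<in> hom C (S i) Y" for h i j
    using comp_assoc[OF X(2)[OF that(2)] X(3) X(2)[OF that(1)] Y S(1)[OF that(2)] S(2)[OF that(1)] that(3)] S(3)[OF that(1,2)]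
      comp_ident[OF X(2)[OF that(1)] Y that(3)] comp_zero(2)[OF X(2)[OF that(2)] X(2)[OF that(1)] Y that(3)] by auto
  have dW: "amb.dim (?W i) = hom_dim (S i) Y" "amb.subspace (?W i)" if "i < n" for i
  proof -
    note s = hom_subspace[OF X(2)[OF that] Y]
    have lin: "(h + h') \<cdot> \<pi> i = h \<cdot> \<pi> i + h' \<cdot> \<pi> i" "scale C c h \<cdot> \<pi> i = scale C c (h \<cdot> \<pi> i)" if "h \<in> hom C (S i) Y" "h' \<in> hom C (S i) Y" for h h' c
      using comp_add_left[OF X(3) X(2)[OF \<open>i < n\<close>] Y S(2)[OF \<open>i < n\<close>]] comp_scale_left[OF X(3) X(2)[OF \<open>i < n\<close>] Y S(2)[OF \<open>i < n\<close>]] that by auto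
    have "inj_on (\<lambda>h. h \<cdot> \<pi> i) (hom C (S i) Y)"
      by (rule inj_on_inverseI[where g = "\<lambda>h. h \<cdot> \<iota> i"]) (use pi[OF that that] in simp)
    then show "amb.dim (?W i) = hom_dim (S i) Y"
      using dim_bij[OF s, of "\<lambda>h. h \<cdot> \<pi> i" "?W i"] lin by (simp add: bij_betw_def)
    obtain g where "Vector_Spaces.linear (scale C) (scale C) g" "\<And>x. x \<in> hom C (S i) Y \<Longrightarrow> g x = x \<cdot> \<pi> i"
      using extend_from_subspace[OF s, of "\<lambda>h. h \<cdot> \<pi> i"] lin by metis
    then show "amb.subspace (?W i)" using linear_subspace_image[of g, OF _ s] by simp
  qed
  have "{\<Sum>i<n. x i |x. \<forall>i<n. x i \<in> ?W i} = hom C X Y"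
  proof (rule set_eqI, rule iffI)
    fix u assume "u \<in> {\<Sum>i<n. x i |x. \<forall>i<n. x i \<in> ?W i}"
    then obtain x where "u = (\<Sum>i<n. x i)" "\<forall>i<n. x i \<in> ?W i" by blast
    then have x: "u = (\<Sum>i<n. x i)" "\<And>i. i < n \<Longrightarrow> x i \<in> ?W i" by simp_all
    have "x i \<in> hom C X Y" if "i \<in> {..<n}" for i using that subsetD[OF W x(2)] by simp
    from comp_sum_left[OF X(3) X(3) Y ident_in_hom[OF X(3)] this] show "u \<in> hom C X Y" unfolding x(1) by (rule conjunct2)
  next
    fix u assume u: "u \<in> hom C X Y"
    have "u = u \<cdot> (\<Sum>k<n. \<iota> k \<cdot> \<pi> k)" using S(4) comp_ident[OF X(3) Y u] by simp
    also have "... = (\<Sum>k<n. u \<cdot> (\<iota> k \<cdot> \<pi> k))"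
      using comp_sum_right[OF X(3) X(3) Y u, of "{..<n}" "\<lambda>k. \<iota> k \<cdot> \<pi> k"] comp_in_hom[OF X(3) X(2) X(3) S(2) S(1)] by simp
    also have "... = (\<Sum>k<n. (u \<cdot> \<iota> k) \<cdot> \<pi> k)"
      using comp_assoc[OF X(3) X(2) X(3) Y S(2) S(1) u] by simp
    finally show "u \<in> {\<Sum>i<n. x i |x. \<forall>i<n. x i \<in> ?W i}"
      using comp_in_hom[OF X(2) X(3) Y S(1) u] by (auto intro!: exI[of _ "\<lambda>k. (u \<cdot> \<iota> k) \<cdot> \<pi> k"])
  qed
  moreover have "\<forall>i<n. x i = 0" if x: "\<forall>i<n. x i \<in> ?W i" "(\<Sum>i<n. x i) = 0" for x
  proof (intro allI impI)
    fix j assume j: "j < n"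
    have "\<forall>i. \<exists>h. i < n \<longrightarrow> h \<in> hom C (S i) Y \<and> x i = h \<cdot> \<pi> i" using x(1) by blast
    then obtain h where h: "\<And>i. i < n \<Longrightarrow> h i \<in> hom C (S i) Y \<and> x i = h i \<cdot> \<pi> i" by metis
    have "x i \<in> hom C X Y" if "i \<in> {..<n}" for i using x(1) that subsetD[OF W, of i "x i"] by simp
    from conjunct1[OF comp_sum_left[OF X(2)[OF j] X(3) Y S(1)[OF j], of "{..<n}" x, OF this]]
    have "0 \<cdot> \<iota> j = (\<Sum>i<n. x i \<cdot> \<iota> j)" unfolding x(2) .
    then have "0 = (\<Sum>i<n. x i \<cdot> \<iota> j)" using comp_zero(1)[OF X(2)[OF j] X(3) Y S(1)[OF j]] by simp
    also have "... = (\<Sum>i<n. if i = j then h j else 0)"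
      by (rule sum.cong) (use h pi[OF _ j] in auto)
    also have "... = h j" using j by simp
    finally show "x j = 0" using h[OF j] comp_zero(1)[OF X(3) X(2)[OF j] Y S(2)[OF j]] by simp
  qed
  ultimately have "hom_dim X Y = (\<Sum>i<n. amb.dim (?W i))"
    using amb.dim_family_sum[of n ?W] dW(2) amb.fin_dim_subset[OF hom_fin_dim[OF X(3) Y] W] by simp
  then show "hom_dim X Y = (\<Sum>i<n. hom_dim (S i) Y)" using dW(1) by simp
qed

lemma op: "regular_linear_category (op_cat C)"
proof (rule regular_linear_category.intro[OF op_linear], rule regular_linear_category_axioms.intro, unfold op_cat_simps)
  fix X Y f assume o: "X \<in> obj C" "Y \<in> obj C" and f: "f \<in> hom C Y X"
  obtain g where g: "g \<in> hom C X Y" "(f \<cdot> g) \<cdot> f = f" using regular[OF o(2,1) f] by blast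
  then show "\<exists>g\<in>hom C X Y. f \<cdot> (g \<cdot> f) = f" using comp_assoc[OF o(2,1,2,1) f g(1) f] by metis
next
  fix X Y u assume "X \<in> obj C" "u \<in> hom C X X" "u \<cdot> u = u"
  from idem_split[OF this] show "\<exists>Y\<in>obj C. \<exists>i\<in>hom C X Y. \<exists>p\<in>hom C Y X. i \<cdot> p = ident C Y \<and> p \<cdot> i = u" by blast
qed (rule hom_fin_dim)

lemma hom_dim_iso:
  assumes "isomorphic X X'" "X \<in> obj C" "X' \<in> obj C" "Y \<in> obj C"
  shows "hom_dim X Y = hom_dim X' Y" "hom_dim Y X = hom_dim Y X'"
proof -
  interpret O: regular_linear_category "op_cat C" by (rule op)
  have "O.isomorphic X X'" using isomorphic_sym[OF assms(1)] by (auto simp: O.isomorphic_def isomorphic_def isomorphism_def)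
  from O.hom_dim_iso_left[OF this, of Y] assms show "hom_dim Y X = hom_dim Y X'" by simp
qed (rule hom_dim_iso_left[OF assms])

lemma hom_dim_direct_sum:
  assumes "direct_sum C n S X" "\<And>i. i < n \<Longrightarrow> S i \<in> obj C" "X \<in> obj C" "Y \<in> obj C"
  shows "hom_dim X Y = (\<Sum>i<n. hom_dim (S i) Y)" and "hom_dim Y X = (\<Sum>i<n. hom_dim Y (S i))"
proof -
  interpret O: regular_linear_category "op_cat C" by (rule op)
  obtain \<iota> \<pi> where "\<forall>i<n. \<iota> i \<in> hom C (S i) X" "\<forall>i<n. \<pi> i \<in> hom C X (S i)"
    "\<forall>i<n. \<forall>j<n. \<pi> i \<cdot> \<iota> j = (if i = j then ident C (S i) else 0)" "(\<Sum>k<n. \<iota> k \<cdot> \<pi> k) = ident C X"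
    using direct_sumE[OF assms(1)] by blast
  then have "direct_sum (op_cat C) n S X"
    unfolding direct_sum_def by (intro exI[of _ \<pi>] exI[of _ \<iota>]) auto
  from O.hom_dim_direct_sum_left[OF this, of Y] assms show "hom_dim Y X = (\<Sum>i<n. hom_dim Y (S i))" by simp
qed (rule hom_dim_direct_sum_left[OF assms])

end

section \<open>The form dim Hom on isomorphism classes\<close>

context regular_linear_category
begin

text \<open>The choice predicate depends only on the isomorphism class of \<open>S\<close>, so
  isomorphic objects receive the same representative and isomorphism becomes equality.\<close>

definition iso_rep :: "'o \<Rightarrow> 'o" where
  "iso_rep S = (SOME T. T \<in> obj C \<and> isomorphic S T)"

lemma iso_rep: "S \<in> obj C \<Longrightarrow> iso_rep S \<in> obj C \<and> isomorphic S (iso_rep S)"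
  unfolding iso_rep_def using isomorphic_refl[of S] by (intro someI[of "\<lambda>T. T \<in> obj C \<and> isomorphic S T" S]) auto

lemma iso_rep_eq_iff:
  assumes "S \<in> obj C" "T \<in> obj C"
  shows "iso_rep S = iso_rep T \<longleftrightarrow> isomorphic S T"
proof
  assume "iso_rep S = iso_rep T"
  then show "isomorphic S T" using iso_rep[OF assms(1)] iso_rep[OF assms(2)] isomorphic_sym isomorphic_trans assms by metis
next
  assume "isomorphic S T"
  then have "isomorphic S X \<longleftrightarrow> isomorphic T X" if "X \<in> obj C" for X
    using isomorphic_sym isomorphic_trans assms that by metis
  then have "(\<lambda>X. X \<in> obj C \<and> isomorphic S X) = (\<lambda>X. X \<in> obj C \<and> isomorphic T X)" by auto
  then show "iso_rep S = iso_rep T" unfolding iso_rep_def by simp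
qed

lemma hom_dim_simple:
  assumes "simple_object C S" "simple_object C T"
  shows "hom_dim S T = (if iso_rep S = iso_rep T then hom_dim (iso_rep S) (iso_rep S) else 0)"
proof -
  have o: "S \<in> obj C" "T \<in> obj C" using assms by (auto simp: simple_object_def)
  show ?thesis
  proof (cases "iso_rep S = iso_rep T")
    case True
    then show ?thesis
      using hom_dim_iso(1)[of S "iso_rep S" T] hom_dim_iso(2)[of T "iso_rep T" "iso_rep S"]
        iso_rep[OF o(1)] iso_rep[OF o(2)] o by simp
  next
    case False
    then show ?thesis using hom_dim_not_isomorphic[OF assms] iso_rep_eq_iff o by simp
  qed
qed

text \<open>In terms of the isomorphism classes t of simple objects, with multiplicity coordinates
  y_t, the form is the sum of d_t y_t^2 with d_t = dim End(t) positive. A rational vector of norm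
  zero therefore has all coordinates zero and pairs to zero with every \<open>Q\<close>.\<close>

lemma hom_dim_positive_definite:
  fixes \<xi> :: "'i \<Rightarrow> rat"
  assumes I: "finite I" and X: "\<And>i. i \<in> I \<Longrightarrow> X i \<in> obj C" and Q: "Q \<in> obj C"
    and zero: "(\<Sum>i\<in>I. \<Sum>j\<in>I. \<xi> i * \<xi> j * of_nat (hom_dim (X i) (X j))) = 0"
  shows "(\<Sum>i\<in>I. \<xi> i * of_nat (hom_dim (X i) Q)) = 0"
proof -
  have "\<forall>i. \<exists>n S. i \<in> I \<longrightarrow> (\<forall>k<n. simple_object C (S k)) \<and> direct_sum C n S (X i)"
    using decompose X by blast
  then obtain n S where S: "\<And>i k. i \<in> I \<Longrightarrow> k < n i \<Longrightarrow> simple_object C (S i k)"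
    "\<And>i. i \<in> I \<Longrightarrow> direct_sum C (n i) (S i) (X i)" by metis
  then have So: "S i k \<in> obj C" if "i \<in> I" "k < n i" for i k using that by (auto simp: simple_object_def)
  define \<T> where "\<T> = (\<Union>i\<in>I. (\<lambda>k. iso_rep (S i k)) ` {..<n i})"
  have T: "finite \<T>" using I by (auto simp: \<T>_def)
  define m where "m i t = card {k. k < n i \<and> iso_rep (S i k) = t}" for i t
  let ?d = "\<lambda>t. hom_dim t t"
  have count: "(\<Sum>k<n i. h (iso_rep (S i k))) = (\<Sum>t\<in>\<T>. of_nat (m i t) * h t)" if i: "i \<in> I" for i and h :: "'o \<Rightarrow> rat"
  proof -
    have "(\<Sum>k<n i. h (iso_rep (S i k))) = (\<Sum>k<n i. \<Sum>t\<in>\<T>. if iso_rep (S i k) = t then h t else 0)"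
      using i T by (intro sum.cong) (auto simp: \<T>_def)
    also have "... = (\<Sum>t\<in>\<T>. \<Sum>k<n i. if iso_rep (S i k) = t then h t else 0)" by (rule sum.swap)
    also have "... = (\<Sum>t\<in>\<T>. of_nat (m i t) * h t)"
    proof (rule sum.cong[OF refl])
      fix t
      have "(\<Sum>k<n i. if iso_rep (S i k) = t then h t else 0) = (\<Sum>k\<in>{k \<in> {..<n i}. iso_rep (S i k) = t}. h t)"
        by (rule sum.inter_filter[symmetric]) simp
      then show "(\<Sum>k<n i. if iso_rep (S i k) = t then h t else 0) = of_nat (m i t) * h t"
        by (simp add: m_def)
    qed
    finally show ?thesis .
  qed
  have dimQ: "of_nat (hom_dim (X i) Q) = (\<Sum>t\<in>\<T>. of_nat (m i t) * (of_nat (hom_dim t Q) :: rat))" if i: "i \<in> I" for i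
  proof -
    have "of_nat (hom_dim (X i) Q) = (\<Sum>k<n i. of_nat (hom_dim (S i k) Q) :: rat)"
      using hom_dim_direct_sum(1)[OF S(2)[OF i] So[OF i] X[OF i] Q] by simp
    also have "... = (\<Sum>k<n i. of_nat (hom_dim (iso_rep (S i k)) Q))"
      using hom_dim_iso(1)[of "S i k" "iso_rep (S i k)" Q for k] iso_rep So[OF i] Q by (intro sum.cong) auto
    finally show ?thesis using count[OF i, of "\<lambda>t. of_nat (hom_dim t Q)"] by simp
  qed
  have dimX: "of_nat (hom_dim (X i) (X j)) = (\<Sum>t\<in>\<T>. of_nat (m i t) * of_nat (m j t) * (of_nat (?d t) :: rat))"
    if i: "i \<in> I" "j \<in> I" for i j
  proof -
    have *: "of_nat (hom_dim t (X j)) = (of_nat (m j t) * of_nat (?d t) :: rat)" if tT: "t \<in> \<T>" for t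
    proof -
      obtain i' k' where t: "i' \<in> I" "k' < n i'" "t = iso_rep (S i' k')" using tT by (auto simp: \<T>_def)
      have "hom_dim t (X j) = hom_dim (S i' k') (X j)"
        using hom_dim_iso(1)[of "S i' k'" t "X j"] t iso_rep So[OF t(1,2)] X[OF i(2)] by simp
      also have "... = (\<Sum>l<n j. hom_dim (S i' k') (S j l))"
        using hom_dim_direct_sum(2)[OF S(2)[OF i(2)] So[OF i(2)] X[OF i(2)]] So[OF t(1,2)] by simp
      also have "... = (\<Sum>l<n j. if iso_rep (S j l) = t then ?d t else 0)"
        using hom_dim_simple[OF S(1)[OF t(1,2)] S(1)[OF i(2)]] t(3) by (intro sum.cong) auto
      also have "... = (\<Sum>l\<in>{l \<in> {..<n j}. iso_rep (S j l) = t}. ?d t)"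
        by (rule sum.inter_filter[symmetric]) simp
      finally show ?thesis by (simp add: m_def)
    qed
    show ?thesis using dimQ[of i] hom_dim_direct_sum(1)[OF S(2)[OF i(1)] So[OF i(1)] X[OF i(1)] X[OF i(2)]]
    proof -
      have "of_nat (hom_dim (X i) (X j)) = (\<Sum>k<n i. of_nat (hom_dim (S i k) (X j)) :: rat)"
        using hom_dim_direct_sum(1)[OF S(2)[OF i(1)] So[OF i(1)] X[OF i(1)] X[OF i(2)]] by simp
      also have "... = (\<Sum>k<n i. of_nat (hom_dim (iso_rep (S i k)) (X j)))"
        using hom_dim_iso(1)[of "S i k" "iso_rep (S i k)" "X j" for k] iso_rep So[OF i(1)] X[OF i(2)] by (intro sum.cong) auto
      also have "... = (\<Sum>t\<in>\<T>. of_nat (m i t) * of_nat (hom_dim t (X j)))"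
        using count[OF i(1), of "\<lambda>t. of_nat (hom_dim t (X j))"] by simp
      finally show ?thesis using * by (simp add: mult.assoc)
    qed
  qed
  let ?y = "\<lambda>t. \<Sum>i\<in>I. \<xi> i * of_nat (m i t)"
  have "(\<Sum>i\<in>I. \<Sum>j\<in>I. \<xi> i * \<xi> j * of_nat (hom_dim (X i) (X j))) =
     (\<Sum>i\<in>I. \<Sum>j\<in>I. \<Sum>t\<in>\<T>. of_nat (?d t) * ((\<xi> i * of_nat (m i t)) * (\<xi> j * of_nat (m j t))))"
    by (intro sum.cong refl) (simp add: dimX sum_distrib_left mult_ac)
  also have "... = (\<Sum>i\<in>I. \<Sum>t\<in>\<T>. \<Sum>j\<in>I. of_nat (?d t) * ((\<xi> i * of_nat (m i t)) * (\<xi> j * of_nat (m j t))))"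
    by (intro sum.cong refl sum.swap)
  also have "... = (\<Sum>t\<in>\<T>. \<Sum>i\<in>I. \<Sum>j\<in>I. of_nat (?d t) * ((\<xi> i * of_nat (m i t)) * (\<xi> j * of_nat (m j t))))"
    by (rule sum.swap)
  also have "... = (\<Sum>t\<in>\<T>. of_nat (?d t) * (?y t * ?y t))"
    by (simp add: sum_product flip: sum_distrib_left)
  finally have "(\<Sum>t\<in>\<T>. of_nat (?d t) * (?y t * ?y t)) = 0" using zero by simp
  then have "\<forall>t\<in>\<T>. of_nat (?d t) * (?y t * ?y t) = 0"
    by (subst (asm) sum_nonneg_eq_0_iff) (auto simp: T)
  moreover have "0 < ?d t" if t: "t \<in> \<T>" for t
  proof -
    obtain i k where "i \<in> I" "k < n i" "t = iso_rep (S i k)" using t by (auto simp: \<T>_def)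
    then show ?thesis using hom_dim_self_pos[OF S(1), of i k] hom_dim_simple[OF S(1) S(1), of i k i k] by simp
  qed
  ultimately have y: "?y t = 0" if "t \<in> \<T>" for t using that by fastforce
  have "(\<Sum>i\<in>I. \<xi> i * of_nat (hom_dim (X i) Q)) = (\<Sum>i\<in>I. \<Sum>t\<in>\<T>. of_nat (hom_dim t Q) * (\<xi> i * of_nat (m i t)))"
    by (intro sum.cong refl) (simp add: dimQ sum_distrib_left mult_ac)
  also have "... = (\<Sum>t\<in>\<T>. \<Sum>i\<in>I. of_nat (hom_dim t Q) * (\<xi> i * of_nat (m i t)))" by (rule sum.swap)
  also have "... = (\<Sum>t\<in>\<T>. of_nat (hom_dim t Q) * ?y t)" by (simp add: sum_distrib_left)
  finally show ?thesis using y by simp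
qed

text \<open>The number dim Hom(T, X) is dim End(T) times the multiplicity of T in X. Division by dim
  End(T) is needed because the field need not split the simple objects.\<close>

lemma additive_function:
  fixes v :: "'o \<Rightarrow> rat"
  assumes \<Sigma>: "finite \<Sigma>" "\<And>S. S \<in> \<Sigma> \<Longrightarrow> simple_object C S"
    "\<And>S T. S \<in> \<Sigma> \<Longrightarrow> T \<in> \<Sigma> \<Longrightarrow> isomorphic S T \<Longrightarrow> S = T"
    and X: "X \<in> obj C" "direct_sum C n S X" "\<And>k. k < n \<Longrightarrow> simple_object C (S k)"
    and c: "\<And>k. k < n \<Longrightarrow> \<exists>T\<in>\<Sigma>. isomorphic (S k) T \<and> v (S k) = v T"
    and v: "v X = (\<Sum>k<n. v (S k))"
  shows "v X = (\<Sum>T\<in>\<Sigma>. v T / of_nat (hom_dim T T) * of_nat (hom_dim T X))"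
proof -
  have o: "T \<in> obj C" if "T \<in> \<Sigma>" for T using \<Sigma>(2)[OF that] by (simp add: simple_object_def)
  have So: "S k \<in> obj C" if "k < n" for k using X(3)[OF that] by (simp add: simple_object_def)
  have "v (S k) = (\<Sum>T\<in>\<Sigma>. v T / of_nat (hom_dim T T) * of_nat (hom_dim T (S k)))" if k: "k < n" for k
  proof -
    obtain T0 where T0: "T0 \<in> \<Sigma>" "isomorphic (S k) T0" "v (S k) = v T0" using c[OF k] by blast
    have "hom_dim T (S k) = (if T = T0 then hom_dim T0 T0 else 0)" if T: "T \<in> \<Sigma>" for T
    proof (cases "T = T0")
      case True
      then show ?thesis using hom_dim_iso(2)[OF T0(2) So[OF k] o[OF T0(1)] o[OF T0(1)]] by simp
    next
      case False
      have "\<not> isomorphic T (S k)"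
        using False \<Sigma>(3)[OF T T0(1)] isomorphic_trans[OF _ T0(2) o[OF T] So[OF k] o[OF T0(1)]] by blast
      then show ?thesis using hom_dim_not_isomorphic[OF \<Sigma>(2)[OF T] X(3)[OF k]] False by simp
    qed
    then have "(\<Sum>T\<in>\<Sigma>. v T / of_nat (hom_dim T T) * of_nat (hom_dim T (S k))) =
        (\<Sum>T\<in>\<Sigma>. if T = T0 then v T0 / of_nat (hom_dim T0 T0) * of_nat (hom_dim T0 T0) else 0)"
      by (intro sum.cong) auto
    also have "... = v T0" using T0 \<Sigma>(1) hom_dim_self_pos[OF \<Sigma>(2)[OF T0(1)]] by simp
    finally show ?thesis using T0 by simp
  qed
  then have "v X = (\<Sum>k<n. \<Sum>T\<in>\<Sigma>. v T / of_nat (hom_dim T T) * of_nat (hom_dim T (S k)))" using v by simp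
  also have "... = (\<Sum>T\<in>\<Sigma>. \<Sum>k<n. v T / of_nat (hom_dim T T) * of_nat (hom_dim T (S k)))" by (rule sum.swap)
  also have "... = (\<Sum>T\<in>\<Sigma>. v T / of_nat (hom_dim T T) * of_nat (hom_dim T X))"
    using hom_dim_direct_sum(2)[OF X(2) So X(1) o] by (simp add: sum_distrib_left)
  finally show ?thesis .
qed

end

section \<open>Finite categories\<close>

lemma vector_space_seq_scale: "vector_space (seq_scale :: 'k::field \<Rightarrow> _)"
  by unfold_locales (auto simp: seq_scale_def algebra_simps)

interpretation seq: ambient_space "seq_scale :: 'k::field \<Rightarrow> _"
  by (rule ambient_space.intro[OF vector_space_seq_scale])

definition fun_scale :: "'k::field \<Rightarrow> ('a \<Rightarrow> 'k sequence) \<Rightarrow> 'a \<Rightarrow> 'k sequence" where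
  "fun_scale c f = (\<lambda>v. seq_scale c (f v))"

lemma vector_space_fun_scale: "vector_space (fun_scale :: 'k::field \<Rightarrow> _)"
  by unfold_locales (auto simp: fun_scale_def seq_scale_def algebra_simps plus_fun_def)

interpretation seqfun: ambient_space "fun_scale :: 'k::field \<Rightarrow> ('k sequence \<Rightarrow> 'k sequence) \<Rightarrow> _"
  by (rule ambient_space.intro[OF vector_space_fun_scale])

lemma fd_space_iff: "fd_space V \<longleftrightarrow> seq.subspace V \<and> fin_dim seq_scale V"
proof
  show "seq.subspace V \<and> fin_dim seq_scale V" if "fd_space V"
    using that by (auto simp: fd_space_def fin_dim_def)
  show "fd_space V" if "seq.subspace V \<and> fin_dim seq_scale V"
    using that seq.finite_basis[of V] unfolding fd_space_def by metis
qed

section \<open>Modules over a finite-dimensional algebra\<close>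

locale fd_alg = fixes A :: "'k::field fd_alg"
  assumes alg: "fd_algebra A"
begin

lemma one_in [simp]: "alg_one A \<in> alg_space A" using alg by (simp add: fd_algebra_def)

lemma fd_moduleD:
  assumes "fd_module A M"
  shows "seq.subspace (mod_space M)" "fin_dim seq_scale (mod_space M)"
    "a \<in> alg_space A \<Longrightarrow> v \<in> mod_space M \<Longrightarrow> mod_act M a v \<in> mod_space M"
    "a \<in> alg_space A \<Longrightarrow> a' \<in> alg_space A \<Longrightarrow> v \<in> mod_space M \<Longrightarrow> mod_act M (a + a') v = mod_act M a v + mod_act M a' v"
    "a \<in> alg_space A \<Longrightarrow> v \<in> mod_space M \<Longrightarrow> w \<in> mod_space M \<Longrightarrow> mod_act M a (v + w) = mod_act M a v + mod_act M a w"
    "a \<in> alg_space A \<Longrightarrow> v \<in> mod_space M \<Longrightarrow> mod_act M a (seq_scale c v) = seq_scale c (mod_act M a v)"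
    "a \<in> alg_space A \<Longrightarrow> v \<in> mod_space M \<Longrightarrow> mod_act M (seq_scale c a) v = seq_scale c (mod_act M a v)"
    "v \<in> mod_space M \<Longrightarrow> mod_act M (alg_one A) v = v"
    "a \<in> alg_space A \<Longrightarrow> b \<in> alg_space A \<Longrightarrow> v \<in> mod_space M \<Longrightarrow> mod_act M (alg_mult A a b) v = mod_act M a (mod_act M b v)"
  using assms by (auto simp: fd_module_def fd_space_iff bilinear_op_def)

lemma fd_moduleI:
  assumes "seq.subspace V" "fin_dim seq_scale V"
    "\<And>a v. a \<in> alg_space A \<Longrightarrow> v \<in> V \<Longrightarrow> act a v \<in> V"
    "\<And>a a' v. a \<in> alg_space A \<Longrightarrow> a' \<in> alg_space A \<Longrightarrow> v \<in> V \<Longrightarrow> act (a + a') v = act a v + act a' v"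
    "\<And>a v w. a \<in> alg_space A \<Longrightarrow> v \<in> V \<Longrightarrow> w \<in> V \<Longrightarrow> act a (v + w) = act a v + act a w"
    "\<And>c a v. a \<in> alg_space A \<Longrightarrow> v \<in> V \<Longrightarrow> act a (seq_scale c v) = seq_scale c (act a v)"
    "\<And>c a v. a \<in> alg_space A \<Longrightarrow> v \<in> V \<Longrightarrow> act (seq_scale c a) v = seq_scale c (act a v)"
    "\<And>v. v \<in> V \<Longrightarrow> act (alg_one A) v = v"
    "\<And>a b v. a \<in> alg_space A \<Longrightarrow> b \<in> alg_space A \<Longrightarrow> v \<in> V \<Longrightarrow> act (alg_mult A a b) v = act a (act b v)"
  shows "fd_module A \<lparr>mod_space = V, mod_act = act\<rparr>"
  using assms by (auto simp: fd_module_def fd_space_iff bilinear_op_def)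

lemma homD:
  assumes "f \<in> module_homs A M N"
  shows "v \<in> mod_space M \<Longrightarrow> f v \<in> mod_space N"
    "v \<in> mod_space M \<Longrightarrow> w \<in> mod_space M \<Longrightarrow> f (v + w) = f v + f w"
    "v \<in> mod_space M \<Longrightarrow> f (seq_scale c v) = seq_scale c (f v)"
    "a \<in> alg_space A \<Longrightarrow> v \<in> mod_space M \<Longrightarrow> f (mod_act M a v) = mod_act N a (f v)"
    "v \<notin> mod_space M \<Longrightarrow> f v = 0"
  using assms by (auto simp: module_homs_def)

lemma homI:
  assumes "seq.subspace (mod_space M)" "\<And>a v. a \<in> alg_space A \<Longrightarrow> v \<in> mod_space M \<Longrightarrow> mod_act M a v \<in> mod_space M"
    "\<And>v. v \<in> mod_space M \<Longrightarrow> h v \<in> mod_space N"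
    "\<And>v w. v \<in> mod_space M \<Longrightarrow> w \<in> mod_space M \<Longrightarrow> h (v + w) = h v + h w"
    "\<And>c v. v \<in> mod_space M \<Longrightarrow> h (seq_scale c v) = seq_scale c (h v)"
    "\<And>a v. a \<in> alg_space A \<Longrightarrow> v \<in> mod_space M \<Longrightarrow> h (mod_act M a v) = mod_act N a (h v)"
  shows "(\<lambda>v. if v \<in> mod_space M then h v else 0) \<in> module_homs A M N"
  using assms(3-6) seq.subspace_add[OF assms(1)] seq.subspace_scale[OF assms(1)] assms(2)
  by (auto simp: module_homs_def)

lemma hom_zero:
  assumes "fd_module A M" "f \<in> module_homs A M N"
  shows "f 0 = 0"
  using homD(3)[OF assms(2), of 0 0] seq.subspace_0[OF fd_moduleD(1)[OF assms(1)]] by simp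

lemma hom_diff:
  assumes "fd_module A M" "f \<in> module_homs A M N" "v \<in> mod_space M" "w \<in> mod_space M"
  shows "f (v - w) = f v - f w"
proof -
  note s = fd_moduleD(1)[OF assms(1)]
  have "f v = f ((v - w) + w)" by simp
  also have "... = f (v - w) + f w" using homD(2)[OF assms(2)] seq.subspace_diff[OF s] assms by blast
  finally show ?thesis by simp
qed

lemma submodule:
  assumes "fd_module A M" "seq.subspace V" "V \<subseteq> mod_space M"
    "\<And>a v. a \<in> alg_space A \<Longrightarrow> v \<in> V \<Longrightarrow> mod_act M a v \<in> V"
  shows "fd_module A \<lparr>mod_space = V, mod_act = mod_act M\<rparr>"
proof -
  note D = fd_moduleD[OF assms(1)] and sub = subsetD[OF assms(3)]
  show ?thesis
    by (rule fd_moduleI)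
      (use assms D sub seq.fin_dim_subset in \<open>auto\<close>)
qed

lemma image_subspace:
  assumes "fd_module A M" "fd_module A N" "f \<in> module_homs A M N"
  shows "seq.subspace (f ` mod_space M)" "f ` mod_space M \<subseteq> mod_space N"
    "a \<in> alg_space A \<Longrightarrow> v \<in> f ` mod_space M \<Longrightarrow> mod_act N a v \<in> f ` mod_space M"
proof -
  note D = fd_moduleD[OF assms(1)] and h = homD[OF assms(3)]
  show "seq.subspace (f ` mod_space M)"
  proof (rule seq.subspaceI)
    show "0 \<in> f ` mod_space M"
      using hom_zero[OF assms(1,3)] seq.subspace_0[OF D(1)] by (metis imageI)
  next
    fix x y assume "x \<in> f ` mod_space M" "y \<in> f ` mod_space M"
    then obtain v w where "x = f v" "y = f w" "v \<in> mod_space M" "w \<in> mod_space M" by blast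
    then show "x + y \<in> f ` mod_space M"
      using h(2)[of v w] seq.subspace_add[OF D(1)] by (metis imageI)
  next
    fix c x assume "x \<in> f ` mod_space M"
    then obtain v where "x = f v" "v \<in> mod_space M" by blast
    then show "seq_scale c x \<in> f ` mod_space M"
      using h(3)[of v c] seq.subspace_scale[OF D(1)] by (metis imageI)
  qed
  show "f ` mod_space M \<subseteq> mod_space N" using h(1) by blast
  show "mod_act N a v \<in> f ` mod_space M" if a: "a \<in> alg_space A" "v \<in> f ` mod_space M"
  proof -
    obtain u where "v = f u" "u \<in> mod_space M" using a by blast
    then show ?thesis using h(4)[of a u] D(3)[of a u] a by (metis imageI)
  qed
qed

text \<open>Modules live inside the sequence space, so the quotient is realized on a linear
  complement of \<open>V\<close> in \<open>N\<close>, with the action followed by the projection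
  \<open>p\<close> along \<open>V\<close>.\<close>

lemma quotient:
  assumes N: "fd_module A N" and V: "seq.subspace V" "V \<subseteq> mod_space N" "V \<noteq> mod_space N"
    "\<And>a v. a \<in> alg_space A \<Longrightarrow> v \<in> V \<Longrightarrow> mod_act N a v \<in> V"
  obtains Q g where "fd_module A Q" "g \<in> module_homs A N Q" "g \<noteq> 0" "\<And>v. v \<in> V \<Longrightarrow> g v = 0"
proof -
  note D = fd_moduleD[OF N]
  obtain B1 where B1: "B1 \<subseteq> V" "seq.independent B1" "V \<subseteq> seq.span B1" using seq.maximal_independent_subset[of V] by blast
  have V1: "V = seq.span B1" using B1 V(1) seq.span_minimal by blast
  obtain B where B: "B1 \<subseteq> B" "B \<subseteq> mod_space N" "seq.independent B" "mod_space N \<subseteq> seq.span B"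
    using seq.maximal_independent_subset_extend[of B1 "mod_space N"] B1 V(2) by blast
  have NB: "mod_space N = seq.span B" using B D(1) seq.span_minimal by blast
  interpret ambient_space_pair "seq_scale :: 'k \<Rightarrow> _" "seq_scale :: 'k \<Rightarrow> _"
    by (simp add: ambient_space_pair_def vector_space_pair_def vector_space_seq_scale)
  obtain p where p: "Vector_Spaces.linear seq_scale seq_scale p" "\<And>b. b \<in> B \<Longrightarrow> p b = (if b \<in> B1 then 0 else b)"
    using linear_independent_extend[OF B(3), of "\<lambda>b. if b \<in> B1 then 0 else b"] by blast
  note lin = linear_add[OF p(1)] linear_scale[OF p(1)] linear_0[OF p(1)] linear_diff[OF p(1)]
  let ?K = "seq.span (B - B1)"
  have K: "seq.subspace ?K" "?K \<subseteq> mod_space N" unfolding NB by (auto intro!: seq.span_mono seq.subspace_span)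
  have "p b = 0" if "b \<in> B1" for b using p(2)[of b] that B(1) by auto
  then have pV: "p v = 0" if "v \<in> V" for v
    using linear_eq_0_on_span[OF p(1), of B1 v] that V1 by blast
  have pK: "p v \<in> ?K" if "v \<in> mod_space N" for v
  proof -
    have "p ` B \<subseteq> ?K" using p(2) seq.span_base seq.span_zero by auto
    then have "seq.span (p ` B) \<subseteq> ?K" by (simp add: seq.span_minimal)
    then show ?thesis using that linear_span_image[OF p(1), of B] NB by auto
  qed
  have pid: "p v = v" if "v \<in> ?K" for v
    using linear_eq_on_span[OF p(1) seq.linear_id, of "B - B1" v] that p(2) by auto
  have diff: "v - p v \<in> V" if "v \<in> mod_space N" for v
  proof -
    have "seq.subspace {v. v - p v \<in> V}"
    proof (rule seq.subspaceI)
      show "0 \<in> {v. v - p v \<in> V}" using lin seq.subspace_0[OF V(1)] by simp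
    next
      fix x y assume xy: "x \<in> {v. v - p v \<in> V}" "y \<in> {v. v - p v \<in> V}"
      have *: "x + y - p (x + y) = (x - p x) + (y - p y)" unfolding lin by (simp add: algebra_simps)
      show "x + y \<in> {v. v - p v \<in> V}" unfolding mem_Collect_eq *
        using xy seq.subspace_add[OF V(1)] by blast
    next
      fix c x assume "x \<in> {v. v - p v \<in> V}"
      moreover have "seq_scale c x - p (seq_scale c x) = seq_scale c (x - p x)"
        by (simp add: lin seq.scale_right_diff_distrib)
      ultimately show "seq_scale c x \<in> {v. v - p v \<in> V}" using seq.subspace_scale[OF V(1)] by simp
    qed
    moreover have "B \<subseteq> {v. v - p v \<in> V}" using p(2) B1(1) seq.subspace_0[OF V(1)] by auto
    ultimately have "seq.span B \<subseteq> {v. v - p v \<in> V}" by (rule seq.span_minimal[rotated])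
    then show ?thesis using that NB by auto
  qed
  \<comment> \<open>That \<open>V\<close> is a submodule enters here: the action keeps
    \<open>v - p v\<close> in \<open>V\<close>, which \<open>p\<close> kills.\<close>
  have pact: "p (mod_act N a v) = p (mod_act N a (p v))" if "a \<in> alg_space A" "v \<in> mod_space N" for a v
  proof -
    have pv: "p v \<in> mod_space N" using pK[OF that(2)] K by blast
    have vp: "v - p v \<in> mod_space N" using diff[OF that(2)] V(2) by blast
    have "mod_act N a v = mod_act N a ((v - p v) + p v)" by simp
    also have "... = mod_act N a (v - p v) + mod_act N a (p v)" using D(5)[OF that(1) vp pv] .
    finally show ?thesis using pV[OF V(4)[OF that(1) diff[OF that(2)]]] by (simp add: lin)
  qed
  let ?Q = "\<lparr>mod_space = ?K, mod_act = \<lambda>a v. p (mod_act N a v)\<rparr>"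
  have Q: "fd_module A ?Q"
  proof (rule fd_moduleI)
    show "fin_dim seq_scale ?K" by (rule seq.fin_dim_subset[OF D(2) K(2)])
  qed (use D K pK pid in \<open>auto simp: lin pact[symmetric] subset_iff\<close>)
  let ?g = "\<lambda>v. if v \<in> mod_space N then p v else 0"
  have g: "?g \<in> module_homs A N ?Q"
    by (rule homI) (use D pK in \<open>auto simp: lin intro: pact\<close>)
  have "\<not> B \<subseteq> V"
  proof
    assume "B \<subseteq> V"
    then have "mod_space N \<subseteq> V" unfolding NB by (rule seq.span_minimal[OF _ V(1)])
    then show False using V by blast
  qed
  then obtain b where b: "b \<in> B" "b \<notin> V" by blast
  then have "b \<notin> B1" using B1 by blast
  then have "?g b = b" using b p(2) B(2) by auto
  moreover have "b \<noteq> 0" using b seq.subspace_0[OF V(1)] by auto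
  ultimately have "?g b \<noteq> 0" by simp
  then have "?g \<noteq> 0" using fun_cong[of ?g 0 b] by auto
  moreover have "?g v = 0" if "v \<in> V" for v using pV[OF that] by simp
  ultimately show ?thesis by (rule that[OF Q g])
qed

lemma homs_fin_dim:
  assumes "fd_module A M" "fd_module A N"
  shows "fin_dim fun_scale (module_homs A M N)"
proof -
  note D = fd_moduleD[OF assms(1)] and D' = fd_moduleD[OF assms(2)]
  obtain B where B: "finite B" "seq.independent B" "B \<subseteq> mod_space M" "mod_space M = seq.span B"
    using seq.finite_basis[OF D(1,2)] by metis
  obtain B' where B': "finite B'" "seq.independent B'" "mod_space N = seq.span B'"
    using seq.finite_basis[OF D'(1,2)] by metis
  \<comment> \<open>Matrix units for the two bases. They need not be module maps; they merely span a
    space that contains all of them.\<close>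
  let ?E = "\<lambda>b b' v. if v \<in> mod_space M then seq_scale (seq.representation B v b) b' else 0"
  let ?S = "(\<lambda>(b, b'). ?E b b') ` (B \<times> B')"
  have "module_homs A M N \<subseteq> seqfun.span ?S"
  proof
    fix f assume f: "f \<in> module_homs A M N"
    have sum: "f (\<Sum>b\<in>T. seq_scale (c b) b) = (\<Sum>b\<in>T. seq_scale (c b) (f b))" if "finite T" "T \<subseteq> B" for c T
      using that
    proof (induction T)
      case empty
      show ?case unfolding sum.empty by (rule hom_zero[OF assms(1) f])
    next
      case (insert b T)
      have "(\<Sum>b\<in>T. seq_scale (c b) b) \<in> mod_space M" "b \<in> mod_space M"
        using insert B(3) by (auto intro!: seq.subspace_sum[OF D(1)] seq.subspace_scale[OF D(1)])
      note m = this
      have "f (seq_scale (c b) b + (\<Sum>b\<in>T. seq_scale (c b) b)) =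
          f (seq_scale (c b) b) + f (\<Sum>b\<in>T. seq_scale (c b) b)"
        by (rule homD(2)[OF f seq.subspace_scale[OF D(1) m(2)] m(1)])
      also have "f (\<Sum>b\<in>T. seq_scale (c b) b) = (\<Sum>b\<in>T. seq_scale (c b) (f b))"
        by (rule insert(3)) (use insert(4) in blast)
      finally show ?case unfolding sum.insert[OF insert(1,2)] homD(3)[OF f m(2)] .
    qed
    have "f = (\<Sum>b\<in>B. \<Sum>b'\<in>B'. fun_scale (seq.representation B' (f b) b') (?E b b'))"
    proof
      fix v
      have ev: "(\<Sum>x\<in>X. h x) v = (\<Sum>x\<in>X. h x v)" for X and h :: "'b \<Rightarrow> 'k sequence \<Rightarrow> 'k sequence"
        by (induction X rule: infinite_finite_induct) auto
      show "f v = (\<Sum>b\<in>B. \<Sum>b'\<in>B'. fun_scale (seq.representation B' (f b) b') (?E b b')) v"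
      proof (cases "v \<in> mod_space M")
        case True
        have fb: "(\<Sum>b'\<in>B'. seq_scale (seq.representation B' (f b) b') b') = f b" if "b \<in> B" for b
          using that B B' homD(1)[OF f] by (intro seq.sum_representation_eq) auto
        have "v = (\<Sum>b\<in>B. seq_scale (seq.representation B v b) b)"
          using True B by (intro seq.sum_representation_eq[symmetric]) auto
        then have "f v = (\<Sum>b\<in>B. seq_scale (seq.representation B v b) (f b))"
          using sum[OF B(1) order.refl, of "seq.representation B v"] by simp
        also have "... = (\<Sum>b\<in>B. seq_scale (seq.representation B v b) (\<Sum>b'\<in>B'. seq_scale (seq.representation B' (f b) b') b'))"
          using fb by simp
        also have "... = (\<Sum>b\<in>B. \<Sum>b'\<in>B'. fun_scale (seq.representation B' (f b) b') (?E b b') v)"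
          unfolding seq.scale_sum_right fun_scale_def if_P[OF True] by (simp only: seq.scale_scale mult.commute)
        finally show ?thesis by (simp only: ev)
      next
        case False
        then show ?thesis using homD(5)[OF f] by (simp add: ev fun_scale_def)
      qed
    qed
    also have "... \<in> seqfun.span ?S"
      by (intro seqfun.span_sum seqfun.span_scale seqfun.span_base) auto
    finally show "f \<in> seqfun.span ?S" .
  qed
  moreover have "finite ?S" using B(1) B'(1) by simp
  ultimately show ?thesis unfolding fin_dim_def by blast
qed

lemma regular_module: "fd_module A \<lparr>mod_space = alg_space A, mod_act = alg_mult A\<rparr>"
  using alg by (auto simp: fd_module_def fd_algebra_def bilinear_op_def)

end

text \<open>The equivalence reduced to what the transfer of properties requires: a fully faithful
  functor that reaches every module up to isomorphism.\<close>

locale module_model = linear_category C + fd_alg A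
  for C :: "('o, 'm::ab_group_add, 'k::field, 'x) lincat_scheme" (structure) and A :: "'k fd_alg" +
  fixes F :: "('o, 'm, 'k fd_mod, 'k sequence \<Rightarrow> 'k sequence) lfunctor"
  assumes F_linear: "linear_functor C (fd_modules A) F"
    and full_faithful: "\<lbrakk>X \<in> obj C; Y \<in> obj C\<rbrakk> \<Longrightarrow>
      bij_betw (on_hom F X Y) (hom C X Y) (module_homs A (on_obj F X) (on_obj F Y))"
    and ess_surj: "fd_module A N \<Longrightarrow> \<exists>X\<in>obj C. \<exists>u\<in>module_homs A (on_obj F X) N. \<exists>v\<in>module_homs A N (on_obj F X).
      (\<forall>x\<in>mod_space (on_obj F X). v (u x) = x) \<and> (\<forall>y\<in>mod_space N. u (v y) = y)"

lemma linear_equivalence_model: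
  fixes C :: "('o, 'm::ab_group_add, 'k::field, 'x) lincat_scheme" (structure)
  assumes "linear_category C" "fd_algebra A" "linearly_equivalent C (fd_modules A)"
  shows "\<exists>F. module_model C A F"
proof -
  interpret linear_category C by fact
  interpret fd_alg A by unfold_locales fact
  let ?D = "fd_modules A"
  obtain F G \<eta> \<epsilon> where FG: "linear_functor C ?D F" "linear_functor ?D C G"
    "natural_isomorphism C C id_functor (comp_functor G F) \<eta>"
    "natural_isomorphism ?D ?D (comp_functor F G) id_functor \<epsilon>"
    using assms(3) unfolding linearly_equivalent_def by blast
  let ?Fo = "on_obj F" and ?Go = "on_obj G"
  have Fo: "fd_module A (?Fo X)" if "X \<in> obj C" for X using FG(1) that by (auto simp: linear_functor_def fd_modules_def)
  have Go: "?Go N \<in> obj C" if "fd_module A N" for N using FG(2) that by (auto simp: linear_functor_def fd_modules_def)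
  have Fh: "on_hom F X Y f \<in> module_homs A (?Fo X) (?Fo Y)" if "X \<in> obj C" "Y \<in> obj C" "f \<in> hom C X Y" for X Y f
    using FG(1) that by (auto simp: linear_functor_def fd_modules_def)
  have Gh: "on_hom G M N f \<in> hom C (?Go M) (?Go N)" if "fd_module A M" "fd_module A N" "f \<in> module_homs A M N" for M N f
    using FG(2) that by (auto simp: linear_functor_def fd_modules_def)
  have eta: "\<exists>w\<in>hom C (?Go (?Fo X)) X. \<eta> X \<in> hom C X (?Go (?Fo X)) \<and> w \<cdot> \<eta> X = ident C X \<and> \<eta> X \<cdot> w = ident C (?Go (?Fo X))"
    if "X \<in> obj C" for X
    using FG(3) that by (auto simp: natural_isomorphism_def isomorphism_def id_functor_def comp_functor_def)
  have etan: "\<eta> Y \<cdot> f = on_hom G (?Fo X) (?Fo Y) (on_hom F X Y f) \<cdot> \<eta> X" if "X \<in> obj C" "Y \<in> obj C" "f \<in> hom C X Y" for X Y f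
    using FG(3) that by (auto simp: natural_isomorphism_def id_functor_def comp_functor_def)
  have eps: "\<exists>w\<in>module_homs A N (?Fo (?Go N)). \<epsilon> N \<in> module_homs A (?Fo (?Go N)) N \<and>
      w \<circ> \<epsilon> N = ident ?D (?Fo (?Go N)) \<and> \<epsilon> N \<circ> w = ident ?D N" if "fd_module A N" for N
    using FG(4) that by (auto simp: natural_isomorphism_def isomorphism_def id_functor_def comp_functor_def fd_modules_def)
  have epsn: "\<epsilon> N \<circ> on_hom F (?Go M) (?Go N) (on_hom G M N f) = f \<circ> \<epsilon> M"
    if "fd_module A M" "fd_module A N" "f \<in> module_homs A M N" for M N f
    using FG(4) that by (auto simp: natural_isomorphism_def id_functor_def comp_functor_def fd_modules_def)
  have Ginj: "f = g" if fg: "fd_module A M" "fd_module A N" "f \<in> module_homs A M N" "g \<in> module_homs A M N"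
    "on_hom G M N f = on_hom G M N g" for M N f g
  proof
    fix v
    have "f \<circ> \<epsilon> M = g \<circ> \<epsilon> M" using epsn[of M N f] epsn[of M N g] fg by simp
    moreover obtain w where "w \<in> module_homs A M (?Fo (?Go M))" "\<epsilon> M \<circ> w = ident ?D M" using eps[OF fg(1)] by blast
    ultimately have "f (ident ?D M v) = g (ident ?D M v)" by (metis comp_apply)
    then show "f v = g v" using homD(5)[OF fg(3)] homD(5)[OF fg(4)]
      by (cases "v \<in> mod_space M") (auto simp: fd_modules_def)
  qed
  have inj: "inj_on (on_hom F X Y) (hom C X Y)" if o: "X \<in> obj C" "Y \<in> obj C" for X Y
  proof (rule inj_onI)
    fix f g assume fg: "f \<in> hom C X Y" "g \<in> hom C X Y" "on_hom F X Y f = on_hom F X Y g"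
    then have e: "\<eta> Y \<cdot> f = \<eta> Y \<cdot> g" using etan[OF o, of f] etan[OF o, of g] by simp
    obtain w where t: "w \<in> hom C (?Go (?Fo Y)) Y" "\<eta> Y \<in> hom C Y (?Go (?Fo Y))" "w \<cdot> \<eta> Y = ident C Y" using eta[OF o(2)] by blast
    have "w \<cdot> (\<eta> Y \<cdot> h) = h" if "h \<in> hom C X Y" for h
      using comp_assoc[OF o Go[OF Fo[OF o(2)]] o(2) that t(2,1)] t(3) ident_comp[OF o that] by simp
    then show "f = g" using e fg by metis
  qed
  have surj: "\<exists>f\<in>hom C X Y. on_hom F X Y f = h" if o: "X \<in> obj C" "Y \<in> obj C" and h: "h \<in> module_homs A (?Fo X) (?Fo Y)" for X Y h
  proof -
    note oo = Go[OF Fo[OF o(1)]] Go[OF Fo[OF o(2)]]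
    obtain w where t: "w \<in> hom C (?Go (?Fo Y)) Y" "\<eta> Y \<in> hom C Y (?Go (?Fo Y))" "\<eta> Y \<cdot> w = ident C (?Go (?Fo Y))" using eta[OF o(2)] by blast
    obtain w' where t': "w' \<in> hom C (?Go (?Fo X)) X" "\<eta> X \<in> hom C X (?Go (?Fo X))" "\<eta> X \<cdot> w' = ident C (?Go (?Fo X))" using eta[OF o(1)] by blast
    let ?g = "on_hom G (?Fo X) (?Fo Y) h"
    have g: "?g \<in> hom C (?Go (?Fo X)) (?Go (?Fo Y))" using Gh[OF Fo[OF o(1)] Fo[OF o(2)] h] .
    have ge: "?g \<cdot> \<eta> X \<in> hom C X (?Go (?Fo Y))" using comp_in_hom[OF o(1) oo t'(2) g] .
    let ?f = "w \<cdot> (?g \<cdot> \<eta> X)"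
    have f: "?f \<in> hom C X Y" using comp_in_hom[OF o(1) oo(2) o(2) ge t(1)] .
    have "on_hom G (?Fo X) (?Fo Y) (on_hom F X Y ?f) \<cdot> \<eta> X = \<eta> Y \<cdot> ?f" using etan[OF o f] by simp
    also have "... = ?g \<cdot> \<eta> X" using comp_assoc[OF o(1) oo(2) o(2) oo(2) ge t(1,2)] t(3) ident_comp[OF o(1) oo(2) ge] by simp
    finally have e: "on_hom G (?Fo X) (?Fo Y) (on_hom F X Y ?f) \<cdot> \<eta> X = ?g \<cdot> \<eta> X" .
    have "(k \<cdot> \<eta> X) \<cdot> w' = k" if "k \<in> hom C (?Go (?Fo X)) (?Go (?Fo Y))" for k
      using comp_assoc[OF oo(1) o(1) oo t'(1,2) that] t'(3) comp_ident[OF oo that] by simp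
    then have "on_hom G (?Fo X) (?Fo Y) (on_hom F X Y ?f) = ?g"
      using e g Gh[OF Fo[OF o(1)] Fo[OF o(2)] Fh[OF o f]] by metis
    then have "on_hom F X Y ?f = h" using Ginj[OF Fo[OF o(1)] Fo[OF o(2)] Fh[OF o f] h] by blast
    then show ?thesis using f by blast
  qed
  have "module_model C A F"
  proof unfold_locales
    show "linear_functor C ?D F" by fact
    show "bij_betw (on_hom F X Y) (hom C X Y) (module_homs A (?Fo X) (?Fo Y))" if "X \<in> obj C" "Y \<in> obj C" for X Y
      unfolding bij_betw_def
    proof
      show "inj_on (on_hom F X Y) (hom C X Y)" using inj[OF that] .
      show "on_hom F X Y ` hom C X Y = module_homs A (?Fo X) (?Fo Y)"
      proof (rule set_eqI, rule iffI)
        show "h \<in> module_homs A (?Fo X) (?Fo Y)" if "h \<in> on_hom F X Y ` hom C X Y" for h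
          using that Fh[OF \<open>X \<in> obj C\<close> \<open>Y \<in> obj C\<close>] by blast
        show "h \<in> on_hom F X Y ` hom C X Y" if "h \<in> module_homs A (?Fo X) (?Fo Y)" for h
          using surj[OF \<open>X \<in> obj C\<close> \<open>Y \<in> obj C\<close> that] by blast
      qed
    qed
    fix N assume N: "fd_module A N"
    obtain w where t: "w \<in> module_homs A N (?Fo (?Go N))" "\<epsilon> N \<in> module_homs A (?Fo (?Go N)) N"
      "w \<circ> \<epsilon> N = ident ?D (?Fo (?Go N))" "\<epsilon> N \<circ> w = ident ?D N" using eps[OF N] by blast
    have "w (\<epsilon> N x) = x" if "x \<in> mod_space (?Fo (?Go N))" for x
      using fun_cong[OF t(3), of x] that by (simp add: fd_modules_def)
    moreover have "\<epsilon> N (w y) = y" if "y \<in> mod_space N" for y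
      using fun_cong[OF t(4), of y] that by (simp add: fd_modules_def)
    ultimately show "\<exists>X\<in>obj C. \<exists>u\<in>module_homs A (?Fo X) N. \<exists>v\<in>module_homs A N (?Fo X).
      (\<forall>x\<in>mod_space (?Fo X). v (u x) = x) \<and> (\<forall>y\<in>mod_space N. u (v y) = y)"
      using Go[OF N] t(1,2) by blast
  qed
  then show ?thesis by blast
qed

section \<open>Transfer of epimorphisms, monomorphisms, images and projectives from modules\<close>

context module_model
begin

abbreviation Fo :: "'o \<Rightarrow> 'k fd_mod" where "Fo \<equiv> on_obj F"
abbreviation Fs :: "'o \<Rightarrow> 'k sequence set" where "Fs X \<equiv> mod_space (Fo X)"

lemma Fo: "X \<in> obj C \<Longrightarrow> fd_module A (Fo X)"
  using F_linear by (auto simp: linear_functor_def fd_modules_def)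

lemma Fh:
  assumes "X \<in> obj C" "Y \<in> obj C" "f \<in> hom C X Y"
  shows "on_hom F X Y f \<in> module_homs A (Fo X) (Fo Y)"
    "g \<in> hom C X Y \<Longrightarrow> on_hom F X Y (f + g) = on_hom F X Y f + on_hom F X Y g"
    "on_hom F X Y (scale C c f) = fun_scale c (on_hom F X Y f)"
    "Z \<in> obj C \<Longrightarrow> h \<in> hom C Y Z \<Longrightarrow> on_hom F X Z (h \<cdot> f) = on_hom F Y Z h \<circ> on_hom F X Y f"
  using F_linear assms by (auto simp: linear_functor_def fd_modules_def fun_scale_def)

lemma F_full:
  assumes "X \<in> obj C" "Y \<in> obj C" "h \<in> module_homs A (Fo X) (Fo Y)"
  obtains f where "f \<in> hom C X Y" "on_hom F X Y f = h"
proof -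
  have "h \<in> on_hom F X Y ` hom C X Y" using full_faithful[OF assms(1,2)] assms(3) by (simp add: bij_betw_def)
  then show ?thesis using that by blast
qed

lemma F_faithful:
  assumes "X \<in> obj C" "Y \<in> obj C" "f \<in> hom C X Y" "g \<in> hom C X Y" "on_hom F X Y f = on_hom F X Y g"
  shows "f = g"
  using full_faithful[OF assms(1,2)] assms(3-5) by (auto simp: bij_betw_def inj_on_def)

lemma F_hom_fin_dim:
  assumes "X \<in> obj C" "Y \<in> obj C"
  shows "fin_dim (scale C) (hom C X Y)"
proof -
  interpret ambient_space_pair "scale C" fun_scale
    by (simp add: ambient_space_pair_def vector_space_pair_def ambient_vector_space vector_space_fun_scale)
  show ?thesis
  proof (rule fin_dim_inj[OF hom_subspace[OF assms]])
    show "inj_on (on_hom F X Y) (hom C X Y)" using full_faithful[OF assms] by (simp add: bij_betw_def)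
    show "fin_dim fun_scale (on_hom F X Y ` hom C X Y)"
      using full_faithful[OF assms] homs_fin_dim[OF Fo Fo] assms by (simp add: bij_betw_def)
  qed (use Fh[OF assms] in auto)
qed

lemma hom_ext:
  assumes "f \<in> module_homs A M N" "g \<in> module_homs A M N'" "\<And>v. v \<in> mod_space M \<Longrightarrow> f v = g v"
  shows "f = g"
proof
  show "f v = g v" for v
    using assms(3)[of v] homD(5)[OF assms(1), of v] homD(5)[OF assms(2), of v] by (cases "v \<in> mod_space M") auto
qed

lemma homs_comp:
  assumes "f \<in> module_homs A L M" "g \<in> module_homs A M N" "fd_module A M"
  shows "g \<circ> f \<in> module_homs A L N"
  using homD[OF assms(1)] homD[OF assms(2)] hom_zero[OF assms(3,2)] by (auto simp: module_homs_def)

text \<open>If the image were a proper submodule, the projection to the quotient would be a non-zero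
  map that vanishes after \<open>e\<close>. Essential surjectivity moves the quotient into the image
  of the functor, where \<open>e\<close> can be cancelled.\<close>

lemma epi_surj:
  assumes o: "X \<in> obj C" "Y \<in> obj C" and e: "epimorphism C X Y e"
  shows "on_hom F X Y e ` Fs X = Fs Y"
proof (rule ccontr)
  assume ne: "on_hom F X Y e ` Fs X \<noteq> Fs Y"
  have e': "e \<in> hom C X Y" using e by (simp add: epimorphism_def)
  note im = image_subspace[OF Fo[OF o(1)] Fo[OF o(2)] Fh(1)[OF o e']]
  obtain Q g where Q: "fd_module A Q" "g \<in> module_homs A (Fo Y) Q" "g \<noteq> 0" "\<And>v. v \<in> on_hom F X Y e ` Fs X \<Longrightarrow> g v = 0"
    using quotient[OF Fo[OF o(2)] im(1,2) ne im(3)] by metis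
  obtain Z u v where Z: "Z \<in> obj C" "u \<in> module_homs A (Fo Z) Q" "v \<in> module_homs A Q (Fo Z)" "\<forall>y\<in>mod_space Q. u (v y) = y"
    using ess_surj[OF Q(1)] by blast
  have "v \<circ> g \<in> module_homs A (Fo Y) (Fo Z)" using homs_comp[OF Q(2) Z(3) Q(1)] .
  then obtain h where h: "h \<in> hom C Y Z" "on_hom F Y Z h = v \<circ> g" using F_full[OF o(2) Z(1)] by blast
  have z: "0 \<in> hom C X Z" "0 \<in> hom C Y Z" using linear_category.hom_zero[OF linear_category_axioms] o Z by auto
  have Fz: "on_hom F X' Z 0 = 0" if "X' \<in> obj C" "0 \<in> hom C X' Z" for X'
    using Fh(2)[OF that(1) Z(1) that(2) that(2)] by simp
  have "on_hom F X Z (h \<cdot> e) = 0"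
  proof
    fix x
    have "g (on_hom F X Y e x) = 0"
      using Q(4) homD(5)[OF Fh(1)[OF o e'], of x] hom_zero[OF Fo[OF o(2)] Q(2)] by (cases "x \<in> Fs X") auto
    then show "on_hom F X Z (h \<cdot> e) x = 0 x"
      using Fh(4)[OF o e' Z(1) h(1)] h(2) hom_zero[OF Q(1) Z(3)] by simp
  qed
  then have "h \<cdot> e = 0"
    using F_faithful[OF o(1) Z(1) comp_in_hom[OF o Z(1) e' h(1)] z(1)] Fz[OF o(1) z(1)] by simp
  also have "0 = 0 \<cdot> e" using comp_zero(1)[OF o Z(1) e'] by simp
  finally have "h = 0" using e h(1) z(2) Z(1) by (auto simp: epimorphism_def)
  then have vg: "v \<circ> g = 0" using h(2) Fz[OF o(2) z(2)] by simp
  have "g = 0"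
  proof
    fix y
    show "g y = 0 y"
    proof (cases "y \<in> Fs Y")
      case True
      have "g y = u (v (g y))" using Z(4) homD(1)[OF Q(2) True] by simp
      also have "... = u ((v \<circ> g) y)" by simp
      also have "... = 0" unfolding vg using hom_zero[OF Fo[OF Z(1)] Z(2)] by simp
      finally show ?thesis by simp
    next
      case False
      then show ?thesis using homD(5)[OF Q(2)] by simp
    qed
  qed
  then show False using Q(3) by blast
qed

lemma surj_epi:
  assumes o: "X \<in> obj C" "Y \<in> obj C" and e: "e \<in> hom C X Y" "on_hom F X Y e ` Fs X = Fs Y"
  shows "epimorphism C X Y e"
  unfolding epimorphism_def
proof (intro conjI ballI impI)
  show "e \<in> hom C X Y" by fact
  fix Z g h assume Z: "Z \<in> obj C" "g \<in> hom C Y Z" "h \<in> hom C Y Z" and eq: "g \<cdot> e = h \<cdot> e"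
  show "g = h"
  proof (rule F_faithful[OF o(2) Z], rule hom_ext[OF Fh(1)[OF o(2) Z(1,2)] Fh(1)[OF o(2) Z(1,3)]])
    fix y assume "y \<in> Fs Y"
    then obtain x where x: "y = on_hom F X Y e x" using e(2) by blast
    have "on_hom F Y Z g \<circ> on_hom F X Y e = on_hom F Y Z h \<circ> on_hom F X Y e"
      using Fh(4)[OF o e(1) Z(1)] Z eq by metis
    then show "on_hom F Y Z g y = on_hom F Y Z h y" using x by (metis comp_apply)
  qed
qed

text \<open>The kernel, as a module, is isomorphic to the image of some object; its inclusion
  vanishes after \<open>i\<close> and is therefore zero.\<close>

lemma mono_inj:
  assumes o: "X \<in> obj C" "Y \<in> obj C" and i: "monomorphism C X Y i"
  shows "inj_on (on_hom F X Y i) (Fs X)"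
proof -
  have i': "i \<in> hom C X Y" using i by (simp add: monomorphism_def)
  note FX = Fo[OF o(1)] and FY = Fo[OF o(2)] and h = homD[OF Fh(1)[OF o i']]
  let ?f = "on_hom F X Y i"
  let ?K = "{x \<in> Fs X. ?f x = 0}"
  note D = fd_moduleD[OF FX] and D' = fd_moduleD[OF FY]
  have K0: "mod_act (Fo Y) a 0 = 0" if "a \<in> alg_space A" for a
    using D'(6)[OF that, of 0 0] seq.subspace_0[OF D'(1)] by simp
  have K: "fd_module A \<lparr>mod_space = ?K, mod_act = mod_act (Fo X)\<rparr>"
    using h hom_zero[OF FX Fh(1)[OF o i']] D K0
    by (intro submodule[OF FX]) (auto intro!: seq.subspaceI simp: seq.subspace_0 seq.subspace_add seq.subspace_scale)
  let ?M = "\<lparr>mod_space = ?K, mod_act = mod_act (Fo X)\<rparr>"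
  have inc: "(\<lambda>x. if x \<in> mod_space ?M then x else 0) \<in> module_homs A ?M (Fo X)"
    by (rule homI) (use fd_moduleD[OF K] in auto)
  obtain Z u v where Z: "Z \<in> obj C" "u \<in> module_homs A (Fo Z) ?M" "v \<in> module_homs A ?M (Fo Z)" "\<forall>y\<in>mod_space ?M. u (v y) = y"
    using ess_surj[OF K] by blast
  have "(\<lambda>x. if x \<in> mod_space ?M then x else 0) \<circ> u \<in> module_homs A (Fo Z) (Fo X)" by (rule homs_comp[OF Z(2) inc K])
  then obtain k where k: "k \<in> hom C Z X" "on_hom F Z X k = (\<lambda>x. if x \<in> mod_space ?M then x else 0) \<circ> u"
    using F_full[OF Z(1) o(1)] by blast
  have z: "0 \<in> hom C Z Y" "0 \<in> hom C Z X" using linear_category.hom_zero[OF linear_category_axioms] o Z by auto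
  have Fz: "on_hom F Z X' 0 = 0" if "X' \<in> obj C" "0 \<in> hom C Z X'" for X'
    using Fh(2)[OF Z(1) that(1) that(2) that(2)] by simp
  have "on_hom F Z Y (i \<cdot> k) = 0"
  proof
    fix x
    show "on_hom F Z Y (i \<cdot> k) x = 0 x"
      using Fh(4)[OF Z(1) o(1) k(1) o(2) i'] k(2) hom_zero[OF FX Fh(1)[OF o i']] homD(1)[OF Z(2), of x] homD(5)[OF Z(2), of x]
      by (cases "x \<in> Fs Z") auto
  qed
  then have "i \<cdot> k = 0"
    using F_faithful[OF Z(1) o(2) comp_in_hom[OF Z(1) o k(1) i'] z(1)] Fz[OF o(2) z(1)] by simp
  also have "0 = i \<cdot> 0" using comp_zero(2)[OF Z(1) o i'] by simp
  finally have "k = 0" using i k(1) z(2) Z(1) by (auto simp: monomorphism_def)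
  then have ku: "(\<lambda>x. if x \<in> mod_space ?M then x else 0) \<circ> u = 0" using k(2) Fz[OF o(1) z(2)] by simp
  have zero: "x = 0" if x: "x \<in> ?K" for x
  proof -
    have "x = ((\<lambda>x. if x \<in> mod_space ?M then x else 0) \<circ> u) (v x)" using Z(4) x by simp
    then show ?thesis unfolding ku by simp
  qed
  show ?thesis
  proof (rule inj_onI)
    fix x y assume xy: "x \<in> Fs X" "y \<in> Fs X" "?f x = ?f y"
    have "x - y \<in> ?K" using xy hom_diff[OF FX Fh(1)[OF o i'] xy(1,2)] seq.subspace_diff[OF D(1)] by simp
    then show "x = y" using zero by force
  qed
qed

lemma inj_mono:
  assumes o: "X \<in> obj C" "Y \<in> obj C" and i: "i \<in> hom C X Y" "inj_on (on_hom F X Y i) (Fs X)"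
  shows "monomorphism C X Y i"
  unfolding monomorphism_def
proof (intro conjI ballI impI)
  show "i \<in> hom C X Y" by fact
  fix W g h assume W: "W \<in> obj C" "g \<in> hom C W X" "h \<in> hom C W X" and eq: "i \<cdot> g = i \<cdot> h"
  show "g = h"
  proof (rule F_faithful[OF W(1) o(1) W(2,3)], rule hom_ext[OF Fh(1)[OF W(1) o(1) W(2)] Fh(1)[OF W(1) o(1) W(3)]])
    fix y assume y: "y \<in> Fs W"
    have "on_hom F X Y i \<circ> on_hom F W X g = on_hom F X Y i \<circ> on_hom F W X h"
      using Fh(4)[OF W(1) o(1) _ o(2) i(1)] W eq by metis
    then have "on_hom F X Y i (on_hom F W X g y) = on_hom F X Y i (on_hom F W X h y)" by (metis comp_apply)
    then show "on_hom F W X g y = on_hom F W X h y"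
      using i(2) homD(1)[OF Fh(1)[OF W(1) o(1) W(2)] y] homD(1)[OF Fh(1)[OF W(1) o(1) W(3)] y] by (auto simp: inj_on_def)
  qed
qed

lemma image_factorization:
  assumes o: "X \<in> obj C" "Y \<in> obj C" and f: "f \<in> hom C X Y"
  shows "\<exists>J\<in>obj C. \<exists>p i. epimorphism C X J p \<and> monomorphism C J Y i \<and> i \<cdot> p = f"
proof -
  let ?f = "on_hom F X Y f"
  let ?M = "\<lparr>mod_space = ?f ` Fs X, mod_act = mod_act (Fo Y)\<rparr>"
  note FX = Fo[OF o(1)] and FY = Fo[OF o(2)]
  note im = image_subspace[OF FX FY Fh(1)[OF o f]] and h = homD[OF Fh(1)[OF o f]]
  have K: "fd_module A ?M" by (rule submodule[OF FY im])
  have f1: "?f \<in> module_homs A (Fo X) ?M" using h by (auto simp: module_homs_def)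
  have inc: "(\<lambda>x. if x \<in> mod_space ?M then x else 0) \<in> module_homs A ?M (Fo Y)"
    by (rule homI) (use fd_moduleD[OF K] im(2) in auto)
  obtain J u v where J: "J \<in> obj C" "u \<in> module_homs A (Fo J) ?M" "v \<in> module_homs A ?M (Fo J)"
     "\<forall>x\<in>Fs J. v (u x) = x" "\<forall>y\<in>mod_space ?M. u (v y) = y"
    using ess_surj[OF K] by blast
  obtain p where p: "p \<in> hom C X J" "on_hom F X J p = v \<circ> ?f"
    using F_full[OF o(1) J(1) homs_comp[OF f1 J(3) K]] by blast
  obtain i where i: "i \<in> hom C J Y" "on_hom F J Y i = (\<lambda>x. if x \<in> mod_space ?M then x else 0) \<circ> u"
    using F_full[OF J(1) o(2) homs_comp[OF J(2) inc K]] by blast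
  have "epimorphism C X J p"
  proof (rule surj_epi[OF o(1) J(1) p(1)], rule set_eqI, rule iffI)
    show "y \<in> Fs J" if "y \<in> on_hom F X J p ` Fs X" for y using that homD(1)[OF Fh(1)[OF o(1) J(1) p(1)]] by blast
    fix y assume y: "y \<in> Fs J"
    then have "u y \<in> ?f ` Fs X" using homD(1)[OF J(2)] by simp
    then obtain x where "x \<in> Fs X" "u y = ?f x" by blast
    then show "y \<in> on_hom F X J p ` Fs X" using p(2) J(4) y by (metis comp_apply imageI)
  qed
  moreover have "monomorphism C J Y i"
  proof (rule inj_mono[OF J(1) o(2) i(1)], rule inj_onI)
    fix x y assume xy: "x \<in> Fs J" "y \<in> Fs J" "on_hom F J Y i x = on_hom F J Y i y"
    then have "u x = u y" using i(2) homD(1)[OF J(2)] by simp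
    then show "x = y" using J(4) xy by metis
  qed
  moreover have "i \<cdot> p = f"
  proof (rule F_faithful[OF o comp_in_hom[OF o(1) J(1) o(2) p(1) i(1)] f],
      rule hom_ext[OF Fh(1)[OF o comp_in_hom[OF o(1) J(1) o(2) p(1) i(1)]] Fh(1)[OF o f]])
    fix x assume "x \<in> Fs X"
    then show "on_hom F X Y (i \<cdot> p) x = ?f x"
      using Fh(4)[OF o(1) J(1) p(1) o(2) i(1)] p(2) i(2) J(5) by simp
  qed
  ultimately show ?thesis using J(1) by blast
qed

text \<open>Elements of the target of \<open>e\<close> lift along it, and injectivity of
  \<open>i\<close> makes the resulting value in \<open>U\<close> unique; uniqueness also gives
  linearity.\<close>

lemma diagonal:
  assumes o: "X \<in> obj C" "Y \<in> obj C" "U \<in> obj C" "W \<in> obj C"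
    and e: "epimorphism C X Y e" and i: "monomorphism C U W i"
    and s: "s \<in> hom C X U" and t: "t \<in> hom C Y W" and eq: "i \<cdot> s = t \<cdot> e"
  shows "\<exists>d\<in>hom C Y U. d \<cdot> e = s \<and> i \<cdot> d = t"
proof -
  have e': "e \<in> hom C X Y" and i': "i \<in> hom C U W" using e i by (auto simp: epimorphism_def monomorphism_def)
  let ?e = "on_hom F X Y e" and ?i = "on_hom F U W i" and ?s = "on_hom F X U s" and ?t = "on_hom F Y W t"
  note he = Fh(1)[OF o(1,2) e'] and hi = Fh(1)[OF o(3,4) i'] and hs = Fh(1)[OF o(1,3) s] and ht = Fh(1)[OF o(2,4) t]
  note surj = epi_surj[OF o(1,2) e] and inj = mono_inj[OF o(3,4) i]
  have sq: "?i (?s x) = ?t (?e x)" for x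
    using Fh(4)[OF o(1,3) s o(4) i'] Fh(4)[OF o(1,2) e' o(4) t] eq by (metis comp_apply)
  have "\<exists>d. \<forall>y\<in>Fs Y. d y \<in> Fs U \<and> ?i (d y) = ?t y"
  proof (intro bchoice ballI)
    fix y assume "y \<in> Fs Y"
    then obtain x where "x \<in> Fs X" "y = ?e x" using surj by blast
    then show "\<exists>u. u \<in> Fs U \<and> ?i u = ?t y" using sq homD(1)[OF hs] by metis
  qed
  then obtain d where d: "\<And>y. y \<in> Fs Y \<Longrightarrow> d y \<in> Fs U" "\<And>y. y \<in> Fs Y \<Longrightarrow> ?i (d y) = ?t y" by blast
  note DY = fd_moduleD[OF Fo[OF o(2)]] and DU = fd_moduleD[OF Fo[OF o(3)]]
  let ?d = "\<lambda>y. if y \<in> Fs Y then d y else 0"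
  have uniq: "u = v" if "u \<in> Fs U" "v \<in> Fs U" "?i u = ?i v" for u v using inj that by (auto simp: inj_on_def)
  have hd: "?d \<in> module_homs A (Fo Y) (Fo U)"
  proof (rule homI[OF DY(1) DY(3)])
    show "d v \<in> Fs U" if "v \<in> Fs Y" for v using d(1)[OF that] .
    show "d (v + w) = d v + d w" if vw: "v \<in> Fs Y" "w \<in> Fs Y" for v w
    proof (rule uniq)
      have vw': "v + w \<in> Fs Y" by (rule seq.subspace_add[OF DY(1) vw])
      show "d (v + w) \<in> Fs U" using d(1)[OF vw'] .
      show "d v + d w \<in> Fs U" by (rule seq.subspace_add[OF DU(1) d(1)[OF vw(1)] d(1)[OF vw(2)]])
      show "?i (d (v + w)) = ?i (d v + d w)"
        unfolding d(2)[OF vw'] homD(2)[OF hi d(1)[OF vw(1)] d(1)[OF vw(2)]] d(2)[OF vw(1)] d(2)[OF vw(2)]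
        by (rule homD(2)[OF ht vw])
    qed
    show "d (seq_scale c v) = seq_scale c (d v)" if v: "v \<in> Fs Y" for c v
    proof (rule uniq)
      have v': "seq_scale c v \<in> Fs Y" by (rule seq.subspace_scale[OF DY(1) v])
      show "d (seq_scale c v) \<in> Fs U" using d(1)[OF v'] .
      show "seq_scale c (d v) \<in> Fs U" by (rule seq.subspace_scale[OF DU(1) d(1)[OF v]])
      show "?i (d (seq_scale c v)) = ?i (seq_scale c (d v))"
        unfolding d(2)[OF v'] homD(3)[OF hi d(1)[OF v]] d(2)[OF v] by (rule homD(3)[OF ht v])
    qed
    show "d (mod_act (Fo Y) a v) = mod_act (Fo U) a (d v)" if a: "a \<in> alg_space A" and v: "v \<in> Fs Y" for a v
    proof (rule uniq)
      have v': "mod_act (Fo Y) a v \<in> Fs Y" by (rule DY(3)[OF a v])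
      show "d (mod_act (Fo Y) a v) \<in> Fs U" using d(1)[OF v'] .
      show "mod_act (Fo U) a (d v) \<in> Fs U" by (rule DU(3)[OF a d(1)[OF v]])
      show "?i (d (mod_act (Fo Y) a v)) = ?i (mod_act (Fo U) a (d v))"
        unfolding d(2)[OF v'] homD(4)[OF hi a d(1)[OF v]] d(2)[OF v] by (rule homD(4)[OF ht a v])
    qed
  qed
  obtain k where k: "k \<in> hom C Y U" "on_hom F Y U k = ?d" using F_full[OF o(2,3) hd] by blast
  have "k \<cdot> e = s"
  proof (rule F_faithful[OF o(1,3) comp_in_hom[OF o(1-3) e' k(1)] s],
      rule hom_ext[OF Fh(1)[OF o(1,3) comp_in_hom[OF o(1-3) e' k(1)]] hs])
    fix x assume x: "x \<in> Fs X"
    have ex: "?e x \<in> Fs Y" using homD(1)[OF he x] .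
    have "d (?e x) = ?s x"
      by (rule uniq) (use d(1,2)[OF ex] homD(1)[OF hs x] sq in auto)
    then show "on_hom F X U (k \<cdot> e) x = ?s x" using Fh(4)[OF o(1,2) e' o(3) k(1)] k(2) ex by simp
  qed
  moreover have "i \<cdot> k = t"
  proof (rule F_faithful[OF o(2,4) comp_in_hom[OF o(2,3,4) k(1) i'] t],
      rule hom_ext[OF Fh(1)[OF o(2,4) comp_in_hom[OF o(2,3,4) k(1) i']] ht])
    fix y assume y: "y \<in> Fs Y"
    then show "on_hom F Y W (i \<cdot> k) y = ?t y" using Fh(4)[OF o(2,3) k(1) o(4) i'] k(2) d(2)[OF y] by simp
  qed
  ultimately show ?thesis using k(1) by blast
qed

text \<open>The object modelling the regular module: maps out of it are elements of the target, so
  they lift along surjections and detect non-zero modules. The image of the algebra unit,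
  \<open>v (alg_one A)\<close>, is the generating element.\<close>

lemma projective_generator:
  "\<exists>P\<in>obj C. projective_object C P \<and> (\<forall>V\<in>obj C. ident C V \<noteq> 0 \<longrightarrow> (\<exists>x\<in>hom C P V. x \<noteq> 0))"
proof -
  let ?R = "\<lparr>mod_space = alg_space A, mod_act = alg_mult A\<rparr>"
  note DR = fd_moduleD[OF regular_module]
  obtain P u v where P: "P \<in> obj C" "u \<in> module_homs A (Fo P) ?R" "v \<in> module_homs A ?R (Fo P)"
     "\<forall>x\<in>Fs P. v (u x) = x" "\<forall>y\<in>mod_space ?R. u (v y) = y"
    using ess_surj[OF regular_module] by blast
  have one: "alg_mult A a (alg_one A) = a" if "a \<in> alg_space A" for a using alg that by (simp add: fd_algebra_def)
  have from_R: "(\<lambda>a. if a \<in> mod_space ?R then mod_act N a n else 0) \<in> module_homs A ?R N"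
    if N: "fd_module A N" "n \<in> mod_space N" for N n
    by (rule homI) (use DR fd_moduleD[OF N(1)] N(2) in auto)
  have vone: "v (alg_one A) \<in> Fs P" using homD(1)[OF P(3)] by simp
  have uP: "u x \<in> alg_space A" if "x \<in> Fs P" for x using homD(1)[OF P(2) that] by simp
  have v_act: "v a = mod_act (Fo P) a (v (alg_one A))" if "a \<in> alg_space A" for a
    using homD(4)[OF P(3) that, of "alg_one A"] one[OF that] by simp
  have "projective_object C P"
    unfolding projective_object_def
  proof (intro conjI ballI allI impI)
    show "P \<in> obj C" by fact
    fix X Y e f assume o: "X \<in> obj C" "Y \<in> obj C" and e: "epimorphism C X Y e" and f: "f \<in> hom C P Y"
    have e': "e \<in> hom C X Y" using e by (simp add: epimorphism_def)
    let ?f = "on_hom F P Y f" and ?e = "on_hom F X Y e"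
    note hf = Fh(1)[OF P(1) o(2) f] and he = Fh(1)[OF o e']
    have "?f (v (alg_one A)) \<in> Fs Y" using homD(1)[OF hf vone] .
    then obtain x where x: "x \<in> Fs X" "?e x = ?f (v (alg_one A))" using epi_surj[OF o e] by (metis imageE)
    let ?g = "(\<lambda>a. if a \<in> mod_space ?R then mod_act (Fo X) a x else 0) \<circ> u"
    have hg: "?g \<in> module_homs A (Fo P) (Fo X)"
      by (rule homs_comp[OF P(2) from_R[OF Fo[OF o(1)] x(1)] regular_module])
    obtain g where g: "g \<in> hom C P X" "on_hom F P X g = ?g" using F_full[OF P(1) o(1) hg] by blast
    have "e \<cdot> g = f"
    proof (rule F_faithful[OF P(1) o(2) comp_in_hom[OF P(1) o g(1) e'] f],
      rule hom_ext[OF Fh(1)[OF P(1) o(2) comp_in_hom[OF P(1) o g(1) e']] hf])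
      fix y assume y: "y \<in> Fs P"
      have "on_hom F P Y (e \<cdot> g) y = ?e (mod_act (Fo X) (u y) x)"
        using Fh(4)[OF P(1) o(1) g(1) o(2) e'] g(2) uP[OF y] by simp
      also have "... = mod_act (Fo Y) (u y) (?f (v (alg_one A)))"
        using homD(4)[OF he uP[OF y] x(1)] x(2) by simp
      also have "... = ?f (mod_act (Fo P) (u y) (v (alg_one A)))" using homD(4)[OF hf uP[OF y] vone] by simp
      also have "... = ?f y" using v_act[OF uP[OF y]] P(4) y by simp
      finally show "on_hom F P Y (e \<cdot> g) y = ?f y" .
    qed
    then show "\<exists>g\<in>hom C P X. e \<cdot> g = f" using g(1) by blast
  qed
  moreover have "\<exists>x\<in>hom C P V. x \<noteq> 0" if V: "V \<in> obj C" "ident C V \<noteq> 0" for V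
  proof -
    have "\<exists>n\<in>Fs V. n \<noteq> 0"
    proof (rule ccontr)
      assume *: "\<not> (\<exists>n\<in>Fs V. n \<noteq> 0)"
      have z: "0 \<in> hom C V V" using linear_category.hom_zero[OF linear_category_axioms] V by auto
      have "ident C V = 0"
        by (rule F_faithful[OF V(1) V(1) ident_in_hom[OF V(1)] z],
            rule hom_ext[OF Fh(1)[OF V(1) V(1) ident_in_hom[OF V(1)]] Fh(1)[OF V(1) V(1) z]])
          (use * homD(1)[OF Fh(1)[OF V(1) V(1) ident_in_hom[OF V(1)]]] homD(1)[OF Fh(1)[OF V(1) V(1) z]] in metis)
      then show False using V(2) by blast
    qed
    then obtain n where n: "n \<in> Fs V" "n \<noteq> 0" by blast
    let ?g = "(\<lambda>a. if a \<in> mod_space ?R then mod_act (Fo V) a n else 0) \<circ> u"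
    have hg: "?g \<in> module_homs A (Fo P) (Fo V)"
      by (rule homs_comp[OF P(2) from_R[OF Fo[OF V(1)] n(1)] regular_module])
    obtain g where g: "g \<in> hom C P V" "on_hom F P V g = ?g" using F_full[OF P(1) V(1) hg] by blast
    have "u (v (alg_one A)) = alg_one A" using P(5) by simp
    then have "?g (v (alg_one A)) = n" using fd_moduleD(8)[OF Fo[OF V(1)] n(1)] by simp
    then have ne: "on_hom F P V g \<noteq> 0" using n(2) g(2) zero_fun_apply[of "v (alg_one A)"] by metis
    have z: "0 \<in> hom C P V" using linear_category.hom_zero[OF linear_category_axioms] V P by auto
    have "on_hom F P V 0 = 0" using Fh(2)[OF P(1) V(1) z z] by simp
    then show ?thesis using ne g(1) by metis
  qed
  ultimately show ?thesis using P(1) by blast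
qed

end

declare eval_nat_numeral [simp]

section \<open>Projective objects in finite tensor categories\<close>

definition injective_object :: "('o, 'm, 'k, 'x) lincat_scheme \<Rightarrow> 'o \<Rightarrow> bool" where
  "injective_object C Q \<longleftrightarrow> projective_object (op_cat C) Q"

lemma op_epimorphism: "epimorphism (op_cat C) Y X i \<longleftrightarrow> monomorphism C X Y i"
  by (simp add: epimorphism_def monomorphism_def)

lemma injective_iff: "injective_object C Q \<longleftrightarrow> Q \<in> obj C \<and>
     (\<forall>X\<in>obj C. \<forall>Y\<in>obj C. \<forall>i. monomorphism C X Y i \<longrightarrow> (\<forall>f\<in>hom C X Q. \<exists>g\<in>hom C Y Q. g \<cdot>\<^bsub>C\<^esub> i = f))"
  unfolding injective_object_def projective_object_def op_epimorphism op_cat_simps by blast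

section \<open>Retracts and splittings\<close>

context linear_category
begin

lemma projective_lift: "projective_object C P \<Longrightarrow> X \<in> obj C \<Longrightarrow> Y \<in> obj C \<Longrightarrow> epimorphism C X Y e \<Longrightarrow>
    f \<in> hom C P Y \<Longrightarrow> \<exists>g\<in>hom C P X. e \<cdot> g = f"
  by (simp add: projective_object_def)

lemma projective_retract:
  assumes P: "projective_object C P" and Q: "Q \<in> obj C" and i: "i \<in> hom C Q P" and p: "p \<in> hom C P Q"
    and pi: "p \<cdot> i = ident C Q"
  shows "projective_object C Q"
  unfolding projective_object_def
proof (intro conjI ballI allI impI)
  show "Q \<in> obj C" by fact
  fix X Y e f assume o: "X \<in> obj C" "Y \<in> obj C" and e: "epimorphism C X Y e" and f: "f \<in> hom C Q Y"
  have Po: "P \<in> obj C" using P by (simp add: projective_object_def)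
  have e': "e \<in> hom C X Y" using e by (simp add: epimorphism_def)
  obtain g where g: "g \<in> hom C P X" "e \<cdot> g = f \<cdot> p"
    using projective_lift[OF P o e comp_in_hom[OF Po Q o(2) p f]] by blast
  have "e \<cdot> (g \<cdot> i) = (f \<cdot> p) \<cdot> i" using comp_assoc[OF Q Po o i g(1) e'] g(2) by simp
  also have "... = f" using comp_assoc[OF Q Po Q o(2) i p f] pi comp_ident[OF Q o(2) f] by simp
  finally show "\<exists>g\<in>hom C Q X. e \<cdot> g = f" using comp_in_hom[OF Q Po o(1) i g(1)] by blast
qed

lemma injective_retract:
  assumes "injective_object C P" "Q \<in> obj C" "i \<in> hom C Q P" "p \<in> hom C P Q" "p \<cdot> i = ident C Q"
  shows "injective_object C Q"
  using linear_category.projective_retract[OF op_linear, of P Q p i] assms by (simp add: injective_object_def)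

lemma epi_hom: "epimorphism C X Y e \<Longrightarrow> e \<in> hom C X Y"
  and mono_hom: "monomorphism C X Y e \<Longrightarrow> e \<in> hom C X Y"
  by (simp_all add: epimorphism_def monomorphism_def)

lemma epi_cancel:
  "epimorphism C X Y e \<Longrightarrow> Z \<in> obj C \<Longrightarrow> g \<in> hom C Y Z \<Longrightarrow> h \<in> hom C Y Z \<Longrightarrow> g \<cdot> e = h \<cdot> e \<Longrightarrow> g = h"
  by (simp add: epimorphism_def)

lemma mono_cancel:
  "monomorphism C X Y i \<Longrightarrow> W \<in> obj C \<Longrightarrow> g \<in> hom C W X \<Longrightarrow> h \<in> hom C W X \<Longrightarrow> i \<cdot> g = i \<cdot> h \<Longrightarrow> g = h"
  by (simp add: monomorphism_def)

lemma epi_comp: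
  assumes o: "X \<in> obj C" "Y \<in> obj C" "Z \<in> obj C" and f: "epimorphism C X Y f" and g: "epimorphism C Y Z g"
  shows "epimorphism C X Z (g \<cdot> f)"
  unfolding epimorphism_def
proof (intro conjI ballI impI)
  note f' = epi_hom[OF f] and g' = epi_hom[OF g]
  show "g \<cdot> f \<in> hom C X Z" by (rule comp_in_hom[OF o f' g'])
  fix W h k assume W: "W \<in> obj C" and h: "h \<in> hom C Z W" and k: "k \<in> hom C Z W" and eq: "h \<cdot> (g \<cdot> f) = k \<cdot> (g \<cdot> f)"
  have "(h \<cdot> g) \<cdot> f = (k \<cdot> g) \<cdot> f"
    unfolding comp_assoc[OF o W f' g' h] comp_assoc[OF o W f' g' k] by fact
  then have "h \<cdot> g = k \<cdot> g" by (rule epi_cancel[OF f W comp_in_hom[OF o(2,3) W g' h] comp_in_hom[OF o(2,3) W g' k]])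
  then show "h = k" by (rule epi_cancel[OF g W h k])
qed

lemma split_epi:
  assumes o: "X \<in> obj C" "Y \<in> obj C" and f: "f \<in> hom C X Y" and s: "s \<in> hom C Y X" and fs: "f \<cdot> s = ident C Y"
  shows "epimorphism C X Y f"
  unfolding epimorphism_def
proof (intro conjI ballI impI)
  show "f \<in> hom C X Y" by fact
  fix W h k assume W: "W \<in> obj C" and h: "h \<in> hom C Y W" and k: "k \<in> hom C Y W" and eq: "h \<cdot> f = k \<cdot> f"
  have "h = (h \<cdot> f) \<cdot> s" unfolding comp_assoc[OF o(2,1,2) W s f h] fs comp_ident[OF o(2) W h] ..
  also have "... = k" unfolding eq comp_assoc[OF o(2,1,2) W s f k] fs comp_ident[OF o(2) W k] ..
  finally show "h = k" .
qed

lemma epi_split: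
  assumes "projective_object C Y" "X \<in> obj C" "epimorphism C X Y e"
  obtains s where "s \<in> hom C Y X" "e \<cdot> s = ident C Y"
  using projective_lift[OF assms(1,2) _ assms(3) ident_in_hom] assms(1) that by (auto simp: projective_object_def)

lemma mono_split:
  assumes "injective_object C X" "Y \<in> obj C" "monomorphism C X Y i"
  obtains s where "s \<in> hom C Y X" "s \<cdot> i = ident C X"
  using linear_category.epi_split[OF op_linear, of X Y i] assms that by (auto simp: injective_object_def op_epimorphism)

end

section \<open>Tensoring with a dualizable object\<close>

context linear_monoidal_category
begin

lemma epi_cancel_diagram:
  assumes e: "epimorphism C X Y e" and o: "X \<in> obj C" "Y \<in> obj C"
    and d: "deq [X] ((0, [X], [Y], e) # d) ((0, [X], [Y], e) # d')" "ok [Y] d" "ok [Y] d'" "run [Y] d = run [Y] d'"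
  shows "deq [Y] d d'"
proof -
  have b: "box ([X], [Y], e)" using epi_hom[OF e] o by (simp add: box_def)
  have "sem [Y] d \<cdot> e = sem [Y] d' \<cdot> e"
    using d(1) layer_box(1)[OF b] by (simp add: deq_def sem.simps(2))
  then have "sem [Y] d = sem [Y] d'"
    using epi_cancel[OF e, of "tens (run [Y] d)" "sem [Y] d" "sem [Y] d'"] sem_in_hom[OF d(2)] sem_in_hom[OF d(3)] run_obj[OF d(2)] d(4) o
    by simp
  then show ?thesis using d by (simp add: deq_def)
qed

lemma mono_cancel_diagram:
  assumes i: "monomorphism C X Y i" and o: "X \<in> obj C" "Y \<in> obj C"
    and d: "deq w (d @ [(0, [X], [Y], i)]) (d' @ [(0, [X], [Y], i)])" "run w d = [X]" "run w d' = [X]"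
  shows "deq w d d'"
proof -
  have b: "box ([X], [Y], i)" using mono_hom[OF i] o by (simp add: box_def)
  have k: "ok w d" "ok w d'" using d by (simp_all add: deq_def ok_append)
  have "i \<cdot> sem w d = i \<cdot> sem w d'"
    using d layer_box(1)[OF b] sem_append[of w d "[(0, [X], [Y], i)]"] sem_append[of w d' "[(0, [X], [Y], i)]"] k b o sem_box[OF b]
    by (simp add: deq_def)
  then have "sem w d = sem w d'"
    using mono_cancel[OF i, of "tens w" "sem w d" "sem w d'"] sem_in_hom[OF k(1)] sem_in_hom[OF k(2)] ok_set[OF k(1)] d o by simp
  then show ?thesis using d k by (simp add: deq_def)
qed

context
  fixes D V ev co assumes d: "dualizes D V ev co"
begin

text \<open>The functor \<open>D \<odot> -\<close> is left adjoint to \<open>V \<odot> -\<close>: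
  transposed with \<open>co\<close>, the two maps start at \<open>Y\<close>, where \<open>e\<close>
  can be cancelled.\<close>

lemma tensor_epi_left:
  assumes o [simp]: "X \<in> obj C" "Y \<in> obj C" and e: "epimorphism C X Y e"
  shows "epimorphism C (D \<odot> X) (D \<odot> Y) (ident C D \<otimes> e)"
  unfolding epimorphism_def
proof (intro conjI ballI impI)
  note [simp] = dualizes_box[OF d]
  let ?e = "([X], [Y], e)" and ?co = "([], [V, D], co)" and ?ev = "([D, V], [], ev)"
  have [simp]: "box ?e" using epi_hom[OF e] by (simp add: box_def)
  show "ident C D \<otimes> e \<in> hom C (D \<odot> X) (D \<odot> Y)" by (simp add: tensor_in_hom ident_in_hom epi_hom[OF e])
  fix Z g h assume [simp]: "Z \<in> obj C" and gh: "g \<in> hom C (D \<odot> Y) Z" "h \<in> hom C (D \<odot> Y) Z"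
    and eq: "g \<cdot> (ident C D \<otimes> e) = h \<cdot> (ident C D \<otimes> e)"
  let ?g = "([D, Y], [Z], g)" and ?h = "([D, Y], [Z], h)"
  have [simp]: "box ?g" "box ?h" using gh by (simp_all add: box_def tens_simps)
  have "deq [D, X] [(1, ?e), (0, ?g)] [(1, ?e), (0, ?h)]" using eq by (simp add: sem_morphism)
  then have "deq [X] ((0, ?e) # [(0, ?co), (1, ?g)]) ((0, ?e) # [(0, ?co), (1, ?h)])"
    by (rule step[of _ _ _ "[(0, ?co)]" 1 "[]"]; simp)
  then have eq': "deq [Y] [(0, ?co), (1, ?g)] [(0, ?co), (1, ?h)]" by (rule epi_cancel_diagram[OF e o]; simp)
  have "deq [D, Y] [(0, ?g)] [(1, ?co), (2, ?g), (0, ?ev)]"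
    by (rule step_sym[OF snake(2)[OF d], of "[]" 0 "[(0, ?g)]"]; simp)
  also have "deq [D, Y] ... [(1, ?co), (2, ?h), (0, ?ev)]"
    by (rule at[OF eq', of 1 0]; simp)
  also have "deq [D, Y] ... [(0, ?h)]"
    by (rule step[OF snake(2)[OF d], of "[]" 0 "[(0, ?h)]"]; simp)
  finally show "g = h" by (simp add: sem_morphism)
qed

text \<open>Dually, \<open>- \<odot> D\<close> is right adjoint to \<open>- \<odot> V\<close>, and
  right adjoints preserve monomorphisms.\<close>

lemma tensor_mono_right:
  assumes o [simp]: "X \<in> obj C" "Y \<in> obj C" and i: "monomorphism C X Y i"
  shows "monomorphism C (X \<odot> D) (Y \<odot> D) (i \<otimes> ident C D)"
  unfolding monomorphism_def
proof (intro conjI ballI impI)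
  note [simp] = dualizes_box[OF d]
  let ?i = "([X], [Y], i)" and ?co = "([], [V, D], co)" and ?ev = "([D, V], [], ev)"
  have [simp]: "box ?i" using mono_hom[OF i] by (simp add: box_def)
  show "i \<otimes> ident C D \<in> hom C (X \<odot> D) (Y \<odot> D)" by (simp add: tensor_in_hom ident_in_hom mono_hom[OF i])
  fix W g h assume [simp]: "W \<in> obj C" and gh: "g \<in> hom C W (X \<odot> D)" "h \<in> hom C W (X \<odot> D)"
    and eq: "(i \<otimes> ident C D) \<cdot> g = (i \<otimes> ident C D) \<cdot> h"
  let ?g = "([W], [X, D], g)" and ?h = "([W], [X, D], h)"
  have [simp]: "box ?g" "box ?h" using gh by (simp_all add: box_def tens_simps)
  have "deq [W] [(0, ?g), (0, ?i)] [(0, ?h), (0, ?i)]" using eq by (simp add: sem_morphism)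
  then have "deq [W, V] ([(0, ?g), (1, ?ev)] @ [(0, ?i)]) ([(0, ?h), (1, ?ev)] @ [(0, ?i)])"
    by (rule step[of _ _ _ "[]" 0 "[(1, ?ev)]"]; simp)
  then have eq': "deq [W, V] [(0, ?g), (1, ?ev)] [(0, ?h), (1, ?ev)]" by (rule mono_cancel_diagram[OF i o]; simp)
  have "deq [W] [(0, ?g)] [(1, ?co), (0, ?g), (1, ?ev)]"
    by (rule step_sym[OF snake(2)[OF d], of "[(0, ?g)]" 1 "[]"]; simp)
  also have "deq [W] ... [(1, ?co), (0, ?h), (1, ?ev)]"
    by (rule at[OF eq', of 0 1]; simp)
  also have "deq [W] ... [(0, ?h)]"
    by (rule step[OF snake(2)[OF d], of "[(0, ?h)]" 1 "[]"]; simp)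
  finally show "g = h" by (simp add: sem_morphism)
qed

text \<open>A left adjoint preserves projective objects when its right adjoint preserves
  epimorphisms.\<close>

lemma projective_tensor_left:
  assumes P: "projective_object C P"
    and epi: "\<And>X Y e. X \<in> obj C \<Longrightarrow> Y \<in> obj C \<Longrightarrow> epimorphism C X Y e \<Longrightarrow> epimorphism C (V \<odot> X) (V \<odot> Y) (ident C V \<otimes> e)"
  shows "projective_object C (D \<odot> P)"
  unfolding projective_object_def
proof (intro conjI ballI allI impI)
  have [simp]: "P \<in> obj C" using P by (simp add: projective_object_def)
  note [simp] = dualizes_box[OF d]
  show "D \<odot> P \<in> obj C" by (simp add: tensor_in_obj)
  fix X Y e f assume o [simp]: "X \<in> obj C" "Y \<in> obj C" and e: "epimorphism C X Y e" and f: "f \<in> hom C (D \<odot> P) Y"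
  let ?e = "([X], [Y], e)" and ?co = "([], [V, D], co)" and ?ev = "([D, V], [], ev)" and ?f = "([D, P], [Y], f)"
  have [simp]: "box ?e" "box ?f" using epi_hom[OF e] f by (simp_all add: box_def tens_simps)
  obtain F where F: "deq [P] [(0, [P], [V, Y], F)] [(0, ?co), (1, ?f)]" "box ([P], [V, Y], F)"
    by (rule that[OF deq_box]; simp)
  obtain g where g: "g \<in> hom C P (V \<odot> X)" "(ident C V \<otimes> e) \<cdot> g = F"
    using projective_lift[OF P _ _ epi[OF o e], of F] F(2) by (auto simp: box_def tens_simps tensor_in_obj)
  note [simp] = F(2)
  let ?g = "([P], [V, X], g)"
  have [simp]: "box ?g" using g by (simp add: box_def tens_simps)
  have gF: "deq [P] [(0, ?g), (1, ?e)] [(0, [P], [V, Y], F)]" using g by (simp add: sem_morphism)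
  obtain G where G: "deq [D, P] [(0, [D, P], [X], G)] [(1, ?g), (0, ?ev)]" "box ([D, P], [X], G)"
    by (rule that[OF deq_box]; simp)
  note [simp] = G(2)
  have "deq [D, P] [(0, [D, P], [X], G), (0, ?e)] [(1, ?g), (0, ?ev), (0, ?e)]"
    by (rule at[OF G(1), of 0 0]; simp)
  also have "deq [D, P] ... [(1, [P], [V, Y], F), (0, ?ev)]"
    by (rule step[OF gF, of "[]" 1 "[(0, ?ev)]"]; simp)
  also have "deq [D, P] ... [(1, ?co), (2, ?f), (0, ?ev)]"
    by (rule at[OF F(1), of 1 0]; simp)
  also have "deq [D, P] ... [(0, ?f)]"
    by (rule step[OF snake(2)[OF d], of "[]" 0 "[(0, ?f)]"]; simp)
  finally have "e \<cdot> G = f" by (simp add: sem_morphism)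
  moreover have "G \<in> hom C (D \<odot> P) X" using G(2) by (simp add: box_def tens_simps)
  ultimately show "\<exists>g\<in>hom C (D \<odot> P) X. e \<cdot> g = f" by blast
qed

end

end

section \<open>Projective and injective objects in the braided category\<close>

context finite_braided_tensor_category
begin

lemma model: obtains A F where "module_model C A F"
  using finite_cat linear_equivalence_model that unfolding finite_category_def by metis

lemma left_dual_dualizes: assumes "X \<in> obj C" obtains D ev co where "dualizes D X ev co"
  using left_dual[OF assms] assms that unfolding dualizes_def by blast

lemma right_dual_dualizes: assumes "X \<in> obj C" obtains D ev co where "dualizes X D ev co"
  using right_dual[OF assms] assms that unfolding dualizes_def by blast

lemma braiding_inverse:
  assumes "X \<in> obj C" "Y \<in> obj C"
  obtains c where "c \<in> hom C (Y \<odot> X) (X \<odot> Y)" "c \<cdot> braiding C X Y = ident C (X \<odot> Y)" "braiding C X Y \<cdot> c = ident C (Y \<odot> X)"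
  using braiding_iso[OF assms] unfolding isomorphism_def by blast

text \<open>The right dual of \<open>Z\<close> handles tensoring from the left; the invertible
  braiding carries the result to the other side.\<close>

lemma epi_tensor:
  assumes o: "X \<in> obj C" "Y \<in> obj C" "Z \<in> obj C" and e: "epimorphism C X Y e"
  shows "epimorphism C (Z \<odot> X) (Z \<odot> Y) (ident C Z \<otimes> e)" "epimorphism C (X \<odot> Z) (Y \<odot> Z) (e \<otimes> ident C Z)"
proof -
  obtain D ev co where "dualizes Z D ev co" using right_dual_dualizes[OF o(3)] .
  from tensor_epi_left[OF this o(1,2) e] show 1: "epimorphism C (Z \<odot> X) (Z \<odot> Y) (ident C Z \<otimes> e)" .
  note t = tensor_in_obj[OF o(1,3)] tensor_in_obj[OF o(3,1)] tensor_in_obj[OF o(3,2)] tensor_in_obj[OF o(2,3)]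
  note c = braiding_in_hom[OF o(1,3)] braiding_in_hom[OF o(2,3)] and z = ident_in_hom[OF o(3)]
  note ez = tensor_in_hom[OF o(1,2,3,3) epi_hom[OF e] z]
  obtain c' where c': "c' \<in> hom C (Z \<odot> X) (X \<odot> Z)" "braiding C X Z \<cdot> c' = ident C (Z \<odot> X)" by (rule braiding_inverse[OF o(1,3)])
  obtain d where d: "d \<in> hom C (Z \<odot> Y) (Y \<odot> Z)" "d \<cdot> braiding C Y Z = ident C (Y \<odot> Z)" by (rule braiding_inverse[OF o(2,3)])
  have "epimorphism C (X \<odot> Z) (Z \<odot> Y) ((ident C Z \<otimes> e) \<cdot> braiding C X Z)"
    by (rule epi_comp[OF t(1-3) split_epi[OF t(1,2) c(1) c'] 1])
  then have "epimorphism C (X \<odot> Z) (Y \<odot> Z) (d \<cdot> ((ident C Z \<otimes> e) \<cdot> braiding C X Z))"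
    by (rule epi_comp[OF t(1,3,4) _ split_epi[OF t(3,4) d(1) c(2) d(2)]])
  also have "d \<cdot> ((ident C Z \<otimes> e) \<cdot> braiding C X Z) = e \<otimes> ident C Z"
    unfolding braiding_natural[OF o(1,2,3,3) epi_hom[OF e] z, symmetric] comp_assoc[OF t(1,4,3,4) ez c(2) d(1), symmetric] d(2)
    by (rule ident_comp[OF t(1,4) ez])
  finally show "epimorphism C (X \<odot> Z) (Y \<odot> Z) (e \<otimes> ident C Z)" .
qed

lemma mono_tensor:
  assumes "X \<in> obj C" "Y \<in> obj C" "Z \<in> obj C" "monomorphism C X Y i"
  shows "monomorphism C (X \<odot> Z) (Y \<odot> Z) (i \<otimes> ident C Z)"
proof -
  obtain D ev co where "dualizes Z D ev co" using right_dual_dualizes[OF assms(3)] .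
  from tensor_mono_right[OF this assms(1,2,4)] show ?thesis .
qed

lemma projective_tensor:
  assumes P: "projective_object C P" and Z: "Z \<in> obj C"
  shows "projective_object C (Z \<odot> P)" "projective_object C (P \<odot> Z)"
proof -
  have Po: "P \<in> obj C" using P by (simp add: projective_object_def)
  obtain V ev co where d: "dualizes Z V ev co" using right_dual_dualizes[OF Z] .
  show 1: "projective_object C (Z \<odot> P)" by (rule projective_tensor_left[OF d P epi_tensor(1)[OF _ _ dualizes_box(1)[OF d]]])
  obtain c where "c \<in> hom C (Z \<odot> P) (P \<odot> Z)" "c \<cdot> braiding C P Z = ident C (P \<odot> Z)" by (rule braiding_inverse[OF Po Z])
  then show "projective_object C (P \<odot> Z)"
    by (rule projective_retract[OF 1 tensor_in_obj[OF Po Z] braiding_in_hom[OF Po Z]])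
qed

lemma image_factorization:
  assumes "X \<in> obj C" "Y \<in> obj C" "f \<in> hom C X Y"
  obtains J p i where "J \<in> obj C" "epimorphism C X J p" "monomorphism C J Y i" "i \<cdot> p = f"
proof -
  obtain A F where "module_model C A F" using model .
  from module_model.image_factorization[OF this assms] show ?thesis using that by blast
qed

lemma diagonal:
  assumes "X \<in> obj C" "Y \<in> obj C" "U \<in> obj C" "W \<in> obj C"
    "epimorphism C X Y e" "monomorphism C U W i" "s \<in> hom C X U" "t \<in> hom C Y W" "i \<cdot> s = t \<cdot> e"
  obtains d where "d \<in> hom C Y U" "d \<cdot> e = s" "i \<cdot> d = t"
proof -
  obtain A F where "module_model C A F" using model .
  from module_model.diagonal[OF this assms] show ?thesis using that by blast
qed

lemma projective_generator:
  obtains P where "projective_object C P" "\<And>V. V \<in> obj C \<Longrightarrow> ident C V \<noteq> 0 \<Longrightarrow> \<exists>x\<in>hom C P V. x \<noteq> 0"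
proof -
  obtain A F where "module_model C A F" using model .
  from module_model.projective_generator[OF this] show ?thesis using that by blast
qed

lemma hom_fin_dim: "X \<in> obj C \<Longrightarrow> Y \<in> obj C \<Longrightarrow> fin_dim (scale C) (hom C X Y)"
  by (rule model) (rule module_model.F_hom_fin_dim)

text \<open>The image factorization of an idempotent splits it: in u u = u the epimorphism and the
  monomorphism can be cancelled.\<close>

lemma idempotent_split:
  assumes X: "X \<in> obj C" and u: "u \<in> hom C X X" "u \<cdot> u = u"
  obtains Y i p where "Y \<in> obj C" "i \<in> hom C Y X" "p \<in> hom C X Y" "p \<cdot> i = ident C Y" "i \<cdot> p = u"
proof -
  obtain Y p i where Y: "Y \<in> obj C" and p: "epimorphism C X Y p" and i: "monomorphism C Y X i" and ip: "i \<cdot> p = u"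
    using image_factorization[OF X X u(1)] .
  note p' = epi_hom[OF p] and i' = mono_hom[OF i]
  have pi: "p \<cdot> i \<in> hom C Y Y" by (rule comp_in_hom[OF Y X Y i' p'])
  have "((i \<cdot> p) \<cdot> i) \<cdot> p = ident C X \<cdot> (i \<cdot> p)"
    using u(2) comp_assoc[OF X Y X X p' i' u(1)] ident_comp[OF X X u(1)] ip by simp
  then have "((i \<cdot> p) \<cdot> i) \<cdot> p = i \<cdot> p" using ident_comp[OF X X u(1)] ip by simp
  then have "(i \<cdot> p) \<cdot> i = i"
    using epi_cancel[OF p X comp_in_hom[OF Y X X i' u(1)] i'] ip by simp
  then have "i \<cdot> (p \<cdot> i) = i \<cdot> ident C Y"
    using comp_assoc[OF Y X Y X i' p' i'] comp_ident[OF Y X i'] by simp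
  then have "p \<cdot> i = ident C Y" using mono_cancel[OF i Y pi ident_in_hom[OF Y]] by simp
  then show ?thesis using that[OF Y i' p'] ip by blast
qed

text \<open>The mate \<open>D\<^sub>Y \<rightarrow> D\<^sub>X\<close> of a monomorphism \<open>X \<rightarrow> Y\<close> is an epimorphism, and a morphism to
  the right dual of \<open>P\<close> is a morphism from \<open>P\<close> to a left dual.\<close>
lemma right_dual_injective:
  assumes P: "projective_object C P" and d: "dualizes P Q ev co"
  shows "injective_object C Q"
  unfolding injective_iff
proof (intro conjI ballI allI impI)
  note QP = dualizes_box(1,2)[OF d]
  show "Q \<in> obj C" using QP by simp
  fix X Y i f assume o: "X \<in> obj C" "Y \<in> obj C" and i: "monomorphism C X Y i" and f: "f \<in> hom C X Q"
  note i' = mono_hom[OF i]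
  note [simp] = o QP dualizes_box[OF d]
  obtain DX evX coX where dX: "dualizes DX X evX coX" using left_dual_dualizes[OF o(1)] .
  obtain DY evY coY where dY: "dualizes DY Y evY coY" using left_dual_dualizes[OF o(2)] .
  note [simp] = dualizes_box[OF dX] dualizes_box[OF dY]
  have [simp]: "box ([X], [Y], i)" "box ([X], [Q], f)" using i' f by (intro boxI; simp)+
  let ?i = "([X], [Y], i)" and ?CX = "([], [X, DX], coX)" and ?CY = "([], [Y, DY], coY)" and ?EX = "([DX, X], [], evX)"
    and ?EY = "([DY, Y], [], evY)" and ?E = "([P, Q], [], ev)" and ?C = "([], [Q, P], co)"
  obtain k where bk [simp]: "box ([DY], [DX], k)"
    and k1: "deq [DY, X] [(0, [DY], [DX], k), (0, ?EX)] [(1, ?i), (0, ?EY)]"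
    and k2: "deq [] [(0, ?CY), (1, [DY], [DX], k)] [(0, ?CX), (0, ?i)]"
    using mate[OF dX dY, of i] by auto
  have k: "k \<in> hom C DY DX" using bk by (simp add: box_def)
  have epi: "epimorphism C DY DX k"
    unfolding epimorphism_def
  proof (intro conjI ballI impI)
    show "k \<in> hom C DY DX" by fact
    fix Z g h assume Z [simp]: "Z \<in> obj C" and g: "g \<in> hom C DX Z" and h: "h \<in> hom C DX Z" and eq: "g \<cdot> k = h \<cdot> k"
    have [simp]: "box ([DX], [Z], g)" "box ([DX], [Z], h)" using g h by (intro boxI; simp)+
    have *: "deq [DY] [(0, [DY], [DX], k), (0, [DX], [Z], g)] [(0, [DY], [DX], k), (0, [DX], [Z], h)]"
      using eq by (simp add: deq_def sem_eval)
    obtain g' where g': "deq [] [(0, [], [X, Z], g')] [(0, ?CX), (1, [DX], [Z], g)]" "box ([], [X, Z], g')"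
      by (rule that[OF deq_box]; simp)
    obtain h' where h': "deq [] [(0, [], [X, Z], h')] [(0, ?CX), (1, [DX], [Z], h)]" "box ([], [X, Z], h')"
      by (rule that[OF deq_box]; simp)
    note [simp] = g'(2) h'(2)
    have "deq [] [(0, [], [X, Z], g'), (0, ?i)] [(0, ?CX), (0, ?i), (1, [DX], [Z], g)]"
      by (rule at[OF g'(1), of 0 0]; simp)
    also have "deq [] ... [(0, ?CY), (1, [DY], [DX], k), (1, [DX], [Z], g)]"
      by (rule at_sym[OF k2, of 0 0]; simp)
    also have "deq [] ... [(0, ?CY), (1, [DY], [DX], k), (1, [DX], [Z], h)]"
      by (rule at[OF *, of 1 1]; simp)
    also have "deq [] ... [(0, ?CX), (0, ?i), (1, [DX], [Z], h)]"
      by (rule at[OF k2, of 0 0]; simp)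
    also have "deq [] ... [(0, [], [X, Z], h'), (0, ?i)]"
      by (rule step_sym[OF h'(1), of "[]" 0 "[(0, ?i)]"]; simp)
    finally have "(i \<otimes> ident C Z) \<cdot> g' = (i \<otimes> ident C Z) \<cdot> h'"
      by (simp add: deq_def sem_eval)
    moreover have "g' \<in> hom C (unit_obj C) (X \<odot> Z)" "h' \<in> hom C (unit_obj C) (X \<odot> Z)"
      using g'(2) h'(2) by (simp_all add: box_def tens_simps)
    ultimately have "g' = h'" using mono_cancel[OF mono_tensor[OF o Z i] unit_in_obj] by blast
    then have gh: "deq [] [(0, ?CX), (1, [DX], [Z], g)] [(0, ?CX), (1, [DX], [Z], h)]"
      using deq_trans[OF deq_sym[OF g'(1)]] h'(1) by simp
    have "deq [DX] [(0, [DX], [Z], g)] [(1, ?CX), (2, [DX], [Z], g), (0, ?EX)]"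
      by (rule at_sym[OF snake(2)[OF dX], of 0 0]; simp)
    also have "deq [DX] ... [(1, ?CX), (2, [DX], [Z], h), (0, ?EX)]"
      by (rule at[OF gh, of 1 0]; simp)
    also have "deq [DX] ... [(0, [DX], [Z], h)]"
      by (rule step[OF snake(2)[OF dX], of "[]" 0 "[(0, [DX], [Z], h)]"]; simp)
    finally show "g = h" by (simp add: deq_def sem_eval)
  qed
  obtain f' where f': "deq [P] [(0, [P], [DX], f')] [(1, ?CX), (1, [X], [Q], f), (0, ?E)]" "box ([P], [DX], f')"
    by (rule that[OF deq_box]; simp)
  then have f'h: "f' \<in> hom C P DX" by (simp add: box_def)
  obtain g where g: "g \<in> hom C P DY" "k \<cdot> g = f'"
    using projective_lift[OF P _ _ epi f'h] dualizes_box[OF dX] dualizes_box[OF dY] by blast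
  have [simp]: "box ([P], [DY], g)" using g by (intro boxI) simp_all
  note [simp] = f'(2)
  have kg: "deq [P] [(0, [P], [DY], g), (0, [DY], [DX], k)] [(0, [P], [DX], f')]"
    using g by (simp add: deq_def sem_eval)
  obtain h where h: "deq [Y] [(0, [Y], [Q], h)] [(0, ?C), (1, [P], [DY], g), (1, ?EY)]" "box ([Y], [Q], h)"
    by (rule that[OF deq_box]; simp)
  note [simp] = h(2)
  have "deq [X] [(0, ?i), (0, [Y], [Q], h)] [(0, ?C), (1, [P], [DY], g), (2, ?i), (1, ?EY)]"
    by (rule at[OF h(1), of 0 1]; simp)
  also have "deq [X] ... [(0, ?C), (1, [P], [DY], g), (1, [DY], [DX], k), (1, ?EX)]"
    by (rule at_sym[OF k1, of 1 2]; simp)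
  also have "deq [X] ... [(0, ?C), (1, [P], [DX], f'), (1, ?EX)]"
    by (rule at[OF kg, of 1 1]; simp)
  also have "deq [X] ... [(0, ?C), (2, ?CX), (2, [X], [Q], f), (1, ?E), (1, ?EX)]"
    by (rule at[OF f'(1), of 1 1]; simp)
  also have "deq [X] ... [(0, ?CX), (0, [X], [Q], f), (1, ?EX)]"
    by (rule step[OF snake(1)[OF d], of "[(0, ?CX), (0, [X], [Q], f)]" 0 "[(1, ?EX)]"]; simp)
  also have "deq [X] ... [(0, [X], [Q], f)]"
    by (rule step[OF snake(1)[OF dX], of "[]" 0 "[(0, [X], [Q], f)]"]; simp)
  finally have "h \<cdot> i = f" by (simp add: deq_def sem_eval)
  moreover have "h \<in> hom C Y Q" using h(2) by (simp add: box_def)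
  ultimately show "\<exists>g\<in>hom C Y Q. g \<cdot> i = f" by blast
qed

text \<open>Let \<open>V\<close> be the right dual and \<open>D\<close> the left dual of
  \<open>P\<close>. By a snake identity \<open>P\<close> is a retract of
  \<open>P \<odot> V \<odot> P\<close>, which is the right dual of the projective object
  \<open>D \<odot> P \<odot> D\<close> and hence injective.\<close>

lemma projective_injective:
  assumes P: "projective_object C P"
  shows "injective_object C P"
proof -
  have Po: "P \<in> obj C" using P by (simp add: projective_object_def)
  obtain V ev co where d: "dualizes P V ev co" using right_dual_dualizes[OF Po] .
  obtain D ev' co' where d': "dualizes D P ev' co'" using left_dual_dualizes[OF Po] .
  note V = dualizes_box(1)[OF d] and D = dualizes_box(2)[OF d']
  obtain e1 c1 where d1: "dualizes (P \<odot> D) (P \<odot> V) e1 c1" using dualizes_tensor[OF d' d] by blast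
  obtain e2 c2 where d2: "dualizes (D \<odot> P \<odot> D) ((P \<odot> V) \<odot> P) e2 c2" using dualizes_tensor[OF d1 d'] by blast
  have inj: "injective_object C ((P \<odot> V) \<odot> P)"
    by (rule right_dual_injective[OF projective_tensor(1)[OF projective_tensor(2)[OF P D] D] d2])
  note [simp] = dualizes_box[OF d]
  have ok: "ok [P] [(1, [], [V, P], co)]" "ok [P, V, P] [(0, [P, V], [], ev)]" by simp_all
  have "deq [P] ([(1, [], [V, P], co)] @ [(0, [P, V], [], ev)]) []" using snake(2)[OF d] by simp
  then have "sem [P, V, P] [(0, [P, V], [], ev)] \<cdot> sem [P] [(1, [], [V, P], co)] = ident C P"
    using sem_append[OF ok(1), of "[(0, [P, V], [], ev)]"] ok(2) by (simp add: deq_def)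
  then show ?thesis
    using injective_retract[OF inj Po, of "sem [P] [(1, [], [V, P], co)]" "sem [P, V, P] [(0, [P, V], [], ev)]"]
      sem_in_hom[OF ok(1)] sem_in_hom[OF ok(2)] Po V
    by (simp add: tens_simps tensor_obj_assoc)
qed

text \<open>A projective image is also injective, so both halves of the factorization split; the
  composite of the two splittings is a generalized inverse.\<close>

lemma factor_split:
  assumes o: "X \<in> obj C" "Y \<in> obj C" and J: "projective_object C J"
    and p: "epimorphism C X J p" and i: "monomorphism C J Y i"
  shows "\<exists>g\<in>hom C Y X. ((i \<cdot> p) \<cdot> g) \<cdot> (i \<cdot> p) = i \<cdot> p"
proof -
  have Jo: "J \<in> obj C" using J by (simp add: projective_object_def)
  note p' = epi_hom[OF p] and i' = mono_hom[OF i]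
  obtain s where s: "s \<in> hom C J X" "p \<cdot> s = ident C J" using epi_split[OF J o(1) p] .
  obtain q where q: "q \<in> hom C Y J" "q \<cdot> i = ident C J" using mono_split[OF projective_injective[OF J] o(2) i] .
  have sq: "s \<cdot> q \<in> hom C Y X" by (rule comp_in_hom[OF o(2) Jo o(1) q(1) s(1)])
  have ip: "i \<cdot> p \<in> hom C X Y" by (rule comp_in_hom[OF o(1) Jo o(2) p' i'])
  have "((i \<cdot> p) \<cdot> (s \<cdot> q)) \<cdot> (i \<cdot> p) = (i \<cdot> q) \<cdot> (i \<cdot> p)"
    using comp_assoc[OF o(2,1) Jo o(2) sq p' i'] comp_assoc[OF o(2) Jo o(1) Jo q(1) s(1) p'] s(2)
      ident_comp[OF o(2) Jo q(1)] by simp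
  also have "... = i \<cdot> ((q \<cdot> i) \<cdot> p)"
    using comp_assoc[OF o(1,2) Jo o(2) ip q(1) i'] comp_assoc[OF o(1) Jo o(2) Jo p' i' q(1)] by simp
  also have "... = i \<cdot> p" using q(2) ident_comp[OF o(1) Jo p'] by simp
  finally show ?thesis using sq by blast
qed

text \<open>Every object X is \<open>unit_obj C \<odot> X\<close>, hence projective. Then all images
  are projective and all morphisms have generalized inverses.\<close>

lemma semisimple_if_unit_projective:
  assumes "projective_object C (unit_obj C)"
  shows "semisimple_category C"
proof -
  have proj: "projective_object C X" if "X \<in> obj C" for X
    using projective_tensor(2)[OF assms that] tensor_obj_unit(1)[OF that] by simp
  interpret regular_linear_category C
  proof unfold_locales
    show "fin_dim (scale C) (hom C X Y)" if "X \<in> obj C" "Y \<in> obj C" for X Y by (rule hom_fin_dim[OF that])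
    show "\<exists>g\<in>hom C Y X. (f \<cdot> g) \<cdot> f = f" if f: "X \<in> obj C" "Y \<in> obj C" "f \<in> hom C X Y" for X Y f
      using image_factorization[OF f] factor_split[OF f(1,2) proj] by metis
    show "\<exists>Y\<in>obj C. \<exists>i\<in>hom C Y X. \<exists>p\<in>hom C X Y. p \<cdot> i = ident C Y \<and> i \<cdot> p = u"
      if "X \<in> obj C" "u \<in> hom C X X" "u \<cdot> u = u" for X u
      using idempotent_split[OF that] by metis
  qed
  show ?thesis by (rule semisimple)
qed

text \<open>The image of \<open>x\<close> is a non-zero subobject of the simple unit, hence all of
  it.\<close>

lemma epi_unit:
  assumes X: "X \<in> obj C" and x: "x \<in> hom C X (unit_obj C)" "x \<noteq> 0"
  shows "epimorphism C X (unit_obj C) x"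
proof -
  note u = unit_in_obj
  obtain J p i where J: "J \<in> obj C" and p: "epimorphism C X J p" and i: "monomorphism C J (unit_obj C) i" and ip: "i \<cdot> p = x"
    using image_factorization[OF X u x(1)] .
  note p' = epi_hom[OF p] and i' = mono_hom[OF i]
  have "\<not> zero_object C J"
  proof
    assume "zero_object C J"
    then have "p = 0" using zero_object_iff[OF J] ident_comp[OF X J p'] comp_zero(1)[OF X J J p'] by simp
    then show False using ip x(2) comp_zero(2)[OF X J u i'] by simp
  qed
  then have "isomorphism C J (unit_obj C) i" using simple_unit J i unfolding simple_object_def by blast
  then obtain j where j: "j \<in> hom C (unit_obj C) J" "i \<cdot> j = ident C (unit_obj C)"
    unfolding isomorphism_def by blast
  show ?thesis
    unfolding epimorphism_def
  proof (intro conjI ballI impI)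
    show "x \<in> hom C X (unit_obj C)" by fact
    fix Z g h assume Z: "Z \<in> obj C" and g: "g \<in> hom C (unit_obj C) Z" and h: "h \<in> hom C (unit_obj C) Z" and eq: "g \<cdot> x = h \<cdot> x"
    have gi: "g \<cdot> i \<in> hom C J Z" "h \<cdot> i \<in> hom C J Z" using comp_in_hom[OF J u Z i'] g h by auto
    have "(g \<cdot> i) \<cdot> p = (h \<cdot> i) \<cdot> p"
      unfolding comp_assoc[OF X J u Z p' i' g] comp_assoc[OF X J u Z p' i' h] ip by fact
    then have *: "g \<cdot> i = h \<cdot> i" by (rule epi_cancel[OF p Z gi])
    have "g = (g \<cdot> i) \<cdot> j" unfolding comp_assoc[OF u J u Z j(1) i' g] j(2) comp_ident[OF u Z g] ..
    also have "... = h" unfolding * comp_assoc[OF u J u Z j(1) i' h] j(2) comp_ident[OF u Z h] ..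
    finally show "g = h" .
  qed
qed

text \<open>The non-zero endomorphism \<open>t \<cdot> s\<close> of the unit is an epimorphism, so
  precomposition with it is injective on the finite-dimensional endomorphism space and therefore
  surjective. This gives a left inverse even if that space is larger than the ground field.\<close>

lemma unit_projective_if_factor:
  assumes P: "projective_object C P" and s: "s \<in> hom C (unit_obj C) P" and t: "t \<in> hom C P (unit_obj C)"
    and ne: "t \<cdot> s \<noteq> 0"
  shows "projective_object C (unit_obj C)"
proof -
  note u = unit_in_obj
  let ?u = "unit_obj C"
  have Po: "P \<in> obj C" using P by (simp add: projective_object_def)
  let ?c = "t \<cdot> s" and ?H = "hom C ?u ?u"
  have c: "?c \<in> ?H" by (rule comp_in_hom[OF u Po u s t])
  have epi: "epimorphism C ?u ?u ?c" by (rule epi_unit[OF u c ne])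
  interpret amb: ambient_space "scale C" by (rule ambient_space.intro[OF ambient_vector_space])
  interpret ambient_space_pair "scale C" "scale C"
    by (simp add: ambient_space_pair_def vector_space_pair_def ambient_vector_space)
  have H: "amb.subspace ?H" by (rule hom_subspace[OF u u])
  let ?T = "\<lambda>g. g \<cdot> ?c"
  have inj: "inj_on ?T ?H" using epi_cancel[OF epi u] by (rule inj_onI)
  have add: "?T (g + h) = ?T g + ?T h" if "g \<in> ?H" "h \<in> ?H" for g h
    using comp_add_left[OF u u u c that] .
  have sc: "?T (scale C k g) = scale C k (?T g)" if "g \<in> ?H" for k g using comp_scale_left[OF u u u c that] .
  have im: "?T ` ?H \<subseteq> ?H" using comp_in_hom[OF u u u c] by blast
  have sub: "amb.subspace (?T ` ?H)"
  proof (rule amb.subspaceI)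
    show "0 \<in> ?T ` ?H" by (rule image_eqI[OF _ amb.subspace_0[OF H]]) (simp only: comp_zero(1)[OF u u u c])
    fix x y k assume "x \<in> ?T ` ?H"
    then obtain g where g: "x = ?T g" "g \<in> ?H" by (rule imageE)
    show "scale C k x \<in> ?T ` ?H"
      by (rule image_eqI[OF _ amb.subspace_scale[OF H g(2)]]) (simp only: sc[OF g(2)] g(1))
    assume "y \<in> ?T ` ?H"
    then obtain h where h: "y = ?T h" "h \<in> ?H" by (rule imageE)
    show "x + y \<in> ?T ` ?H"
      by (rule image_eqI[OF _ amb.subspace_add[OF H g(2) h(2)]]) (simp only: add[OF g(2) h(2)] g(1) h(1))
  qed
  have "ident C ?u \<in> ?T ` ?H"
  proof (rule ccontr)
    assume "ident C ?u \<notin> ?T ` ?H"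
    then have "amb.dim (?T ` ?H) < amb.dim ?H"
      by (rule amb.dim_less[OF sub H hom_fin_dim[OF u u] im ident_in_hom[OF u]])
    moreover have "amb.dim (?T ` ?H) = amb.dim ?H"
      by (rule dim_bij[OF H bij_betw_imageI[OF inj refl] add sc])
    ultimately show False by simp
  qed
  then obtain g where g: "ident C ?u = g \<cdot> ?c" "g \<in> ?H" by (rule imageE)
  show ?thesis
    by (rule projective_retract[OF P u s comp_in_hom[OF Po u u t g(2)]])
      (use comp_assoc[OF u Po u u s t g(2)] g(1) in simp)
qed

text \<open>No minimality is meant: a projective generator has a non-zero map to the unit, and such
  a map is an epimorphism.\<close>

lemma projective_cover_unit:
  obtains P x where "projective_object C P" "epimorphism C P (unit_obj C) x"
    "\<And>V. V \<in> obj C \<Longrightarrow> ident C V \<noteq> 0 \<Longrightarrow> \<exists>x\<in>hom C P V. x \<noteq> 0"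
proof -
  obtain P where P: "projective_object C P" "\<And>V. V \<in> obj C \<Longrightarrow> ident C V \<noteq> 0 \<Longrightarrow> \<exists>x\<in>hom C P V. x \<noteq> 0"
    using projective_generator by blast
  have "ident C (unit_obj C) \<noteq> 0" using simple_unit zero_object_iff[OF unit_in_obj] by (simp add: simple_object_def)
  then obtain x where "x \<in> hom C P (unit_obj C)" "x \<noteq> 0" using P(2)[OF unit_in_obj] by blast
  then show ?thesis using that[OF P(1) epi_unit P(2)] P(1) by (simp add: projective_object_def)
qed

end

section \<open>Bimodules over separable algebras\<close>

context finite_braided_tensor_category
begin

text \<open>The image of an equivariant map inherits an action, and the unit law exhibits the image
  as a retract of its product with the projective object \<open>a\<close>. So the image is
  projective, and the map has a generalized inverse, although not yet an equivariant one.\<close>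

lemma equivariant_regular:
  assumes a: "projective_object C a" and \<eta>: "\<eta> \<in> hom C (unit_obj C) a"
    and o: "V \<in> obj C" "V' \<in> obj C"
    and \<alpha>: "\<alpha> \<in> hom C (a \<odot> V) V" "\<alpha> \<cdot> (\<eta> \<otimes> ident C V) = ident C V"
    and \<alpha>': "\<alpha>' \<in> hom C (a \<odot> V') V'"
    and u: "u \<in> hom C V V'" "u \<cdot> \<alpha> = \<alpha>' \<cdot> (ident C a \<otimes> u)"
  shows "\<exists>\<psi>\<in>hom C V' V. (u \<cdot> \<psi>) \<cdot> u = u"
proof -
  have ao: "a \<in> obj C" using a by (simp add: projective_object_def)
  obtain J p i where J: "J \<in> obj C" and p: "epimorphism C V J p" and i: "monomorphism C J V' i" and ip: "i \<cdot> p = u"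
    using image_factorization[OF o u(1)] .
  note p' = epi_hom[OF p] and i' = mono_hom[OF i]
  note t = tensor_in_obj[OF ao]
  have 1: "ident C a \<otimes> p \<in> hom C (a \<odot> V) (a \<odot> J)" "ident C a \<otimes> i \<in> hom C (a \<odot> J) (a \<odot> V')"
    using tensor_in_hom[OF ao ao] ident_in_hom[OF ao] o J p' i' by auto
  have "i \<cdot> (p \<cdot> \<alpha>) = (\<alpha>' \<cdot> (ident C a \<otimes> i)) \<cdot> (ident C a \<otimes> p)"
    using comp_assoc[OF t[OF o(1)] o(1) J o(2) \<alpha>(1) p' i'] ip u(2) tensor_id_comp(1)[OF o(1) J o(2) ao p' i']
      comp_assoc[OF t[OF o(1)] t[OF J] t[OF o(2)] o(2) 1 \<alpha>'] by simp
  \<comment> \<open>Diagonal fill-in between the epimorphism \<open>ident C a \<otimes> p\<close>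
    and the monomorphism \<open>i\<close>: this is the action on the image.\<close>
  then obtain w where w: "w \<in> hom C (a \<odot> J) J" "w \<cdot> (ident C a \<otimes> p) = p \<cdot> \<alpha>"
    using diagonal[OF t[OF o(1)] t[OF J] J o(2) epi_tensor(1)[OF o(1) J ao p] i comp_in_hom[OF t[OF o(1)] o(1) J \<alpha>(1) p']
      comp_in_hom[OF t[OF J] t[OF o(2)] o(2) 1(2) \<alpha>']] by blast
  have \<eta>J: "\<eta> \<otimes> ident C J \<in> hom C J (a \<odot> J)" and \<eta>V: "\<eta> \<otimes> ident C V \<in> hom C V (a \<odot> V)"
    using tensor_in_hom[OF unit_in_obj ao J J \<eta> ident_in_hom[OF J]] tensor_in_hom[OF unit_in_obj ao o(1) o(1) \<eta> ident_in_hom[OF o(1)]]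
    by (simp_all add: tensor_obj_unit J o)
  have w\<eta>: "w \<cdot> (\<eta> \<otimes> ident C J) \<in> hom C J J" by (rule comp_in_hom[OF J t[OF J] J \<eta>J w(1)])
  have sw: "(\<eta> \<otimes> ident C J) \<cdot> p = (ident C a \<otimes> p) \<cdot> (\<eta> \<otimes> ident C V)"
    using tensor_comp[OF unit_in_obj unit_in_obj ao o(1) J J ident_in_hom[OF unit_in_obj] \<eta> p' ident_in_hom[OF J]]
      tensor_comp[OF unit_in_obj ao ao o(1) o(1) J \<eta> ident_in_hom[OF ao] ident_in_hom[OF o(1)] p']
      ident_comp[OF o(1) J p'] comp_ident[OF o(1) J p'] ident_comp[OF unit_in_obj ao \<eta>] comp_ident[OF unit_in_obj ao \<eta>]
      tensor_unit(1)[OF o(1) J p'] by simp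
  have "(w \<cdot> (\<eta> \<otimes> ident C J)) \<cdot> p = w \<cdot> ((ident C a \<otimes> p) \<cdot> (\<eta> \<otimes> ident C V))"
    unfolding comp_assoc[OF o(1) J t[OF J] J p' \<eta>J w(1)] sw ..
  also have "... = (p \<cdot> \<alpha>) \<cdot> (\<eta> \<otimes> ident C V)"
    unfolding comp_assoc[OF o(1) t[OF o(1)] t[OF J] J \<eta>V 1(1) w(1), symmetric] w(2) ..
  also have "... = ident C J \<cdot> p"
    unfolding comp_assoc[OF o(1) t[OF o(1)] o(1) J \<eta>V \<alpha>(1) p'] \<alpha>(2) comp_ident[OF o(1) J p'] ident_comp[OF o(1) J p'] ..
  finally have "w \<cdot> (\<eta> \<otimes> ident C J) = ident C J" by (rule epi_cancel[OF p J w\<eta> ident_in_hom[OF J]])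
  then have "projective_object C J"
    by (rule projective_retract[OF projective_tensor(2)[OF a J] J \<eta>J w(1)])
  from factor_split[OF o this p i] show ?thesis unfolding ip .
qed

end

context braided_algebra
begin

abbreviation alg :: "('o, 'm) algebra_object" where
  "alg \<equiv> \<lparr>carrier_obj = a, mult = \<mu>, unit_mor = \<eta>\<rparr>"

abbreviation bim :: "'o \<Rightarrow> 'm \<Rightarrow> 'm \<Rightarrow> ('o, 'm) bimodule" where
  "bim v l r \<equiv> \<lparr>bimod_obj = v, left_act = l, right_act = r\<rparr>"

abbreviation bimod_homs :: "('o, 'm) bimodule \<Rightarrow> ('o, 'm) bimodule \<Rightarrow> 'm set" where
  "bimod_homs \<equiv> bimodule_homs C alg"

lemma bimodule_deq:
  assumes "is_bimodule C alg (bim v l r)"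
  shows "v \<in> obj C" "box ([a, v], [v], l)" "box ([v, a], [v], r)"
    "deq [a, a, v] [(0, M), (0, [a, v], [v], l)] [(1, [a, v], [v], l), (0, [a, v], [v], l)]"
    "deq [v] [(0, E), (0, [a, v], [v], l)] []"
    "deq [v, a, a] [(1, M), (0, [v, a], [v], r)] [(0, [v, a], [v], r), (0, [v, a], [v], r)]"
    "deq [v] [(1, E), (0, [v, a], [v], r)] []"
    "deq [a, v, a] [(0, [a, v], [v], l), (0, [v, a], [v], r)] [(1, [v, a], [v], r), (0, [a, v], [v], l)]"
proof -
  note D = assms[unfolded is_bimodule_def Let_def, simplified]
  show [simp]: "v \<in> obj C" using D by simp
  show [simp]: "box ([a, v], [v], l)" "box ([v, a], [v], r)" using D by (intro boxI; simp add: tens_simps)+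
  note s = sem_morphism
  show "deq [a, a, v] [(0, M), (0, [a, v], [v], l)] [(1, [a, v], [v], l), (0, [a, v], [v], l)]"
    "deq [v] [(0, E), (0, [a, v], [v], l)] []"
    "deq [v, a, a] [(1, M), (0, [v, a], [v], r)] [(0, [v, a], [v], r), (0, [v, a], [v], r)]"
    "deq [v] [(1, E), (0, [v, a], [v], r)] []"
    "deq [a, v, a] [(0, [a, v], [v], l), (0, [v, a], [v], r)] [(1, [v, a], [v], r), (0, [a, v], [v], l)]"
    using D by (simp_all add: s)
qed

lemma bimodule_homs_iff:
  "f \<in> bimod_homs (bim v l r) (bim v' l' r') \<longleftrightarrow>
     f \<in> hom C v v' \<and> f \<cdot> l = l' \<cdot> (ident C a \<otimes> f) \<and> f \<cdot> r = r' \<cdot> (f \<otimes> ident C a)"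
  by (simp add: bimodule_homs_def)

lemma bimodule_hom_deq:
  assumes "v \<in> obj C" "v' \<in> obj C" "box ([a, v], [v], l)" "box ([v, a], [v], r)" "box ([a, v'], [v'], l')" "box ([v', a], [v'], r')"
  shows "f \<in> bimod_homs (bim v l r) (bim v' l' r') \<longleftrightarrow>
    box ([v], [v'], f) \<and>
    deq [a, v] [(0, [a, v], [v], l), (0, [v], [v'], f)] [(1, [v], [v'], f), (0, [a, v'], [v'], l')] \<and>
    deq [v, a] [(0, [v, a], [v], r), (0, [v], [v'], f)] [(0, [v], [v'], f), (0, [v', a], [v'], r')]"
proof -
  note [simp] = assms
  have b: "f \<in> hom C v v' \<longleftrightarrow> box ([v], [v'], f)" by (simp add: box_def)
  note s = sem_morphism
  show ?thesis unfolding bimodule_homs_iff b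
    by (rule conj_cong[OF refl]) (simp add: s)
qed

lemma two_sided_free_bimodule:
  assumes X [simp]: "X \<in> obj C"
  shows "is_bimodule C alg (bim (a \<odot> X \<odot> a) (\<mu> \<otimes> ident C (X \<odot> a)) (ident C (a \<odot> X) \<otimes> \<mu>))"
proof -
  have 1: "deq [a, a, a, X, a] [(0, M), (0, M)] [(1, M), (0, M)]"
    by (rule at[OF assoc, of 0 0]; simp)
  have 2: "deq [a, X, a] [(0, E), (0, M)] []"
    by (rule at[OF unit_left, of 0 0]; simp)
  have 3: "deq [a, X, a, a, a] [(3, M), (2, M)] [(2, M), (2, M)]"
    by (rule at_sym[OF assoc, of 2 0]; simp)
  have 4: "deq [a, X, a] [(3, E), (2, M)] []"
    by (rule at[OF unit_right, of 2 0]; simp)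
  have 5: "deq [a, a, X, a, a] [(0, M), (2, M)] [(3, M), (0, M)]"
    by (rule isotopy; simp)
  note s = sem_morphism
  have h: "\<mu> \<otimes> ident C (X \<odot> a) \<in> hom C (a \<odot> a \<odot> X \<odot> a) (a \<odot> X \<odot> a)"
    "ident C (a \<odot> X) \<otimes> \<mu> \<in> hom C (a \<odot> X \<odot> a \<odot> a) (a \<odot> X \<odot> a)"
    using sem_in_hom[of "[a, a, X, a]" "[(0, M)]"] sem_in_hom[of "[a, X, a, a]" "[(2, M)]"]
    by (simp_all add: sem_eval)
  note Xa = tensor_in_obj[OF X a_obj] and aX = tensor_in_obj[OF a_obj X] and aa = tensor_in_obj[OF a_obj a_obj] and i = ident_in_hom
  have "(ident C (a \<odot> X) \<otimes> \<mu>) \<otimes> ident C a = ident C (a \<odot> X) \<otimes> (\<mu> \<otimes> ident C a)"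
    by (rule tensor_assoc[OF aX aX aa a_obj a_obj a_obj i[OF aX] mu_hom i[OF a_obj]])
  moreover have "(\<mu> \<otimes> ident C (X \<odot> a)) \<otimes> ident C a = \<mu> \<otimes> ident C (X \<odot> a \<odot> a)"
    using tensor_assoc[OF aa a_obj Xa Xa a_obj a_obj mu_hom i[OF Xa] i[OF a_obj]] tensor_ident[OF Xa a_obj]
    by (simp add: tensor_obj_assoc)
  moreover have "ident C a \<otimes> (ident C (a \<odot> X) \<otimes> \<mu>) = ident C (a \<odot> a \<odot> X) \<otimes> \<mu>"
    using tensor_assoc[OF a_obj a_obj aX aX aa a_obj i[OF a_obj] i[OF aX] mu_hom] tensor_ident[OF a_obj aX] by simp
  ultimately show ?thesis
    using 1 2 3 4 5 h
    by (simp add: is_bimodule_def Let_def tensor_in_obj tensor_obj_assoc s)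
qed

lemma regular_bimodule: "is_bimodule C alg (bim a \<mu> \<mu>)"
  by (simp add: is_bimodule_def Let_def mu_hom mu_assoc mu_eta)

text \<open>Already in the underlying category the map is an epimorphism: tensoring preserves the
  epimorphism \<open>x\<close>, and the multiplication is split by the unit.\<close>

lemma two_sided_free_epi:
  assumes X [simp]: "X \<in> obj C" and x: "epimorphism C X (unit_obj C) x"
  shows "epimorphism (bimod C alg)
      (bim (a \<odot> X \<odot> a) (\<mu> \<otimes> ident C (X \<odot> a)) (ident C (a \<odot> X) \<otimes> \<mu>))
      (bim a \<mu> \<mu>) (\<mu> \<cdot> (ident C a \<otimes> (x \<otimes> ident C a)))"
    (is "epimorphism _ ?F ?R ?m")
proof -
  have x': "box ([X], [], x)" using epi_hom[OF x] by (simp add: box_def)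
  note [simp] = x'
  have Xa: "X \<odot> a \<in> obj C" "a \<odot> X \<odot> a \<in> obj C" "a \<odot> a \<in> obj C" by (simp_all add: tensor_in_obj)
  have e1: "epimorphism C (a \<odot> X \<odot> a) (a \<odot> a) (ident C a \<otimes> (x \<otimes> ident C a))"
    using epi_tensor(1)[OF Xa(1) a_obj a_obj] epi_tensor(2)[OF X unit_in_obj a_obj x] by (simp add: tensor_obj_unit)
  have u: "ident C a \<otimes> \<eta> \<in> hom C a (a \<odot> a)"
    using tensor_in_hom[OF a_obj a_obj unit_in_obj a_obj ident_in_hom[OF a_obj] eta_hom] by (simp add: tensor_obj_unit)
  have "epimorphism C (a \<odot> a) a \<mu>" by (rule split_epi[OF Xa(3) a_obj mu_hom u mu_eta(2)])
  then have epi: "epimorphism C (a \<odot> X \<odot> a) a ?m" by (rule epi_comp[OF Xa(2,3) a_obj e1])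
  have m: "deq [a, X, a] [(0, [a, X, a], [a], ?m)] [(1, [X], [], x), (0, M)]" "box ([a, X, a], [a], ?m)"
    using deq_box[of "[a, X, a]" "[(1, [X], [], x), (0, M)]" "[a]"]
    by (simp_all add: sem_eval typed_layer_middle)
  note [simp] = m(2)
  have "deq [a, a, X, a] [(0, M), (0, [a, X, a], [a], ?m)] [(0, M), (1, [X], [], x), (0, M)]"
    by (rule at[OF m(1), of 0 1]; simp)
  also have "deq [a, a, X, a] ... [(2, [X], [], x), (1, M), (0, M)]"
    by (rule step[OF assoc, of "[(2, [X], [], x)]" 0 "[]"]; simp)
  also have "deq [a, a, X, a] ... [(1, [a, X, a], [a], ?m), (0, M)]"
    by (rule at_sym[OF m(1), of 1 0]; simp)
  finally have l: "?m \<cdot> (\<mu> \<otimes> ident C (X \<odot> a)) = \<mu> \<cdot> (ident C a \<otimes> ?m)"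
    by (simp add: sem_morphism)
  have "deq [a, X, a, a] [(2, M), (0, [a, X, a], [a], ?m)] [(2, M), (1, [X], [], x), (0, M)]"
    by (rule at[OF m(1), of 0 1]; simp)
  also have "deq [a, X, a, a] ... [(1, [X], [], x), (0, M), (0, M)]"
    by (rule step_sym[OF assoc, of "[(1, [X], [], x)]" 0 "[]"]; simp)
  also have "deq [a, X, a, a] ... [(0, [a, X, a], [a], ?m), (0, M)]"
    by (rule at_sym[OF m(1), of 0 0]; simp)
  finally have r: "?m \<cdot> (ident C (a \<odot> X) \<otimes> \<mu>) = \<mu> \<cdot> (?m \<otimes> ident C a)"
    by (simp add: sem_morphism)
  have "?m \<in> bimod_homs ?F ?R" using l r epi_hom[OF epi] by (simp add: bimodule_homs_iff)
  moreover have "g = h" if Z: "is_bimodule C alg Z" and gh: "g \<in> bimod_homs ?R Z" "h \<in> bimod_homs ?R Z"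
    and eq: "g \<cdot> ?m = h \<cdot> ?m" for Z g h
    by (rule epi_cancel[OF epi _ _ _ eq, of "bimod_obj Z"])
      (use Z gh in \<open>simp_all add: is_bimodule_def bimodule_homs_def Let_def\<close>)
  ultimately show ?thesis by (simp add: epimorphism_def bimod_def)
qed

text \<open>The hypothesis of projectivity is exploited only here, and twice: for \<open>X\<close>
  the unit object the lift is a section of the multiplication, and for \<open>X\<close> projective
  it makes \<open>a\<close> a retract of a projective object.\<close>

lemma regular_bimodule_lift:
  assumes proj: "projective_object (bimod C alg) (bim a \<mu> \<mu>)"
    and X: "X \<in> obj C" and x: "epimorphism C X (unit_obj C) x"
  obtains s where
    "s \<in> bimod_homs (bim a \<mu> \<mu>)
      (bim (a \<odot> X \<odot> a) (\<mu> \<otimes> ident C (X \<odot> a)) (ident C (a \<odot> X) \<otimes> \<mu>))"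
    "(\<mu> \<cdot> (ident C a \<otimes> (x \<otimes> ident C a))) \<cdot> s = ident C a"
proof -
  have "ident C a \<in> bimod_homs (bim a \<mu> \<mu>) (bim a \<mu> \<mu>)"
    using ident_in_hom[OF a_obj] ident_comp[OF _ a_obj mu_hom] comp_ident[OF _ a_obj mu_hom]
    by (simp add: bimodule_homs_iff tensor_ident tensor_in_obj)
  then show ?thesis
    using proj two_sided_free_epi[OF X x] regular_bimodule two_sided_free_bimodule[OF X] that
    unfolding projective_object_def by (simp add: bimod_def) metis
qed

lemma casimir_if_projective:
  assumes proj: "projective_object (bimod C alg) (bim a \<mu> \<mu>)"
  obtains s where
    "s \<in> hom (bimod C alg) (regular_bimodule alg) (tensor_square_bimodule C alg)" "\<mu> \<cdot> s = ident C a"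
    "separable_braided_algebra C a \<mu> \<eta> (s \<cdot> \<eta>)"
proof -
  have id: "epimorphism C (unit_obj C) (unit_obj C) (ident C (unit_obj C))"
    using ident_in_hom[OF unit_in_obj] ident_comp[OF unit_in_obj unit_in_obj]
    by (intro split_epi[of _ _ _ "ident C (unit_obj C)"]) (simp_all add: unit_in_obj)
  note aa = tensor_in_obj[OF a_obj a_obj]
  obtain s where s: "s \<in> bimod_homs (bim a \<mu> \<mu>)
      (bim (a \<odot> a) (\<mu> \<otimes> ident C a) (ident C a \<otimes> \<mu>))" "\<mu> \<cdot> s = ident C a"
    using regular_bimodule_lift[OF proj unit_in_obj id] comp_ident[OF aa a_obj mu_hom]
    by (simp add: tensor_obj_unit tensor_ident unit_in_obj) metis
  have sh: "s \<in> hom C a (a \<odot> a)" and sl: "s \<cdot> \<mu> = (\<mu> \<otimes> ident C a) \<cdot> (ident C a \<otimes> s)"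
    and sr: "s \<cdot> \<mu> = (ident C a \<otimes> \<mu>) \<cdot> (s \<otimes> ident C a)"
    using s(1) unfolding bimodule_homs_iff by blast+
  note u = unit_in_obj
  have ae: "ident C a \<otimes> \<eta> \<in> hom C a (a \<odot> a)" "\<eta> \<otimes> ident C a \<in> hom C a (a \<odot> a)"
    using tensor_in_hom[OF a_obj a_obj u a_obj ident_in_hom[OF a_obj] eta_hom] tensor_in_hom[OF u a_obj a_obj a_obj eta_hom ident_in_hom[OF a_obj]]
    by (simp_all add: tensor_obj_unit)
  have as: "ident C a \<otimes> s \<in> hom C (a \<odot> a) (a \<odot> a \<odot> a)" "s \<otimes> ident C a \<in> hom C (a \<odot> a) (a \<odot> a \<odot> a)"
    using tensor_in_hom[OF a_obj a_obj a_obj aa ident_in_hom[OF a_obj] sh] tensor_in_hom[OF a_obj aa a_obj a_obj sh ident_in_hom[OF a_obj]]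
    by (simp_all add: tensor_obj_assoc)
  have am: "\<mu> \<otimes> ident C a \<in> hom C (a \<odot> a \<odot> a) (a \<odot> a)" "ident C a \<otimes> \<mu> \<in> hom C (a \<odot> a \<odot> a) (a \<odot> a)"
    using tensor_in_hom[OF aa a_obj a_obj a_obj mu_hom ident_in_hom[OF a_obj]] tensor_in_hom[OF a_obj a_obj aa a_obj ident_in_hom[OF a_obj] mu_hom]
    by (simp_all add: tensor_obj_assoc)
  note aaa = tensor_in_obj[OF a_obj aa]
  have "separable_braided_algebra C a \<mu> \<eta> (s \<cdot> \<eta>)"
  proof unfold_locales
    show "s \<cdot> \<eta> \<in> hom C (unit_obj C) (a \<odot> a)" by (rule comp_in_hom[OF u a_obj aa eta_hom sh])
    show "\<mu> \<cdot> (s \<cdot> \<eta>) = \<eta>"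
      using comp_assoc[OF u a_obj aa a_obj eta_hom sh mu_hom] s(2) ident_comp[OF u a_obj eta_hom] by simp
    \<comment> \<open>Both sides of the Casimir identity are \<open>s\<close> itself, because s(x) =
      x s(1) = s(1) x for a bimodule map.\<close>
    have "(\<mu> \<otimes> ident C a) \<cdot> (ident C a \<otimes> (s \<cdot> \<eta>)) = (s \<cdot> \<mu>) \<cdot> (ident C a \<otimes> \<eta>)"
      unfolding tensor_id_comp(1)[OF u a_obj aa a_obj eta_hom sh] sl comp_assoc[OF a_obj aa aaa aa ae(1) as(1) am(1)] ..
    also have "... = s" using comp_assoc[OF a_obj aa a_obj aa ae(1) mu_hom sh] mu_eta comp_ident[OF a_obj aa sh] by simp
    also have "... = (s \<cdot> \<mu>) \<cdot> (\<eta> \<otimes> ident C a)"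
      using comp_assoc[OF a_obj aa a_obj aa ae(2) mu_hom sh] mu_eta comp_ident[OF a_obj aa sh] by simp
    also have "... = (ident C a \<otimes> \<mu>) \<cdot> ((s \<cdot> \<eta>) \<otimes> ident C a)"
      unfolding tensor_id_comp(2)[OF u a_obj aa a_obj eta_hom sh] sr comp_assoc[OF a_obj aa aaa aa ae(2) as(2) am(2)] ..
    finally show "(\<mu> \<otimes> ident C a) \<cdot> (ident C a \<otimes> (s \<cdot> \<eta>)) = (ident C a \<otimes> \<mu>) \<cdot> ((s \<cdot> \<eta>) \<otimes> ident C a)" .
  qed
  then show ?thesis using that s by (simp add: bimod_def regular_bimodule_def tensor_square_bimodule_def)
qed

lemma carrier_projective:
  assumes proj: "projective_object (bimod C alg) (bim a \<mu> \<mu>)"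
  shows "projective_object C a"
proof -
  obtain P x where P: "projective_object C P" "epimorphism C P (unit_obj C) x"
    by (rule projective_cover_unit)
  have Po: "P \<in> obj C" using P by (simp add: projective_object_def)
  obtain s where s: "s \<in> bimod_homs (bim a \<mu> \<mu>)
      (bim (a \<odot> P \<odot> a) (\<mu> \<otimes> ident C (P \<odot> a)) (ident C (a \<odot> P) \<otimes> \<mu>))"
    "(\<mu> \<cdot> (ident C a \<otimes> (x \<otimes> ident C a))) \<cdot> s = ident C a"
    using regular_bimodule_lift[OF proj Po P(2)] .
  have sh: "s \<in> hom C a (a \<odot> P \<odot> a)" using s(1) by (simp add: bimodule_homs_iff)
  have m: "\<mu> \<cdot> (ident C a \<otimes> (x \<otimes> ident C a)) \<in> hom C (a \<odot> P \<odot> a) a"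
    using epi_hom[OF P(2)] Po ident_in_hom[OF a_obj] tensor_in_hom[OF Po unit_in_obj a_obj a_obj, of x "ident C a"]
      tensor_in_hom[OF a_obj a_obj tensor_in_obj[OF Po a_obj] a_obj, of "ident C a" "x \<otimes> ident C a"]
      comp_in_hom[OF _ _ a_obj _ mu_hom, of "a \<odot> P \<odot> a" "ident C a \<otimes> (x \<otimes> ident C a)"]
    by (simp add: tensor_obj_unit tensor_in_obj)
  show ?thesis
    by (rule projective_retract[OF projective_tensor(1)[OF projective_tensor(2)[OF P(1) a_obj] a_obj] a_obj sh m s(2)])
qed

end


section \<open>Averaging with the Casimir element\<close>

context separable_braided_algebra
begin

text \<open>Averaging over the Casimir element turns a generalized inverse in \<open>C\<close> into a bimodule map.\<close>
lemma bimodule_regular: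
  assumes proj: "projective_object C a"
    and N: "is_bimodule C alg (bim v l r)"
    and N': "is_bimodule C alg (bim v' l' r')"
    and \<phi>: "\<phi> \<in> bimod_homs (bim v l r) (bim v' l' r')"
  shows "\<exists>\<psi>\<in>bimod_homs (bim v' l' r') (bim v l r).
    (\<phi> \<cdot> \<psi>) \<cdot> \<phi> = \<phi>"
proof -
  note b = bimodule_deq[OF N] and b' = bimodule_deq[OF N']
  note [simp] = b(1-3) b'(1-3)
  let ?l = "([a, v], [v], l)" and ?r = "([v, a], [v], r)" and ?l' = "([a, v'], [v'], l')" and ?r' = "([v', a], [v'], r')"
  let ?\<phi> = "([v], [v'], \<phi>)"
  note s = sem_morphism
  have \<phi>d [simp]: "box ?\<phi>" and \<phi>l: "deq [a, v] [(0, ?l), (0, ?\<phi>)] [(1, ?\<phi>), (0, ?l')]"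
    and \<phi>r: "deq [v, a] [(0, ?r), (0, ?\<phi>)] [(0, ?\<phi>), (0, ?r')]"
    using \<phi> by (simp_all add: bimodule_hom_deq)
  have h: "\<phi> \<in> hom C v v'" "l \<in> hom C (a \<odot> v) v" "l' \<in> hom C (a \<odot> v') v'" using \<phi>d b(2) b'(2) by (simp_all add: box_def tens_simps)
  have "l \<cdot> (\<eta> \<otimes> ident C v) = ident C v" "\<phi> \<cdot> l = l' \<cdot> (ident C a \<otimes> \<phi>)"
    using b(5) \<phi>l by (simp_all add: s)
  then obtain \<psi>0 where \<psi>0: "\<psi>0 \<in> hom C v' v" "(\<phi> \<cdot> \<psi>0) \<cdot> \<phi> = \<phi>"
    using equivariant_regular[OF proj eta_hom b(1) b'(1) h(2) _ h(3,1)] by blast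
  let ?\<psi>0 = "([v'], [v], \<psi>0)"
  have [simp]: "box ?\<psi>0" using \<psi>0 by (intro boxI) simp_all
  have r0: "deq [v] [(0, ?\<phi>), (0, ?\<psi>0), (0, ?\<phi>)] [(0, ?\<phi>)]"
    using \<psi>0 h comp_assoc[of v v' v v' \<phi> \<psi>0 \<phi>] by (simp add: s)
  \<comment> \<open>x \<mapsto> e_1 \<psi>0(e_2 x) is linear on the left; the same construction on
    the right, applied afterwards, keeps this linearity since the two actions commute.\<close>
  obtain \<psi>1 where \<psi>1: "deq [v'] [(0, ([v'], [v], \<psi>1))] [(0, S), (1, ?l'), (1, ?\<psi>0), (0, ?l)]" "box ([v'], [v], \<psi>1)"
    by (rule that[OF deq_box]; simp)
  let ?\<psi>1 = "([v'], [v], \<psi>1)"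
  note [simp] = \<psi>1(2)
  have left1: "deq [a, v'] [(0, ?l'), (0, ?\<psi>1)] [(1, ?\<psi>1), (0, ?l)]"
  proof -
    have "deq [a, v'] [(0, ?l'), (0, ?\<psi>1)] [(0, ?l'), (0, S), (1, ?l'), (1, ?\<psi>0), (0, ?l)]"
      by (rule at[OF \<psi>1(1), of 0 1]; simp)
    also have "deq [a, v'] ... [(0, S), (1, M), (1, ?l'), (1, ?\<psi>0), (0, ?l)]"
      by (rule step_sym[OF b'(4), of "[(0, S)]" 1 "[(1, ?\<psi>0), (0, ?l)]"]; simp)
    also have "deq [a, v'] ... [(1, S), (0, M), (1, ?l'), (1, ?\<psi>0), (0, ?l)]"
      by (rule at_sym[OF casimir, of 0 0]; simp)
    also have "deq [a, v'] ... [(1, S), (2, ?l'), (2, ?\<psi>0), (1, ?l), (0, ?l)]"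
      by (rule step[OF b(4), of "[(1, S), (2, ?l'), (2, ?\<psi>0)]" 0 "[]"]; simp)
    also have "deq [a, v'] ... [(1, ?\<psi>1), (0, ?l)]"
      by (rule at_sym[OF \<psi>1(1), of 1 0]; simp)
    finally show ?thesis .
  qed
  have r1: "deq [v] [(0, ?\<phi>), (0, ?\<psi>1), (0, ?\<phi>)] [(0, ?\<phi>)]"
  proof -
    have "deq [v] [(0, ?\<phi>), (0, ?\<psi>1), (0, ?\<phi>)] [(0, ?\<phi>), (0, S), (1, ?l'), (1, ?\<psi>0), (0, ?l), (0, ?\<phi>)]"
      by (rule at[OF \<psi>1(1), of 0 1]; simp)
    also have "deq [v] ... [(0, ?\<phi>), (0, S), (1, ?l'), (1, ?\<psi>0), (1, ?\<phi>), (0, ?l')]"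
      by (rule at[OF \<phi>l, of 0 4]; simp)
    also have "deq [v] ... [(0, S), (1, ?l), (1, ?\<phi>), (1, ?\<psi>0), (1, ?\<phi>), (0, ?l')]"
      by (rule step_sym[OF \<phi>l, of "[(0, S)]" 1 "[(1, ?\<psi>0), (1, ?\<phi>), (0, ?l')]"]; simp)
    also have "deq [v] ... [(0, S), (1, ?l), (1, ?\<phi>), (0, ?l')]"
      by (rule at[OF r0, of 1 2]; simp)
    also have "deq [v] ... [(0, S), (1, ?l), (0, ?l), (0, ?\<phi>)]"
      by (rule at_sym[OF \<phi>l, of 0 2]; simp)
    also have "deq [v] ... [(0, S), (0, M), (0, ?l), (0, ?\<phi>)]"
      by (rule at_sym[OF b(4), of 0 1]; simp)
    also have "deq [v] ... [(0, E), (0, ?l), (0, ?\<phi>)]"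
      by (rule at[OF split, of 0 0]; simp)
    also have "deq [v] ... [(0, ?\<phi>)]"
      by (rule at[OF b(5), of 0 0]; simp)
    finally show ?thesis .
  qed
  obtain \<psi>2 where \<psi>2: "deq [v'] [(0, ([v'], [v], \<psi>2))] [(1, S), (0, ?r'), (0, ?\<psi>1), (0, ?r)]" "box ([v'], [v], \<psi>2)"
    by (rule that[OF deq_box]; simp)
  let ?\<psi>2 = "([v'], [v], \<psi>2)"
  note [simp] = \<psi>2(2)
  have right2: "deq [v', a] [(0, ?r'), (0, ?\<psi>2)] [(0, ?\<psi>2), (0, ?r)]"
  proof -
    have "deq [v', a] [(0, ?r'), (0, ?\<psi>2)] [(0, ?r'), (1, S), (0, ?r'), (0, ?\<psi>1), (0, ?r)]"
      by (rule at[OF \<psi>2(1), of 0 1]; simp)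
    also have "deq [v', a] ... [(2, S), (1, M), (0, ?r'), (0, ?\<psi>1), (0, ?r)]"
      by (rule step_sym[OF b'(6), of "[(2, S)]" 0 "[(0, ?\<psi>1), (0, ?r)]"]; simp)
    also have "deq [v', a] ... [(1, S), (2, M), (0, ?r'), (0, ?\<psi>1), (0, ?r)]"
      by (rule at[OF casimir, of 1 0]; simp)
    also have "deq [v', a] ... [(1, S), (0, ?r'), (0, ?\<psi>1), (0, ?r), (0, ?r)]"
      by (rule step[OF b(6), of "[(1, S), (0, ?r'), (0, ?\<psi>1)]" 0 "[]"]; simp)
    also have "deq [v', a] ... [(0, ?\<psi>2), (0, ?r)]"
      by (rule at_sym[OF \<psi>2(1), of 0 0]; simp)
    finally show ?thesis .
  qed
  have left2: "deq [a, v'] [(0, ?l'), (0, ?\<psi>2)] [(1, ?\<psi>2), (0, ?l)]"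
  proof -
    have "deq [a, v'] [(0, ?l'), (0, ?\<psi>2)] [(2, S), (0, ?l'), (0, ?r'), (0, ?\<psi>1), (0, ?r)]"
      by (rule at[OF \<psi>2(1), of 0 1]; simp)
    also have "deq [a, v'] ... [(2, S), (1, ?r'), (0, ?l'), (0, ?\<psi>1), (0, ?r)]"
      by (rule at[OF b'(8), of 0 1]; simp)
    also have "deq [a, v'] ... [(2, S), (1, ?r'), (1, ?\<psi>1), (0, ?l), (0, ?r)]"
      by (rule at[OF left1, of 0 2]; simp)
    also have "deq [a, v'] ... [(2, S), (1, ?r'), (1, ?\<psi>1), (1, ?r), (0, ?l)]"
      by (rule at[OF b(8), of 0 3]; simp)
    also have "deq [a, v'] ... [(1, ?\<psi>2), (0, ?l)]"
      by (rule at_sym[OF \<psi>2(1), of 1 0]; simp)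
    finally show ?thesis .
  qed
  have r2: "deq [v] [(0, ?\<phi>), (0, ?\<psi>2), (0, ?\<phi>)] [(0, ?\<phi>)]"
  proof -
    have "deq [v] [(0, ?\<phi>), (0, ?\<psi>2), (0, ?\<phi>)] [(0, ?\<phi>), (1, S), (0, ?r'), (0, ?\<psi>1), (0, ?r), (0, ?\<phi>)]"
      by (rule at[OF \<psi>2(1), of 0 1]; simp)
    also have "deq [v] ... [(0, ?\<phi>), (1, S), (0, ?r'), (0, ?\<psi>1), (0, ?\<phi>), (0, ?r')]"
      by (rule at[OF \<phi>r, of 0 4]; simp)
    also have "deq [v] ... [(1, S), (0, ?r), (0, ?\<phi>), (0, ?\<psi>1), (0, ?\<phi>), (0, ?r')]"
      by (rule step_sym[OF \<phi>r, of "[(1, S)]" 0 "[(0, ?\<psi>1), (0, ?\<phi>), (0, ?r')]"]; simp)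
    also have "deq [v] ... [(1, S), (0, ?r), (0, ?\<phi>), (0, ?r')]"
      by (rule at[OF r1, of 0 2]; simp)
    also have "deq [v] ... [(1, S), (0, ?r), (0, ?r), (0, ?\<phi>)]"
      by (rule at_sym[OF \<phi>r, of 0 2]; simp)
    also have "deq [v] ... [(1, S), (1, M), (0, ?r), (0, ?\<phi>)]"
      by (rule at_sym[OF b(6), of 0 1]; simp)
    also have "deq [v] ... [(1, E), (0, ?r), (0, ?\<phi>)]"
      by (rule at[OF split, of 1 0]; simp)
    also have "deq [v] ... [(0, ?\<phi>)]"
      by (rule at[OF b(7), of 0 0]; simp)
    finally show ?thesis .
  qed
  have "\<psi>2 \<in> bimod_homs (bim v' l' r') (bim v l r)"
    using left2 right2 by (simp add: bimodule_hom_deq)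
  moreover have \<psi>2h: "\<psi>2 \<in> hom C v' v" using \<psi>2(2) by (simp add: box_def)
  have "(\<phi> \<cdot> \<psi>2) \<cdot> \<phi> = \<phi>"
    using r2 h comp_assoc[of v v' v v' \<phi> \<psi>2 \<phi>] \<psi>2h by (simp add: s)
  ultimately show ?thesis by blast
qed

end

section \<open>Identities, composites and linear combinations of bimodule maps\<close>

context braided_algebra
begin

lemma bimoduleD:
  assumes "is_bimodule C alg N"
  shows "bimod_obj N \<in> obj C" "left_act N \<in> hom C (a \<odot> bimod_obj N) (bimod_obj N)"
    "right_act N \<in> hom C (bimod_obj N \<odot> a) (bimod_obj N)"
    "a \<odot> bimod_obj N \<in> obj C" "bimod_obj N \<odot> a \<in> obj C"
  using assms by (simp_all add: is_bimodule_def Let_def tensor_in_obj)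

lemma bimodule_homD:
  assumes "f \<in> bimod_homs N N'"
  shows "f \<in> hom C (bimod_obj N) (bimod_obj N')" "f \<cdot> left_act N = left_act N' \<cdot> (ident C a \<otimes> f)"
    "f \<cdot> right_act N = right_act N' \<cdot> (f \<otimes> ident C a)"
  using assms unfolding bimodule_homs_def by simp_all

lemma bimodule_homI:
  assumes "f \<in> hom C (bimod_obj N) (bimod_obj N')" "f \<cdot> left_act N = left_act N' \<cdot> (ident C a \<otimes> f)"
    "f \<cdot> right_act N = right_act N' \<cdot> (f \<otimes> ident C a)"
  shows "f \<in> bimod_homs N N'"
  using assms unfolding bimodule_homs_def by simp

lemma bimodule_ident:
  assumes "is_bimodule C alg N"
  shows "ident C (bimod_obj N) \<in> bimod_homs N N"
  using bimoduleD[OF assms] by (intro bimodule_homI) (simp_all add: ident_in_hom ident_comp comp_ident tensor_ident)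

lemma bimodule_comp:
  assumes M: "is_bimodule C alg N" and N: "is_bimodule C alg N'" and K: "is_bimodule C alg N''"
    and f: "f \<in> bimod_homs N N'" and g: "g \<in> bimod_homs N' N''"
  shows "g \<cdot> f \<in> bimod_homs N N''"
proof -
  note m = bimoduleD[OF M] and n = bimoduleD[OF N] and k = bimoduleD[OF K] and f' = bimodule_homD[OF f] and g' = bimodule_homD[OF g]
  have af: "ident C a \<otimes> f \<in> hom C (a \<odot> bimod_obj N) (a \<odot> bimod_obj N')" "f \<otimes> ident C a \<in> hom C (bimod_obj N \<odot> a) (bimod_obj N' \<odot> a)"
    and ag: "ident C a \<otimes> g \<in> hom C (a \<odot> bimod_obj N') (a \<odot> bimod_obj N'')" "g \<otimes> ident C a \<in> hom C (bimod_obj N' \<odot> a) (bimod_obj N'' \<odot> a)"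
    by (simp_all add: tensor_in_hom ident_in_hom f' g' m n k)
  show ?thesis
  proof (rule bimodule_homI)
    show "g \<cdot> f \<in> hom C (bimod_obj N) (bimod_obj N'')" by (rule comp_in_hom[OF m(1) n(1) k(1) f'(1) g'(1)])
    show "(g \<cdot> f) \<cdot> left_act N = left_act N'' \<cdot> (ident C a \<otimes> (g \<cdot> f))"
      unfolding comp_assoc[OF m(4,1) n(1) k(1) m(2) f'(1) g'(1)] f'(2)
        comp_assoc[OF m(4) n(4,1) k(1) af(1) n(2) g'(1), symmetric] g'(2) comp_assoc[OF m(4) n(4) k(4,1) af(1) ag(1) k(2)]
        tensor_id_comp(1)[OF m(1) n(1) k(1) a_obj f'(1) g'(1)] ..
    show "(g \<cdot> f) \<cdot> right_act N = right_act N'' \<cdot> ((g \<cdot> f) \<otimes> ident C a)"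
      unfolding comp_assoc[OF m(5,1) n(1) k(1) m(3) f'(1) g'(1)] f'(3)
        comp_assoc[OF m(5) n(5,1) k(1) af(2) n(3) g'(1), symmetric] g'(3) comp_assoc[OF m(5) n(5) k(5,1) af(2) ag(2) k(3)]
        tensor_id_comp(2)[OF m(1) n(1) k(1) a_obj f'(1) g'(1)] ..
  qed
qed

lemma bimodule_homs_subspace:
  assumes M: "is_bimodule C alg N" and N: "is_bimodule C alg N'"
  shows "module.subspace (scale C) (bimod_homs N N')"
proof -
  interpret vector_space "scale C" by (rule ambient_vector_space)
  note m = bimoduleD[OF M] and n = bimoduleD[OF N]
  note i = ident_in_hom[OF a_obj]
  have t: "ident C a \<otimes> f \<in> hom C (a \<odot> bimod_obj N) (a \<odot> bimod_obj N')" "f \<otimes> ident C a \<in> hom C (bimod_obj N \<odot> a) (bimod_obj N' \<odot> a)"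
    if "f \<in> hom C (bimod_obj N) (bimod_obj N')" for f
    by (simp_all add: tensor_in_hom i m n that)
  show ?thesis
  proof (rule subspaceI)
    show "0 \<in> bimod_homs N N'"
      using m n i by (intro bimodule_homI) (simp_all add: hom_zero comp_zero[of "a \<odot> bimod_obj N"] comp_zero[of "bimod_obj N \<odot> a"] tensor_zero[of a a] tensor_zero[of _ _ a a])
    fix f c assume f: "f \<in> bimod_homs N N'"
    note f' = bimodule_homD[OF f]
    show "scale C c f \<in> bimod_homs N N'"
      using f' t[OF f'(1)] m n i
      by (intro bimodule_homI) (simp_all add: hom_scale comp_scale_left[of "a \<odot> bimod_obj N"] comp_scale_left[of "bimod_obj N \<odot> a"]
        comp_scale_right[of "a \<odot> bimod_obj N"] comp_scale_right[of "bimod_obj N \<odot> a"] tensor_scale_left[of _ _ a a] tensor_scale_right[of a a])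
    fix g assume g: "g \<in> bimod_homs N N'"
    note g' = bimodule_homD[OF g]
    show "f + g \<in> bimod_homs N N'"
      using f' g' t[OF f'(1)] t[OF g'(1)] m n i
      by (intro bimodule_homI) (simp_all add: hom_add comp_add_left[of "a \<odot> bimod_obj N"] comp_add_left[of "bimod_obj N \<odot> a"]
        comp_add_right[of "a \<odot> bimod_obj N"] comp_add_right[of "bimod_obj N \<odot> a"] tensor_add_left[of _ _ a a] tensor_add_right[of a a])
  qed
qed

lemma bimodule_diff:
  assumes "is_bimodule C alg N" "is_bimodule C alg N'" "f \<in> bimod_homs N N'" "g \<in> bimod_homs N N'"
  shows "f - g \<in> bimod_homs N N'"
proof -
  interpret vector_space "scale C" by (rule ambient_vector_space)
  show ?thesis by (rule subspace_diff[OF bimodule_homs_subspace[OF assms(1,2)] assms(3,4)])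
qed

end

context split_centre
begin

text \<open>The tensor product of \<open>a\<close> with itself over the centre is realized as a
  summand of \<open>a \<odot> a\<close>, and the Casimir element of \<open>z\<close> is obtained
  from the class of 1 \<otimes> 1 in it. The image of \<open>e\<close> under \<rho> \<otimes> \<rho>
  would also satisfy the Casimir identity, but its product need not be the unit: for n by n matrices
  and the element (1/n) \<Sum> e_ij \<otimes> e_ji it is 1/n^2.\<close>

lemma centre_separable:
  assumes proj: "projective_object C a"
  shows "\<exists>w. commutative_separable_algebra C z mu_z eta_z w"
proof -
  note [simp] = z_obj
  let ?F = "(bim (a \<odot> z \<odot> a) (\<mu> \<otimes> ident C (z \<odot> a)) (ident C (a \<odot> z) \<otimes> \<mu>))"
  let ?T = "(bim (a \<odot> a) (\<mu> \<otimes> ident C a) (ident C a \<otimes> \<mu>))"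
  note s = sem_morphism
  have F: "is_bimodule C alg ?F" by (rule two_sided_free_bimodule) simp
  have T: "is_bimodule C alg ?T" using two_sided_free_bimodule[OF unit_in_obj] by (simp add: tensor_obj_unit)
  have o: "a \<odot> z \<odot> a \<in> obj C" "a \<odot> a \<in> obj C" by (simp_all add: tensor_in_obj)
  obtain f1 where f1: "deq [a, z, a] [(0, [a, z, a], [a, a], f1)] [(1, I), (0, M)]" "box ([a, z, a], [a, a], f1)"
    by (rule that[OF deq_box]; simp)
  obtain f2 where f2: "deq [a, z, a] [(0, [a, z, a], [a, a], f2)] [(1, I), (1, M)]" "box ([a, z, a], [a, a], f2)"
    by (rule that[OF deq_box]; simp)
  note [simp] = f1(2) f2(2)
  let ?f1 = "([a, z, a], [a, a], f1)" and ?f2 = "([a, z, a], [a, a], f2)"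
  have f12: "f1 \<in> hom C (a \<odot> z \<odot> a) (a \<odot> a)" "f2 \<in> hom C (a \<odot> z \<odot> a) (a \<odot> a)"
    using f1(2) f2(2) by (simp_all add: box_def tens_simps)
  have 1: "f1 \<in> bimod_homs ?F ?T"
  proof -
    have "deq [a, a, z, a] [(0, M), (0, ?f1)] [(0, M), (1, I), (0, M)]"
      by (rule at[OF f1(1), of 0 1]; simp)
    also have "deq [a, a, z, a] ... [(2, I), (1, M), (0, M)]"
      by (rule step[OF assoc, of "[(2, I)]" 0 "[]"]; simp)
    also have "deq [a, a, z, a] ... [(1, ?f1), (0, M)]"
      by (rule at_sym[OF f1(1), of 1 0]; simp)
    finally have l: "deq [a, a, z, a] [(0, M), (0, ?f1)] [(1, ?f1), (0, M)]" .
    have "deq [a, z, a, a] [(2, M), (0, ?f1)] [(2, M), (1, I), (0, M)]"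
      by (rule at[OF f1(1), of 0 1]; simp)
    also have "deq [a, z, a, a] ... [(0, ?f1), (1, M)]"
      by (rule step_sym[OF f1(1), of "[]" 0 "[(1, M)]"]; simp)
    finally show ?thesis using l f12 unfolding bimodule_homs_iff by (simp add: s)
  qed
  have 2: "f2 \<in> bimod_homs ?F ?T"
  proof -
    have "deq [a, a, z, a] [(0, M), (0, ?f2)] [(0, M), (1, I), (1, M)]"
      by (rule at[OF f2(1), of 0 1]; simp)
    also have "deq [a, a, z, a] ... [(1, ?f2), (0, M)]"
      by (rule step_sym[OF f2(1), of "[]" 1 "[(0, M)]"]; simp)
    finally have l: "deq [a, a, z, a] [(0, M), (0, ?f2)] [(1, ?f2), (0, M)]" .
    have "deq [a, z, a, a] [(2, M), (0, ?f2)] [(2, M), (1, I), (1, M)]"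
      by (rule at[OF f2(1), of 0 1]; simp)
    also have "deq [a, z, a, a] ... [(1, I), (1, M), (1, M)]"
      by (rule step_sym[OF assoc, of "[(1, I)]" 1 "[]"]; simp)
    also have "deq [a, z, a, a] ... [(0, ?f2), (1, M)]"
      by (rule at_sym[OF f2(1), of 0 0]; simp)
    finally show ?thesis using l f12 unfolding bimodule_homs_iff by (simp add: s)
  qed
  \<comment> \<open>\<open>f1\<close> and \<open>f2\<close> let the middle factor act to the left
    and to the right, so the cokernel of the difference is the tensor product over the
    centre.\<close>
  let ?\<Phi> = "f1 - f2"
  have \<Phi>: "?\<Phi> \<in> bimod_homs ?F ?T" by (rule bimodule_diff[OF F T 1 2])
  then have \<Phi>h: "?\<Phi> \<in> hom C (a \<odot> z \<odot> a) (a \<odot> a)" by (simp add: bimodule_homs_iff)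
  obtain \<Psi> where \<Psi>: "\<Psi> \<in> bimod_homs ?T ?F" "(?\<Phi> \<cdot> \<Psi>) \<cdot> ?\<Phi> = ?\<Phi>"
    using bimodule_regular[OF proj F T \<Phi>] by blast
  have \<Psi>h: "\<Psi> \<in> hom C (a \<odot> a) (a \<odot> z \<odot> a)" using bimodule_homD(1)[OF \<Psi>(1)] by simp
  let ?q = "?\<Phi> \<cdot> \<Psi>"
  have q: "?q \<in> bimod_homs ?T ?T" by (rule bimodule_comp[OF T F T \<Psi>(1) \<Phi>])
  have qh: "?q \<in> hom C (a \<odot> a) (a \<odot> a)" using bimodule_homD(1)[OF q] by simp
  have aah: "ident C (a \<odot> a) \<in> hom C (a \<odot> a) (a \<odot> a)" by (rule ident_in_hom[OF o(2)])
  \<comment> \<open>As \<Phi> \<Psi> \<Phi> = \<Phi>, this is an idempotent bimodule map that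
    annihilates the image of \<Phi>: the projection onto the tensor product over the centre.\<close>
  define p where "p = ident C (a \<odot> a) - ?q"
  have p: "p \<in> bimod_homs ?T ?T"
    unfolding p_def using bimodule_diff[OF T T _ q] bimodule_ident[OF T] by simp
  have ph: "p \<in> hom C (a \<odot> a) (a \<odot> a)" using bimodule_homD(1)[OF p] by simp
  then have bp [simp]: "box ([a, a], [a, a], p)" by (intro boxI) (simp_all add: tens_simps)
  let ?p = "([a, a], [a, a], p)"
  have "p \<cdot> ?\<Phi> = 0"
    unfolding p_def comp_diff_left[OF o o(2) \<Phi>h aah qh] \<Psi>(2) ident_comp[OF o \<Phi>h] by simp
  then have pf: "p \<cdot> f1 = p \<cdot> f2" using comp_diff_right[OF o o(2) f12 ph] by simp
  have p_left: "deq [a, a, a] [(0, M), (0, ?p)] [(1, ?p), (0, M)]" and p_right: "deq [a, a, a] [(1, M), (0, ?p)] [(0, ?p), (1, M)]"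
    using bimodule_homD(2,3)[OF p] by (simp_all add: s)
  have pf': "deq [a, z, a] [(0, ?f1), (0, ?p)] [(0, ?f2), (0, ?p)]" using pf by (simp add: s)
  obtain t where t: "deq [] [(0, [], [a, a], t)] [(0, E), (1, E), (0, ?p)]" "box ([], [a, a], t)"
    by (rule that[OF deq_box]; simp)
  note [simp] = t(2)
  let ?t = "([], [a, a], t)"
  obtain w where w: "deq [] [(0, [], [z, z], w)] [(0, ?t), (0, R), (1, R)]" "box ([], [z, z], w)"
    by (rule that[OF deq_box]; simp)
  note [simp] = w(2)
  let ?w = "([], [z, z], w)"
  \<comment> \<open>Included into \<open>a\<close>, the central factor is brought to the middle of 1
    \<otimes> 1, crosses over by \<open>p \<cdot> f1 = p \<cdot> f2\<close>, and leaves on the other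
    side.\<close>
  have cas: "deq [z] [(1, ?w), (0, MZ)] [(0, ?w), (1, MZ)]"
  proof -
    have "deq [z] [(1, ?w), (0, MZ)] [(1, ?t), (1, R), (0, MZ), (1, R)]"
      by (rule at[OF w(1), of 1 0]; simp)
    also have "deq [z] ... [(1, ?t), (0, I), (0, M), (0, R), (1, R)]"
      by (rule at_sym[OF R_left, of 0 1]; simp)
    also have "deq [z] ... [(0, I), (1, E), (2, E), (1, ?p), (0, M), (0, R), (1, R)]"
      by (rule step[OF t(1), of "[(0, I)]" 1 "[(0, M), (0, R), (1, R)]"]; simp)
    also have "deq [z] ... [(0, I), (1, E), (2, E), (0, M), (0, ?p), (0, R), (1, R)]"
      by (rule at_sym[OF p_left, of 0 3]; simp)
    also have "deq [z] ... [(0, I), (1, E), (0, ?p), (0, R), (1, R)]"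
      by (rule step[OF unit_right, of "[(0, I)]" 0 "[(1, E), (0, ?p), (0, R), (1, R)]"]; simp)
    also have "deq [z] ... [(0, E), (1, I), (0, M), (1, E), (0, ?p), (0, R), (1, R)]"
      by (rule at_sym[OF unit_left, of 0 1]; simp)
    also have "deq [z] ... [(0, E), (2, E), (0, ?f1), (0, ?p), (0, R), (1, R)]"
      by (rule step_sym[OF f1(1), of "[(0, E), (2, E)]" 0 "[(0, ?p), (0, R), (1, R)]"]; simp)
    also have "deq [z] ... [(0, E), (2, E), (0, ?f2), (0, ?p), (0, R), (1, R)]"
      by (rule at[OF pf', of 0 2]; simp)
    also have "deq [z] ... [(0, E), (2, E), (1, I), (1, M), (0, ?p), (0, R), (1, R)]"
      by (rule at[OF f2(1), of 0 2]; simp)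
    also have "deq [z] ... [(0, E), (1, I), (0, ?p), (0, R), (1, R)]"
      by (rule step[OF unit_right, of "[(0, E), (1, I)]" 1 "[(0, ?p), (0, R), (1, R)]"]; simp)
    also have "deq [z] ... [(0, E), (1, E), (2, I), (1, M), (0, ?p), (0, R), (1, R)]"
      by (rule at_sym[OF unit_left, of 1 2]; simp)
    also have "deq [z] ... [(0, E), (1, E), (2, I), (0, ?p), (1, M), (0, R), (1, R)]"
      by (rule at[OF p_right, of 0 3]; simp)
    also have "deq [z] ... [(0, ?t), (0, R), (2, I), (1, M), (1, R)]"
      by (rule step_sym[OF t(1), of "[]" 0 "[(2, I), (1, M), (0, R), (1, R)]"]; simp)
    also have "deq [z] ... [(0, ?t), (0, R), (1, R), (1, MZ)]"
      by (rule at[OF R_right, of 1 2]; simp)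
    also have "deq [z] ... [(0, ?w), (1, MZ)]"
      by (rule at_sym[OF w(1), of 0 0]; simp)
    finally show ?thesis .
  qed
  \<comment> \<open>The map x \<otimes> y \<mapsto> \<rho>(P(x) y), with P for
    \<open>centering\<close>, is balanced over the centre and hence unchanged by \<open>p\<close>.
    On \<open>t\<close> it computes the product of the Casimir element, and on 1 \<otimes> 1 it
    gives the unit.\<close>
  obtain h where h: "deq [a, a] [(0, [a, a], [z], h)] [(0, P), (0, M), (0, R)]" "box ([a, a], [z], h)"
    by (rule that[OF deq_box]; simp)
  note [simp] = h(2)
  let ?h = "([a, a], [z], h)"
  have hh: "h \<in> hom C (a \<odot> a) z" using h(2) by (simp add: box_def tens_simps)
  have "deq [a, z, a] [(0, ?f1), (0, ?h)] [(0, ?f1), (0, P), (0, M), (0, R)]"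
    by (rule at[OF h(1), of 0 1]; simp)
  also have "deq [a, z, a] ... [(1, I), (0, M), (0, P), (0, M), (0, R)]"
    by (rule at[OF f1(1), of 0 0]; simp)
  also have "deq [a, z, a] ... [(0, P), (1, I), (0, M), (0, M), (0, R)]"
    by (rule at[OF centering_right, of 0 0]; simp)
  also have "deq [a, z, a] ... [(0, P), (1, I), (1, M), (0, M), (0, R)]"
    by (rule at[OF assoc, of 0 2]; simp)
  also have "deq [a, z, a] ... [(0, ?f2), (0, P), (0, M), (0, R)]"
    by (rule step_sym[OF f2(1), of "[]" 0 "[(0, P), (0, M), (0, R)]"]; simp)
  also have "deq [a, z, a] ... [(0, ?f2), (0, ?h)]"
    by (rule at_sym[OF h(1), of 0 1]; simp)
  finally have "h \<cdot> f1 = h \<cdot> f2" by (simp add: s)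
  then have "h \<cdot> ?\<Phi> = 0" using comp_diff_right[OF o z_obj f12 hh] by simp
  then have "h \<cdot> ?q = 0" using comp_assoc[OF o(2,1,2) z_obj \<Psi>h \<Phi>h hh] comp_zero(1)[OF o(2,1) z_obj \<Psi>h] by simp
  then have "h \<cdot> p = h" unfolding p_def
    using comp_diff_right[OF o(2) o(2) z_obj aah qh hh] comp_ident[OF o(2) z_obj hh] by simp
  then have hp: "deq [a, a] [(0, ?p), (0, ?h)] [(0, ?h)]" by (simp add: s)
  have "deq [] [(0, ?w), (0, MZ)] [(0, ?t), (0, R), (1, R), (0, MZ)]"
    by (rule at[OF w(1), of 0 0]; simp)
  also have "deq [] ... [(0, ?t), (0, R), (0, I), (0, M), (0, R)]"
    by (rule at_sym[OF R_left, of 0 2]; simp)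
  also have "deq [] ... [(0, ?t), (0, P), (0, M), (0, R)]"
    by (rule at[OF RI, of 0 1]; simp)
  also have "deq [] ... [(0, ?t), (0, ?h)]"
    by (rule at_sym[OF h(1), of 0 1]; simp)
  also have "deq [] ... [(0, E), (1, E), (0, ?p), (0, ?h)]"
    by (rule at[OF t(1), of 0 0]; simp)
  also have "deq [] ... [(0, E), (1, E), (0, ?h)]"
    by (rule at[OF hp, of 0 2]; simp)
  also have "deq [] ... [(0, E), (0, P), (1, E), (0, M), (0, R)]"
    by (rule at[OF h(1), of 0 2]; simp)
  also have "deq [] ... [(0, E), (0, P), (0, R)]"
    by (rule at[OF unit_right, of 0 2]; simp)
  also have "deq [] ... [(0, E), (0, R)]"
    by (rule at[OF centering_unit, of 0 0]; simp)
  also have "deq [] ... [(0, EZ)]" by (rule deq_sym[OF EZ_def])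
  finally have unit: "mu_z \<cdot> w = eta_z" by (simp add: s)
  have zh: "mu_z \<in> hom C (z \<odot> z) z" "eta_z \<in> hom C (unit_obj C) z" "w \<in> hom C (unit_obj C) (z \<odot> z)"
    using box_MZ box_EZ w(2) by (simp_all add: box_def tens_simps)
  have "commutative_separable_algebra C z mu_z eta_z w"
  proof unfold_locales
    show "is_algebra C \<lparr>carrier_obj = z, mult = mu_z, unit_mor = eta_z\<rparr>"
      using assoc_z unit_left_z unit_right_z zh by (simp add: is_algebra_def Let_def s)
    show "w \<in> hom C (unit_obj C) (z \<odot> z)" by fact
    show "(mu_z \<otimes> ident C z) \<cdot> (ident C z \<otimes> w) = (ident C z \<otimes> mu_z) \<cdot> (w \<otimes> ident C z)"
      using cas by (simp add: s)
    show "mu_z \<cdot> w = eta_z" by fact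
    show "mu_z \<cdot> braiding C z z = mu_z" using commutative_z by (simp add: s)
  qed
  then show ?thesis by blast
qed

end

section \<open>The category of twisted bimodules\<close>

text \<open>Characteristic zero enters at this point, for the factor 1/2 in the average over twists
  and for the rational functional at the end.\<close>

locale twisted_bimodules = commutative_separable_algebra C a \<mu> \<eta> e
  for C :: "('o, 'm::ab_group_add, 'k::field_char_0, 'x) brcat_scheme" (structure) and a \<mu> \<eta> e +
  assumes a_projective: "projective_object C a"
begin

text \<open>A twist is not a bimodule endomorphism. In a ribbon category with trivial twist on
  \<open>a\<close>, naturality would give the twist of the object \<open>v\<close> exactly these two
  equations with the actions.\<close>

definition twisted :: "('o, 'm) bimodule \<times> 'm \<Rightarrow> bool" where
  "twisted X \<longleftrightarrow> (let N = fst X; f = snd X; v = bimod_obj N; l = left_act N; r = right_act N in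
     is_bimodule C alg N \<and> f \<in> hom C v v \<and>
     f \<cdot> l = l \<cdot> ((braiding C v a \<cdot> braiding C a v) \<cdot> (ident C a \<otimes> f)) \<and>
     f \<cdot> r = r \<cdot> ((braiding C a v \<cdot> braiding C v a) \<cdot> (f \<otimes> ident C a)) \<and>
     f \<cdot> (double_twist v \<cdot> f) = ident C v)"

definition tcat :: "(('o, 'm) bimodule \<times> 'm, 'm, 'k) lincat" where
  "tcat = \<lparr>obj = Collect twisted,
     hom = (\<lambda>X Y. {\<phi> \<in> bimod_homs (fst X) (fst Y). \<phi> \<cdot> snd X = snd Y \<cdot> \<phi>}),
     ident = (\<lambda>X. ident C (bimod_obj (fst X))), comp = comp C, scale = scale C\<rparr>"

lemma tcat_simps [simp]:
  "obj tcat = Collect twisted" "comp tcat = comp C" "scale tcat = scale C"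
  "ident tcat X = ident C (bimod_obj (fst X))"
  by (simp_all add: tcat_def)

lemma tcat_hom: "u \<in> hom tcat X Y \<longleftrightarrow> u \<in> bimod_homs (fst X) (fst Y) \<and> u \<cdot> snd X = snd Y \<cdot> u"
  by (simp add: tcat_def)

lemma twistedD:
  assumes "twisted X"
  shows "is_bimodule C alg (fst X)" "snd X \<in> hom C (bimod_obj (fst X)) (bimod_obj (fst X))" "bimod_obj (fst X) \<in> obj C"
  using assms bimoduleD(1) by (simp_all add: twisted_def Let_def)

lemma tcat_homD:
  assumes "u \<in> hom tcat X Y"
  shows "u \<in> hom C (bimod_obj (fst X)) (bimod_obj (fst Y))" "u \<in> bimod_homs (fst X) (fst Y)"
    "u \<cdot> snd X = snd Y \<cdot> u"
  using assms bimodule_homD(1) unfolding tcat_hom by blast+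

lemma linear_category_tcat: "linear_category tcat"
proof (rule linear_category.intro, unfold tcat_simps mem_Collect_eq)
  show "vector_space (scale C)" by (rule ambient_vector_space)
  interpret vector_space "scale C" by (rule ambient_vector_space)
  fix W X Y Z f f' g g' h c
  assume X: "twisted X"
  note x = twistedD[OF X]
  show "ident C (bimod_obj (fst X)) \<in> hom tcat X X"
    using bimodule_ident[OF x(1)] ident_comp[OF x(3,3,2)] comp_ident[OF x(3,3,2)] by (simp add: tcat_hom)
  assume Y: "twisted Y"
  note y = twistedD[OF Y]
  show "subspace (hom tcat X Y)"
  proof (rule subspaceI)
    note S = bimodule_homs_subspace[OF x(1) y(1)]
    show "0 \<in> hom tcat X Y"
      using subspace_0[OF S] comp_zero(1)[OF x(3,3) y(3) x(2)] comp_zero(2)[OF x(3) y(3,3,2)] by (simp add: tcat_hom)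
    fix p q c assume p: "p \<in> hom tcat X Y"
    note p' = tcat_homD[OF p]
    show "scale C c p \<in> hom tcat X Y"
      unfolding tcat_hom comp_scale_left[OF x(3,3) y(3) x(2) p'(1)] comp_scale_right[OF x(3) y(3,3) p'(1) y(2)]
      using subspace_scale[OF S p'(2)] p'(3) by simp
    assume q: "q \<in> hom tcat X Y"
    note q' = tcat_homD[OF q]
    show "p + q \<in> hom tcat X Y"
      unfolding tcat_hom comp_add_left[OF x(3,3) y(3) x(2) p'(1) q'(1)] comp_add_right[OF x(3) y(3,3) p'(1) q'(1) y(2)]
      using subspace_add[OF S p'(2) q'(2)] p'(3) q'(3) by simp
  qed
  assume f: "f \<in> hom tcat X Y"
  note f' = tcat_homD[OF f]
  show "f \<cdot> ident C (bimod_obj (fst X)) = f" "ident C (bimod_obj (fst Y)) \<cdot> f = f"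
    using comp_ident[OF x(3) y(3) f'(1)] ident_comp[OF x(3) y(3) f'(1)] by simp_all
  assume Z: "twisted Z" and g: "g \<in> hom tcat Y Z"
  note z = twistedD[OF Z] and g' = tcat_homD[OF g]
  show "g \<cdot> f \<in> hom tcat X Z"
    using bimodule_comp[OF x(1) y(1) z(1) f'(2) g'(2)] comp_assoc[OF x(3,3) y(3) z(3) x(2) f'(1) g'(1)]
      comp_assoc[OF x(3) y(3,3) z(3) f'(1) y(2) g'(1)] comp_assoc[OF x(3) y(3) z(3,3) f'(1) g'(1) z(2)] f'(3) g'(3)
    by (simp add: tcat_hom)
  show "scale C c g \<cdot> f = scale C c (g \<cdot> f)" "g \<cdot> scale C c f = scale C c (g \<cdot> f)"
    using comp_scale_left[OF x(3) y(3) z(3) f'(1) g'(1)] comp_scale_right[OF x(3) y(3) z(3) f'(1) g'(1)] by simp_all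
next
  fix W X Y Z f g h
  assume A: "twisted W" "twisted X" "twisted Y" "twisted Z" and f: "f \<in> hom tcat W X" "g \<in> hom tcat X Y" "h \<in> hom tcat Y Z"
  show "(h \<cdot> g) \<cdot> f = h \<cdot> (g \<cdot> f)"
    by (rule comp_assoc[OF A[THEN twistedD(3)] f[THEN tcat_homD(1)]])
next
  fix X Y Z f g g'
  assume A: "twisted X" "twisted Y" "twisted Z" and f: "f \<in> hom tcat X Y" "g \<in> hom tcat Y Z" "g' \<in> hom tcat Y Z"
  show "(g + g') \<cdot> f = g \<cdot> f + g' \<cdot> f"
    by (rule comp_add_left[OF A[THEN twistedD(3)] f[THEN tcat_homD(1)]])
next
  fix X Y Z f f' g
  assume A: "twisted X" "twisted Y" "twisted Z" and f: "f \<in> hom tcat X Y" "f' \<in> hom tcat X Y" "g \<in> hom tcat Y Z"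
  show "g \<cdot> (f + f') = g \<cdot> f + g \<cdot> f'"
    by (rule comp_add_right[OF A[THEN twistedD(3)] f[THEN tcat_homD(1)]])
qed

abbreviation DT :: "'o \<Rightarrow> ('o, 'm) box" where "DT v \<equiv> ([v], [v], double_twist v)"

lemma box_DT [simp]: "v \<in> obj C \<Longrightarrow> box (DT v)"
  using double_twist_in_hom[of v] by (simp add: box_def)

lemma DT_natural:
  assumes "box ([v], [v'], g)" "v \<in> obj C" "v' \<in> obj C"
  shows "deq [v] [(0, [v], [v'], g), (0, DT v')] [(0, DT v), (0, [v], [v'], g)]"
proof -
  have "g \<in> hom C v v'" using assms by (simp add: box_def)
  then show ?thesis using assms double_twist_nat[of v v' g] by (simp add: deq_def sem_eval)
qed

lemma twist_assoc:
  assumes [simp]: "v \<in> obj C" "l \<in> hom C (a \<odot> v) v" "r \<in> hom C (v \<odot> a) v" "f \<in> hom C v v"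
  shows "l \<cdot> ((braiding C v a \<cdot> braiding C a v) \<cdot> (ident C a \<otimes> f)) = ((l \<cdot> braiding C v a) \<cdot> braiding C a v) \<cdot> (ident C a \<otimes> f)"
    "r \<cdot> ((braiding C a v \<cdot> braiding C v a) \<cdot> (f \<otimes> ident C a)) = ((r \<cdot> braiding C a v) \<cdot> braiding C v a) \<cdot> (f \<otimes> ident C a)"
    "f \<cdot> (double_twist v \<cdot> f) = (f \<cdot> double_twist v) \<cdot> f"
proof -
  have [simp]: "ident C a \<otimes> f \<in> hom C (a \<odot> v) (a \<odot> v)" "f \<otimes> ident C a \<in> hom C (v \<odot> a) (v \<odot> a)"
    by (intro tensor_in_hom ident_in_hom; simp)+
  note c [simp] = braiding_in_hom[OF assms(1) a_obj] braiding_in_hom[OF a_obj assms(1)]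
  note t [simp] = tensor_in_obj[OF assms(1) a_obj] tensor_in_obj[OF a_obj assms(1)]
  show "l \<cdot> ((braiding C v a \<cdot> braiding C a v) \<cdot> (ident C a \<otimes> f)) = ((l \<cdot> braiding C v a) \<cdot> braiding C a v) \<cdot> (ident C a \<otimes> f)"
    using comp_assoc[OF t(2,2,2) assms(1) _ comp_in_hom[OF t(2,1,2) c(2,1)] assms(2)] comp_assoc[OF t(2,1,2) assms(1) c(2,1) assms(2)] by simp
  show "r \<cdot> ((braiding C a v \<cdot> braiding C v a) \<cdot> (f \<otimes> ident C a)) = ((r \<cdot> braiding C a v) \<cdot> braiding C v a) \<cdot> (f \<otimes> ident C a)"
    using comp_assoc[OF t(1,1,1) assms(1) _ comp_in_hom[OF t(1,2,1) c(1,2)] assms(3)] comp_assoc[OF t(1,2,1) assms(1) c(1,2) assms(3)] by simp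
  show "f \<cdot> (double_twist v \<cdot> f) = (f \<cdot> double_twist v) \<cdot> f"
    using comp_assoc[of v v v v f "double_twist v" f] double_twist_in_hom[of v] assms by simp
qed

lemma twisted_iff:
  assumes [simp]: "v \<in> obj C" "box ([a, v], [v], l)" "box ([v, a], [v], r)" "box ([v], [v], f)"
  shows "twisted (bim v l r, f) \<longleftrightarrow>
    (deq [a, a, v] [(0, M), (0, [a, v], [v], l)] [(1, [a, v], [v], l), (0, [a, v], [v], l)] \<and>
    deq [v] [(0, E), (0, [a, v], [v], l)] [] \<and>
    deq [v, a, a] [(1, M), (0, [v, a], [v], r)] [(0, [v, a], [v], r), (0, [v, a], [v], r)] \<and>
    deq [v] [(1, E), (0, [v, a], [v], r)] [] \<and>
    deq [a, v, a] [(0, [a, v], [v], l), (0, [v, a], [v], r)] [(1, [v, a], [v], r), (0, [a, v], [v], l)]) \<and>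
    deq [a, v] [(0, [a, v], [v], l), (0, [v], [v], f)] [(1, [v], [v], f), (0, Br a v), (0, Br v a), (0, [a, v], [v], l)] \<and>
    deq [v, a] [(0, [v, a], [v], r), (0, [v], [v], f)] [(0, [v], [v], f), (0, Br v a), (0, Br a v), (0, [v, a], [v], r)] \<and>
    deq [v] [(0, [v], [v], f), (0, DT v), (0, [v], [v], f)] []"
proof -
  have h: "l \<in> hom C (a \<odot> v) v" "r \<in> hom C (v \<odot> a) v" "f \<in> hom C v v" using assms by (simp_all add: box_def tens_simps)
  show ?thesis
    unfolding twisted_def is_bimodule_def Let_def fst_conv snd_conv bimodule.simps algebra_object.simps
    by (simp add: h twist_assoc[OF assms(1) h] deq_def sem_eval typed_layer_middle)
qed

end

section \<open>Conjugation by twists and generalized inverses\<close>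

context twisted_bimodules
begin

lemma twisted_boxes:
  assumes "twisted (bim v l r, f)"
  shows "v \<in> obj C" "box ([a, v], [v], l)" "box ([v, a], [v], r)" "box ([v], [v], f)"
  using bimodule_deq(1-3)[of v l r] twistedD[OF assms] by (auto simp: box_def)

lemma tcat_hom_iff:
  assumes "twisted (bim v l r, f)" "twisted (bim v' l' r', f')"
  shows "u \<in> hom tcat (bim v l r, f) (bim v' l' r', f') \<longleftrightarrow> box ([v], [v'], u) \<and>
    deq [a, v] [(0, [a, v], [v], l), (0, [v], [v'], u)] [(1, [v], [v'], u), (0, [a, v'], [v'], l')] \<and>
    deq [v, a] [(0, [v, a], [v], r), (0, [v], [v'], u)] [(0, [v], [v'], u), (0, [v', a], [v'], r')] \<and>
    deq [v] [(0, [v], [v], f), (0, [v], [v'], u)] [(0, [v], [v'], u), (0, [v'], [v'], f')]"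
proof -
  note [simp] = twisted_boxes[OF assms(1)] twisted_boxes[OF assms(2)]
  show ?thesis
  proof (cases "box ([v], [v'], u)")
    case True
    then have "u \<cdot> f = f' \<cdot> u \<longleftrightarrow> deq [v] [(0, [v], [v], f), (0, [v], [v'], u)] [(0, [v], [v'], u), (0, [v'], [v'], f')]"
      by (simp add: deq_def sem_eval)
    then show ?thesis unfolding tcat_hom fst_conv snd_conv by (simp add: bimodule_hom_deq)
  qed (simp add: tcat_hom bimodule_hom_deq)
qed

lemma twisted_inverse:
  assumes "twisted (bim v l r, f)"
  shows "deq [v] [(0, [v], [v], f), (0, DT v), (0, [v], [v], f)] []" "deq [v] [(0, DT v), (0, [v], [v], f), (0, [v], [v], f)] []"
proof -
  note [simp] = twisted_boxes[OF assms]
  let ?f = "([v], [v], f)"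
  show 1: "deq [v] [(0, ?f), (0, DT v), (0, ?f)] []" using twisted_iff[OF twisted_boxes[OF assms]] assms by simp
  have "deq [v] [(0, DT v), (0, ?f), (0, ?f)] [(0, ?f), (0, DT v), (0, ?f)]"
    by (rule at_sym[OF DT_natural[of v v f], of 0 0]; simp)
  also note 1
  finally show "deq [v] [(0, DT v), (0, ?f), (0, ?f)] []" .
qed

text \<open>The map \<open>w\<close> is f^-1 u f'. It is again a bimodule map because the double
  braidings produced by the two twists cancel. The second equation holds since the squares of both
  twists are inverse to the natural double twist; conjugation is thus an involution.\<close>

lemma twist_conjugate:
  assumes X: "twisted (bim v l r, f)" and Y: "twisted (bim v' l' r', f')"
    and u: "u \<in> bimod_homs (bim v' l' r') (bim v l r)"
  shows "\<exists>w\<in>bimod_homs (bim v' l' r') (bim v l r). f \<cdot> w = u \<cdot> f' \<and> w \<cdot> f' = f \<cdot> u"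
proof -
  note [simp] = twisted_boxes[OF X] twisted_boxes[OF Y]
  note dx = twisted_iff[OF twisted_boxes[OF X]] and dy = twisted_iff[OF twisted_boxes[OF Y]] and ix = twisted_inverse[OF X] and iy = twisted_inverse[OF Y]
  let ?l = "([a, v], [v], l)" and ?r = "([v, a], [v], r)" and ?l' = "([a, v'], [v'], l')" and ?r' = "([v', a], [v'], r')"
  let ?f = "([v], [v], f)" and ?f' = "([v'], [v'], f')"
  have fl: "deq [a, v] [(0, ?l), (0, ?f)] [(1, ?f), (0, Br a v), (0, Br v a), (0, ?l)]"
    and fr: "deq [v, a] [(0, ?r), (0, ?f)] [(0, ?f), (0, Br v a), (0, Br a v), (0, ?r)]"
    using dx X by simp_all
  have fl': "deq [a, v'] [(0, ?l'), (0, ?f')] [(1, ?f'), (0, Br a v'), (0, Br v' a), (0, ?l')]"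
    and fr': "deq [v', a] [(0, ?r'), (0, ?f')] [(0, ?f'), (0, Br v' a), (0, Br a v'), (0, ?r')]"
    using dy Y by simp_all
  let ?u = "([v'], [v], u)"
  have ud [simp]: "box ?u" and ul: "deq [a, v'] [(0, ?l'), (0, ?u)] [(1, ?u), (0, ?l)]"
    and ur: "deq [v', a] [(0, ?r'), (0, ?u)] [(0, ?u), (0, ?r)]"
    using u by (simp_all add: bimodule_hom_deq)
  \<comment> \<open>Since f T f = 1 for the double twist T, the composite f T serves as the inverse
    of \<open>f\<close>.\<close>
  obtain w where w: "deq [v'] [(0, ([v'], [v], w))] [(0, ?f'), (0, ?u), (0, DT v), (0, ?f)]" "box ([v'], [v], w)"
    by (rule that[OF deq_box]; simp)
  let ?w = "([v'], [v], w)"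
  note [simp] = w(2)
  have "deq [a, v'] [(0, ?l'), (0, ?w)] [(0, ?l'), (0, ?f'), (0, ?u), (0, DT v), (0, ?f)]"
    by (rule at[OF w(1), of 0 1]; simp)
  also have "deq [a, v'] ... [(1, ?f'), (0, Br a v'), (0, Br v' a), (0, ?l'), (0, ?u), (0, DT v), (0, ?f)]"
    by (rule at[OF fl', of 0 0]; simp)
  also have "deq [a, v'] ... [(1, ?f'), (0, Br a v'), (0, Br v' a), (1, ?u), (0, ?l), (0, DT v), (0, ?f)]"
    by (rule at[OF ul, of 0 3]; simp)
  also have "deq [a, v'] ... [(1, ?f'), (0, Br a v'), (0, ?u), (0, Br v a), (0, ?l), (0, DT v), (0, ?f)]"
    by (rule at_sym[OF wire_left_natural[of _ _ u a], of "[v']" "[v]" 0 2]; simp)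
  also have "deq [a, v'] ... [(1, ?f'), (1, ?u), (0, Br a v), (0, Br v a), (0, ?l), (0, DT v), (0, ?f)]"
    by (rule at_sym[OF wire_right_natural[of _ _ u a], of "[v']" "[v]" 0 1]; simp)
  also have "deq [a, v'] ... [(1, ?f'), (1, ?u), (1, DT v), (1, ?f), (1, ?f), (0, Br a v), (0, Br v a), (0, ?l), (0, DT v), (0, ?f)]"
    by (rule at_sym[OF ix(2), of 1 2]; simp)
  also have "deq [a, v'] ... [(1, ?f'), (1, ?u), (1, DT v), (1, ?f), (0, ?l), (0, ?f), (0, DT v), (0, ?f)]"
    by (rule at_sym[OF fl, of 0 4]; simp)
  also have "deq [a, v'] ... [(1, ?f'), (1, ?u), (1, DT v), (1, ?f), (0, ?l)]"
    by (rule at[OF ix(1), of 0 5]; simp)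
  also have "deq [a, v'] ... [(1, ?w), (0, ?l)]"
    by (rule at_sym[OF w(1), of 1 0]; simp)
  finally have wl: "deq [a, v'] [(0, ?l'), (0, ?w)] [(1, ?w), (0, ?l)]" .
  have "deq [v', a] [(0, ?r'), (0, ?w)] [(0, ?r'), (0, ?f'), (0, ?u), (0, DT v), (0, ?f)]"
    by (rule at[OF w(1), of 0 1]; simp)
  also have "deq [v', a] ... [(0, ?f'), (0, Br v' a), (0, Br a v'), (0, ?r'), (0, ?u), (0, DT v), (0, ?f)]"
    by (rule at[OF fr', of 0 0]; simp)
  also have "deq [v', a] ... [(0, ?f'), (0, Br v' a), (0, Br a v'), (0, ?u), (0, ?r), (0, DT v), (0, ?f)]"
    by (rule at[OF ur, of 0 3]; simp)
  also have "deq [v', a] ... [(0, ?f'), (0, Br v' a), (1, ?u), (0, Br a v), (0, ?r), (0, DT v), (0, ?f)]"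
    by (rule at_sym[OF wire_right_natural[of _ _ u a], of "[v']" "[v]" 0 2]; simp)
  also have "deq [v', a] ... [(0, ?f'), (0, ?u), (0, Br v a), (0, Br a v), (0, ?r), (0, DT v), (0, ?f)]"
    by (rule at_sym[OF wire_left_natural[of _ _ u a], of "[v']" "[v]" 0 1]; simp)
  also have "deq [v', a] ... [(0, ?f'), (0, ?u), (0, DT v), (0, ?f), (0, ?f), (0, Br v a), (0, Br a v), (0, ?r), (0, DT v), (0, ?f)]"
    by (rule at_sym[OF ix(2), of 0 2]; simp)
  also have "deq [v', a] ... [(0, ?f'), (0, ?u), (0, DT v), (0, ?f), (0, ?r), (0, ?f), (0, DT v), (0, ?f)]"
    by (rule at_sym[OF fr, of 0 4]; simp)
  also have "deq [v', a] ... [(0, ?f'), (0, ?u), (0, DT v), (0, ?f), (0, ?r)]"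
    by (rule at[OF ix(1), of 0 5]; simp)
  also have "deq [v', a] ... [(0, ?w), (0, ?r)]"
    by (rule at_sym[OF w(1), of 0 0]; simp)
  finally have wr: "deq [v', a] [(0, ?r'), (0, ?w)] [(0, ?w), (0, ?r)]" .
  have wb: "w \<in> bimod_homs (bim v' l' r') (bim v l r)" using wl wr by (simp add: bimodule_hom_deq)
  have "deq [v'] [(0, ?w), (0, ?f)] [(0, ?f'), (0, ?u), (0, DT v), (0, ?f), (0, ?f)]"
    by (rule at[OF w(1), of 0 0]; simp)
  also have "deq [v'] ... [(0, ?f'), (0, ?u)]"
    by (rule at[OF ix(2), of 0 2]; simp)
  finally have fw: "deq [v'] [(0, ?w), (0, ?f)] [(0, ?f'), (0, ?u)]" .
  have "deq [v'] [(0, ?f'), (0, ?w)] [(0, ?f'), (0, ?f'), (0, ?u), (0, DT v), (0, ?f)]"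
    by (rule at[OF w(1), of 0 1]; simp)
  also have "deq [v'] ... [(0, ?f'), (0, ?f'), (0, DT v'), (0, ?u), (0, ?f)]"
    by (rule at[OF DT_natural[of v' v u], of 0 2]; simp)
  also have "deq [v'] ... [(0, ?f'), (0, DT v'), (0, ?f'), (0, ?u), (0, ?f)]"
    by (rule at[OF DT_natural[of v' v' f'], of 0 1]; simp)
  also have "deq [v'] ... [(0, ?u), (0, ?f)]"
    by (rule at[OF iy(1), of 0 0]; simp)
  finally have wf: "deq [v'] [(0, ?f'), (0, ?w)] [(0, ?u), (0, ?f)]" .
  have "f \<cdot> w = u \<cdot> f'" "w \<cdot> f' = f \<cdot> u"
    using fw wf by (simp_all add: deq_def sem_eval typed_layer_middle)
  then show ?thesis using wb by blast
qed

text \<open>A generalized inverse is averaged with its conjugate by the twists to commute with them.\<close>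
lemma tcat_regular:
  assumes X: "twisted (bim v l r, f)" and Y: "twisted (bim v' l' r', f')"
    and \<phi>: "\<phi> \<in> hom tcat (bim v l r, f) (bim v' l' r', f')"
  shows "\<exists>\<psi>\<in>hom tcat (bim v' l' r', f') (bim v l r, f). (\<phi> \<cdot> \<psi>) \<cdot> \<phi> = \<phi>"
proof -
  note [simp] = twisted_boxes[OF X] twisted_boxes[OF Y]
  note iy = twisted_inverse[OF Y]
  have BX: "is_bimodule C alg (bim v l r)" and BY: "is_bimodule C alg (bim v' l' r')" using twistedD(1)[OF X] twistedD(1)[OF Y] by simp_all
  let ?\<phi> = "([v], [v'], \<phi>)" and ?f = "([v], [v], f)" and ?f' = "([v'], [v'], f')"
  have \<phi>d [simp]: "box ?\<phi>" and \<phi>f: "deq [v] [(0, ?f), (0, ?\<phi>)] [(0, ?\<phi>), (0, ?f')]"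
    using \<phi> by (simp_all add: tcat_hom_iff[OF X Y])
  have \<phi>b: "\<phi> \<in> bimod_homs (bim v l r) (bim v' l' r')" using tcat_homD(2)[OF \<phi>] by simp
  obtain \<psi> where \<psi>: "\<psi> \<in> bimod_homs (bim v' l' r') (bim v l r)" "(\<phi> \<cdot> \<psi>) \<cdot> \<phi> = \<phi>"
    using bimodule_regular[OF a_projective BX BY \<phi>b] by blast
  obtain \<chi> where \<chi>b: "\<chi> \<in> bimod_homs (bim v' l' r') (bim v l r)" and c: "f \<cdot> \<chi> = \<psi> \<cdot> f'" "\<chi> \<cdot> f' = f \<cdot> \<psi>"
    using twist_conjugate[OF X Y \<psi>(1)] by blast
  let ?\<psi> = "([v'], [v], \<psi>)" and ?\<chi> = "([v'], [v], \<chi>)"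
  have \<psi>d [simp]: "box ?\<psi>" and \<chi>d [simp]: "box ?\<chi>"
    using \<psi>(1) \<chi>b by (simp_all add: bimodule_hom_deq)
  have f\<chi>: "deq [v'] [(0, ?\<chi>), (0, ?f)] [(0, ?f'), (0, ?\<psi>)]"
    using c by (simp add: deq_def sem_eval)
  note s = sem_morphism
  have h: "\<phi> \<in> hom C v v'" "\<psi> \<in> hom C v' v" "\<chi> \<in> hom C v' v" "f \<in> hom C v v" "f' \<in> hom C v' v'"
    using \<phi>d \<psi>d \<chi>d twisted_boxes(4)[OF X] twisted_boxes(4)[OF Y] by (simp_all add: box_def)
  have o: "v \<in> obj C" "v' \<in> obj C" by simp_all
  have \<psi>\<phi>: "deq [v] [(0, ?\<phi>), (0, ?\<psi>), (0, ?\<phi>)] [(0, ?\<phi>)]"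
    using \<psi>(2) comp_assoc[OF o(1,2,1,2) h(1,2,1)] by (simp add: s)
  have "deq [v] [(0, ?\<phi>), (0, ?\<chi>), (0, ?\<phi>)] [(0, ?\<phi>), (0, ?\<chi>), (0, ?\<phi>), (0, ?f'), (0, DT v'), (0, ?f')]"
    by (rule at_sym[OF iy(1), of 0 3]; simp)
  also have "deq [v] ... [(0, ?\<phi>), (0, ?\<chi>), (0, ?f), (0, ?\<phi>), (0, DT v'), (0, ?f')]"
    by (rule at_sym[OF \<phi>f, of 0 2]; simp)
  also have "deq [v] ... [(0, ?\<phi>), (0, ?f'), (0, ?\<psi>), (0, ?\<phi>), (0, DT v'), (0, ?f')]"
    by (rule at[OF f\<chi>, of 0 1]; simp)
  also have "deq [v] ... [(0, ?f), (0, ?\<phi>), (0, ?\<psi>), (0, ?\<phi>), (0, DT v'), (0, ?f')]"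
    by (rule at_sym[OF \<phi>f, of 0 0]; simp)
  also have "deq [v] ... [(0, ?f), (0, ?\<phi>), (0, DT v'), (0, ?f')]"
    by (rule at[OF \<psi>\<phi>, of 0 1]; simp)
  also have "deq [v] ... [(0, ?\<phi>), (0, ?f'), (0, DT v'), (0, ?f')]"
    by (rule at[OF \<phi>f, of 0 0]; simp)
  also have "deq [v] ... [(0, ?\<phi>)]"
    by (rule at[OF iy(1), of 0 1]; simp)
  finally have "(\<phi> \<cdot> \<chi>) \<cdot> \<phi> = \<phi>"
    using comp_assoc[OF o(1,2,1,2) h(1,3,1)] by (simp add: s)
  note \<chi>\<phi> = this
  interpret vector_space "scale C" by (rule ambient_vector_space)
  define \<theta> where "\<theta> = scale C (1 / 2) (\<psi> + \<chi>)"
  have half: "scale C (1 / 2) (x + x) = x" for x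
    by (simp add: scale_right_distrib flip: scale_left_distrib)
  note S = bimodule_homs_subspace[OF BY BX]
  have sumh: "\<psi> + \<chi> \<in> hom C v' v" by (rule hom_add[OF o(2,1) h(2,3)])
  have \<theta>b: "\<theta> \<in> bimod_homs (bim v' l' r') (bim v l r)"
    unfolding \<theta>_def by (rule subspace_scale[OF S subspace_add[OF S \<psi>(1) \<chi>b]])
  have "\<theta> \<cdot> f' = f \<cdot> \<theta>"
    unfolding \<theta>_def comp_scale_left[OF o(2,2,1) h(5) sumh] comp_scale_right[OF o(2,1,1) sumh h(4)]
      comp_add_left[OF o(2,2,1) h(5,2,3)] comp_add_right[OF o(2,1,1) h(2,3,4)] c by (simp add: add.commute)
  then have "\<theta> \<in> hom tcat (bim v' l' r', f') (bim v l r, f)" using \<theta>b by (simp add: tcat_hom)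
  moreover have "(\<phi> \<cdot> \<theta>) \<cdot> \<phi> = \<phi>"
    unfolding \<theta>_def comp_scale_right[OF o(2,1,2) sumh h(1)] comp_add_right[OF o(2,1,2) h(2,3,1)]
      comp_scale_left[OF o(1,2,2) h(1) hom_add[OF o(2,2) comp_in_hom[OF o(2,1,2) h(2,1)] comp_in_hom[OF o(2,1,2) h(3,1)]]]
      comp_add_left[OF o(1,2,2) h(1) comp_in_hom[OF o(2,1,2) h(2,1)] comp_in_hom[OF o(2,1,2) h(3,1)]] \<psi>(2) \<chi>\<phi> by (rule half)
  ultimately show ?thesis by blast
qed

end

text \<open>A map that commutes with idempotents restricts to the objects splitting them. One
  statement serves the left action, the right action and the twist.\<close>

lemma (in linear_category) split_transport:
  assumes o: "W \<in> obj C" "W' \<in> obj C" "v \<in> obj C" "y \<in> obj C"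
    and i: "i \<in> hom C y v" and p: "p \<in> hom C v y" and pi: "p \<cdot> i = ident C y" and ip: "i \<cdot> p = u"
    and j: "j \<in> hom C W' W" and q: "q \<in> hom C W W'" and qj: "q \<cdot> j = ident C W'" and jq: "j \<cdot> q = w"
    and b: "b \<in> hom C W v" "u \<cdot> b = b \<cdot> w"
  shows "p \<cdot> (b \<cdot> j) \<in> hom C W' y" "i \<cdot> (p \<cdot> (b \<cdot> j)) = b \<cdot> j" "(p \<cdot> (b \<cdot> j)) \<cdot> q = p \<cdot> b"
proof -
  have bj: "b \<cdot> j \<in> hom C W' v" by (rule comp_in_hom[OF o(2,1,3) j b(1)])
  have u: "u \<in> hom C v v" using comp_in_hom[OF o(3,4,3) p i] ip by simp
  show "p \<cdot> (b \<cdot> j) \<in> hom C W' y" by (rule comp_in_hom[OF o(2,3,4) bj p])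
  have "i \<cdot> (p \<cdot> (b \<cdot> j)) = (u \<cdot> b) \<cdot> j"
    using comp_assoc[OF o(2,3,4,3) bj p i] ip comp_assoc[OF o(2,1,3,3) j b(1) u] by simp
  also have "... = b \<cdot> (j \<cdot> (q \<cdot> j))"
    unfolding b(2) jq[symmetric] comp_assoc[OF o(2,1,1,3) j comp_in_hom[OF o(1,2,1) q j] b(1)] comp_assoc[OF o(2,1,2,1) j q j] ..
  finally show "i \<cdot> (p \<cdot> (b \<cdot> j)) = b \<cdot> j" unfolding qj comp_ident[OF o(2,1) j] .
  have "(p \<cdot> (b \<cdot> j)) \<cdot> q = p \<cdot> (u \<cdot> b)"
    unfolding comp_assoc[OF o(1,2,3,4) q bj p] comp_assoc[OF o(1,2,1,3) q j b(1)] jq b(2) ..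
  also have "... = ((p \<cdot> i) \<cdot> p) \<cdot> b"
    unfolding ip[symmetric] comp_assoc[OF o(3,4,3,4) p i p] comp_assoc[OF o(1,3,3,4) b(1) comp_in_hom[OF o(3,4,3) p i] p] ..
  finally show "(p \<cdot> (b \<cdot> j)) \<cdot> q = p \<cdot> b" unfolding pi ident_comp[OF o(3,4) p] .
qed

context twisted_bimodules
begin

text \<open>The idempotent splits in the underlying category. Each axiom for the retract is verified
  after the inclusion \<open>i\<close>, where it is an axiom of the large object, and
  \<open>i\<close> is then cancelled.\<close>

lemma tcat_split:
  assumes X: "twisted (bim v l r, f)" and u: "u \<in> hom tcat (bim v l r, f) (bim v l r, f)" "u \<cdot> u = u"
  shows "\<exists>Y. twisted Y \<and> (\<exists>i\<in>hom tcat Y (bim v l r, f). \<exists>p\<in>hom tcat (bim v l r, f) Y. p \<cdot> i = ident tcat Y \<and> i \<cdot> p = u)"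
proof -
  note [simp] = twisted_boxes[OF X]
  note dx = twisted_iff[OF twisted_boxes[OF X]]
  have uh: "u \<in> hom C v v" using tcat_homD(1)[OF u(1)] by simp
  obtain y i p where y [simp]: "y \<in> obj C" and i: "i \<in> hom C y v" and p: "p \<in> hom C v y" and pi': "p \<cdot> i = ident C y" and ip': "i \<cdot> p = u"
    using idempotent_split[OF _ uh u(2)] twisted_boxes(1)[OF X] by blast
  let ?i = "([y], [v], i)" and ?p = "([v], [y], p)"
  let ?l = "([a, v], [v], l)" and ?r = "([v, a], [v], r)" and ?f = "([v], [v], f)"
  have bi [simp]: "box ?i" and bp [simp]: "box ?p" using i p by (intro boxI; simp)+
  have pi: "deq [y] [(0, ?i), (0, ?p)] []" using pi' by (simp add: deq_def sem_eval)
  have X1: "deq [a, a, v] [(0, M), (0, ?l)] [(1, ?l), (0, ?l)]" and X2: "deq [v] [(0, E), (0, ?l)] []"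
    and X3: "deq [v, a, a] [(1, M), (0, ?r)] [(0, ?r), (0, ?r)]" and X4: "deq [v] [(1, E), (0, ?r)] []"
    and X5: "deq [a, v, a] [(0, ?l), (0, ?r)] [(1, ?r), (0, ?l)]"
    and X6: "deq [a, v] [(0, ?l), (0, ?f)] [(1, ?f), (0, Br a v), (0, Br v a), (0, ?l)]"
    and X7: "deq [v, a] [(0, ?r), (0, ?f)] [(0, ?f), (0, Br v a), (0, Br a v), (0, ?r)]"
    and X8: "deq [v] [(0, ?f), (0, DT v), (0, ?f)] []"
    using dx X by simp_all
  have nl: "deq [y, a] [(0, ?i), (0, Br v a)] [(0, Br y a), (1, ?i)]" and nr: "deq [a, y] [(1, ?i), (0, Br a v)] [(0, Br a y), (0, ?i)]"
    using wire_left_natural[OF bi a_obj] wire_right_natural[OF bi a_obj] by simp_all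
  note nD = DT_natural[OF bi y twisted_boxes(1)[OF X]]
  note o = twisted_boxes(1)[OF X] y and id = ident_in_hom[OF a_obj] and u' = bimodule_homD(2,3)[OF tcat_homD(2)[OF u(1)]] tcat_homD(3)[OF u(1)]
  have lrf: "l \<in> hom C (a \<odot> v) v" "r \<in> hom C (v \<odot> a) v" "f \<in> hom C v v" using twisted_boxes[OF X] by (simp_all add: box_def tens_simps)
  note ta = tensor_in_obj[OF a_obj o(1)] tensor_in_obj[OF a_obj o(2)] and tb = tensor_in_obj[OF o(1) a_obj] tensor_in_obj[OF o(2) a_obj]
  note h = tensor_in_hom[OF a_obj a_obj o(2,1) id i] tensor_in_hom[OF a_obj a_obj o id p]
    tensor_in_hom[OF o(2,1) a_obj a_obj i id] tensor_in_hom[OF o a_obj a_obj p id]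
  note c = tensor_id_comp[OF o(2,1,2) a_obj i p, symmetric, unfolded pi' tensor_ident[OF a_obj o(2)] tensor_ident[OF o(2) a_obj]]
    tensor_id_comp[OF o(1,2,1) a_obj p i, symmetric, unfolded ip']
  define ly where "ly = p \<cdot> (l \<cdot> (ident C a \<otimes> i))"
  define ry where "ry = p \<cdot> (r \<cdot> (i \<otimes> ident C a))"
  define fy where "fy = p \<cdot> (f \<cdot> i)"
  let ?ly = "([a, y], [y], ly)" and ?ry = "([y, a], [y], ry)" and ?fy = "([y], [y], fy)"
  have L: "ly \<in> hom C (a \<odot> y) y" "i \<cdot> ly = l \<cdot> (ident C a \<otimes> i)" "ly \<cdot> (ident C a \<otimes> p) = p \<cdot> l"
    unfolding ly_def using u' by (intro split_transport[OF ta o i p pi' ip' h(1,2) c(1,3) lrf(1)]; simp)+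
  have R: "ry \<in> hom C (y \<odot> a) y" "i \<cdot> ry = r \<cdot> (i \<otimes> ident C a)" "ry \<cdot> (p \<otimes> ident C a) = p \<cdot> r"
    unfolding ry_def using u' by (intro split_transport[OF tb o i p pi' ip' h(3,4) c(2,4) lrf(2)]; simp)+
  have F: "fy \<in> hom C y y" "i \<cdot> fy = f \<cdot> i" "fy \<cdot> p = p \<cdot> f"
    unfolding fy_def using u' by (intro split_transport[OF o o i p pi' ip' i p pi' ip' lrf(3)]; simp)+
  have ly [simp]: "box ?ly" and ry [simp]: "box ?ry" and fy [simp]: "box ?fy" using L R F by (simp_all add: box_def tens_simps)
  have il: "deq [a, y] [(0, ?ly), (0, ?i)] [(1, ?i), (0, ?l)]" and pl: "deq [a, v] [(0, ?l), (0, ?p)] [(1, ?p), (0, ?ly)]"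
    and ir: "deq [y, a] [(0, ?ry), (0, ?i)] [(0, ?i), (0, ?r)]" and pr: "deq [v, a] [(0, ?r), (0, ?p)] [(0, ?p), (0, ?ry)]"
    and i_f: "deq [y] [(0, ?fy), (0, ?i)] [(0, ?i), (0, ?f)]" and pf: "deq [v] [(0, ?f), (0, ?p)] [(0, ?p), (0, ?fy)]"
    using L R F by (simp_all add: sem_morphism)
  have "deq [a, a, y] [(0, M), (0, ?ly), (0, ?i)] [(0, M), (1, ?i), (0, ?l)]"
    by (rule at[OF il, of 0 1]; simp)
  also have "deq [a, a, y] ... [(2, ?i), (1, ?l), (0, ?l)]"
    by (rule step[OF X1, of "[(2, ?i)]" 0 "[]"]; simp)
  also have "deq [a, a, y] ... [(1, ?ly), (1, ?i), (0, ?l)]"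
    by (rule at_sym[OF il, of 1 0]; simp)
  also have "deq [a, a, y] ... [(1, ?ly), (0, ?ly), (0, ?i)]"
    by (rule at_sym[OF il, of 0 1]; simp)
  finally have c1: "deq [a, a, y] [(0, M), (0, ?ly), (0, ?i)] [(1, ?ly), (0, ?ly), (0, ?i)]" .
  have 1: "deq [a, a, y] [(0, M), (0, ?ly)] [(1, ?ly), (0, ?ly)]"
    by (rule section_cancel[OF pi bp]) (use c1 in simp_all)
  have "deq [y] [(0, E), (0, ?ly), (0, ?i)] [(0, E), (1, ?i), (0, ?l)]"
    by (rule at[OF il, of 0 1]; simp)
  also have "deq [y] ... [(0, ?i)]"
    by (rule step[OF X2, of "[(0, ?i)]" 0 "[]"]; simp)
  finally have c2: "deq [y] [(0, E), (0, ?ly), (0, ?i)] [(0, ?i)]" .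
  have 2: "deq [y] [(0, E), (0, ?ly)] []"
    by (rule section_cancel[OF pi bp]) (use c2 in simp_all)
  have "deq [y, a, a] [(1, M), (0, ?ry), (0, ?i)] [(1, M), (0, ?i), (0, ?r)]"
    by (rule at[OF ir, of 0 1]; simp)
  also have "deq [y, a, a] ... [(0, ?i), (0, ?r), (0, ?r)]"
    by (rule step[OF X3, of "[(0, ?i)]" 0 "[]"]; simp)
  also have "deq [y, a, a] ... [(0, ?ry), (0, ?i), (0, ?r)]"
    by (rule at_sym[OF ir, of 0 0]; simp)
  also have "deq [y, a, a] ... [(0, ?ry), (0, ?ry), (0, ?i)]"
    by (rule at_sym[OF ir, of 0 1]; simp)
  finally have c3: "deq [y, a, a] [(1, M), (0, ?ry), (0, ?i)] [(0, ?ry), (0, ?ry), (0, ?i)]" .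
  have 3: "deq [y, a, a] [(1, M), (0, ?ry)] [(0, ?ry), (0, ?ry)]"
    by (rule section_cancel[OF pi bp]) (use c3 in simp_all)
  have "deq [y] [(1, E), (0, ?ry), (0, ?i)] [(1, E), (0, ?i), (0, ?r)]"
    by (rule at[OF ir, of 0 1]; simp)
  also have "deq [y] ... [(0, ?i)]"
    by (rule step[OF X4, of "[(0, ?i)]" 0 "[]"]; simp)
  finally have c4: "deq [y] [(1, E), (0, ?ry), (0, ?i)] [(0, ?i)]" .
  have 4: "deq [y] [(1, E), (0, ?ry)] []"
    by (rule section_cancel[OF pi bp]) (use c4 in simp_all)
  have "deq [a, y, a] [(0, ?ly), (0, ?ry), (0, ?i)] [(0, ?ly), (0, ?i), (0, ?r)]"
    by (rule at[OF ir, of 0 1]; simp)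
  also have "deq [a, y, a] ... [(1, ?i), (0, ?l), (0, ?r)]"
    by (rule at[OF il, of 0 0]; simp)
  also have "deq [a, y, a] ... [(1, ?i), (1, ?r), (0, ?l)]"
    by (rule at[OF X5, of 0 1]; simp)
  also have "deq [a, y, a] ... [(1, ?ry), (1, ?i), (0, ?l)]"
    by (rule at_sym[OF ir, of 1 0]; simp)
  also have "deq [a, y, a] ... [(1, ?ry), (0, ?ly), (0, ?i)]"
    by (rule at_sym[OF il, of 0 1]; simp)
  finally have c5: "deq [a, y, a] [(0, ?ly), (0, ?ry), (0, ?i)] [(1, ?ry), (0, ?ly), (0, ?i)]" .
  have 5: "deq [a, y, a] [(0, ?ly), (0, ?ry)] [(1, ?ry), (0, ?ly)]"
    by (rule section_cancel[OF pi bp]) (use c5 in simp_all)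
  have "deq [a, y] [(0, ?ly), (0, ?fy), (0, ?i)] [(0, ?ly), (0, ?i), (0, ?f)]"
    by (rule at[OF i_f, of 0 1]; simp)
  also have "deq [a, y] ... [(1, ?i), (0, ?l), (0, ?f)]"
    by (rule at[OF il, of 0 0]; simp)
  also have "deq [a, y] ... [(1, ?i), (1, ?f), (0, Br a v), (0, Br v a), (0, ?l)]"
    by (rule at[OF X6, of 0 1]; simp)
  also have "deq [a, y] ... [(1, ?fy), (1, ?i), (0, Br a v), (0, Br v a), (0, ?l)]"
    by (rule at_sym[OF i_f, of 1 0]; simp)
  also have "deq [a, y] ... [(1, ?fy), (0, Br a y), (0, ?i), (0, Br v a), (0, ?l)]"
    by (rule at[OF nr, of 0 1]; simp)
  also have "deq [a, y] ... [(1, ?fy), (0, Br a y), (0, Br y a), (1, ?i), (0, ?l)]"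
    by (rule at[OF nl, of 0 2]; simp)
  also have "deq [a, y] ... [(1, ?fy), (0, Br a y), (0, Br y a), (0, ?ly), (0, ?i)]"
    by (rule at_sym[OF il, of 0 3]; simp)
  finally have c6: "deq [a, y] [(0, ?ly), (0, ?fy), (0, ?i)] [(1, ?fy), (0, Br a y), (0, Br y a), (0, ?ly), (0, ?i)]" .
  have 6: "deq [a, y] [(0, ?ly), (0, ?fy)] [(1, ?fy), (0, Br a y), (0, Br y a), (0, ?ly)]"
    by (rule section_cancel[OF pi bp]) (use c6 in simp_all)
  have "deq [y, a] [(0, ?ry), (0, ?fy), (0, ?i)] [(0, ?ry), (0, ?i), (0, ?f)]"
    by (rule at[OF i_f, of 0 1]; simp)
  also have "deq [y, a] ... [(0, ?i), (0, ?r), (0, ?f)]"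
    by (rule at[OF ir, of 0 0]; simp)
  also have "deq [y, a] ... [(0, ?i), (0, ?f), (0, Br v a), (0, Br a v), (0, ?r)]"
    by (rule at[OF X7, of 0 1]; simp)
  also have "deq [y, a] ... [(0, ?fy), (0, ?i), (0, Br v a), (0, Br a v), (0, ?r)]"
    by (rule at_sym[OF i_f, of 0 0]; simp)
  also have "deq [y, a] ... [(0, ?fy), (0, Br y a), (1, ?i), (0, Br a v), (0, ?r)]"
    by (rule at[OF nl, of 0 1]; simp)
  also have "deq [y, a] ... [(0, ?fy), (0, Br y a), (0, Br a y), (0, ?i), (0, ?r)]"
    by (rule at[OF nr, of 0 2]; simp)
  also have "deq [y, a] ... [(0, ?fy), (0, Br y a), (0, Br a y), (0, ?ry), (0, ?i)]"
    by (rule at_sym[OF ir, of 0 3]; simp)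
  finally have c7: "deq [y, a] [(0, ?ry), (0, ?fy), (0, ?i)] [(0, ?fy), (0, Br y a), (0, Br a y), (0, ?ry), (0, ?i)]" .
  have 7: "deq [y, a] [(0, ?ry), (0, ?fy)] [(0, ?fy), (0, Br y a), (0, Br a y), (0, ?ry)]"
    by (rule section_cancel[OF pi bp]) (use c7 in simp_all)
  have "deq [y] [(0, ?fy), (0, DT y), (0, ?fy), (0, ?i)] [(0, ?fy), (0, DT y), (0, ?i), (0, ?f)]"
    by (rule at[OF i_f, of 0 2]; simp)
  also have "deq [y] ... [(0, ?fy), (0, ?i), (0, DT v), (0, ?f)]"
    by (rule at_sym[OF nD, of 0 1]; simp)
  also have "deq [y] ... [(0, ?i), (0, ?f), (0, DT v), (0, ?f)]"
    by (rule at[OF i_f, of 0 0]; simp)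
  also have "deq [y] ... [(0, ?i)]"
    by (rule at[OF X8, of 0 1]; simp)
  finally have c8: "deq [y] [(0, ?fy), (0, DT y), (0, ?fy), (0, ?i)] [(0, ?i)]" .
  have 8: "deq [y] [(0, ?fy), (0, DT y), (0, ?fy)] []"
    by (rule section_cancel[OF pi bp]) (use c8 in simp_all)
  have Y: "twisted (bim y ly ry, fy)"
    unfolding twisted_iff[OF y ly ry fy] using 1 2 3 4 5 6 7 8 by blast
  have "i \<in> hom tcat (bim y ly ry, fy) (bim v l r, f)" "p \<in> hom tcat (bim v l r, f) (bim y ly ry, fy)"
    unfolding tcat_hom_iff[OF Y X] tcat_hom_iff[OF X Y] using il ir i_f pl pr pf bi bp by blast+
  then show ?thesis using Y pi' ip' by (intro exI[of _ "(bim y ly ry, fy)"]) auto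
qed

sublocale T: regular_linear_category tcat
proof (rule regular_linear_category.intro[OF linear_category_tcat], rule regular_linear_category_axioms.intro,
    unfold tcat_simps mem_Collect_eq)
  fix X Y \<phi> u
  assume X: "twisted X" and Y: "twisted Y"
  obtain v l r f where x: "X = (bim v l r, f)" by (metis bimodule.cases prod.exhaust)
  obtain v' l' r' f' where y: "Y = (bim v' l' r', f')" by (metis bimodule.cases prod.exhaust)
  show "fin_dim (scale C) (hom tcat X Y)"
  proof -
    interpret ambient_space "scale C" by (rule ambient_space.intro[OF ambient_vector_space])
    show ?thesis
      by (rule fin_dim_subset[OF hom_fin_dim[OF twistedD(3)[OF X] twistedD(3)[OF Y]]]) (use tcat_homD(1) in blast)
  qed
  show "\<exists>g\<in>hom tcat Y X. (\<phi> \<cdot> g) \<cdot> \<phi> = \<phi>" if "\<phi> \<in> hom tcat X Y"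
    using tcat_regular X Y that unfolding x y by blast
  show "\<exists>Y\<in>Collect twisted. \<exists>i\<in>hom tcat Y X. \<exists>p\<in>hom tcat X Y. p \<cdot> i = ident C (bimod_obj (fst Y)) \<and> i \<cdot> p = u"
    if "u \<in> hom tcat X X" "u \<cdot> u = u"
    using tcat_split[of v l r f u] X that unfolding x tcat_simps by blast
qed

end

section \<open>Symmetrization and induction\<close>

context twisted_bimodules
begin

definition symmetric :: "('o, 'm) bimodule \<times> 'm \<Rightarrow> bool" where
  "symmetric X \<longleftrightarrow> right_act (fst X) = left_act (fst X) \<cdot> braiding C (bimod_obj (fst X)) a"

definition symmetrization :: "('o, 'm) bimodule \<times> 'm \<Rightarrow> ('o, 'm) bimodule \<times> 'm" where
  "symmetrization X = (let v = bimod_obj (fst X); l = left_act (fst X) in (bim v l (l \<cdot> braiding C v a), snd X))"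

text \<open>The induced bimodule on \<open>V \<odot> a\<close>, where \<open>V\<close> is regarded as a left module only.\<close>
definition free :: "('o, 'm) bimodule \<times> 'm \<Rightarrow> ('o, 'm) bimodule \<times> 'm" where
  "free X = (let v = bimod_obj (fst X) in
     (bim (v \<odot> a) (left_act (fst X) \<otimes> ident C a) (ident C v \<otimes> \<mu>),
      (braiding C a v \<cdot> braiding C v a) \<cdot> (snd X \<otimes> ident C a)))"

lemma twisted_bim: obtains v l r f where "X = (bim v l r, f)"
  by (metis bimodule.cases prod.exhaust)

lemma symmetrization_symmetric: "symmetric (symmetrization X)"
  by (simp add: symmetric_def symmetrization_def Let_def)

lemma symmetrization_id: "symmetric X \<Longrightarrow> symmetrization X = X"
  by (rule twisted_bim[of X]) (simp add: symmetric_def symmetrization_def)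

lemma twisted_moduleI:
  assumes "twisted X"
  shows "twisted_module C a \<mu> \<eta> e (bimod_obj (fst X)) (left_act (fst X)) (snd X)"
proof -
  have "\<And>b. is_bimodule C alg b \<Longrightarrow> left_act b \<cdot> (\<mu> \<otimes> ident C (bimod_obj b)) = left_act b \<cdot> (ident C a \<otimes> left_act b)
    \<and> left_act b \<cdot> (\<eta> \<otimes> ident C (bimod_obj b)) = ident C (bimod_obj b)"
    unfolding is_bimodule_def Let_def by simp
  then show ?thesis
    using assms bimoduleD[OF twistedD(1)[OF assms]] unfolding twisted_def Let_def
    by unfold_locales blast+
qed

lemma twisted_symmetrization:
  assumes X: "twisted X"
  shows "twisted (symmetrization X)"
proof -
  interpret V: twisted_module C a \<mu> \<eta> e "bimod_obj (fst X)" "left_act (fst X)" "snd X" by (rule twisted_moduleI[OF X])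
  show ?thesis
    using V.symmetric_bimodule V.symmetric_twist_right V.twist_action V.twist_double V.f_hom
    by (simp add: twisted_def symmetrization_def Let_def)
qed

lemma twisted_free:
  assumes X: "twisted X"
  shows "twisted (free X)"
proof -
  interpret V: twisted_module C a \<mu> \<eta> e "bimod_obj (fst X)" "left_act (fst X)" "snd X" by (rule twisted_moduleI[OF X])
  show ?thesis
    using V.free_bimodule V.free_twist_left V.free_twist_right V.free_twist_double V.free_twist_hom
    unfolding V.free_twist_eq by (simp add: twisted_def free_def Let_def)
qed

lemma free_hom_iff:
  assumes X: "twisted (bim v l r, f)" and Q: "twisted (bim q m k, h)"
  shows "u \<in> hom tcat (free (bim v l r, f)) (bim q m k, h) \<longleftrightarrow> box ([v, a], [q], u) \<and>
    deq [a, v, a] [(0, [a, v], [v], l), (0, [v, a], [q], u)] [(1, [v, a], [q], u), (0, [a, q], [q], m)] \<and>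
    deq [v, a, a] [(1, M), (0, [v, a], [q], u)] [(0, [v, a], [q], u), (0, [q, a], [q], k)] \<and>
    deq [v, a] [(0, [v], [v], f), (0, Br v a), (0, Br a v), (0, [v, a], [q], u)] [(0, [v, a], [q], u), (0, [q], [q], h)]"
proof -
  note [simp] = twisted_boxes[OF X] twisted_boxes[OF Q]
  show ?thesis
  proof (cases "box ([v, a], [q], u)")
    case True
    note [simp] = True
    have u: "u \<in> hom C (v \<odot> a) q" using True by (simp add: box_def tens_simps)
    have fh: "f \<otimes> ident C a \<in> hom C (v \<odot> a) (v \<odot> a)"
      using twisted_boxes(1,4)[OF X] tensor_in_hom[of v v a a f] ident_in_hom[of a] by (simp add: box_def)
    have va: "v \<odot> a \<in> obj C" "a \<odot> v \<in> obj C" by (simp_all add: tensor_in_obj)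
    have q: "q \<in> obj C" and c: "braiding C v a \<in> hom C (v \<odot> a) (a \<odot> v)" "braiding C a v \<in> hom C (a \<odot> v) (v \<odot> a)"
      by (simp_all add: braiding_in_hom)
    have as: "u \<cdot> ((braiding C a v \<cdot> braiding C v a) \<cdot> (f \<otimes> ident C a)) = ((u \<cdot> braiding C a v) \<cdot> braiding C v a) \<cdot> (f \<otimes> ident C a)"
      using comp_assoc[OF va(1,1,1) q fh comp_in_hom[OF va(1,2,1) c] u] comp_assoc[OF va(1,2,1) q c u] by simp
    show ?thesis
      unfolding free_def tcat_hom Let_def fst_conv snd_conv bimodule.simps bimodule_homs_iff as
      using u by (simp add: sem_morphism)
  next
    case False
    then show ?thesis by (simp add: free_def tcat_hom Let_def bimodule_homs_iff box_def tens_simps)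
  qed
qed

text \<open>A map out of \<open>V \<odot> a\<close> that is linear on the right is determined by its
  restriction along the unit, as for free modules. The restriction sees only the left action and the
  twist of \<open>Q\<close>; symmetry of \<open>X\<close> makes it compatible with the symmetrized
  right action.\<close>

lemma free_hom_bij:
  assumes X: "twisted X" "symmetric X" and Q: "twisted Q"
  shows "bij_betw (\<lambda>u. right_act (fst Q) \<cdot> (u \<otimes> ident C a)) (hom tcat X (symmetrization Q)) (hom tcat (free X) Q)"
proof -
  obtain v l r f where x: "X = (bim v l r, f)" by (rule twisted_bim)
  obtain q m k h where y: "Q = (bim q m k, h)" by (rule twisted_bim)
  have r: "r = l \<cdot> braiding C v a" using X(2) by (simp add: x symmetric_def)
  have sQ: "symmetrization Q = (bim q m (m \<cdot> braiding C q a), h)" by (simp add: y symmetrization_def)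
  note tX = X(1)[unfolded x] and tQ = Q[unfolded y] and tS = twisted_symmetrization[OF Q, unfolded sQ]
  note [simp] = twisted_boxes[OF tX] twisted_boxes[OF tQ] twisted_boxes[OF tS]
  note dx = twisted_iff[OF twisted_boxes[OF tX]] and dq = twisted_iff[OF twisted_boxes[OF tQ]]
  let ?l = "([a, v], [v], l)" and ?r = "([v, a], [v], r)" and ?f = "([v], [v], f)"
  let ?m = "([a, q], [q], m)" and ?k = "([q, a], [q], k)" and ?h = "([q], [q], h)" and ?s = "([q, a], [q], m \<cdot> braiding C q a)"
  note s = sem_morphism
  have rd: "deq [v, a] [(0, ?r)] [(0, Br v a), (0, ?l)]" and sd: "deq [q, a] [(0, ?s)] [(0, Br q a), (0, ?m)]"
    using twisted_boxes(3)[OF tX] by (simp_all add: r s)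
  have q3: "deq [q, a, a] [(1, M), (0, ?k)] [(0, ?k), (0, ?k)]" and q4: "deq [q] [(1, E), (0, ?k)] []"
    and q5: "deq [a, q, a] [(0, ?m), (0, ?k)] [(1, ?k), (0, ?m)]"
    and q7: "deq [q, a] [(0, ?k), (0, ?h)] [(0, ?h), (0, Br q a), (0, Br a q), (0, ?k)]"
    using dq tQ by simp_all
  have f: "box ([v, a], [q], k \<cdot> (u \<otimes> ident C a)) \<and> deq [v, a] [(0, [v, a], [q], k \<cdot> (u \<otimes> ident C a))] [(0, [v], [q], u), (0, ?k)]"
    if "box ([v], [q], u)" for u
    using that deq_box[of "[v, a]" "[(0, [v], [q], u), (0, ?k)]" "[q]"] by (simp add: sem_eval)
  have g: "box ([v], [q], w \<cdot> (ident C v \<otimes> \<eta>)) \<and> deq [v] [(0, [v], [q], w \<cdot> (ident C v \<otimes> \<eta>))] [(1, E), (0, [v, a], [q], w)]"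
    if "box ([v, a], [q], w)" for w
    using that deq_box[of "[v]" "[(1, E), (0, [v, a], [q], w)]" "[q]"] by (simp add: sem_eval)
  show ?thesis
    unfolding sQ unfolding y x fst_conv bimodule.simps
  proof (rule bij_betw_byWitness[where f' = "\<lambda>w. w \<cdot> (ident C v \<otimes> \<eta>)"])
    show "(\<lambda>u. k \<cdot> (u \<otimes> ident C a)) ` hom tcat (bim v l r, f) (bim q m (m \<cdot> braiding C q a), h) \<subseteq> hom tcat (free (bim v l r, f)) (bim q m k, h)"
    proof (rule image_subsetI)
      fix u assume u: "u \<in> hom tcat (bim v l r, f) (bim q m (m \<cdot> braiding C q a), h)"
      let ?u = "([v], [q], u)" and ?w = "([v, a], [q], k \<cdot> (u \<otimes> ident C a))"
      have b [simp]: "box ?u" and ul: "deq [a, v] [(0, ?l), (0, ?u)] [(1, ?u), (0, ?m)]"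
        and uf: "deq [v] [(0, ?f), (0, ?u)] [(0, ?u), (0, ?h)]"
        using u by (simp_all add: tcat_hom_iff[OF tX tS])
      have [simp]: "box ?w" and w: "deq [v, a] [(0, ?w)] [(0, ?u), (0, ?k)]" using f[OF b] by blast+
      have "deq [a, v, a] [(0, ?l), (0, ?w)] [(0, ?l), (0, ?u), (0, ?k)]"
        by (rule at[OF w, of 0 1]; simp)
      also have "deq [a, v, a] ... [(1, ?u), (0, ?m), (0, ?k)]"
        by (rule at[OF ul, of 0 0]; simp)
      also have "deq [a, v, a] ... [(1, ?u), (1, ?k), (0, ?m)]"
        by (rule at[OF q5, of 0 1]; simp)
      also have "deq [a, v, a] ... [(1, ?w), (0, ?m)]"
        by (rule at_sym[OF w, of 1 0]; simp)
      finally have 1: "deq [a, v, a] [(0, ?l), (0, ?w)] [(1, ?w), (0, ?m)]" .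
      have "deq [v, a, a] [(1, M), (0, ?w)] [(1, M), (0, ?u), (0, ?k)]"
        by (rule at[OF w, of 0 1]; simp)
      also have "deq [v, a, a] ... [(0, ?u), (0, ?k), (0, ?k)]"
        by (rule step[OF q3, of "[(0, ?u)]" 0 "[]"]; simp)
      also have "deq [v, a, a] ... [(0, ?w), (0, ?k)]"
        by (rule at_sym[OF w, of 0 0]; simp)
      finally have 2: "deq [v, a, a] [(1, M), (0, ?w)] [(0, ?w), (0, ?k)]" .
      have "deq [v, a] [(0, ?f), (0, Br v a), (0, Br a v), (0, ?w)] [(0, ?f), (0, Br v a), (0, Br a v), (0, ?u), (0, ?k)]"
        by (rule at[OF w, of 0 3]; simp)
      also have "deq [v, a] ... [(0, ?f), (0, Br v a), (1, ?u), (0, Br a q), (0, ?k)]"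
        by (rule at_sym[OF wire_right_natural[of _ _ u a], of "[v]" "[q]" 0 2]; simp)
      also have "deq [v, a] ... [(0, ?f), (0, ?u), (0, Br q a), (0, Br a q), (0, ?k)]"
        by (rule at_sym[OF wire_left_natural[of _ _ u a], of "[v]" "[q]" 0 1]; simp)
      also have "deq [v, a] ... [(0, ?u), (0, ?h), (0, Br q a), (0, Br a q), (0, ?k)]"
        by (rule at[OF uf, of 0 0]; simp)
      also have "deq [v, a] ... [(0, ?u), (0, ?k), (0, ?h)]"
        by (rule at_sym[OF q7, of 0 1]; simp)
      also have "deq [v, a] ... [(0, ?w), (0, ?h)]"
        by (rule at_sym[OF w, of 0 0]; simp)
      finally show "k \<cdot> (u \<otimes> ident C a) \<in> hom tcat (free (bim v l r, f)) (bim q m k, h)"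
        unfolding free_hom_iff[OF tX tQ] using 1 2 by simp
    qed
    show "(\<lambda>w. w \<cdot> (ident C v \<otimes> \<eta>)) ` hom tcat (free (bim v l r, f)) (bim q m k, h) \<subseteq> hom tcat (bim v l r, f) (bim q m (m \<cdot> braiding C q a), h)"
    proof (rule image_subsetI)
      fix w assume w: "w \<in> hom tcat (free (bim v l r, f)) (bim q m k, h)"
      let ?u = "([v], [q], w \<cdot> (ident C v \<otimes> \<eta>))" and ?w = "([v, a], [q], w)"
      have b [simp]: "box ?w" and wl: "deq [a, v, a] [(0, ?l), (0, ?w)] [(1, ?w), (0, ?m)]"
        and wf: "deq [v, a] [(0, ?f), (0, Br v a), (0, Br a v), (0, ?w)] [(0, ?w), (0, ?h)]"
        using w by (simp_all add: free_hom_iff[OF tX tQ])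
      have [simp]: "box ?u" and u: "deq [v] [(0, ?u)] [(1, E), (0, ?w)]" using g[OF b] by blast+
      have "deq [a, v] [(0, ?l), (0, ?u)] [(0, ?l), (1, E), (0, ?w)]"
        by (rule at[OF u, of 0 1]; simp)
      also have "deq [a, v] ... [(2, E), (1, ?w), (0, ?m)]"
        by (rule step[OF wl, of "[(2, E)]" 0 "[]"]; simp)
      also have "deq [a, v] ... [(1, ?u), (0, ?m)]"
        by (rule at_sym[OF u, of 1 0]; simp)
      finally have 1: "deq [a, v] [(0, ?l), (0, ?u)] [(1, ?u), (0, ?m)]" .
      have "deq [v, a] [(0, ?r), (0, ?u)] [(0, Br v a), (0, ?l), (0, ?u)]"
        by (rule at[OF rd, of 0 0]; simp)
      also have "deq [v, a] ... [(0, Br v a), (1, ?u), (0, ?m)]"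
        by (rule at[OF 1, of 0 1]; simp)
      also have "deq [v, a] ... [(0, ?u), (0, Br q a), (0, ?m)]"
        by (rule at_sym[OF wire_left_natural[of _ _ "w \<cdot> (ident C v \<otimes> \<eta>)" a], of "[v]" "[q]" 0 0]; simp)
      also have "deq [v, a] ... [(0, ?u), (0, ?s)]"
        by (rule at_sym[OF sd, of 0 1]; simp)
      finally have 2: "deq [v, a] [(0, ?r), (0, ?u)] [(0, ?u), (0, ?s)]" .
      have "deq [v] [(0, ?u), (0, ?h)] [(1, E), (0, ?w), (0, ?h)]"
        by (rule at[OF u, of 0 0]; simp)
      also have "deq [v] ... [(1, E), (0, ?f), (0, Br v a), (0, Br a v), (0, ?w)]"
        by (rule at_sym[OF wf, of 0 1]; simp)
      also have "deq [v] ... [(0, ?f), (0, E), (0, Br a v), (0, ?w)]"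
        by (rule step[OF wire_right_natural[of _ _ \<eta> v], of "[]" "[a]" "[(0, ?f)]" 0 "[(0, Br a v), (0, ?w)]"]; simp)
      also have "deq [v] ... [(0, ?f), (1, E), (0, ?w)]"
        by (rule at[OF wire_left_natural[of _ _ \<eta> v], of "[]" "[a]" 0 1]; simp)
      also have "deq [v] ... [(0, ?f), (0, ?u)]"
        by (rule at_sym[OF u, of 0 1]; simp)
      finally show "w \<cdot> (ident C v \<otimes> \<eta>) \<in> hom tcat (bim v l r, f) (bim q m (m \<cdot> braiding C q a), h)"
        unfolding tcat_hom_iff[OF tX tS] using 1 2 by (simp add: deq_sym)
    qed
    show "\<forall>u\<in>hom tcat (bim v l r, f) (bim q m (m \<cdot> braiding C q a), h). (k \<cdot> (u \<otimes> ident C a)) \<cdot> (ident C v \<otimes> \<eta>) = u"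
    proof
      fix u assume u: "u \<in> hom tcat (bim v l r, f) (bim q m (m \<cdot> braiding C q a), h)"
      let ?u = "([v], [q], u)" and ?w = "([v, a], [q], k \<cdot> (u \<otimes> ident C a))"
      have b [simp]: "box ?u" using u by (simp add: tcat_hom_iff[OF tX tS])
      have [simp]: "box ?w" and w: "deq [v, a] [(0, ?w)] [(0, ?u), (0, ?k)]" using f[OF b] by blast+
      have "deq [v] [(1, E), (0, ?w)] [(1, E), (0, ?u), (0, ?k)]"
        by (rule at[OF w, of 0 1]; simp)
      also have "deq [v] ... [(0, ?u)]"
        by (rule step[OF q4, of "[(0, ?u)]" 0 "[]"]; simp)
      finally show "(k \<cdot> (u \<otimes> ident C a)) \<cdot> (ident C v \<otimes> \<eta>) = u" by (simp add: s)
    qed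
    show "\<forall>w\<in>hom tcat (free (bim v l r, f)) (bim q m k, h). k \<cdot> ((w \<cdot> (ident C v \<otimes> \<eta>)) \<otimes> ident C a) = w"
    proof
      fix w assume w: "w \<in> hom tcat (free (bim v l r, f)) (bim q m k, h)"
      let ?u = "([v], [q], w \<cdot> (ident C v \<otimes> \<eta>))" and ?w = "([v, a], [q], w)"
      have b [simp]: "box ?w" and wr: "deq [v, a, a] [(1, M), (0, ?w)] [(0, ?w), (0, ?k)]"
        using w by (simp_all add: free_hom_iff[OF tX tQ])
      have [simp]: "box ?u" and u: "deq [v] [(0, ?u)] [(1, E), (0, ?w)]" using g[OF b] by blast+
      have "deq [v, a] [(0, ?u), (0, ?k)] [(1, E), (0, ?w), (0, ?k)]"
        by (rule at[OF u, of 0 0]; simp)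
      also have "deq [v, a] ... [(1, E), (1, M), (0, ?w)]"
        by (rule at_sym[OF wr, of 0 1]; simp)
      also have "deq [v, a] ... [(0, ?w)]"
        by (rule at[OF unit_left, of 1 0]; simp)
      finally show "k \<cdot> ((w \<cdot> (ident C v \<otimes> \<eta>)) \<otimes> ident C a) = w" by (simp add: s)
    qed
  qed
qed

lemma free_hom_dim:
  assumes X: "twisted X" "symmetric X" and Q: "twisted Q"
  shows "T.hom_dim (free X) Q = T.hom_dim X (symmetrization Q)"
proof -
  interpret ambient_space_pair "scale tcat" "scale tcat" by (rule T.vector_space_pair_self)
  note o = twistedD(3)[OF X(1)] and oQ = bimoduleD[OF twistedD(1)[OF Q]] and oS = twisted_symmetrization[OF Q]
  have sq: "bimod_obj (fst (symmetrization Q)) = bimod_obj (fst Q)" by (simp add: symmetrization_def Let_def)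
  note oa = tensor_in_obj[OF o a_obj]
  have h: "u \<in> hom C (bimod_obj (fst X)) (bimod_obj (fst Q))" if "u \<in> hom tcat X (symmetrization Q)" for u
    using tcat_homD(1)[OF that] sq by simp
  have t: "u \<otimes> ident C a \<in> hom C (bimod_obj (fst X) \<odot> a) (bimod_obj (fst Q) \<odot> a)"
    if "u \<in> hom tcat X (symmetrization Q)" for u
    by (rule tensor_in_hom[OF o oQ(1) a_obj a_obj h[OF that] ident_in_hom[OF a_obj]])
  have S: "T.amb.subspace (hom tcat X (symmetrization Q))"
    by (rule T.hom_subspace) (use X oS in simp_all)
  show ?thesis
  proof (rule dim_bij[OF S free_hom_bij[OF X Q]])
    fix x y c assume x: "x \<in> hom tcat X (symmetrization Q)"
    show "right_act (fst Q) \<cdot> (scale tcat c x \<otimes> ident C a) = scale tcat c (right_act (fst Q) \<cdot> (x \<otimes> ident C a))"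
      using tensor_scale_left[OF o oQ(1) a_obj a_obj h[OF x] ident_in_hom[OF a_obj]] comp_scale_right[OF oa oQ(5,1) t[OF x] oQ(3)] by simp
    assume y: "y \<in> hom tcat X (symmetrization Q)"
    show "right_act (fst Q) \<cdot> ((x + y) \<otimes> ident C a) = right_act (fst Q) \<cdot> (x \<otimes> ident C a) + right_act (fst Q) \<cdot> (y \<otimes> ident C a)"
      using tensor_add_left[OF o oQ(1) a_obj a_obj h[OF x] h[OF y] ident_in_hom[OF a_obj]] comp_add_right[OF oa oQ(5,1) t[OF x] t[OF y] oQ(3)] by simp
  qed
qed

end

context linear_category
begin

text \<open>Representatives are selected inside the given set, so that properties of its members are
  kept.\<close>

lemma isomorphism_representatives:
  assumes "finite A" "A \<subseteq> obj C"
  shows "\<exists>B\<subseteq>A. (\<forall>S\<in>B. \<forall>T\<in>B. isomorphic S T \<longrightarrow> S = T) \<and> (\<forall>S\<in>A. \<exists>T\<in>B. isomorphic S T)"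
  using assms
proof (induction A)
  case (insert x A)
  then obtain B where B: "B \<subseteq> A" "\<forall>S\<in>B. \<forall>T\<in>B. isomorphic S T \<longrightarrow> S = T" "\<forall>S\<in>A. \<exists>T\<in>B. isomorphic S T" by auto
  show ?case
  proof (cases "\<exists>T\<in>B. isomorphic x T")
    case True
    then show ?thesis using B by (intro exI[of _ B]) auto
  next
    case False
    have x: "isomorphic x x" using insert by (simp add: isomorphic_refl)
    have "\<forall>T\<in>B. \<not> isomorphic T x" using False isomorphic_sym by blast
    then show ?thesis using B False x by (intro exI[of _ "insert x B"]) auto
  qed
qed auto

end

section \<open>Characters of twisted bimodules\<close>

context twisted_bimodules
begin

text \<open>The character of the left module, with the twist inserted into the closed strand. It
  generalizes the trace form, which it gives for the regular bimodule with trivial twist.\<close>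

definition char_map :: "('o, 'm) bimodule \<times> 'm \<Rightarrow> 'm" where
  "char_map X = trace a (bimod_obj (fst X)) (snd X \<cdot> left_act (fst X))"

context
  fixes X assumes X: "twisted X"
begin

lemma twisted_act_hom: "snd X \<cdot> left_act (fst X) \<in> hom C (a \<odot> bimod_obj (fst X)) (bimod_obj (fst X))"
  using bimoduleD[OF twistedD(1)[OF X]] twistedD(2,3)[OF X] by (intro comp_in_hom)

lemma char_map_add:
  assumes g: "g \<in> hom C (bimod_obj (fst X)) (bimod_obj (fst X))" and h: "h \<in> hom C (bimod_obj (fst X)) (bimod_obj (fst X))"
  shows "trace a (bimod_obj (fst X)) ((snd X \<cdot> left_act (fst X)) \<cdot> (ident C a \<otimes> (g + h))) =
    trace a (bimod_obj (fst X)) ((snd X \<cdot> left_act (fst X)) \<cdot> (ident C a \<otimes> g)) +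
    trace a (bimod_obj (fst X)) ((snd X \<cdot> left_act (fst X)) \<cdot> (ident C a \<otimes> h))"
proof -
  note o = twistedD(3)[OF X] and b = twisted_act_hom
  note oa = tensor_in_obj[OF a_obj o] and i = ident_in_hom[OF a_obj]
  note t = tensor_in_hom[OF a_obj a_obj o o i g] tensor_in_hom[OF a_obj a_obj o o i h]
  show ?thesis
    unfolding tensor_add_right[OF a_obj a_obj o o i g h] comp_add_right[OF oa oa o t b]
    by (rule trace_add[OF o a_obj comp_in_hom[OF oa oa o t(1) b] comp_in_hom[OF oa oa o t(2) b]])
qed

text \<open>Cyclicity moves \<open>p\<close> around the loop, and \<open>i\<close> commutes with
  action and twist, so only the loop of the retract is left. Summed over a decomposition this makes
  characters additive.\<close>

lemma char_map_retract:
  assumes Z: "twisted Z" and i: "i \<in> hom tcat Z X" and p: "p \<in> hom tcat X Z" and pi: "p \<cdot> i = ident C (bimod_obj (fst Z))"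
  shows "trace a (bimod_obj (fst X)) ((snd X \<cdot> left_act (fst X)) \<cdot> (ident C a \<otimes> (i \<cdot> p))) = char_map Z"
proof -
  let ?v = "bimod_obj (fst X)" and ?s = "bimod_obj (fst Z)"
  let ?u = "snd X \<cdot> left_act (fst X)" and ?\<gamma> = "snd Z \<cdot> left_act (fst Z)"
  note o = twistedD(3)[OF X] and os = twistedD(3)[OF Z] and id = ident_in_hom[OF a_obj]
  note oa = tensor_in_obj[OF a_obj o] and osa = tensor_in_obj[OF a_obj os]
  note i' = tcat_homD[OF i] and p' = tcat_homD[OF p]
  note ti = tensor_in_hom[OF a_obj a_obj os o id i'(1)] and tp = tensor_in_hom[OF a_obj a_obj o os id p'(1)]
  note u = twisted_act_hom and bX = bimoduleD[OF twistedD(1)[OF X]] and bS = bimoduleD[OF twistedD(1)[OF Z]]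
  have \<gamma>: "?\<gamma> \<in> hom C (a \<odot> ?s) ?s" by (rule comp_in_hom[OF osa os os bS(2) twistedD(2)[OF Z]])
  have "?u \<cdot> (ident C a \<otimes> i) = snd X \<cdot> (i \<cdot> left_act (fst Z))"
    using comp_assoc[OF osa oa o o ti bX(2) twistedD(2)[OF X]] bimodule_homD(2)[OF i'(2)] by simp
  also have "... = i \<cdot> ?\<gamma>"
    using comp_assoc[OF osa os o o bS(2) i'(1) twistedD(2)[OF X]] comp_assoc[OF osa os os o bS(2) twistedD(2)[OF Z] i'(1)] i'(3) by simp
  finally have eq: "?u \<cdot> (ident C a \<otimes> i) = i \<cdot> ?\<gamma>" .
  have g: "?u \<cdot> (ident C a \<otimes> i) \<in> hom C (a \<odot> ?s) ?v" by (rule comp_in_hom[OF osa oa o ti u])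
  have "?u \<cdot> (ident C a \<otimes> (i \<cdot> p)) = (?u \<cdot> (ident C a \<otimes> i)) \<cdot> (ident C a \<otimes> p)"
    unfolding tensor_id_comp(1)[OF o os o a_obj p'(1) i'(1)] comp_assoc[OF oa osa oa o tp ti u] ..
  then have "trace a ?v (?u \<cdot> (ident C a \<otimes> (i \<cdot> p))) = trace a ?s (p \<cdot> (?u \<cdot> (ident C a \<otimes> i)))"
    using trace_commute[OF o os a_obj p'(1) g] by simp
  also have "p \<cdot> (?u \<cdot> (ident C a \<otimes> i)) = ?\<gamma>"
    unfolding eq comp_assoc[OF osa os o os \<gamma> i'(1) p'(1), symmetric] pi by (rule ident_comp[OF osa os \<gamma>])
  finally show ?thesis by (simp add: char_map_def)
qed

lemma char_map_ident:
  "trace a (bimod_obj (fst X)) ((snd X \<cdot> left_act (fst X)) \<cdot> (ident C a \<otimes> ident C (bimod_obj (fst X)))) = char_map X"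
  using comp_ident[OF tensor_in_obj[OF a_obj twistedD(3)[OF X]] twistedD(3)[OF X] twisted_act_hom] twistedD(3)[OF X]
  by (simp add: char_map_def tensor_ident)

lemma char_map_isomorphic:
  assumes Z: "twisted Z" and iso: "T.isomorphic Z X"
  shows "char_map Z = char_map X"
proof -
  obtain i p where "i \<in> hom tcat Z X" "p \<in> hom tcat X Z" "p \<cdot> i = ident C (bimod_obj (fst Z))" "i \<cdot> p = ident C (bimod_obj (fst X))"
    using iso by (auto simp: T.isomorphic_def isomorphism_def)
  then show ?thesis using char_map_retract[OF Z] char_map_ident by metis
qed

lemma char_map_direct_sum:
  assumes D: "direct_sum tcat n Z X" and Z: "\<And>i. i < n \<Longrightarrow> twisted (Z i)"
  shows "char_map X = (\<Sum>i<n. char_map (Z i))"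
proof -
  obtain \<iota> \<pi> where h: "\<forall>i<n. \<iota> i \<in> hom tcat (Z i) X" "\<forall>i<n. \<pi> i \<in> hom tcat X (Z i)"
    and o: "\<forall>i<n. \<forall>j<n. \<pi> i \<cdot> \<iota> j = (if i = j then ident C (bimod_obj (fst (Z i))) else 0)"
    and s: "(\<Sum>i<n. \<iota> i \<cdot> \<pi> i) = ident C (bimod_obj (fst X))"
    using T.direct_sumE[OF D] unfolding tcat_simps by blast
  let ?v = "bimod_obj (fst X)"
  let ?F = "\<lambda>g. trace a ?v ((snd X \<cdot> left_act (fst X)) \<cdot> (ident C a \<otimes> g))"
  note v = twistedD(3)[OF X]
  have z: "?F 0 = 0" using char_map_add[OF hom_zero hom_zero] v by simp
  have "?F (\<Sum>i<k. \<iota> i \<cdot> \<pi> i) = (\<Sum>i<k. char_map (Z i)) \<and> (\<Sum>i<k. \<iota> i \<cdot> \<pi> i) \<in> hom C ?v ?v" if "k \<le> n" for k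
    using that
  proof (induction k)
    case 0
    show ?case using z hom_zero v by simp
  next
    case (Suc k)
    then have k: "k < n" by simp
    have IH: "?F (\<Sum>i<k. \<iota> i \<cdot> \<pi> i) = (\<Sum>i<k. char_map (Z i))" "(\<Sum>i<k. \<iota> i \<cdot> \<pi> i) \<in> hom C ?v ?v" using Suc by auto
    have m: "\<iota> k \<cdot> \<pi> k \<in> hom C ?v ?v"
      by (rule comp_in_hom[OF v twistedD(3)[OF Z[OF k]] v]) (use h k tcat_homD(1) in blast)+
    have "\<pi> k \<cdot> \<iota> k = ident C (bimod_obj (fst (Z k)))" using o k by simp
    then have "?F (\<iota> k \<cdot> \<pi> k) = char_map (Z k)" using char_map_retract[OF Z[OF k]] h k by blast
    then show ?case using IH m char_map_add[OF IH(2) m] hom_add[OF v v IH(2) m] by simp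
  qed
  from this[of n] show ?thesis using char_map_ident s by simp
qed

end

text \<open>Guarantees that the simple summands of a symmetric object are symmetric, so that
  characters of symmetric objects expand over symmetric simple objects, to which reciprocity
  applies.\<close>

lemma symmetric_retract:
  assumes Z: "twisted Z" and X: "twisted X" "symmetric X"
    and i: "i \<in> hom tcat Z X" and p: "p \<in> hom tcat X Z" and pi: "p \<cdot> i = ident C (bimod_obj (fst Z))"
  shows "symmetric Z"
proof -
  obtain v l r f where x: "X = (bim v l r, f)" by (rule twisted_bim)
  obtain q m k h where y: "Z = (bim q m k, h)" by (rule twisted_bim)
  note tX = X(1)[unfolded x] and tS = Z[unfolded y]
  note [simp] = twisted_boxes[OF tX] twisted_boxes[OF tS]
  let ?l = "([a, v], [v], l)" and ?r = "([v, a], [v], r)" and ?m = "([a, q], [q], m)" and ?k = "([q, a], [q], k)"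
  let ?i = "([q], [v], i)" and ?p = "([v], [q], p)"
  have [simp]: "box ?i" and bp [simp]: "box ?p" and il: "deq [a, q] [(0, ?m), (0, ?i)] [(1, ?i), (0, ?l)]" and ir: "deq [q, a] [(0, ?k), (0, ?i)] [(0, ?i), (0, ?r)]"
    using i p unfolding x y by (simp_all add: tcat_hom_iff[OF tS tX] tcat_hom_iff[OF tX tS])
  have r: "deq [v, a] [(0, ?r)] [(0, Br v a), (0, ?l)]"
    using X(2) twisted_boxes(3)[OF tX] by (simp add: x symmetric_def deq_def sem_eval)
  have pid: "deq [q] [(0, ?i), (0, ?p)] []" using pi by (simp add: y deq_def sem_eval)
  have "deq [q, a] [(0, ?k), (0, ?i)] [(0, ?i), (0, ?r)]" by (rule ir)
  also have "deq [q, a] ... [(0, ?i), (0, Br v a), (0, ?l)]"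
    by (rule step[OF r, of "[(0, ?i)]" 0 "[]"]; simp)
  also have "deq [q, a] ... [(0, Br q a), (1, ?i), (0, ?l)]"
    by (rule at[OF wire_left_natural[of _ _ i a], of "[q]" "[v]" 0 0]; simp)
  also have "deq [q, a] ... [(0, Br q a), (0, ?m), (0, ?i)]"
    by (rule at_sym[OF il, of 0 1]; simp)
  finally have "deq [q, a] ([(0, ?k)] @ [(0, ?i)]) ([(0, Br q a), (0, ?m)] @ [(0, ?i)])" by simp
  then have "deq [q, a] [(0, ?k)] [(0, Br q a), (0, ?m)]"
    by (rule section_cancel[OF pid bp]) simp_all
  then show ?thesis by (simp add: y symmetric_def deq_def sem_eval)
qed

text \<open>A comparison that ignores the twists. Finiteness can be bounded for unlinked families,
  because bimodule maps are controlled by one finite-dimensional endomorphism space.\<close>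

definition linked :: "('o, 'm) bimodule \<times> 'm \<Rightarrow> ('o, 'm) bimodule \<times> 'm \<Rightarrow> bool" where
  "linked Z T \<longleftrightarrow> (\<exists>\<phi>\<in>bimod_homs (fst Z) (fst T). \<phi> \<noteq> 0)"

lemma bimodule_regular':
  assumes "is_bimodule C alg N" "is_bimodule C alg N'" "u \<in> bimod_homs N N'"
  shows "\<exists>\<psi>\<in>bimod_homs N' N. (u \<cdot> \<psi>) \<cdot> u = u"
  by (rule bimodule.cases[of N], rule bimodule.cases[of N'])
    (use bimodule_regular[OF a_projective] assms in \<open>simp add: bimodule.defs; blast\<close>)

lemma linked_sym:
  assumes "twisted Z" "twisted T" "linked Z T"
  shows "linked T Z"
proof -
  note s = twistedD[OF assms(1)] and t = twistedD[OF assms(2)]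
  obtain u where u: "u \<in> bimod_homs (fst Z) (fst T)" "u \<noteq> 0" using assms(3) by (auto simp: linked_def)
  obtain w where w: "w \<in> bimod_homs (fst T) (fst Z)" "(u \<cdot> w) \<cdot> u = u"
    using bimodule_regular'[OF s(1) t(1) u(1)] by blast
  have "w \<noteq> 0"
  proof
    assume "w = 0"
    then have "u \<cdot> w = 0" using comp_zero(2)[OF t(3) s(3) t(3) bimodule_homD(1)[OF u(1)]] by simp
    then have "u = 0 \<cdot> u" using w(2) by simp
    then show False using comp_zero(1)[OF s(3) t(3,3) bimodule_homD(1)[OF u(1)]] u(2) by simp
  qed
  then show ?thesis using w(1) unfolding linked_def by blast
qed

abbreviation opposite :: "('o, 'm) bimodule \<times> 'm \<Rightarrow> ('o, 'm) bimodule \<times> 'm" where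
  "opposite X \<equiv> (fst X, - snd X)"

lemma tensor_minus:
  assumes "v \<in> obj C" "f \<in> hom C v v"
  shows "ident C a \<otimes> (- f) = - (ident C a \<otimes> f)" "(- f) \<otimes> ident C a = - (f \<otimes> ident C a)"
  using tensor_scale_right[OF a_obj a_obj assms(1,1) ident_in_hom[OF a_obj] assms(2), of "- 1"]
    tensor_scale_left[OF assms(1,1) a_obj a_obj assms(2) ident_in_hom[OF a_obj], of "- 1"] by (simp_all add: scale_minus_one)

text \<open>The equations with the actions are linear in the twist and the one with the double twist
  is quadratic, so a change of sign preserves them.\<close>

lemma twisted_opposite:
  assumes X: "twisted X"
  shows "twisted (opposite X)"
proof -
  let ?v = "bimod_obj (fst X)" and ?f = "snd X"
  note o = twistedD(3)[OF X] and f = twistedD(2)[OF X] and b = bimoduleD[OF twistedD(1)[OF X]]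
  have c: "braiding C ?v a \<cdot> braiding C a ?v \<in> hom C (a \<odot> ?v) (a \<odot> ?v)" "braiding C a ?v \<cdot> braiding C ?v a \<in> hom C (?v \<odot> a) (?v \<odot> a)"
    using comp_in_hom[OF b(4,5,4)] comp_in_hom[OF b(5,4,5)] braiding_in_hom o by simp_all
  have t: "ident C a \<otimes> ?f \<in> hom C (a \<odot> ?v) (a \<odot> ?v)" "?f \<otimes> ident C a \<in> hom C (?v \<odot> a) (?v \<odot> a)"
    by (simp_all add: tensor_in_hom o f ident_in_hom)
  have d: "double_twist ?v \<cdot> ?f \<in> hom C ?v ?v" by (rule comp_in_hom[OF o o o f double_twist_in_hom[OF o]])
  show ?thesis
    using X unfolding twisted_def Let_def fst_conv snd_conv
    by (simp add: hom_minus[OF o o f] tensor_minus[OF o f] comp_minus[OF b(4) b(4) b(4) t(1) c(1)] comp_minus[OF b(5) b(5) b(5) t(2) c(2)]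
        comp_minus[OF b(4) b(4) o comp_in_hom[OF b(4,4,4) t(1) c(1)] b(2)] comp_minus[OF b(5) b(5) o comp_in_hom[OF b(5,5,5) t(2) c(2)] b(3)]
        comp_minus[OF b(4) o o b(2) f] comp_minus[OF b(5) o o b(3) f] comp_minus[OF o o o f double_twist_in_hom[OF o]] comp_minus[OF o o o d f]
        comp_minus[OF o o o d hom_minus[OF o o f]])
qed

lemma simple_opposite:
  assumes Z: "simple_object tcat Z"
  shows "simple_object tcat (opposite Z)"
proof (rule T.simple_or_split)
  have tS: "twisted Z" using Z by (simp add: simple_object_def)
  show "opposite Z \<in> obj tcat" using twisted_opposite[OF tS] by simp
  show "ident tcat (opposite Z) \<noteq> 0" using Z T.zero_object_iff[of Z] by (simp add: simple_object_def)
  note o = twistedD(3)[OF tS] and f = twistedD(2)[OF tS]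
  show "u = 0 \<or> u = ident tcat (opposite Z)" if u: "u \<in> hom tcat (opposite Z) (opposite Z)" "comp tcat u u = u" for u
  proof -
    note u' = tcat_homD[OF u(1)]
    have "u \<cdot> snd Z = snd Z \<cdot> u"
      using u' comp_minus[OF o o o f, of u] comp_minus[OF o o o _ f, of u] by simp
    then have "u \<in> hom tcat Z Z" using u' unfolding tcat_hom by simp
    then show ?thesis using T.simple_idem[OF Z _ u(2)] by auto
  qed
qed

text \<open>Adding to a bimodule map \<open>w\<close> its conjugate \<open>q\<close> gives a
  morphism that respects the twists. If the sum vanishes, then q = -w, and \<open>w\<close> respects
  the twists after a change of sign. In either case Schur's lemma applies.\<close>

lemma linked_isomorphic:
  assumes Z: "simple_object tcat Z" and U: "simple_object tcat U" and l: "linked Z U"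
  shows "T.isomorphic Z U \<or> T.isomorphic Z (opposite U)"
proof -
  have tS: "twisted Z" and tU: "twisted U" using Z U by (simp_all add: simple_object_def)
  obtain w where w: "w \<in> bimod_homs (fst Z) (fst U)" "w \<noteq> 0" using l by (auto simp: linked_def)
  note s = twistedD[OF tS] and u = twistedD[OF tU]
  obtain v l r f where x: "U = (bim v l r, f)" by (rule twisted_bim)
  obtain v' l' r' f' where y: "Z = (bim v' l' r', f')" by (rule twisted_bim)
  obtain q where q: "q \<in> bimod_homs (fst Z) (fst U)" and c: "snd U \<cdot> q = w \<cdot> snd Z" "q \<cdot> snd Z = snd U \<cdot> w"
    using twist_conjugate[of v l r f v' l' r' f' w] tS tU w(1) unfolding x y by auto
  note h = bimodule_homD(1)[OF w(1)] bimodule_homD(1)[OF q]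
  interpret vector_space "scale C" by (rule ambient_vector_space)
  have "w + q \<in> bimod_homs (fst Z) (fst U)"
    by (rule subspace_add[OF bimodule_homs_subspace[OF s(1) u(1)] w(1) q])
  moreover have "(w + q) \<cdot> snd Z = snd U \<cdot> (w + q)"
    using comp_add_left[OF s(3,3) u(3) s(2) h] comp_add_right[OF s(3) u(3,3) h u(2)] c by (simp add: add.commute)
  ultimately have 1: "w + q \<in> hom tcat Z U" by (simp add: tcat_hom)
  show ?thesis
  proof (cases "w + q = 0")
    case True
    then have "q = - w" by (metis add.inverse_unique)
    then have "w \<cdot> snd Z = (- snd U) \<cdot> w"
      using c(1) comp_minus[OF s(3) u(3,3) h(1) u(2)] by simp
    then have "w \<in> hom tcat Z (opposite U)" using w(1) by (simp add: tcat_hom)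
    then show ?thesis using T.schur[OF Z simple_opposite[OF U] _ w(2)] by (auto simp: T.isomorphic_def)
  next
    case False
    then show ?thesis using T.schur[OF Z U 1] by (auto simp: T.isomorphic_def)
  qed
qed

text \<open>\<open>x\<close> extends through both actions to the free bimodule; the extension is
  non-zero because it restricts to \<open>x\<close> along the units.\<close>

lemma generator_bimodule_hom:
  assumes X: "twisted X" and x: "x \<in> hom C w (bimod_obj (fst X))" "x \<noteq> 0" and w: "w \<in> obj C"
  shows "\<exists>u\<in>bimod_homs (bim (a \<odot> w \<odot> a) (\<mu> \<otimes> ident C (w \<odot> a)) (ident C (a \<odot> w) \<otimes> \<mu>)) (fst X). u \<noteq> 0"
proof -
  obtain v l r f where X': "X = (bim v l r, f)" by (rule twisted_bim)
  note tX = X[unfolded X']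
  note [simp] = twisted_boxes[OF tX] w
  note dx = twisted_iff[OF twisted_boxes[OF tX]]
  let ?l = "([a, v], [v], l)" and ?r = "([v, a], [v], r)" and ?x = "([w], [v], x)"
  have X1: "deq [a, a, v] [(0, M), (0, ?l)] [(1, ?l), (0, ?l)]" and X2: "deq [v] [(0, E), (0, ?l)] []"
    and X3: "deq [v, a, a] [(1, M), (0, ?r)] [(0, ?r), (0, ?r)]" and X4: "deq [v] [(1, E), (0, ?r)] []"
    and X5: "deq [a, v, a] [(0, ?l), (0, ?r)] [(1, ?r), (0, ?l)]"
    using dx tX by simp_all
  have [simp]: "box ?x" using x by (intro boxI) (simp_all add: X')
  obtain u where u: "deq [a, w, a] [(0, ([a, w, a], [v], u))] [(1, ?x), (0, ?l), (0, ?r)]" "box ([a, w, a], [v], u)"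
    by (rule that[OF deq_box]; simp)
  let ?u = "([a, w, a], [v], u)"
  note [simp] = u(2)
  have "deq [a, a, w, a] [(0, M), (0, ?u)] [(0, M), (1, ?x), (0, ?l), (0, ?r)]"
    by (rule at[OF u(1), of 0 1]; simp)
  also have "deq [a, a, w, a] ... [(2, ?x), (1, ?l), (0, ?l), (0, ?r)]"
    by (rule step[OF X1, of "[(2, ?x)]" 0 "[(0, ?r)]"]; simp)
  also have "deq [a, a, w, a] ... [(2, ?x), (1, ?l), (1, ?r), (0, ?l)]"
    by (rule at[OF X5, of 0 2]; simp)
  also have "deq [a, a, w, a] ... [(1, ?u), (0, ?l)]"
    by (rule at_sym[OF u(1), of 1 0]; simp)
  finally have 1: "deq [a, a, w, a] [(0, M), (0, ?u)] [(1, ?u), (0, ?l)]" .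
  have "deq [a, w, a, a] [(2, M), (0, ?u)] [(2, M), (1, ?x), (0, ?l), (0, ?r)]"
    by (rule at[OF u(1), of 0 1]; simp)
  also have "deq [a, w, a, a] ... [(1, ?x), (0, ?l), (0, ?r), (0, ?r)]"
    by (rule step[OF X3, of "[(1, ?x), (0, ?l)]" 0 "[]"]; simp)
  also have "deq [a, w, a, a] ... [(0, ?u), (0, ?r)]"
    by (rule at_sym[OF u(1), of 0 0]; simp)
  finally have 2: "deq [a, w, a, a] [(2, M), (0, ?u)] [(0, ?u), (0, ?r)]" .
  have "deq [w] [(0, E), (2, E), (0, ?u)] [(0, E), (2, E), (1, ?x), (0, ?l), (0, ?r)]"
    by (rule at[OF u(1), of 0 2]; simp)
  also have "deq [w] ... [(0, ?x), (1, E), (0, ?r)]"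
    by (rule step[OF X2, of "[(0, ?x)]" 0 "[(1, E), (0, ?r)]"]; simp)
  also have "deq [w] ... [(0, ?x)]"
    by (rule at[OF X4, of 0 1]; simp)
  finally have 3: "sem [w] [(0, E), (2, E), (0, ?u)] = x" and ok: "ok [w] ([(0, E), (2, E)] @ (0, ?u) # [])"
    by (simp_all add: deq_def sem_box)
  have "u \<noteq> 0"
  proof
    assume z: "u = 0"
    have "sem [w] ([(0, E), (2, E)] @ (0, ?u) # []) = 0"
      using sem_zero_layer[of "[w]" "[(0, E), (2, E)]" 0 "[a, w, a]" "[v]" "[]"] ok unfolding z by blast
    then show False using 3 x(2) by simp
  qed
  moreover have uh: "u \<in> hom C (a \<odot> w \<odot> a) v" using u(2) by (simp add: box_def tens_simps)
  have "u \<in> bimod_homs (bim (a \<odot> w \<odot> a) (\<mu> \<otimes> ident C (w \<odot> a)) (ident C (a \<odot> w) \<otimes> \<mu>)) (fst X)"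
    using 1 2 uh unfolding X' fst_conv bimodule_homs_iff
    by (simp add: sem_morphism)
  ultimately show ?thesis by blast
qed

text \<open>Pairwise unlinked simple objects give linearly independent endomorphisms of \<open>a \<odot> P \<odot> a\<close>
  for a projective generator \<open>P\<close>.\<close>
lemma unlinked_bound:
  "\<exists>N. \<forall>U. finite U \<and> (\<forall>S\<in>U. simple_object tcat S) \<and> (\<forall>S\<in>U. \<forall>T\<in>U. S \<noteq> T \<longrightarrow> \<not> linked S T) \<longrightarrow> card U < N"
proof -
  interpret amb: ambient_space "scale C" by (rule ambient_space.intro[OF ambient_vector_space])
  obtain P where P: "projective_object C P" and gen: "\<And>V. V \<in> obj C \<Longrightarrow> ident C V \<noteq> 0 \<Longrightarrow> \<exists>x\<in>hom C P V. x \<noteq> 0"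
    using projective_generator by blast
  have Po: "P \<in> obj C" using P by (simp add: projective_object_def)
  let ?q = "a \<odot> P \<odot> a"
  let ?Q = "bim ?q (\<mu> \<otimes> ident C (P \<odot> a)) (ident C (a \<odot> P) \<otimes> \<mu>)"
  have Q: "is_bimodule C alg ?Q" by (rule two_sided_free_bimodule[OF Po])
  have qo: "?q \<in> obj C" by (simp add: tensor_in_obj Po)
  have ex: "\<exists>\<phi>\<in>bimod_homs ?Q (fst S). \<phi> \<noteq> 0" if S: "simple_object tcat S" for S
  proof -
    have tS: "twisted S" using S by (simp add: simple_object_def)
    have "ident C (bimod_obj (fst S)) \<noteq> 0" using S T.zero_object_iff[of S] by (simp add: simple_object_def)
    then obtain x where "x \<in> hom C P (bimod_obj (fst S))" "x \<noteq> 0" using gen[OF twistedD(3)[OF tS]] by blast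
    then show ?thesis using generator_bimodule_hom[OF tS _ _ Po] by blast
  qed
  obtain B where B: "finite B" "hom C ?q ?q \<subseteq> amb.span B" using hom_fin_dim[OF qo qo] unfolding fin_dim_def by blast
  have "card U \<le> card B" if U: "finite U" "\<forall>S\<in>U. simple_object tcat S" "\<forall>S\<in>U. \<forall>T\<in>U. S \<noteq> T \<longrightarrow> \<not> linked S T" for U
  proof -
    have tU: "twisted S" if "S \<in> U" for S using U(2) that by (auto simp: simple_object_def)
    have "\<forall>S\<in>U. \<exists>\<phi> \<psi>. \<phi> \<in> bimod_homs ?Q (fst S) \<and> \<phi> \<noteq> 0 \<and> \<psi> \<in> bimod_homs (fst S) ?Q \<and> (\<phi> \<cdot> \<psi>) \<cdot> \<phi> = \<phi>"
      using ex U(2) bimodule_regular'[OF Q twistedD(1)[OF tU]] by blast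
    then obtain \<phi> \<psi> where \<phi>: "\<And>S. S \<in> U \<Longrightarrow> \<phi> S \<in> bimod_homs ?Q (fst S)" "\<And>S. S \<in> U \<Longrightarrow> \<phi> S \<noteq> 0"
      and \<psi>: "\<And>S. S \<in> U \<Longrightarrow> \<psi> S \<in> bimod_homs (fst S) ?Q" "\<And>S. S \<in> U \<Longrightarrow> (\<phi> S \<cdot> \<psi> S) \<cdot> \<phi> S = \<phi> S"
      by metis
    let ?\<epsilon> = "\<lambda>S. \<psi> S \<cdot> \<phi> S"
    note so = twistedD(3)[OF tU]
    have \<phi>h: "\<phi> S \<in> hom C ?q (bimod_obj (fst S))" and \<psi>h: "\<psi> S \<in> hom C (bimod_obj (fst S)) ?q" if "S \<in> U" for S
      using bimodule_homD(1)[OF \<phi>(1)[OF that]] bimodule_homD(1)[OF \<psi>(1)[OF that]] by simp_all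
    have \<epsilon>h: "?\<epsilon> S \<in> hom C ?q ?q" if "S \<in> U" for S by (rule comp_in_hom[OF qo so[OF that] qo \<phi>h[OF that] \<psi>h[OF that]])
    \<comment> \<open>For different members, \<phi>_T \<psi>_S is a bimodule map between unlinked
      objects and so vanishes. Composing a linear relation between the endomorphisms with \<phi>_T
      then isolates one coefficient.\<close>
    have \<phi>\<epsilon>: "\<phi> T \<cdot> ?\<epsilon> S = (if S = T then \<phi> T else 0)" if ST: "S \<in> U" "T \<in> U" for S T
    proof (cases "S = T")
      case True
      then show ?thesis using \<psi>(2)[OF ST(1)] comp_assoc[OF qo so qo so \<phi>h \<psi>h \<phi>h] ST by simp
    next
      case False
      have "\<phi> T \<cdot> \<psi> S \<in> bimod_homs (fst S) (fst T)"
        by (rule bimodule_comp[OF twistedD(1)[OF tU[OF ST(1)]] Q twistedD(1)[OF tU[OF ST(2)]] \<psi>(1)[OF ST(1)] \<phi>(1)[OF ST(2)]])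
      then have "\<phi> T \<cdot> \<psi> S = 0" using U(3) ST False unfolding linked_def by blast
      then show ?thesis
        using comp_assoc[OF qo so[OF ST(1)] qo so[OF ST(2)] \<phi>h[OF ST(1)] \<psi>h[OF ST(1)] \<phi>h[OF ST(2)]]
          comp_zero(1)[OF qo so[OF ST(1)] so[OF ST(2)] \<phi>h[OF ST(1)]] False by simp
    qed
    have inj: "inj_on ?\<epsilon> U"
      by (rule inj_onI) (metis \<phi>(2) \<phi>\<epsilon>)
    have "amb.independent (?\<epsilon> ` U)"
    proof (rule amb.independent_if_scalars_zero)
      show "finite (?\<epsilon> ` U)" using U(1) by simp
      fix c x assume z: "(\<Sum>x\<in>?\<epsilon> ` U. scale C (c x) x) = 0" and "x \<in> ?\<epsilon> ` U"
      then obtain T where T: "T \<in> U" "x = ?\<epsilon> T" by blast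
      have ch: "scale C (c (?\<epsilon> S)) (?\<epsilon> S) \<in> hom C ?q ?q" if "S \<in> U" for S by (rule hom_scale[OF qo qo \<epsilon>h[OF that]])
      have z': "(\<Sum>S\<in>U. scale C (c (?\<epsilon> S)) (?\<epsilon> S)) = 0" using z sum.reindex[OF inj, of "\<lambda>x. scale C (c x) x"] by simp
      have "(\<Sum>S\<in>U. \<phi> T \<cdot> scale C (c (?\<epsilon> S)) (?\<epsilon> S)) = \<phi> T \<cdot> (\<Sum>S\<in>U. scale C (c (?\<epsilon> S)) (?\<epsilon> S))"
        using comp_sum_right[OF qo qo so[OF T(1)] \<phi>h[OF T(1)], of U "\<lambda>S. scale C (c (?\<epsilon> S)) (?\<epsilon> S)"] ch by simp
      also have "... = 0" unfolding z' using comp_zero(2)[OF qo qo so[OF T(1)] \<phi>h[OF T(1)]] .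
      also have "(\<Sum>S\<in>U. \<phi> T \<cdot> scale C (c (?\<epsilon> S)) (?\<epsilon> S)) = (\<Sum>S\<in>U. if S = T then scale C (c x) (\<phi> T) else 0)"
        by (rule sum.cong[OF refl]) (simp add: comp_scale_right[OF qo qo so[OF T(1)] \<epsilon>h \<phi>h[OF T(1)]] \<phi>\<epsilon> T)
      also have "... = scale C (c x) (\<phi> T)" using U(1) T(1) by simp
      finally show "c x = 0" using \<phi>(2)[OF T(1)] by simp
    qed
    moreover have "?\<epsilon> ` U \<subseteq> amb.span B" using \<epsilon>h B(2) by blast
    ultimately have "card (?\<epsilon> ` U) \<le> card B" using amb.independent_span_bound[OF B(1)] by blast
    then show ?thesis using card_image[OF inj] by simp
  qed
  then show ?thesis by (intro exI[of _ "Suc (card B)"]) (simp add: less_Suc_eq_le)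
qed

end

section \<open>Finitely many simple objects and the value of the trace form on the unit\<close>

context twisted_bimodules
begin

text \<open>In an unlinked family of maximal size every simple object is a member or linked to one,
  and so isomorphic to a member or to a member with the opposite twist.\<close>

lemma finite_simples:
  "\<exists>\<Sigma>. finite \<Sigma> \<and> (\<forall>Z\<in>\<Sigma>. simple_object tcat Z) \<and> (\<forall>Z\<in>\<Sigma>. \<forall>Y\<in>\<Sigma>. T.isomorphic Z Y \<longrightarrow> Z = Y) \<and>
    (\<forall>Z. simple_object tcat Z \<longrightarrow> (\<exists>Y\<in>\<Sigma>. T.isomorphic Z Y))"
proof -
  let ?unl = "\<lambda>U. finite U \<and> (\<forall>Z\<in>U. simple_object tcat Z) \<and> (\<forall>Z\<in>U. \<forall>Y\<in>U. Z \<noteq> Y \<longrightarrow> \<not> linked Z Y)"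
  obtain N where N: "\<forall>U. ?unl U \<longrightarrow> card U < N" by (rule exE[OF unlinked_bound])
  have "\<exists>U. ?unl U \<and> (\<forall>U'. ?unl U' \<longrightarrow> card U' \<le> card U)"
    by (rule ex_has_greatest_nat[of ?unl "{}", OF _ N]) simp
  then obtain U where UU: "?unl U \<and> (\<forall>U'. ?unl U' \<longrightarrow> card U' \<le> card U)" by (rule exE)
  note U = conjunct1[OF UU] conjunct2[OF UU]
  let ?A = "U \<union> (\<lambda>X. opposite X) ` U"
  have A: "finite ?A" "\<And>Z. Z \<in> ?A \<Longrightarrow> simple_object tcat Z" using U(1) simple_opposite by auto
  have iso: "\<exists>Y\<in>?A. T.isomorphic Z Y" if Z: "simple_object tcat Z" for Z
  proof -
    have tw: "twisted Y" if "simple_object tcat Y" for Y using that by (simp add: simple_object_def)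
    have "Z \<in> U \<or> (\<exists>Y\<in>U. linked Z Y)"
    proof (rule ccontr)
      assume n: "\<not> (Z \<in> U \<or> (\<exists>Y\<in>U. linked Z Y))"
      have "\<not> linked Y Z" if "Y \<in> U" for Y using n that linked_sym[OF tw tw] U(1) Z by blast
      then have "?unl (insert Z U)" using n U(1) Z by auto
      then have "card (insert Z U) \<le> card U" by (rule U(2)[rule_format])
      then show False using U(1) n by simp
    qed
    then show ?thesis
    proof
      assume "Z \<in> U"
      then show ?thesis using T.isomorphic_refl[of Z] tw[OF Z] by auto
    next
      assume "\<exists>Y\<in>U. linked Z Y"
      then obtain Y where Y: "Y \<in> U" "linked Z Y" by blast
      then show ?thesis using linked_isomorphic[OF Z _ Y(2)] U(1) by blast
    qed
  qed
  have sub: "?A \<subseteq> obj tcat"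
  proof
    show "Z \<in> obj tcat" if "Z \<in> ?A" for Z using A(2)[OF that] by (simp add: simple_object_def)
  qed
  obtain \<Sigma> where \<Sigma>: "\<Sigma> \<subseteq> ?A" "\<forall>S\<in>\<Sigma>. \<forall>T\<in>\<Sigma>. T.isomorphic S T \<longrightarrow> S = T" "\<forall>S\<in>?A. \<exists>T\<in>\<Sigma>. T.isomorphic S T"
    using T.isomorphism_representatives[OF A(1) sub] by blast
  have "\<exists>Y\<in>\<Sigma>. T.isomorphic Z Y" if Z: "simple_object tcat Z" for Z
  proof -
    obtain Y where Y: "Y \<in> ?A" "T.isomorphic Z Y" using iso[OF Z] by blast
    obtain W where W: "W \<in> \<Sigma>" "T.isomorphic Y W" using \<Sigma>(3) Y(1) by blast
    have "W \<in> ?A" using W \<Sigma>(1) by blast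
    then have "Z \<in> obj tcat" "Y \<in> obj tcat" "W \<in> obj tcat"
      using Z A(2)[OF Y(1)] A(2)[of W] by (auto simp: simple_object_def)
    then show ?thesis using T.isomorphic_trans[OF Y(2) W(2)] W(1) by blast
  qed
  then show ?thesis using \<Sigma> A finite_subset[OF \<Sigma>(1) A(1)] by (intro exI[of _ \<Sigma>]) blast
qed

lemma direct_sum_retracts:
  assumes "direct_sum tcat n F X"
  obtains \<iota> \<pi> where "\<And>i. i < n \<Longrightarrow> \<iota> i \<in> hom tcat (F i) X" "\<And>i. i < n \<Longrightarrow> \<pi> i \<in> hom tcat X (F i)"
    "\<And>i. i < n \<Longrightarrow> \<pi> i \<cdot> \<iota> i = ident C (bimod_obj (fst (F i)))"
proof -
  obtain \<iota> \<pi> where h: "\<forall>i<n. \<iota> i \<in> hom tcat (F i) X" "\<forall>i<n. \<pi> i \<in> hom tcat X (F i)"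
    and o: "\<forall>i<n. \<forall>j<n. \<pi> i \<cdot> \<iota> j = (if i = j then ident C (bimod_obj (fst (F i))) else 0)"
    using T.direct_sumE[OF assms] unfolding tcat_simps by blast
  show ?thesis by (rule that[of \<iota> \<pi>]) (use h o in simp_all)
qed

text \<open>In characteristic zero \<open>of_rat\<close> makes the space of morphisms a rational
  vector space, and a non-zero vector extends to a basis. A functional over the ground field would
  not do, since positivity is available only over the rational numbers.\<close>

lemma rational_functional:
  assumes "t \<noteq> (0::'m)"
  obtains g :: "'m \<Rightarrow> rat" where "\<And>x y. g (x + y) = g x + g y" "g t = 1"
proof -
  interpret C: vector_space "scale C" by (rule ambient_vector_space)
  interpret vector_space_pair "\<lambda>q. scale C (of_rat q)" "(*) :: rat \<Rightarrow> rat \<Rightarrow> rat"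
    by unfold_locales (simp_all add: C.scale_right_distrib C.scale_left_distrib of_rat_add of_rat_mult algebra_simps)
  have "vs1.independent {t}" using assms by simp
  then obtain g where g: "Vector_Spaces.linear (\<lambda>q. scale C (of_rat q)) ((*) :: rat \<Rightarrow> rat \<Rightarrow> rat) g" "g t = 1"
    using linear_independent_extend[of "{t}" "\<lambda>_. 1"] by auto
  show ?thesis using that[of g] linear_add[OF g(1)] g(2) by blast
qed

text \<open>The identity is a twist because the double twist of \<open>a\<close> is trivial and the
  commutative multiplication absorbs the double braiding.\<close>

lemma regular_twisted:
  defines "A0 \<equiv> (bim a \<mu> \<mu>, ident C a)"
  shows "twisted A0" "symmetric A0" "char_map A0 = trace_form"
proof -
  note id = ident_in_hom[OF a_obj] and aa = tensor_in_obj[OF a_obj a_obj]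
  note c = braiding_in_hom[OF a_obj a_obj]
  have cc: "braiding C a a \<cdot> braiding C a a \<in> hom C (a \<odot> a) (a \<odot> a)" by (rule comp_in_hom[OF aa aa aa c c])
  have "\<mu> \<cdot> (braiding C a a \<cdot> braiding C a a) = \<mu>"
    using comp_assoc[OF aa aa aa a_obj c c mu_hom] mu_comm by simp
  then show "twisted A0"
    using regular_bimodule id comp_ident[OF aa aa cc] ident_comp[OF aa a_obj mu_hom] double_twist_a ident_comp[OF a_obj a_obj id]
    by (simp add: A0_def twisted_def tensor_ident)
  show "symmetric A0" by (simp add: A0_def symmetric_def mu_comm)
  show "char_map A0 = trace_form"
    using ident_comp[OF aa a_obj mu_hom] by (simp add: A0_def char_map_def trace_form_eq)
qed

lemma char_map_free:
  assumes X: "twisted X" and z: "trace_form \<cdot> \<eta> = 0"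
  shows "char_map (symmetrization (free X)) = 0"
proof -
  interpret V: twisted_module C a \<mu> \<eta> e "bimod_obj (fst X)" "left_act (fst X)" "snd X" by (rule twisted_moduleI[OF X])
  show ?thesis using V.free_trace[OF z] unfolding V.free_twist_eq
    by (simp add: char_map_def symmetrization_def free_def Let_def)
qed

text \<open>If the trace form vanishes on the unit, the class \<open>\<Sum> \<xi>\<^sub>Z [free Z]\<close> representing a linear functional of
  the trace has norm zero, hence the functional vanishes on the regular bimodule.\<close>
lemma trace_form_unit_nonzero:
  assumes ne: "ident C a \<noteq> 0"
  shows "trace_form \<cdot> \<eta> \<noteq> 0"
proof
  assume z: "trace_form \<cdot> \<eta> = 0"
  let ?A = "(bim a \<mu> \<mu>, ident C a)"
  note A = regular_twisted
  have "trace_form \<noteq> 0"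
  proof
    assume "trace_form = 0"
    note aa = tensor_in_obj[OF a_obj a_obj] and u = unit_in_obj
    have "0 \<otimes> ident C a = 0" by (rule tensor_zero(1)[OF a_obj u a_obj a_obj ident_in_hom[OF a_obj]])
    then have "\<eta> = 0" using trace_form_e \<open>trace_form = 0\<close> comp_zero(1)[OF u aa a_obj e_hom] by simp
    then have "\<eta> \<otimes> ident C a = 0" using tensor_zero(1)[OF u a_obj a_obj a_obj ident_in_hom[OF a_obj]] by simp
    then show False using mu_eta(1) comp_zero(2)[OF a_obj aa a_obj mu_hom] ne by simp
  qed
  then obtain g :: "'m \<Rightarrow> rat" where g: "\<And>x y. g (x + y) = g x + g y" "g trace_form = 1"
    using rational_functional by blast
  have g0: "g 0 = 0" using g(1)[of 0 0] by simp
  have gsum: "g (\<Sum>i<n. x i) = (\<Sum>i<n. g (x i))" for n :: nat and x by (induction n) (simp_all add: g0 g(1))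
  define v where "v X = g (char_map X)" for X
  obtain \<Sigma> where \<Sigma>: "finite \<Sigma>" "\<And>Z. Z \<in> \<Sigma> \<Longrightarrow> simple_object tcat Z" "\<And>Z Y. Z \<in> \<Sigma> \<Longrightarrow> Y \<in> \<Sigma> \<Longrightarrow> T.isomorphic Z Y \<Longrightarrow> Z = Y"
    "\<And>Z. simple_object tcat Z \<Longrightarrow> \<exists>Y\<in>\<Sigma>. T.isomorphic Z Y"
    using finite_simples by blast
  let ?I = "{Z \<in> \<Sigma>. symmetric Z}"
  \<comment> \<open>The coefficients that represent \<open>v\<close> through dim Hom; the
    denominator is the dimension of the endomorphism algebra of a simple object, which may exceed
    1.\<close>
  define \<xi> where "\<xi> Z = v Z / of_nat (T.hom_dim Z Z)" for Z
  have tw: "twisted Z" if "simple_object tcat Z" for Z using that by (simp add: simple_object_def)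
  have expand: "v X = (\<Sum>Z\<in>?I. \<xi> Z * of_nat (T.hom_dim Z X))" if X: "twisted X" "symmetric X" for X
  proof -
    obtain n F where F: "\<And>k. k < n \<Longrightarrow> simple_object tcat (F k)" and D: "direct_sum tcat n F X"
      using T.decompose[of X] X(1) by auto
    have tF: "twisted (F k)" if "k < n" for k using tw F that by blast
    obtain \<iota> \<pi> where h: "\<And>i. i < n \<Longrightarrow> \<iota> i \<in> hom tcat (F i) X" "\<And>i. i < n \<Longrightarrow> \<pi> i \<in> hom tcat X (F i)"
      and o: "\<And>i. i < n \<Longrightarrow> \<pi> i \<cdot> \<iota> i = ident C (bimod_obj (fst (F i)))"
      using direct_sum_retracts[OF D] by blast
    have symF: "symmetric (F k)" if "k < n" for k
      by (rule symmetric_retract[OF tF[OF that] X h(1)[OF that] h(2)[OF that] o[OF that]])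
    show ?thesis
      unfolding \<xi>_def
    proof (rule T.additive_function[OF _ _ _ _ D F])
      show "finite ?I" "\<And>S. S \<in> ?I \<Longrightarrow> simple_object tcat S" "\<And>S T. S \<in> ?I \<Longrightarrow> T \<in> ?I \<Longrightarrow> T.isomorphic S T \<Longrightarrow> S = T"
        "X \<in> obj tcat"
        using \<Sigma> X by auto
      show "v X = (\<Sum>k<n. v (F k))" using char_map_direct_sum[OF X(1) D tF] by (simp add: v_def gsum)
      fix k assume k: "k < n"
      obtain Y where Y: "Y \<in> \<Sigma>" "T.isomorphic (F k) Y" using \<Sigma>(4)[OF F[OF k]] by blast
      have tY: "twisted Y" using tw \<Sigma>(2) Y(1) by blast
      obtain p i where "p \<in> hom tcat (F k) Y" "i \<in> hom tcat Y (F k)" "p \<cdot> i = ident C (bimod_obj (fst Y))"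
        using Y(2) by (auto simp: T.isomorphic_def isomorphism_def)
      then have "symmetric Y" using symmetric_retract[OF tY tF[OF k] symF[OF k]] by blast
      then show "\<exists>T\<in>?I. T.isomorphic (F k) T \<and> v (F k) = v T"
        using Y char_map_isomorphic[OF tY tF[OF k] Y(2)] by (intro bexI[of _ Y]) (simp_all add: v_def)
    qed
  qed
  have tI: "twisted Z" "symmetric Z" if "Z \<in> ?I" for Z using tw \<Sigma>(2) that by auto
  \<comment> \<open>By reciprocity the pairing with \<open>free Y\<close> is the value of
    \<open>v\<close> on the symmetrization of \<open>free Y\<close>, whose character
    vanishes.\<close>
  have zero: "(\<Sum>Z\<in>?I. \<xi> Z * of_nat (T.hom_dim (free Z) (free Y))) = 0" if Y: "Y \<in> ?I" for Y
  proof -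
    note f = twisted_free[OF tI(1)[OF Y]]
    have "0 = v (symmetrization (free Y))" using char_map_free[OF tI(1)[OF Y] z] g0 by (simp add: v_def)
    also have "... = (\<Sum>Z\<in>?I. \<xi> Z * of_nat (T.hom_dim Z (symmetrization (free Y))))"
      by (rule expand[OF twisted_symmetrization[OF f] symmetrization_symmetric])
    also have "... = (\<Sum>Z\<in>?I. \<xi> Z * of_nat (T.hom_dim (free Z) (free Y)))"
      using free_hom_dim[OF tI f] by (intro sum.cong) simp_all
    finally show ?thesis by simp
  qed
  have "(\<Sum>Z\<in>?I. \<xi> Z * of_nat (T.hom_dim (free Z) ?A)) = 0"
  proof (rule T.hom_dim_positive_definite)
    show "finite ?I" using \<Sigma>(1) by simp
    show "free Z \<in> obj tcat" if "Z \<in> ?I" for Z using twisted_free[OF tI(1)[OF that]] by simp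
    show "?A \<in> obj tcat" using A(1) by simp
    have "(\<Sum>Z\<in>?I. \<Sum>Y\<in>?I. \<xi> Z * \<xi> Y * of_nat (T.hom_dim (free Z) (free Y))) =
      (\<Sum>Y\<in>?I. \<xi> Y * (\<Sum>Z\<in>?I. \<xi> Z * of_nat (T.hom_dim (free Z) (free Y))))"
      by (subst sum.swap) (simp add: sum_distrib_left algebra_simps)
    also have "... = 0" using zero by simp
    finally show "(\<Sum>Z\<in>?I. \<Sum>Y\<in>?I. \<xi> Z * \<xi> Y * of_nat (T.hom_dim (free Z) (free Y))) = 0" .
  qed
  \<comment> \<open>Reciprocity for the regular bimodule, which is its own symmetrization: the
    pairing is the value of the functional on the trace form, that is 1.\<close>
  moreover have "(\<Sum>Z\<in>?I. \<xi> Z * of_nat (T.hom_dim (free Z) ?A)) = v ?A"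
    unfolding expand[OF A(1,2)] using free_hom_dim[OF tI A(1)] symmetrization_id[OF A(2)] by (intro sum.cong) simp_all
  ultimately show False using A(3) g(2) by (simp add: v_def)
qed

end

theorem corollary5p19:
  fixes C :: "('o, 'm::ab_group_add, 'k::field_char_0) brcat"
    and A :: "('o, 'm) algebra_object"
  assumes "finite_braided_tensor_category C"
    and "is_algebra C A"
    and "\<not> zero_object C (carrier_obj A)"
    and "projective_object (bimod C A) (regular_bimodule A)"
  shows "semisimple_category C \<and> separable C A"
proof -
  interpret finite_braided_tensor_category C by fact
  obtain a \<mu> \<eta> where A: "A = \<lparr>carrier_obj = a, mult = \<mu>, unit_mor = \<eta>\<rparr>" by (cases A)
  interpret braided_algebra C a \<mu> \<eta> by unfold_locales (use assms(2) A in simp)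
  have proj: "projective_object (bimod C alg) \<lparr>bimod_obj = a, left_act = \<mu>, right_act = \<mu>\<rparr>"
    using assms(4) by (simp add: A regular_bimodule_def)
  have a: "projective_object C a" by (rule carrier_projective[OF proj])
  obtain s where s: "s \<in> hom (bimod C alg) (Defs.regular_bimodule alg) (tensor_square_bimodule C alg)" "comp C \<mu> s = ident C a"
    and sep: "separable_braided_algebra C a \<mu> \<eta> (comp C s \<eta>)"
    by (rule casimir_if_projective[OF proj])
  interpret S: separable_braided_algebra C a \<mu> \<eta> "comp C s \<eta>" by fact
  have ce: "S.centering \<in> hom C a a" "comp C S.centering S.centering = S.centering"
    using S.box_P S.centering_idem by (simp_all add: box_def deq_def sem_eval)
  obtain z \<iota> \<rho> where z: "z \<in> obj C" "\<iota> \<in> hom C z a" "\<rho> \<in> hom C a z" "comp C \<rho> \<iota> = ident C z" "comp C \<iota> \<rho> = S.centering"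
    by (rule idempotent_split[OF a_obj ce])
  interpret Z: split_centre C a \<mu> \<eta> "comp C s \<eta>" z \<iota> \<rho> by unfold_locales fact+
  obtain w where w: "commutative_separable_algebra C z Z.mu_z Z.eta_z w" using Z.centre_separable[OF a] by blast
  have zp: "projective_object C z" by (rule projective_retract[OF a z(1-4)])
  interpret W: commutative_separable_algebra C z Z.mu_z Z.eta_z w by fact
  interpret W: twisted_bimodules C z Z.mu_z Z.eta_z w by unfold_locales fact
  \<comment> \<open>If the centre were zero, so would be its unit and with it \<eta>, which factors
    through the inclusion of the centre; then \<open>a\<close> itself would be zero.\<close>
  have "ident C z \<noteq> 0"
  proof
    assume "ident C z = 0"
    then have "Z.eta_z = 0" using ident_comp[OF unit_in_obj z(1) W.eta_hom] comp_zero(1)[OF unit_in_obj z(1,1) W.eta_hom] by simp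
    moreover have "comp C \<iota> Z.eta_z = \<eta>" using Z.EZ_I by (simp add: deq_def sem_eval)
    ultimately have "\<eta> = 0" using comp_zero(2)[OF unit_in_obj z(1) a_obj z(2)] by simp
    then have "tensor C \<eta> (ident C a) = 0" using tensor_zero(1)[OF unit_in_obj a_obj a_obj a_obj ident_in_hom[OF a_obj]] by simp
    then have "ident C a = 0" using mu_eta(1) comp_zero(2)[OF a_obj tensor_in_obj[OF a_obj a_obj] a_obj mu_hom] by simp
    then show False using assms(3) zero_object_iff[OF a_obj] by (simp add: A)
  qed
  then have "comp C W.trace_form Z.eta_z \<noteq> 0" by (rule W.trace_form_unit_nonzero)
  then have "projective_object C (unit_obj C)"
    by (rule unit_projective_if_factor[OF zp W.eta_hom W.trace_form_hom])
  then show ?thesis using semisimple_if_unit_projective s by (auto simp: separable_def A)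
qed

end
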